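(* Let $G$ be a group, $k$ a commutative ring and $V$ a $kG$-module. Let $\Phi_V: H^\bullet_{\mathrm{EM}}(G,V)\to H^\bullet(G,V)$ be the canonical isomorphism from Eilenberg–MacLane cohomology to $H^\bullet(G,V):=\mathrm{Ext}^\bullet_G(k,V)$, and $\Phi_k$ the same isomorphism for the trivial module $k$. Then the diagram $$\begin{array}{ccc} H^\bullet_{\mathrm{EM}}(G,V)\otimes_k H^\bullet_{\mathrm{EM}}(G,k) & \xrightarrow{\ \Phi_V\otimes\Phi_k\ } & H^\bullet(G,V)\otimes_k H^\bullet(G,k)\\ \downarrow & & \downarrow\\ H^\bullet_{\mathrm{EM}}(G,V) & \xrightarrow{\ \Phi_V\ } & H^\bullet(G,V) \end{array}$$ commutes, where the left vertical arrow is the cup-product of Eilenberg–MacLane cochains and the right vertical arrow is the cup-product $\mathrm{Ext}_G^\bullet(k,V)\otimes_k\mathrm{Ext}_G^\bullet(k,k)\to\mathrm{Ext}_G^\bullet(k,V)$ given by composition.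
   Context: $\mathrm{Ext}_G$ is Ext in the category of $kG$-modules. For an abelian category with derived category $\mathcal{D}$ (localization of cochain complexes at quasi-isomorphisms), $\mathrm{Ext}^n(C^\bullet,D^\bullet):=\mathrm{Hom}_{\mathcal{D}}(C^\bullet,D^{n+\bullet})$, where $D^{n+\bullet}$ is the shifted complex with differential multiplied by $(-1)^n$; the cup-product is composition in $\mathcal{D}$ after shifting. $[A,B]^n$ denotes homotopy classes of complex morphisms $A^\bullet\to B^{n+\bullet}$, with its natural map to $\mathrm{Ext}^n(A,B)$. For a $kG$-module $W$ let $I^n(W)$ be the $kG$-module of all maps $G^{n+1}\to W$, with $(g f)(g_0,\dots,g_n)=g\,f(g^{-1}g_0,\dots,g^{-1}g_n)$ and coboundary $(df)(g_0,\dots,g_n)=\sum_i(-1)^i f(g_0,\dots,\widehat{g_i},\dots,g_n)$. Then $I(W)$ is a right resolution of $W$ (via constant maps $G\to W$). $H_{\mathrm{EM}}^\bullet(G,W)$ is the cohomology of the complex $I(W)^G$ of invariants, which is also the complex of $kG$-morphisms from $k$ to $I(W)$. The combinatorial cup-product of $\alpha\in I^p(V)^G$ and $\beta\in I^q(k)^G$ is $$(\alpha\cup\beta)(g_0,\dots,g_{p+q})=\alpha(g_0,\dots,g_p)\,\beta(g_p,\dots,g_{p+q}).$$ $\Phi_V$ is the composite $H^\bullet_{\mathrm{EM}}(G,V)=[k,I(V)]^\bullet\to\mathrm{Ext}^\bullet_G(k,I(V))\cong\mathrm{Ext}_G^\bullet(k,V)$; it is an isomorphism by a theorem of Eilenberg–MacLane.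 *)

theory Defs
  imports "HOL-Algebra.Module" "HOL-Algebra.AbelCoset" "HOL-Library.FuncSet"
begin

section \<open>Conventions\<close>

text \<open>
  The group \<open>G\<close>, the commutative ring \<open>R\<close> (the paper's \<open>k\<close>) and all modules are HOL-Algebra
  structures, so the zero ring is allowed.  Homomorphisms, differentials and chain maps are
  extensional functions (\<open>undefined\<close> outside the carrier), so that equal morphisms are equal functions.

  The map induced on a quotient by a map \<open>h\<close> on representatives sends a class \<open>X\<close> to the unique
  element of \<open>h ` X\<close>; it is written \<open>induced h X\<close>.
\<close>

definition induced :: "('a \<Rightarrow> 'b) \<Rightarrow> 'a set \<Rightarrow> 'b" where
  "induced h X = the_elem (h ` X)"

definition induced2 :: "('a \<Rightarrow> 'b \<Rightarrow> 'c) \<Rightarrow> 'a set \<Rightarrow> 'b set \<Rightarrow> 'c" where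
  "induced2 h X Y = the_elem {h x y | x y. x \<in> X \<and> y \<in> Y}"


section \<open>Modules over a group ring\<close>

text \<open>
  A \<open>kG\<close>-module is a \<open>k\<close>-module with a \<open>k\<close>-linear action of \<open>G\<close>.  The fields \<open>mult\<close> and \<open>one\<close>
  that the library's module record inherits from rings carry no meaning.
\<close>

record ('k, 'g, 'm) kGmod = "('k, 'm) module" +
  act :: "'g \<Rightarrow> 'm \<Rightarrow> 'm"

definition kG_module ::
  "('g, 'a) monoid_scheme \<Rightarrow> ('k, 'b) ring_scheme \<Rightarrow> ('k, 'g, 'm) kGmod \<Rightarrow> bool" where
  "kG_module G R M \<longleftrightarrow> module R M \<and>
     (\<forall>g\<in>carrier G. \<forall>x\<in>carrier M. act M g x \<in> carrier M) \<and>
     (\<forall>g\<in>carrier G. \<forall>x\<in>carrier M. \<forall>y\<in>carrier M.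
        act M g (x \<oplus>\<^bsub>M\<^esub> y) = act M g x \<oplus>\<^bsub>M\<^esub> act M g y) \<and>
     (\<forall>g\<in>carrier G. \<forall>r\<in>carrier R. \<forall>x\<in>carrier M.
        act M g (r \<odot>\<^bsub>M\<^esub> x) = r \<odot>\<^bsub>M\<^esub> act M g x) \<and>
     (\<forall>x\<in>carrier M. act M \<one>\<^bsub>G\<^esub> x = x) \<and>
     (\<forall>g\<in>carrier G. \<forall>h\<in>carrier G. \<forall>x\<in>carrier M.
        act M (g \<otimes>\<^bsub>G\<^esub> h) x = act M g (act M h x))"

definition kG_hom ::
  "('g, 'a) monoid_scheme \<Rightarrow> ('k, 'b) ring_scheme \<Rightarrow> ('k, 'g, 'm) kGmod \<Rightarrow>
   ('k, 'g, 'n) kGmod \<Rightarrow> ('m \<Rightarrow> 'n) set" where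
  "kG_hom G R M N = {f \<in> carrier M \<rightarrow>\<^sub>E carrier N.
     (\<forall>x\<in>carrier M. \<forall>y\<in>carrier M. f (x \<oplus>\<^bsub>M\<^esub> y) = f x \<oplus>\<^bsub>N\<^esub> f y) \<and>
     (\<forall>r\<in>carrier R. \<forall>x\<in>carrier M. f (r \<odot>\<^bsub>M\<^esub> x) = r \<odot>\<^bsub>N\<^esub> f x) \<and>
     (\<forall>g\<in>carrier G. \<forall>x\<in>carrier M. f (act M g x) = act N g (f x))}"

definition trivial_module :: "('k, 'b) ring_scheme \<Rightarrow> ('k, 'g, 'k) kGmod" where
  "trivial_module R =
     \<lparr>carrier = carrier R, mult = mult R, one = one R, zero = zero R, add = add R,
      smult = mult R, act = (\<lambda>g x. x)\<rparr>"

definition zero_submodule :: "('k, 'g, 'm) kGmod \<Rightarrow> ('k, 'g, 'm) kGmod" where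
  "zero_submodule M = M\<lparr>carrier := {\<zero>\<^bsub>M\<^esub>}\<rparr>"

definition invariant_submodule ::
  "('g, 'a) monoid_scheme \<Rightarrow> ('k, 'g, 'm) kGmod \<Rightarrow> ('k, 'g, 'm) kGmod" where
  "invariant_submodule G M =
     M\<lparr>carrier := {x \<in> carrier M. \<forall>g\<in>carrier G. act M g x = x}\<rparr>"


section \<open>Cochain complexes\<close>

record ('k, 'g, 'm) cochain_complex =
  ob :: "int \<Rightarrow> ('k, 'g, 'm) kGmod"
  diff :: "int \<Rightarrow> 'm \<Rightarrow> 'm"

definition is_complex ::
  "('g, 'a) monoid_scheme \<Rightarrow> ('k, 'b) ring_scheme \<Rightarrow> ('k, 'g, 'm) cochain_complex \<Rightarrow> bool" where
  "is_complex G R C \<longleftrightarrow>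
     (\<forall>i. kG_module G R (ob C i)) \<and>
     (\<forall>i. diff C i \<in> kG_hom G R (ob C i) (ob C (i + 1))) \<and>
     (\<forall>i. \<forall>x\<in>carrier (ob C i). diff C (i + 1) (diff C i x) = \<zero>\<^bsub>ob C (i + 2)\<^esub>)"

definition chain_map ::
  "('g, 'a) monoid_scheme \<Rightarrow> ('k, 'b) ring_scheme \<Rightarrow> ('k, 'g, 'm) cochain_complex \<Rightarrow>
   (int \<Rightarrow> 'm \<Rightarrow> 'n) \<Rightarrow> ('k, 'g, 'n) cochain_complex \<Rightarrow> bool" where
  "chain_map G R C f D \<longleftrightarrow> is_complex G R C \<and> is_complex G R D \<and>
     (\<forall>i. f i \<in> kG_hom G R (ob C i) (ob D i)) \<and>
     (\<forall>i. \<forall>x\<in>carrier (ob C i). f (i + 1) (diff C i x) = diff D i (f i x))"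

definition id_map :: "('k, 'g, 'm) cochain_complex \<Rightarrow> int \<Rightarrow> 'm \<Rightarrow> 'm" where
  "id_map C = (\<lambda>i. \<lambda>x\<in>carrier (ob C i). x)"

definition comp_map ::
  "('k, 'g, 'm) cochain_complex \<Rightarrow> (int \<Rightarrow> 'n \<Rightarrow> 'o) \<Rightarrow> (int \<Rightarrow> 'm \<Rightarrow> 'n) \<Rightarrow> int \<Rightarrow> 'm \<Rightarrow> 'o" where
  "comp_map C g f = (\<lambda>i. compose (carrier (ob C i)) (g i) (f i))"

definition zero_map ::
  "('k, 'g, 'm) cochain_complex \<Rightarrow> ('k, 'g, 'n) cochain_complex \<Rightarrow> int \<Rightarrow> 'm \<Rightarrow> 'n" where
  "zero_map C D = (\<lambda>i. \<lambda>x\<in>carrier (ob C i). \<zero>\<^bsub>ob D i\<^esub>)"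

definition add_map ::
  "('k, 'g, 'm) cochain_complex \<Rightarrow> ('k, 'g, 'n) cochain_complex \<Rightarrow>
   (int \<Rightarrow> 'm \<Rightarrow> 'n) \<Rightarrow> (int \<Rightarrow> 'm \<Rightarrow> 'n) \<Rightarrow> int \<Rightarrow> 'm \<Rightarrow> 'n" where
  "add_map C D f g = (\<lambda>i. \<lambda>x\<in>carrier (ob C i). f i x \<oplus>\<^bsub>ob D i\<^esub> g i x)"

definition scalar_map :: "'k \<Rightarrow> ('k, 'g, 'm) cochain_complex \<Rightarrow> int \<Rightarrow> 'm \<Rightarrow> 'm" where
  "scalar_map r C = (\<lambda>i. \<lambda>x\<in>carrier (ob C i). r \<odot>\<^bsub>ob C i\<^esub> x)"

text \<open>The complex with \<open>M\<close> in degree \<open>0\<close> and zero modules elsewhere.\<close>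

definition conc :: "('k, 'g, 'm) kGmod \<Rightarrow> ('k, 'g, 'm) cochain_complex" where
  "conc M =
     \<lparr>ob = (\<lambda>i. if i = 0 then M else zero_submodule M),
      diff = (\<lambda>i. \<lambda>x\<in>carrier (if i = 0 then M else zero_submodule M). \<zero>\<^bsub>M\<^esub>)\<rparr>"

definition shift :: "int \<Rightarrow> ('k, 'g, 'm) cochain_complex \<Rightarrow> ('k, 'g, 'm) cochain_complex" where
  "shift n C =
     \<lparr>ob = (\<lambda>i. ob C (n + i)),
      diff = (\<lambda>i. if even n then diff C (n + i)
                  else (\<lambda>x\<in>carrier (ob C (n + i)). \<ominus>\<^bsub>ob C (n + i + 1)\<^esub> diff C (n + i) x))\<rparr>"

definition shift_map :: "int \<Rightarrow> (int \<Rightarrow> 'm \<Rightarrow> 'n) \<Rightarrow> int \<Rightarrow> 'm \<Rightarrow> 'n" where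
  "shift_map n f = (\<lambda>i. f (n + i))"

definition invariant_complex ::
  "('g, 'a) monoid_scheme \<Rightarrow> ('k, 'g, 'm) cochain_complex \<Rightarrow> ('k, 'g, 'm) cochain_complex" where
  "invariant_complex G C =
     \<lparr>ob = (\<lambda>i. invariant_submodule G (ob C i)),
      diff = (\<lambda>i. restrict (diff C i) (carrier (invariant_submodule G (ob C i))))\<rparr>"

definition cocycles :: "('k, 'g, 'm) cochain_complex \<Rightarrow> int \<Rightarrow> 'm set" where
  "cocycles C n = {x \<in> carrier (ob C n). diff C n x = \<zero>\<^bsub>ob C (n + 1)\<^esub>}"

definition coboundaries :: "('k, 'g, 'm) cochain_complex \<Rightarrow> int \<Rightarrow> 'm set" where
  "coboundaries C n = diff C (n - 1) ` carrier (ob C (n - 1))"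

definition coh_class :: "('k, 'g, 'm) cochain_complex \<Rightarrow> int \<Rightarrow> 'm \<Rightarrow> 'm set" where
  "coh_class C n x = coboundaries C n +>\<^bsub>ob C n\<^esub> x"

definition cohomology :: "('k, 'g, 'm) cochain_complex \<Rightarrow> int \<Rightarrow> ('k, 'g, 'm set) kGmod" where
  "cohomology C n =
     \<lparr>carrier = coh_class C n ` cocycles C n, mult = undefined, one = undefined,
      zero = coboundaries C n,
      add = set_add (ob C n),
      smult = (\<lambda>r. induced (\<lambda>x. coh_class C n (r \<odot>\<^bsub>ob C n\<^esub> x))),
      act = (\<lambda>g. induced (\<lambda>x. coh_class C n (act (ob C n) g x)))\<rparr>"

definition quasi_iso ::
  "('g, 'a) monoid_scheme \<Rightarrow> ('k, 'b) ring_scheme \<Rightarrow> ('k, 'g, 'm) cochain_complex \<Rightarrow>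
   (int \<Rightarrow> 'm \<Rightarrow> 'n) \<Rightarrow> ('k, 'g, 'n) cochain_complex \<Rightarrow> bool" where
  "quasi_iso G R C s D \<longleftrightarrow> chain_map G R C s D \<and>
     (\<forall>n. bij_betw (induced (\<lambda>x. coh_class D n (s n x)))
            (carrier (cohomology C n)) (carrier (cohomology D n)))"

definition homotopic ::
  "('g, 'a) monoid_scheme \<Rightarrow> ('k, 'b) ring_scheme \<Rightarrow>
   ('k, 'g, 'm) cochain_complex \<Rightarrow> ('k, 'g, 'n) cochain_complex \<Rightarrow>
   (int \<Rightarrow> 'm \<Rightarrow> 'n) \<Rightarrow> (int \<Rightarrow> 'm \<Rightarrow> 'n) \<Rightarrow> bool" where
  "homotopic G R C D f g \<longleftrightarrow> chain_map G R C f D \<and> chain_map G R C g D \<and>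
     (\<exists>h. (\<forall>i. h i \<in> kG_hom G R (ob C i) (ob D (i - 1))) \<and>
          (\<forall>i. \<forall>x\<in>carrier (ob C i).
             f i x \<ominus>\<^bsub>ob D i\<^esub> g i x
               = diff D (i - 1) (h i x) \<oplus>\<^bsub>ob D i\<^esub> h (i + 1) (diff C i x)))"

text \<open>
  Homotopy classes; \<open>htpy_classes G R C D n\<close> is the paper's \<open>[C, D]\<^sup>n\<close>.
\<close>

definition htpy_class ::
  "('g, 'a) monoid_scheme \<Rightarrow> ('k, 'b) ring_scheme \<Rightarrow>
   ('k, 'g, 'm) cochain_complex \<Rightarrow> ('k, 'g, 'n) cochain_complex \<Rightarrow>
   (int \<Rightarrow> 'm \<Rightarrow> 'n) \<Rightarrow> (int \<Rightarrow> 'm \<Rightarrow> 'n) set" where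
  "htpy_class G R C D f = {g. homotopic G R C D f g}"

definition htpy_classes ::
  "('g, 'a) monoid_scheme \<Rightarrow> ('k, 'b) ring_scheme \<Rightarrow>
   ('k, 'g, 'm) cochain_complex \<Rightarrow> ('k, 'g, 'n) cochain_complex \<Rightarrow> int \<Rightarrow>
   (int \<Rightarrow> 'm \<Rightarrow> 'n) set set" where
  "htpy_classes G R C D n =
     htpy_class G R C (shift n D) ` {f. chain_map G R C f (shift n D)}"


section \<open>The derived category\<close>

text \<open>
  The localization of cochain complexes at quasi-isomorphisms, in its generators-and-relations
  form: morphisms are zigzags (lists of composable arrows, each a chain map or a formal inverse of a
  quasi-isomorphism) modulo the smallest congruence that respects identities and composition of
  chain maps and makes formal inverses inverse.  The modules have their carriers in a fixed
  type \<open>'u\<close>, which plays the role of a universe.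

  \<open>Fwd C f D\<close> is the chain map \<open>f\<close> from \<open>C\<close> to \<open>D\<close>.  \<open>Bwd C s D\<close> is the formal inverse, going
  from \<open>D\<close> to \<open>C\<close>, of the quasi-isomorphism \<open>s\<close> from \<open>C\<close> to \<open>D\<close>.  A list is read from left to right,
  so \<open>u @ v\<close> is \<open>u\<close> followed by \<open>v\<close>.
\<close>

datatype ('k, 'g, 'u) arrow =
    Fwd "('k, 'g, 'u) cochain_complex" "int \<Rightarrow> 'u \<Rightarrow> 'u" "('k, 'g, 'u) cochain_complex"
  | Bwd "('k, 'g, 'u) cochain_complex" "int \<Rightarrow> 'u \<Rightarrow> 'u" "('k, 'g, 'u) cochain_complex"

type_synonym ('k, 'g, 'u) zigzag = "('k, 'g, 'u) arrow list"

inductive is_zigzag ::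
  "('g, 'a) monoid_scheme \<Rightarrow> ('k, 'b) ring_scheme \<Rightarrow>
   ('k, 'g, 'u) cochain_complex \<Rightarrow> ('k, 'g, 'u) zigzag \<Rightarrow> ('k, 'g, 'u) cochain_complex \<Rightarrow> bool"
  for G :: "('g, 'a) monoid_scheme" and R :: "('k, 'b) ring_scheme" where
  Nil: "is_complex G R C \<Longrightarrow> is_zigzag G R C [] C"
| Fwd: "chain_map G R C f D \<Longrightarrow> is_zigzag G R D w E \<Longrightarrow> is_zigzag G R C (Fwd C f D # w) E"
| Bwd: "quasi_iso G R D s C \<Longrightarrow> is_zigzag G R D w E \<Longrightarrow> is_zigzag G R C (Bwd D s C # w) E"

inductive zigzag_eq ::
  "('g, 'a) monoid_scheme \<Rightarrow> ('k, 'b) ring_scheme \<Rightarrow>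
   ('k, 'g, 'u) cochain_complex \<Rightarrow> ('k, 'g, 'u) cochain_complex \<Rightarrow>
   ('k, 'g, 'u) zigzag \<Rightarrow> ('k, 'g, 'u) zigzag \<Rightarrow> bool"
  for G :: "('g, 'a) monoid_scheme" and R :: "('k, 'b) ring_scheme" where
  refl: "is_zigzag G R C w D \<Longrightarrow> zigzag_eq G R C D w w"
| sym: "zigzag_eq G R C D v w \<Longrightarrow> zigzag_eq G R C D w v"
| trans: "zigzag_eq G R C D u v \<Longrightarrow> zigzag_eq G R C D v w \<Longrightarrow> zigzag_eq G R C D u w"
| cong: "is_zigzag G R A u B \<Longrightarrow> zigzag_eq G R B C v v' \<Longrightarrow> is_zigzag G R C w D \<Longrightarrow>
    zigzag_eq G R A D (u @ v @ w) (u @ v' @ w)"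
| ident: "is_complex G R C \<Longrightarrow> zigzag_eq G R C C [Fwd C (id_map C) C] []"
| comp: "chain_map G R A f B \<Longrightarrow> chain_map G R B g C \<Longrightarrow>
    zigzag_eq G R A C [Fwd A f B, Fwd B g C] [Fwd A (comp_map A g f) C]"
| inv_right: "quasi_iso G R A s B \<Longrightarrow> zigzag_eq G R A A [Fwd A s B, Bwd A s B] []"
| inv_left: "quasi_iso G R A s B \<Longrightarrow> zigzag_eq G R B B [Bwd A s B, Fwd A s B] []"

definition der_class ::
  "('g, 'a) monoid_scheme \<Rightarrow> ('k, 'b) ring_scheme \<Rightarrow>
   ('k, 'g, 'u) cochain_complex \<Rightarrow> ('k, 'g, 'u) cochain_complex \<Rightarrow>
   ('k, 'g, 'u) zigzag \<Rightarrow> ('k, 'g, 'u) zigzag set" where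
  "der_class G R C D w = {v. zigzag_eq G R C D w v}"

definition der_hom ::
  "('g, 'a) monoid_scheme \<Rightarrow> ('k, 'b) ring_scheme \<Rightarrow>
   ('k, 'g, 'u) cochain_complex \<Rightarrow> ('k, 'g, 'u) cochain_complex \<Rightarrow>
   ('k, 'g, 'u) zigzag set set" where
  "der_hom G R C D = der_class G R C D ` {w. is_zigzag G R C w D}"

text \<open>\<open>der_comp G R A C Y X\<close> is the composite of \<open>X\<close>, with source \<open>A\<close>, and \<open>Y\<close>, with target \<open>C\<close>.\<close>

definition der_comp ::
  "('g, 'a) monoid_scheme \<Rightarrow> ('k, 'b) ring_scheme \<Rightarrow>
   ('k, 'g, 'u) cochain_complex \<Rightarrow> ('k, 'g, 'u) cochain_complex \<Rightarrow>
   ('k, 'g, 'u) zigzag set \<Rightarrow> ('k, 'g, 'u) zigzag set \<Rightarrow> ('k, 'g, 'u) zigzag set" where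
  "der_comp G R A C Y X = induced2 (\<lambda>u v. der_class G R A C (u @ v)) X Y"

definition der_of_map ::
  "('g, 'a) monoid_scheme \<Rightarrow> ('k, 'b) ring_scheme \<Rightarrow>
   ('k, 'g, 'u) cochain_complex \<Rightarrow> (int \<Rightarrow> 'u \<Rightarrow> 'u) \<Rightarrow> ('k, 'g, 'u) cochain_complex \<Rightarrow>
   ('k, 'g, 'u) zigzag set" where
  "der_of_map G R C f D = der_class G R C D [Fwd C f D]"

primrec shift_arrow :: "int \<Rightarrow> ('k, 'g, 'u) arrow \<Rightarrow> ('k, 'g, 'u) arrow" where
  "shift_arrow n (Fwd C f D) = Fwd (shift n C) (shift_map n f) (shift n D)"
| "shift_arrow n (Bwd C s D) = Bwd (shift n C) (shift_map n s) (shift n D)"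

definition der_shift ::
  "('g, 'a) monoid_scheme \<Rightarrow> ('k, 'b) ring_scheme \<Rightarrow> int \<Rightarrow>
   ('k, 'g, 'u) cochain_complex \<Rightarrow> ('k, 'g, 'u) cochain_complex \<Rightarrow>
   ('k, 'g, 'u) zigzag set \<Rightarrow> ('k, 'g, 'u) zigzag set" where
  "der_shift G R n C D =
     induced (\<lambda>w. der_class G R (shift n C) (shift n D) (map (shift_arrow n) w))"

text \<open>
  Addition of morphisms is addition over a common denominator:
  \<open>f \<circ> u + g \<circ> u = (f + g) \<circ> u\<close> for chain maps \<open>f\<close>, \<open>g\<close> and any morphism \<open>u\<close> of the localization.
\<close>

definition der_add ::
  "('g, 'a) monoid_scheme \<Rightarrow> ('k, 'b) ring_scheme \<Rightarrow>
   ('k, 'g, 'u) cochain_complex \<Rightarrow> ('k, 'g, 'u) cochain_complex \<Rightarrow>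
   ('k, 'g, 'u) zigzag set \<Rightarrow> ('k, 'g, 'u) zigzag set \<Rightarrow> ('k, 'g, 'u) zigzag set" where
  "der_add G R C D X Y = (THE Z. \<exists>E u f g.
     u \<in> der_hom G R C E \<and> chain_map G R E f D \<and> chain_map G R E g D \<and>
     X = der_comp G R C D (der_of_map G R E f D) u \<and>
     Y = der_comp G R C D (der_of_map G R E g D) u \<and>
     Z = der_comp G R C D (der_of_map G R E (add_map E D f g) D) u)"

definition Ext ::
  "('g, 'a) monoid_scheme \<Rightarrow> ('k, 'b) ring_scheme \<Rightarrow>
   ('k, 'g, 'u) cochain_complex \<Rightarrow> ('k, 'g, 'u) cochain_complex \<Rightarrow> int \<Rightarrow>
   ('k, ('k, 'g, 'u) zigzag set) module" where
  "Ext G R C D n =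
     \<lparr>carrier = der_hom G R C (shift n D), mult = undefined, one = undefined,
      zero = der_of_map G R C (zero_map C (shift n D)) (shift n D),
      add = der_add G R C (shift n D),
      smult = (\<lambda>r. der_comp G R C (shift n D)
                 (der_of_map G R (shift n D) (scalar_map r (shift n D)) (shift n D)))\<rparr>"

text \<open>
  The cup-product \<open>Ext\<^sup>p(B, C) \<times> Ext\<^sup>q(A, B) \<rightarrow> Ext\<^sup>p\<^sup>+\<^sup>q(A, C)\<close>.  It ends in \<open>shift q (shift p C)\<close>,
  which is equal to \<open>shift (p + q) C\<close> by the lemma \<open>shift_shift\<close> below.
\<close>

definition ext_cup ::
  "('g, 'a) monoid_scheme \<Rightarrow> ('k, 'b) ring_scheme \<Rightarrow>
   ('k, 'g, 'u) cochain_complex \<Rightarrow> ('k, 'g, 'u) cochain_complex \<Rightarrow>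
   ('k, 'g, 'u) cochain_complex \<Rightarrow> int \<Rightarrow> int \<Rightarrow>
   ('k, 'g, 'u) zigzag set \<Rightarrow> ('k, 'g, 'u) zigzag set \<Rightarrow> ('k, 'g, 'u) zigzag set" where
  "ext_cup G R A B C p q X Y =
     der_comp G R A (shift q (shift p C)) (der_shift G R q B (shift p C) X) Y"

lemma shift_shift:
  assumes "is_complex G R C"
  shows "shift q (shift p C) = shift (p + q) C"
proof (rule cochain_complex.equality)
  show "ob (shift q (shift p C)) = ob (shift (p + q) C)"
    by (simp add: shift_def add.assoc)
  show "diff (shift q (shift p C)) = diff (shift (p + q) C)"
  proof
    fix i
    have a: "abelian_group (ob C j)" for j
      using assms by (auto simp: is_complex_def kG_module_def module_def)
    have d: "diff C j \<in> carrier (ob C j) \<rightarrow>\<^sub>E carrier (ob C (j + 1))" for j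
      using assms by (simp add: is_complex_def kG_hom_def)
    have r: "restrict (diff C j) (carrier (ob C j)) = diff C j" for j
      by (rule PiE_restrict[OF d])
    have m: "\<ominus>\<^bsub>ob C (j + 1)\<^esub> (\<ominus>\<^bsub>ob C (j + 1)\<^esub> diff C j x) = diff C j x"
      if "x \<in> carrier (ob C j)" for j x
      using abelian_group.minus_minus[OF a] PiE_mem[OF d that] by simp
    have n: "(\<lambda>x\<in>carrier (ob C j). \<ominus>\<^bsub>ob C (j + 1)\<^esub> (\<ominus>\<^bsub>ob C (j + 1)\<^esub> diff C j x)) = diff C j" for j
      using m r[of j] by (metis (no_types, lifting) restrict_ext)
    have e: "p + (q + i) = p + q + i" "p + (q + i + 1) = p + q + i + 1"
      by simp_all
    show "diff (shift q (shift p C)) i = diff (shift (p + q) C) i"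
      using n[of "p + q + i"] by (auto simp: shift_def e restrict_def cong: if_cong)
  qed
qed simp


section \<open>The Eilenberg--MacLane resolution\<close>

text \<open>
  The tuples \<open>(g\<^sub>0, \<dots>, g\<^sub>n)\<close>.  There are none for \<open>n < 0\<close>, so that \<open>EM_module G W n\<close> is then a
  zero module.
\<close>

definition tuples :: "('g, 'a) monoid_scheme \<Rightarrow> int \<Rightarrow> 'g list set" where
  "tuples G n = {gs. n \<ge> 0 \<and> int (length gs) = n + 1 \<and> set gs \<subseteq> carrier G}"

definition EM_module ::
  "('g, 'a) monoid_scheme \<Rightarrow> ('k, 'g, 'm) kGmod \<Rightarrow> int \<Rightarrow> ('k, 'g, 'g list \<Rightarrow> 'm) kGmod" where
  "EM_module G W n =
     \<lparr>carrier = tuples G n \<rightarrow>\<^sub>E carrier W, mult = undefined, one = undefined,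
      zero = (\<lambda>gs\<in>tuples G n. \<zero>\<^bsub>W\<^esub>),
      add = (\<lambda>f f'. \<lambda>gs\<in>tuples G n. f gs \<oplus>\<^bsub>W\<^esub> f' gs),
      smult = (\<lambda>r f. \<lambda>gs\<in>tuples G n. r \<odot>\<^bsub>W\<^esub> f gs),
      act = (\<lambda>g f. \<lambda>gs\<in>tuples G n. act W g (f (map (\<lambda>h. inv\<^bsub>G\<^esub> g \<otimes>\<^bsub>G\<^esub> h) gs)))\<rparr>"

definition omit :: "nat \<Rightarrow> 'g list \<Rightarrow> 'g list" where
  "omit i gs = take i gs @ drop (Suc i) gs"

definition EM_complex ::
  "('g, 'a) monoid_scheme \<Rightarrow> ('k, 'g, 'm) kGmod \<Rightarrow> ('k, 'g, 'g list \<Rightarrow> 'm) cochain_complex" where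
  "EM_complex G W =
     \<lparr>ob = EM_module G W,
      diff = (\<lambda>n. \<lambda>f\<in>carrier (EM_module G W n). \<lambda>gs\<in>tuples G (n + 1).
        if n < 0 then \<zero>\<^bsub>W\<^esub>
        else \<Oplus>\<^bsub>W\<^esub>i\<in>{..<length gs}.
               (if even i then f (omit i gs) else \<ominus>\<^bsub>W\<^esub> f (omit i gs)))\<rparr>"

text \<open>The coaugmentation \<open>W \<rightarrow> I(W)\<close>, by constant maps.\<close>

definition coaug ::
  "('g, 'a) monoid_scheme \<Rightarrow> ('k, 'g, 'm) kGmod \<Rightarrow> int \<Rightarrow> 'm \<Rightarrow> 'g list \<Rightarrow> 'm" where
  "coaug G W = (\<lambda>i. \<lambda>x\<in>carrier (ob (conc W) i).
     if i = 0 then (\<lambda>gs\<in>tuples G 0. x) else \<zero>\<^bsub>EM_module G W i\<^esub>)"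

definition H_EM ::
  "('g, 'a) monoid_scheme \<Rightarrow> ('k, 'g, 'm) kGmod \<Rightarrow> nat \<Rightarrow> ('k, 'g, ('g list \<Rightarrow> 'm) set) kGmod" where
  "H_EM G W n = cohomology (invariant_complex G (EM_complex G W)) (int n)"

definition cup_cochain ::
  "('g, 'a) monoid_scheme \<Rightarrow> ('k, 'g, 'v) kGmod \<Rightarrow> nat \<Rightarrow> nat \<Rightarrow>
   ('g list \<Rightarrow> 'v) \<Rightarrow> ('g list \<Rightarrow> 'k) \<Rightarrow> 'g list \<Rightarrow> 'v" where
  "cup_cochain G V p q \<alpha> \<beta> =
     (\<lambda>gs\<in>tuples G (int (p + q)). \<beta> (drop p gs) \<odot>\<^bsub>V\<^esub> \<alpha> (take (Suc p) gs))"

definition cup_EM ::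
  "('g, 'a) monoid_scheme \<Rightarrow> ('k, 'g, 'v) kGmod \<Rightarrow> nat \<Rightarrow> nat \<Rightarrow>
   ('g list \<Rightarrow> 'v) set \<Rightarrow> ('g list \<Rightarrow> 'k) set \<Rightarrow> ('g list \<Rightarrow> 'v) set" where
  "cup_EM G V p q = induced2 (\<lambda>\<alpha> \<beta>.
     coh_class (invariant_complex G (EM_complex G V)) (int (p + q)) (cup_cochain G V p q \<alpha> \<beta>))"

text \<open>
  The identification of \<open>H\<^sub>E\<^sub>M\<^sup>n(G, W)\<close> with \<open>[k, I(W)]\<^sup>n\<close>: an invariant cocycle \<open>\<alpha>\<close> corresponds to
  the chain map from \<open>k\<close> to the \<open>n\<close>-th shift of \<open>I(W)\<close> that sends \<open>c\<close> to \<open>c \<alpha>\<close> in degree \<open>0\<close>.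
\<close>

definition cocycle_map ::
  "('g, 'a) monoid_scheme \<Rightarrow> ('k, 'b) ring_scheme \<Rightarrow> ('k, 'g, 'm) kGmod \<Rightarrow> int \<Rightarrow>
   ('g list \<Rightarrow> 'm) \<Rightarrow> int \<Rightarrow> 'k \<Rightarrow> 'g list \<Rightarrow> 'm" where
  "cocycle_map G R W n \<alpha> =
     (\<lambda>i. \<lambda>c\<in>carrier (ob (conc (trivial_module R :: ('k, 'g, 'k) kGmod)) i).
        if i = 0 then c \<odot>\<^bsub>EM_module G W n\<^esub> \<alpha> else \<zero>\<^bsub>EM_module G W (n + i)\<^esub>)"

definition EM_to_htpy ::
  "('g, 'a) monoid_scheme \<Rightarrow> ('k, 'b) ring_scheme \<Rightarrow> ('k, 'g, 'm) kGmod \<Rightarrow> nat \<Rightarrow>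
   ('g list \<Rightarrow> 'm) set \<Rightarrow> (int \<Rightarrow> 'k \<Rightarrow> 'g list \<Rightarrow> 'm) set" where
  "EM_to_htpy G R W n = induced (\<lambda>\<alpha>.
     htpy_class G R (conc (trivial_module R)) (shift (int n) (EM_complex G W))
       (cocycle_map G R W (int n) \<alpha>))"


section \<open>Transport into a universe\<close>

text \<open>Transport of structure along a map \<open>j\<close> that is injective on the carriers.\<close>

definition transport :: "('m \<Rightarrow> 'u) \<Rightarrow> ('k, 'g, 'm) kGmod \<Rightarrow> ('k, 'g, 'u) kGmod" where
  "transport j M = (let j' = inv_into (carrier M) j in
     \<lparr>carrier = j ` carrier M, mult = undefined, one = undefined,
      zero = j \<zero>\<^bsub>M\<^esub>,
      add = (\<lambda>x y. j (j' x \<oplus>\<^bsub>M\<^esub> j' y)),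
      smult = (\<lambda>r x. j (r \<odot>\<^bsub>M\<^esub> j' x)),
      act = (\<lambda>g x. j (act M g (j' x)))\<rparr>)"

definition transport_fun ::
  "('m \<Rightarrow> 'u) \<Rightarrow> ('n \<Rightarrow> 'u) \<Rightarrow> 'm set \<Rightarrow> ('m \<Rightarrow> 'n) \<Rightarrow> 'u \<Rightarrow> 'u" where
  "transport_fun j l A f = (\<lambda>x\<in>j ` A. l (f (inv_into A j x)))"

definition transport_complex ::
  "('m \<Rightarrow> 'u) \<Rightarrow> ('k, 'g, 'm) cochain_complex \<Rightarrow> ('k, 'g, 'u) cochain_complex" where
  "transport_complex j C =
     \<lparr>ob = (\<lambda>i. transport j (ob C i)),
      diff = (\<lambda>i. transport_fun j j (carrier (ob C i)) (diff C i))\<rparr>"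

definition transport_map ::
  "('m \<Rightarrow> 'u) \<Rightarrow> ('n \<Rightarrow> 'u) \<Rightarrow> ('k, 'g, 'm) cochain_complex \<Rightarrow>
   (int \<Rightarrow> 'm \<Rightarrow> 'n) \<Rightarrow> int \<Rightarrow> 'u \<Rightarrow> 'u" where
  "transport_map j l C f = (\<lambda>i. transport_fun j l (carrier (ob C i)) (f i))"

text \<open>The natural map \<open>[C, D]\<^sup>n \<rightarrow> Ext\<^sup>n(C, D)\<close>, for \<open>C\<close> and \<open>D\<close> transported along \<open>j\<close> and \<open>l\<close>.\<close>

definition htpy_to_ext ::
  "('g, 'a) monoid_scheme \<Rightarrow> ('k, 'b) ring_scheme \<Rightarrow> ('m \<Rightarrow> 'u) \<Rightarrow> ('n \<Rightarrow> 'u) \<Rightarrow>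
   ('k, 'g, 'm) cochain_complex \<Rightarrow> ('k, 'g, 'n) cochain_complex \<Rightarrow> int \<Rightarrow>
   (int \<Rightarrow> 'm \<Rightarrow> 'n) set \<Rightarrow> ('k, 'g, 'u) zigzag set" where
  "htpy_to_ext G R j l C D n = induced (\<lambda>f.
     der_of_map G R (transport_complex j C) (transport_map j l C f)
       (shift n (transport_complex l D)))"

text \<open>
  The canonical map \<open>\<Phi>\<^sub>W : H\<^sub>E\<^sub>M\<^sup>n(G, W) = [k, I(W)]\<^sup>n \<rightarrow> Ext\<^sup>n(k, I(W)) \<cong> Ext\<^sup>n(k, W)\<close>, where \<open>k\<close>,
  \<open>W\<close> and \<open>I(W)\<close> are transported along \<open>jk\<close>, \<open>jW\<close> and \<open>jI\<close>.  The last isomorphism is inverse to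
  composition with the coaugmentation.
\<close>

definition coaug_ext ::
  "('g, 'a) monoid_scheme \<Rightarrow> ('k, 'b) ring_scheme \<Rightarrow> ('k \<Rightarrow> 'u) \<Rightarrow> ('m \<Rightarrow> 'u) \<Rightarrow>
   (('g list \<Rightarrow> 'm) \<Rightarrow> 'u) \<Rightarrow> ('k, 'g, 'm) kGmod \<Rightarrow> int \<Rightarrow>
   ('k, 'g, 'u) zigzag set \<Rightarrow> ('k, 'g, 'u) zigzag set" where
  "coaug_ext G R jk jW jI W n =
     der_comp G R (transport_complex jk (conc (trivial_module R)))
       (shift n (transport_complex jI (EM_complex G W)))
       (der_of_map G R (shift n (transport_complex jW (conc W)))
          (shift_map n (transport_map jW jI (conc W) (coaug G W)))
          (shift n (transport_complex jI (EM_complex G W))))"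

definition Phi ::
  "('g, 'a) monoid_scheme \<Rightarrow> ('k, 'b) ring_scheme \<Rightarrow> ('k \<Rightarrow> 'u) \<Rightarrow> ('m \<Rightarrow> 'u) \<Rightarrow>
   (('g list \<Rightarrow> 'm) \<Rightarrow> 'u) \<Rightarrow> ('k, 'g, 'm) kGmod \<Rightarrow> nat \<Rightarrow>
   ('g list \<Rightarrow> 'm) set \<Rightarrow> ('k, 'g, 'u) zigzag set" where
  "Phi G R jk jW jI W n X =
     inv_into
       (carrier (Ext G R (transport_complex jk (conc (trivial_module R)))
                         (transport_complex jW (conc W)) (int n)))
       (coaug_ext G R jk jW jI W (int n))
       (htpy_to_ext G R jk jI (conc (trivial_module R)) (EM_complex G W) (int n)
          (EM_to_htpy G R W n X))"


section \<open>Tensor products\<close>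

text \<open>
  Elements of \<open>M \<otimes>\<^sub>R N\<close> are formal finite sums of pairs (lists) modulo the bilinearity relations.
\<close>

inductive tensor_eq ::
  "('k, 'b) ring_scheme \<Rightarrow> ('k, 'm, 'x) module_scheme \<Rightarrow> ('k, 'n, 'y) module_scheme \<Rightarrow>
   ('m \<times> 'n) list \<Rightarrow> ('m \<times> 'n) list \<Rightarrow> bool"
  for R :: "('k, 'b) ring_scheme"
    and M :: "('k, 'm, 'x) module_scheme" and N :: "('k, 'n, 'y) module_scheme" where
  refl: "set xs \<subseteq> carrier M \<times> carrier N \<Longrightarrow> tensor_eq R M N xs xs"
| sym: "tensor_eq R M N xs ys \<Longrightarrow> tensor_eq R M N ys xs"
| trans: "tensor_eq R M N xs ys \<Longrightarrow> tensor_eq R M N ys zs \<Longrightarrow> tensor_eq R M N xs zs"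
| append: "tensor_eq R M N xs xs' \<Longrightarrow> tensor_eq R M N ys ys' \<Longrightarrow>
    tensor_eq R M N (xs @ ys) (xs' @ ys')"
| commute: "set xs \<subseteq> carrier M \<times> carrier N \<Longrightarrow> set ys \<subseteq> carrier M \<times> carrier N \<Longrightarrow>
    tensor_eq R M N (xs @ ys) (ys @ xs)"
| zero: "n \<in> carrier N \<Longrightarrow> tensor_eq R M N [(\<zero>\<^bsub>M\<^esub>, n)] []"
| add_left: "m \<in> carrier M \<Longrightarrow> m' \<in> carrier M \<Longrightarrow> n \<in> carrier N \<Longrightarrow>
    tensor_eq R M N [(m \<oplus>\<^bsub>M\<^esub> m', n)] [(m, n), (m', n)]"
| add_right: "m \<in> carrier M \<Longrightarrow> n \<in> carrier N \<Longrightarrow> n' \<in> carrier N \<Longrightarrow>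
    tensor_eq R M N [(m, n \<oplus>\<^bsub>N\<^esub> n')] [(m, n), (m, n')]"
| balanced: "r \<in> carrier R \<Longrightarrow> m \<in> carrier M \<Longrightarrow> n \<in> carrier N \<Longrightarrow>
    tensor_eq R M N [(r \<odot>\<^bsub>M\<^esub> m, n)] [(m, r \<odot>\<^bsub>N\<^esub> n)]"

definition tensor_class ::
  "('k, 'b) ring_scheme \<Rightarrow> ('k, 'm, 'x) module_scheme \<Rightarrow> ('k, 'n, 'y) module_scheme \<Rightarrow>
   ('m \<times> 'n) list \<Rightarrow> ('m \<times> 'n) list set" where
  "tensor_class R M N xs = {ys. tensor_eq R M N xs ys}"

definition tensor ::
  "('k, 'b) ring_scheme \<Rightarrow> ('k, 'm, 'x) module_scheme \<Rightarrow> ('k, 'n, 'y) module_scheme \<Rightarrow>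
   ('k, ('m \<times> 'n) list set) module" where
  "tensor R M N =
     \<lparr>carrier = tensor_class R M N ` {xs. set xs \<subseteq> carrier M \<times> carrier N},
      mult = undefined, one = undefined,
      zero = tensor_class R M N [],
      add = induced2 (\<lambda>xs ys. tensor_class R M N (xs @ ys)),
      smult = (\<lambda>r. induced (\<lambda>xs. tensor_class R M N (map (\<lambda>(m, n). (r \<odot>\<^bsub>M\<^esub> m, n)) xs)))\<rparr>"

text \<open>The linear map on \<open>M \<otimes>\<^sub>R N\<close> with values in \<open>P\<close> induced by a bilinear map \<open>b\<close>.\<close>

definition tensor_lift ::
  "('p, 'z) ring_scheme \<Rightarrow> ('m \<Rightarrow> 'n \<Rightarrow> 'p) \<Rightarrow> ('m \<times> 'n) list set \<Rightarrow> 'p" where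
  "tensor_lift P b = induced (\<lambda>xs. foldr (\<lambda>(m, n) s. b m n \<oplus>\<^bsub>P\<^esub> s) xs \<zero>\<^bsub>P\<^esub>)"

text \<open>The map \<open>f \<otimes> g\<close> with values in \<open>M' \<otimes>\<^sub>R N'\<close>.\<close>

definition tensor_map ::
  "('k, 'b) ring_scheme \<Rightarrow> ('k, 'm1, 'x) module_scheme \<Rightarrow> ('k, 'n1, 'y) module_scheme \<Rightarrow>
   ('m \<Rightarrow> 'm1) \<Rightarrow> ('n \<Rightarrow> 'n1) \<Rightarrow> ('m \<times> 'n) list set \<Rightarrow> ('m1 \<times> 'n1) list set" where
  "tensor_map R M' N' f g = induced (\<lambda>xs. tensor_class R M' N' (map (map_prod f g) xs))"


section \<open>Group cohomology\<close>

text \<open>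
  The universe in which the derived category is formed: a type that contains the elements of \<open>k\<close>
  and \<open>V\<close> and the cochains of \<open>I(k)\<close> and \<open>I(V)\<close>, and is closed under pairs, so that finite direct
  sums exist.  As \<open>'x\<close> is arbitrary, the universe can be as large as desired.
\<close>

datatype ('k, 'g, 'v, 'x) univ =
    Scalar 'k
  | Vector 'v
  | ScalarFun "'g list \<Rightarrow> 'k"
  | VectorFun "'g list \<Rightarrow> 'v"
  | Pair "('k, 'g, 'v, 'x) univ" "('k, 'g, 'v, 'x) univ"
  | Extra 'x

definition k_complex ::
  "('k, 'b) ring_scheme \<Rightarrow> ('k, 'g, ('k, 'g, 'v, 'x) univ) cochain_complex" where
  "k_complex R = transport_complex Scalar (conc (trivial_module R))"

definition V_complex ::
  "('k, 'g, 'v) kGmod \<Rightarrow> ('k, 'g, ('k, 'g, 'v, 'x) univ) cochain_complex" where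
  "V_complex V = transport_complex Vector (conc V)"

text \<open>\<open>H\<^sup>n(G, V)\<close> and \<open>H\<^sup>n(G, k)\<close>\<close>

definition H_V ::
  "('g, 'a) monoid_scheme \<Rightarrow> ('k, 'b) ring_scheme \<Rightarrow> ('k, 'g, 'v) kGmod \<Rightarrow> nat \<Rightarrow>
   ('k, ('k, 'g, ('k, 'g, 'v, 'x) univ) zigzag set) module" where
  "H_V G R V n = Ext G R (k_complex R) (V_complex V) (int n)"

definition H_k ::
  "('g, 'a) monoid_scheme \<Rightarrow> ('k, 'b) ring_scheme \<Rightarrow> nat \<Rightarrow>
   ('k, ('k, 'g, ('k, 'g, 'v, 'x) univ) zigzag set) module" where
  "H_k G R n = Ext G R (k_complex R) (k_complex R) (int n)"

definition cup_H ::
  "('g, 'a) monoid_scheme \<Rightarrow> ('k, 'b) ring_scheme \<Rightarrow> ('k, 'g, 'v) kGmod \<Rightarrow> nat \<Rightarrow> nat \<Rightarrow>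
   ('k, 'g, ('k, 'g, 'v, 'x) univ) zigzag set \<Rightarrow>
   ('k, 'g, ('k, 'g, 'v, 'x) univ) zigzag set \<Rightarrow>
   ('k, 'g, ('k, 'g, 'v, 'x) univ) zigzag set" where
  "cup_H G R V p q = ext_cup G R (k_complex R) (k_complex R) (V_complex V) (int p) (int q)"

definition Phi_V ::
  "('g, 'a) monoid_scheme \<Rightarrow> ('k, 'b) ring_scheme \<Rightarrow> ('k, 'g, 'v) kGmod \<Rightarrow> nat \<Rightarrow>
   ('g list \<Rightarrow> 'v) set \<Rightarrow> ('k, 'g, ('k, 'g, 'v, 'x) univ) zigzag set" where
  "Phi_V G R V = Phi G R Scalar Vector VectorFun V"

definition Phi_k ::
  "('g, 'a) monoid_scheme \<Rightarrow> ('k, 'b) ring_scheme \<Rightarrow> nat \<Rightarrow>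
   ('g list \<Rightarrow> 'k) set \<Rightarrow> ('k, 'g, ('k, 'g, 'v, 'x) univ) zigzag set" where
  "Phi_k G R = Phi G R Scalar Scalar ScalarFun (trivial_module R)"

end

theory Submission
  imports Defs
begin

text \<open>
  Write \<open>c\<^sub>W : W \<rightarrow> I(W)\<close> for the coaugmentation.  It is a quasi-isomorphism, and \<open>\<Phi>\<^sub>W\<close> sends the class of an
  invariant \<open>n\<close>-cocycle \<open>\<alpha>\<close>, seen as a chain map \<open>k \<rightarrow> I(W)[n]\<close>, to the zigzag
  \<open>c\<^sub>W[n]\<^sup>-\<^sup>1 \<circ> \<alpha>\<close>.  For an invariant \<open>p\<close>-cocycle \<open>\<alpha>\<close> of \<open>I(V)\<close>, the Leibniz rule says that \<open>f \<mapsto> \<alpha> \<union> f\<close> is a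
  chain map \<open>\<alpha>' : I(k) \<rightarrow> I(V)[p]\<close>; moreover \<open>\<alpha>' \<circ> c\<^sub>k = \<alpha>\<close>.  Hence \<open>\<alpha>[q] \<circ> c\<^sub>k[q]\<^sup>-\<^sup>1 = \<alpha>'[q]\<close> in the
  derived category, and \<open>\<Phi>(\<alpha>)[q] \<circ> \<Phi>(\<beta>) = c\<^sub>V[p+q]\<^sup>-\<^sup>1 \<circ> \<alpha>'[q] \<circ> \<beta> = \<Phi>(\<alpha> \<union> \<beta>)\<close>.

  The maps out of tensor products are well defined only if composition is bilinear on Ext.  No calculus of
  fractions is needed for this: biproducts of complexes preserve quasi-isomorphisms, so the sum of two
  zigzags \<open>v\<close> and \<open>w\<close> is represented by \<open>\<nabla> \<circ> (v \<oplus> w) \<circ> \<Delta>\<close>.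
\<close>


text \<open>Zigzags have no normal form here, so an identity between them cannot be checked on
  representatives. It is obtained from naturality instead: a transformation between functors that
  preserve quasi-isomorphisms stays natural on zigzags (\<open>zeq_natural\<close>), and zeros,
  scalars, projections and sums come from choosing the two functors, a constant functor among them.
  Addition in Ext is a definite description over common denominators, so existence and uniqueness
  both have to be shown; \<open>common_source\<close> supplies the denominator. The localization
  inverts quasi-isomorphisms of complexes, not of the homotopy category, while \<Phi> is defined on
  homotopy classes. Hence homotopic chain maps must be shown to become equal, by way of a path
  complex. The universe is closed under pairs and is otherwise arbitrary, so every auxiliary complex
  has to be encoded by pairs.\<close>

lemma induced_eq:
  assumes "x \<in> X" and "\<And>y. y \<in> X \<Longrightarrow> h y = c"
  shows "induced h X = c"
proof -
  have "h ` X = {c}" using assms by auto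
  then show ?thesis by (simp add: induced_def)
qed

lemma induced2_eq:
  assumes "x \<in> X" "y \<in> Y" and "\<And>u v. u \<in> X \<Longrightarrow> v \<in> Y \<Longrightarrow> h u v = c"
  shows "induced2 h X Y = c"
proof -
  have "{h x y | x y. x \<in> X \<and> y \<in> Y} = {c}" using assms by blast
  then show ?thesis by (simp add: induced2_def)
qed

locale kG_setting =
  fixes G :: "('g, 'a) monoid_scheme" and R :: "('k, 'b) ring_scheme"
  assumes group_G: "group G" and cring_R: "cring R"
begin

section \<open>Modules and homomorphisms\<close>

abbreviation kmod :: "('k, 'g, 'm) kGmod \<Rightarrow> bool" where "kmod M \<equiv> kG_module G R M"
abbreviation khom :: "('k, 'g, 'm) kGmod \<Rightarrow> ('k, 'g, 'n) kGmod \<Rightarrow> ('m \<Rightarrow> 'n) set"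
  where "khom M N \<equiv> kG_hom G R M N"
abbreviation cpx :: "('k, 'g, 'm) cochain_complex \<Rightarrow> bool" where "cpx C \<equiv> is_complex G R C"
abbreviation cmap ::
  "('k, 'g, 'm) cochain_complex \<Rightarrow> (int \<Rightarrow> 'm \<Rightarrow> 'n) \<Rightarrow> ('k, 'g, 'n) cochain_complex \<Rightarrow> bool"
  where "cmap C f D \<equiv> chain_map G R C f D"
abbreviation qi ::
  "('k, 'g, 'm) cochain_complex \<Rightarrow> (int \<Rightarrow> 'm \<Rightarrow> 'n) \<Rightarrow> ('k, 'g, 'n) cochain_complex \<Rightarrow> bool"
  where "qi C f D \<equiv> quasi_iso G R C f D"

lemma group_closed [simp]:
  "g \<in> carrier G \<Longrightarrow> h \<in> carrier G \<Longrightarrow> g \<otimes>\<^bsub>G\<^esub> h \<in> carrier G"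
  "\<one>\<^bsub>G\<^esub> \<in> carrier G" "g \<in> carrier G \<Longrightarrow> inv\<^bsub>G\<^esub> g \<in> carrier G"
  using group_G by (simp_all add: group.is_monoid monoid.m_closed monoid.one_closed)

lemma kmod_module: "kmod M \<Longrightarrow> module R M"
  by (simp add: kG_module_def)

lemma kmod_abelian_group: "kmod M \<Longrightarrow> abelian_group M"
  by (simp add: kG_module_def module_def)

lemma kmodI:
  fixes M (structure)
  assumes "\<And>x y. x \<in> carrier M \<Longrightarrow> y \<in> carrier M \<Longrightarrow> x \<oplus> y \<in> carrier M"
    and "\<zero> \<in> carrier M"
    and "\<And>x y z. x \<in> carrier M \<Longrightarrow> y \<in> carrier M \<Longrightarrow> z \<in> carrier M \<Longrightarrow>
      (x \<oplus> y) \<oplus> z = x \<oplus> (y \<oplus> z)"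
    and "\<And>x y. x \<in> carrier M \<Longrightarrow> y \<in> carrier M \<Longrightarrow> x \<oplus> y = y \<oplus> x"
    and "\<And>x. x \<in> carrier M \<Longrightarrow> \<zero> \<oplus> x = x"
    and "\<And>x. x \<in> carrier M \<Longrightarrow> \<exists>y\<in>carrier M. y \<oplus> x = \<zero>"
    and "\<And>r x. r \<in> carrier R \<Longrightarrow> x \<in> carrier M \<Longrightarrow> r \<odot> x \<in> carrier M"
    and "\<And>r s x. r \<in> carrier R \<Longrightarrow> s \<in> carrier R \<Longrightarrow> x \<in> carrier M \<Longrightarrow>
      (r \<oplus>\<^bsub>R\<^esub> s) \<odot> x = r \<odot> x \<oplus> s \<odot> x"
    and "\<And>r x y. r \<in> carrier R \<Longrightarrow> x \<in> carrier M \<Longrightarrow> y \<in> carrier M \<Longrightarrow>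
      r \<odot> (x \<oplus> y) = r \<odot> x \<oplus> r \<odot> y"
    and "\<And>r s x. r \<in> carrier R \<Longrightarrow> s \<in> carrier R \<Longrightarrow> x \<in> carrier M \<Longrightarrow>
      (r \<otimes>\<^bsub>R\<^esub> s) \<odot> x = r \<odot> (s \<odot> x)"
    and "\<And>x. x \<in> carrier M \<Longrightarrow> \<one>\<^bsub>R\<^esub> \<odot> x = x"
    and "\<And>g x. g \<in> carrier G \<Longrightarrow> x \<in> carrier M \<Longrightarrow> act M g x \<in> carrier M"
    and "\<And>g x y. g \<in> carrier G \<Longrightarrow> x \<in> carrier M \<Longrightarrow> y \<in> carrier M \<Longrightarrow>
      act M g (x \<oplus> y) = act M g x \<oplus> act M g y"
    and "\<And>g r x. g \<in> carrier G \<Longrightarrow> r \<in> carrier R \<Longrightarrow> x \<in> carrier M \<Longrightarrow>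
      act M g (r \<odot> x) = r \<odot> act M g x"
    and "\<And>x. x \<in> carrier M \<Longrightarrow> act M \<one>\<^bsub>G\<^esub> x = x"
    and "\<And>g h x. g \<in> carrier G \<Longrightarrow> h \<in> carrier G \<Longrightarrow> x \<in> carrier M \<Longrightarrow>
      act M (g \<otimes>\<^bsub>G\<^esub> h) x = act M g (act M h x)"
  shows "kmod M"
  unfolding kG_module_def
  by (intro conjI moduleI abelian_groupI cring_R ballI) (fact assms)+

lemma kmod_abelian_monoid: "kmod M \<Longrightarrow> abelian_monoid M"
  by (rule abelian_group.axioms(1)[OF kmod_abelian_group])

lemma kmod_act_closed:
  "kmod M \<Longrightarrow> g \<in> carrier G \<Longrightarrow> x \<in> carrier M \<Longrightarrow> act M g x \<in> carrier M"
  by (simp add: kG_module_def)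

lemmas kmod_closed [simp] =
  abelian_monoid.zero_closed[OF kmod_abelian_monoid] abelian_monoid.a_closed[OF kmod_abelian_monoid]
  abelian_group.a_inv_closed[OF kmod_abelian_group] abelian_group.minus_closed[OF kmod_abelian_group]
  module.smult_closed[OF kmod_module] kmod_act_closed

lemma kmod_act:
  fixes M (structure)
  assumes "kmod M"
  shows "g \<in> carrier G \<Longrightarrow> x \<in> carrier M \<Longrightarrow> y \<in> carrier M \<Longrightarrow>
      act M g (x \<oplus> y) = act M g x \<oplus> act M g y"
    and "g \<in> carrier G \<Longrightarrow> r \<in> carrier R \<Longrightarrow> x \<in> carrier M \<Longrightarrow>
      act M g (r \<odot> x) = r \<odot> act M g x"
    and "x \<in> carrier M \<Longrightarrow> act M \<one>\<^bsub>G\<^esub> x = x"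
    and "g \<in> carrier G \<Longrightarrow> h \<in> carrier G \<Longrightarrow> x \<in> carrier M \<Longrightarrow>
      act M (g \<otimes>\<^bsub>G\<^esub> h) x = act M g (act M h x)"
  using assms by (simp_all add: kG_module_def)

lemmas kmod_smult =
  module.smult_l_distr[OF kmod_module] module.smult_r_distr[OF kmod_module]
  module.smult_assoc1[OF kmod_module] module.smult_one[OF kmod_module]
  module.smult_r_minus[OF kmod_module] module.smult_r_null[OF kmod_module]
  module.smult_l_null[OF kmod_module]

lemma kmod_minus_eq: "kmod M \<Longrightarrow> x \<ominus>\<^bsub>M\<^esub> y = x \<oplus>\<^bsub>M\<^esub> \<ominus>\<^bsub>M\<^esub> y"
  by (simp add: a_minus_def)

lemmas kmod_grp =
  abelian_monoid.a_assoc[OF kmod_abelian_monoid] abelian_monoid.a_comm[OF kmod_abelian_monoid]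
  abelian_monoid.a_lcomm[OF kmod_abelian_monoid] abelian_group.minus_add[OF kmod_abelian_group]
  abelian_group.r_neg2[OF kmod_abelian_group] abelian_group.r_neg1[OF kmod_abelian_group]
  kmod_minus_eq

lemma kmod_minus_zero: "kmod M \<Longrightarrow> \<ominus>\<^bsub>M\<^esub> \<zero>\<^bsub>M\<^esub> = \<zero>\<^bsub>M\<^esub>"
  by (rule abelian_group.minus_equality[OF kmod_abelian_group])
    (simp_all add: abelian_monoid.l_zero[OF kmod_abelian_monoid])

lemmas kmod_grp_simps [simp] =
  abelian_monoid.l_zero[OF kmod_abelian_monoid] abelian_monoid.r_zero[OF kmod_abelian_monoid]
  kmod_minus_zero abelian_group.minus_minus[OF kmod_abelian_group]
  abelian_group.r_neg[OF kmod_abelian_group] abelian_group.l_neg[OF kmod_abelian_group]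

lemma kmod_diff_simps [simp]:
  "kmod M \<Longrightarrow> x \<in> carrier M \<Longrightarrow> x \<ominus>\<^bsub>M\<^esub> x = \<zero>\<^bsub>M\<^esub>"
  "kmod M \<Longrightarrow> x \<in> carrier M \<Longrightarrow> x \<ominus>\<^bsub>M\<^esub> \<zero>\<^bsub>M\<^esub> = x"
  by (simp_all add: kmod_minus_eq)

text \<open>Rewriting with \<open>kmod_grp\<close> produces right-nested sums in which
  \<open>x\<close> and its negative may be separated by other summands, while the rules there cancel
  only neighbours. Each case cancels across a fixed number of intervening terms.\<close>

lemma kmod_cancel:
  fixes M (structure)
  assumes "kmod M" "x \<in> carrier M" "y \<in> carrier M"
  shows "x \<oplus> (y \<oplus> \<ominus> x) = y"
    and "\<ominus> x \<oplus> (y \<oplus> x) = y"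
    and "z \<in> carrier M \<Longrightarrow> x \<oplus> (y \<oplus> (\<ominus> x \<oplus> z)) = y \<oplus> z"
    and "z \<in> carrier M \<Longrightarrow> x \<oplus> (y \<oplus> (z \<oplus> \<ominus> x)) = y \<oplus> z"
    and "z \<in> carrier M \<Longrightarrow> w \<in> carrier M \<Longrightarrow>
      x \<oplus> (y \<oplus> (z \<oplus> (\<ominus> x \<oplus> w))) = y \<oplus> (z \<oplus> w)"
    and "z \<in> carrier M \<Longrightarrow> w \<in> carrier M \<Longrightarrow>
      x \<oplus> (y \<oplus> (z \<oplus> (w \<oplus> \<ominus> x))) = y \<oplus> (z \<oplus> w)"
proof -
  have *: "u \<oplus> (v \<oplus> \<ominus> u) = v" if "u \<in> carrier M" "v \<in> carrier M" for u v
    using that assms(1) by (simp add: kmod_grp(3)[of M u v])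
  show "x \<oplus> (y \<oplus> \<ominus> x) = y" using assms * by blast
  show "\<ominus> x \<oplus> (y \<oplus> x) = y" using assms *[of "\<ominus> x" y] by simp
  have 3: "u \<oplus> (v \<oplus> (\<ominus> u \<oplus> w)) = v \<oplus> w"
    if "u \<in> carrier M" "v \<in> carrier M" "w \<in> carrier M" for u v w
    using that assms(1) by (simp add: kmod_grp(3)[of M u v] kmod_grp(5))
  show "z \<in> carrier M \<Longrightarrow> x \<oplus> (y \<oplus> (\<ominus> x \<oplus> z)) = y \<oplus> z"
    using 3 assms by blast
  show 4: "z \<in> carrier M \<Longrightarrow> x \<oplus> (y \<oplus> (z \<oplus> \<ominus> x)) = y \<oplus> z"
    using assms *[of x "y \<oplus> z"] by (simp add: kmod_grp(1))
  show "z \<in> carrier M \<Longrightarrow> w \<in> carrier M \<Longrightarrow>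
      x \<oplus> (y \<oplus> (z \<oplus> (\<ominus> x \<oplus> w))) = y \<oplus> (z \<oplus> w)"
    using assms 3[of x "y \<oplus> z" w] by (simp add: kmod_grp(1))
  show "z \<in> carrier M \<Longrightarrow> w \<in> carrier M \<Longrightarrow>
      x \<oplus> (y \<oplus> (z \<oplus> (w \<oplus> \<ominus> x))) = y \<oplus> (z \<oplus> w)"
    using assms *[of x "y \<oplus> (z \<oplus> w)"] by (simp add: kmod_grp(1))
qed

lemma kmod_minus_unique:
  assumes "kmod M" "x \<in> carrier M" "y \<in> carrier M" "y \<oplus>\<^bsub>M\<^esub> x = \<zero>\<^bsub>M\<^esub>"
  shows "\<ominus>\<^bsub>M\<^esub> x = y"
  using assms abelian_group.minus_equality[OF kmod_abelian_group] by metis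

lemma kmod_diff_zero:
  assumes "kmod M" "x \<in> carrier M" "y \<in> carrier M"
  shows "x \<ominus>\<^bsub>M\<^esub> y = \<zero>\<^bsub>M\<^esub> \<longleftrightarrow> x = y"
  using assms by (metis kmod_closed(3) kmod_grp(2,7) kmod_grp_simps(4) kmod_diff_simps(1) kmod_minus_unique)

lemma khomI:
  assumes "\<And>x. x \<in> carrier M \<Longrightarrow> f x \<in> carrier N"
    and "\<And>x. x \<notin> carrier M \<Longrightarrow> f x = undefined"
    and "\<And>x y. x \<in> carrier M \<Longrightarrow> y \<in> carrier M \<Longrightarrow> f (x \<oplus>\<^bsub>M\<^esub> y) = f x \<oplus>\<^bsub>N\<^esub> f y"
    and "\<And>r x. r \<in> carrier R \<Longrightarrow> x \<in> carrier M \<Longrightarrow> f (r \<odot>\<^bsub>M\<^esub> x) = r \<odot>\<^bsub>N\<^esub> f x"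
    and "\<And>g x. g \<in> carrier G \<Longrightarrow> x \<in> carrier M \<Longrightarrow> f (act M g x) = act N g (f x)"
  shows "f \<in> khom M N"
  using assms by (auto simp: kG_hom_def PiE_def extensional_def)

lemma khomD:
  assumes "f \<in> khom M N"
  shows "x \<in> carrier M \<Longrightarrow> f x \<in> carrier N"
    and "x \<notin> carrier M \<Longrightarrow> f x = undefined"
    and "x \<in> carrier M \<Longrightarrow> y \<in> carrier M \<Longrightarrow> f (x \<oplus>\<^bsub>M\<^esub> y) = f x \<oplus>\<^bsub>N\<^esub> f y"
    and "r \<in> carrier R \<Longrightarrow> x \<in> carrier M \<Longrightarrow> f (r \<odot>\<^bsub>M\<^esub> x) = r \<odot>\<^bsub>N\<^esub> f x"
    and "g \<in> carrier G \<Longrightarrow> x \<in> carrier M \<Longrightarrow> f (act M g x) = act N g (f x)"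
  using assms by (auto simp: kG_hom_def PiE_def extensional_def)

lemma khom_zero:
  fixes M (structure)
  assumes "kmod M" "kmod N" "f \<in> khom M N"
  shows "f \<zero> = \<zero>\<^bsub>N\<^esub>"
proof -
  interpret abelian_group N using assms by (intro kmod_abelian_group)
  have c: "f \<zero> \<in> carrier N" using assms khomD(1) by fastforce
  have "f (\<zero> \<oplus> \<zero>) = f \<zero> \<oplus>\<^bsub>N\<^esub> f \<zero>"
    using assms by (intro khomD(3)) auto
  then have "f \<zero> = f \<zero> \<oplus>\<^bsub>N\<^esub> f \<zero>" using assms by simp
  then show ?thesis using c by (metis add.r_cancel_one')
qed

lemma khom_minus:
  assumes "kmod M" "kmod N" "f \<in> khom M N" "x \<in> carrier M"
  shows "f (\<ominus>\<^bsub>M\<^esub> x) = \<ominus>\<^bsub>N\<^esub> f x"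
proof -
  have "f (\<ominus>\<^bsub>M\<^esub> x) \<oplus>\<^bsub>N\<^esub> f x = \<zero>\<^bsub>N\<^esub>"
    using assms khomD(3)[OF assms(3), of "\<ominus>\<^bsub>M\<^esub> x" x] by (simp add: khom_zero)
  then show ?thesis using assms khomD(1)[OF assms(3)] kmod_minus_unique by (metis kmod_closed(3))
qed

lemma khom_diff:
  assumes "kmod M" "kmod N" "f \<in> khom M N" "x \<in> carrier M" "y \<in> carrier M"
  shows "f (x \<ominus>\<^bsub>M\<^esub> y) = f x \<ominus>\<^bsub>N\<^esub> f y"
  using assms khomD(1,3)[OF assms(3)] by (simp add: kmod_grp khom_minus)

lemma khom_comp:
  assumes "f \<in> khom L M" "h \<in> khom M N" "kmod L"
  shows "compose (carrier L) h f \<in> khom L N"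
  using khomD(1)[OF assms(1)] khomD(1)[OF assms(2)]
  by (intro khomI)
    (simp_all add: compose_def khomD(3-5)[OF assms(1)] khomD(3-5)[OF assms(2)] assms(3))

lemma khom_add:
  assumes "kmod L" "kmod M" "f \<in> khom L M" "h \<in> khom L M"
  shows "(\<lambda>x\<in>carrier L. f x \<oplus>\<^bsub>M\<^esub> h x) \<in> khom L M"
  using assms khomD(1)[OF assms(3)] khomD(1)[OF assms(4)]
  by (auto intro!: khomI simp: khomD(3-5)[OF assms(3)] khomD(3-5)[OF assms(4)] kmod_grp kmod_smult kmod_act)

text \<open>The action is given as additive and \<open>R\<close>-linear. It fixes zero because zero
  is the zero scalar times itself and the scalar can be pulled out; negatives then follow from
  additivity and uniqueness of inverses.\<close>

lemma kmod_act_zero_minus: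
  fixes M (structure)
  assumes "kmod M" "g \<in> carrier G"
  shows "act M g \<zero> = \<zero>"
    and "x \<in> carrier M \<Longrightarrow> act M g (\<ominus> x) = \<ominus> act M g x"
proof -
  show z: "act M g \<zero> = \<zero>"
    using assms kmod_act(2)[of M g "\<zero>\<^bsub>R\<^esub>" "\<zero>"] cring.cring_simprules(2)[OF cring_R]
    by (simp add: kmod_smult)
  show "x \<in> carrier M \<Longrightarrow> act M g (\<ominus> x) = \<ominus> act M g x"
    using assms z kmod_act(1)[of M g "\<ominus> x" x]
    by (intro kmod_minus_unique[symmetric]) simp_all
qed

lemma khom_diff_map:
  assumes "kmod L" "kmod M" "f \<in> khom L M" "h \<in> khom L M"
  shows "(\<lambda>x\<in>carrier L. f x \<ominus>\<^bsub>M\<^esub> h x) \<in> khom L M"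
  using assms khomD(1)[OF assms(3)] khomD(1)[OF assms(4)]
  by (auto intro!: khomI simp: khomD(3-5)[OF assms(3)] khomD(3-5)[OF assms(4)] kmod_grp kmod_smult
      kmod_act kmod_act_zero_minus)

lemma khom_zero_map:
  assumes "kmod L" "kmod M"
  shows "(\<lambda>x\<in>carrier L. \<zero>\<^bsub>M\<^esub>) \<in> khom L M"
  using assms by (auto intro!: khomI simp: kmod_smult kmod_act_zero_minus)

lemma khom_scalar:
  fixes M (structure)
  assumes "kmod M" "r \<in> carrier R"
  shows "(\<lambda>x\<in>carrier M. r \<odot> x) \<in> khom M M"
proof -
  \<comment> \<open>Commutativity of \<open>R\<close> is what makes multiplication by
    \<open>r\<close> an \<open>R\<close>-linear endomorphism.\<close>
  have "r \<odot> (s \<odot> x) = s \<odot> (r \<odot> x)" if "s \<in> carrier R" "x \<in> carrier M" for s x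
    using that assms by (metis cring.cring_simprules(14) cring_R kmod_smult(3))
  then show ?thesis using assms by (auto intro!: khomI simp: kmod_smult kmod_act)
qed

lemma khom_id: "kmod M \<Longrightarrow> (\<lambda>x\<in>carrier M. x) \<in> khom M M"
  by (auto intro!: khomI)


section \<open>Complexes, cohomology classes and homotopy classes\<close>

lemma cpx_kmod [simp]: "cpx C \<Longrightarrow> kmod (ob C i)"
  by (simp add: is_complex_def)

lemma cpx_diff: "cpx C \<Longrightarrow> diff C i \<in> khom (ob C i) (ob C (i + 1))"
  by (simp add: is_complex_def)

lemma cpx_diff_closed [simp]:
  "cpx C \<Longrightarrow> x \<in> carrier (ob C i) \<Longrightarrow> j = i + 1 \<Longrightarrow> diff C i x \<in> carrier (ob C j)"
  using khomD(1)[OF cpx_diff[of C i], of x] by simp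

lemma cpx_diff_diff [simp]:
  "cpx C \<Longrightarrow> x \<in> carrier (ob C i) \<Longrightarrow> j = i + 1 \<Longrightarrow> diff C j (diff C i x) = \<zero>\<^bsub>ob C (j + 1)\<^esub>"
  by (simp add: is_complex_def add.assoc)

lemma cpx_diff_linear:
  assumes "cpx C" "x \<in> carrier (ob C i)"
  shows "y \<in> carrier (ob C i) \<Longrightarrow> diff C i (x \<oplus>\<^bsub>ob C i\<^esub> y) = diff C i x \<oplus>\<^bsub>ob C (i + 1)\<^esub> diff C i y"
    and "y \<in> carrier (ob C i) \<Longrightarrow> diff C i (x \<ominus>\<^bsub>ob C i\<^esub> y) = diff C i x \<ominus>\<^bsub>ob C (i + 1)\<^esub> diff C i y"
    and "r \<in> carrier R \<Longrightarrow> diff C i (r \<odot>\<^bsub>ob C i\<^esub> x) = r \<odot>\<^bsub>ob C (i + 1)\<^esub> diff C i x"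
    and "g \<in> carrier G \<Longrightarrow> diff C i (act (ob C i) g x) = act (ob C (i + 1)) g (diff C i x)"
    and "diff C i (\<ominus>\<^bsub>ob C i\<^esub> x) = \<ominus>\<^bsub>ob C (i + 1)\<^esub> diff C i x"
  using assms khomD(3-5)[OF cpx_diff[OF assms(1)]] khom_diff[OF _ _ cpx_diff[OF assms(1)]]
    khom_minus[OF _ _ cpx_diff[OF assms(1)]] by simp_all

lemma cpx_diff_zero [simp]: "cpx C \<Longrightarrow> diff C i \<zero>\<^bsub>ob C i\<^esub> = \<zero>\<^bsub>ob C (i + 1)\<^esub>"
  using khom_zero[OF _ _ cpx_diff[of C i]] by simp

lemma cpxI:
  assumes "\<And>i. kmod (ob C i)" and "\<And>i. diff C i \<in> khom (ob C i) (ob C (i + 1))"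
    and "\<And>i x. x \<in> carrier (ob C i) \<Longrightarrow> diff C (i + 1) (diff C i x) = \<zero>\<^bsub>ob C (i + 2)\<^esub>"
  shows "cpx C"
  unfolding is_complex_def using assms by blast

lemma cmapI:
  assumes "cpx C" "cpx D" and "\<And>i. f i \<in> khom (ob C i) (ob D i)"
    and "\<And>i x. x \<in> carrier (ob C i) \<Longrightarrow> f (i + 1) (diff C i x) = diff D i (f i x)"
  shows "cmap C f D"
  using assms by (simp add: chain_map_def)

lemma cmapD:
  assumes "cmap C f D"
  shows "cpx C" "cpx D" "f i \<in> khom (ob C i) (ob D i)"
    and "x \<in> carrier (ob C i) \<Longrightarrow> f i x \<in> carrier (ob D i)"
    and "x \<in> carrier (ob C i) \<Longrightarrow> y \<in> carrier (ob C i) \<Longrightarrow>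
      f i (x \<oplus>\<^bsub>ob C i\<^esub> y) = f i x \<oplus>\<^bsub>ob D i\<^esub> f i y"
    and "x \<in> carrier (ob C i) \<Longrightarrow> y \<in> carrier (ob C i) \<Longrightarrow>
      f i (x \<ominus>\<^bsub>ob C i\<^esub> y) = f i x \<ominus>\<^bsub>ob D i\<^esub> f i y"
    and "r \<in> carrier R \<Longrightarrow> x \<in> carrier (ob C i) \<Longrightarrow> f i (r \<odot>\<^bsub>ob C i\<^esub> x) = r \<odot>\<^bsub>ob D i\<^esub> f i x"
    and "f i \<zero>\<^bsub>ob C i\<^esub> = \<zero>\<^bsub>ob D i\<^esub>"
    and "x \<in> carrier (ob C i) \<Longrightarrow> f i (\<ominus>\<^bsub>ob C i\<^esub> x) = \<ominus>\<^bsub>ob D i\<^esub> f i x"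
    and "x \<in> carrier (ob C i) \<Longrightarrow> j = i + 1 \<Longrightarrow> f j (diff C i x) = diff D i (f i x)"
    and "g \<in> carrier G \<Longrightarrow> x \<in> carrier (ob C i) \<Longrightarrow> f i (act (ob C i) g x) = act (ob D i) g (f i x)"
proof -
  show c: "cpx C" "cpx D" and h: "f i \<in> khom (ob C i) (ob D i)"
    and "x \<in> carrier (ob C i) \<Longrightarrow> j = i + 1 \<Longrightarrow> f j (diff C i x) = diff D i (f i x)"
    using assms by (simp_all add: chain_map_def)
  show "x \<in> carrier (ob C i) \<Longrightarrow> f i x \<in> carrier (ob D i)"
    and "x \<in> carrier (ob C i) \<Longrightarrow> y \<in> carrier (ob C i) \<Longrightarrow>
      f i (x \<oplus>\<^bsub>ob C i\<^esub> y) = f i x \<oplus>\<^bsub>ob D i\<^esub> f i y"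
    and "x \<in> carrier (ob C i) \<Longrightarrow> y \<in> carrier (ob C i) \<Longrightarrow>
      f i (x \<ominus>\<^bsub>ob C i\<^esub> y) = f i x \<ominus>\<^bsub>ob D i\<^esub> f i y"
    and "r \<in> carrier R \<Longrightarrow> x \<in> carrier (ob C i) \<Longrightarrow> f i (r \<odot>\<^bsub>ob C i\<^esub> x) = r \<odot>\<^bsub>ob D i\<^esub> f i x"
    and "f i \<zero>\<^bsub>ob C i\<^esub> = \<zero>\<^bsub>ob D i\<^esub>"
    and "x \<in> carrier (ob C i) \<Longrightarrow> f i (\<ominus>\<^bsub>ob C i\<^esub> x) = \<ominus>\<^bsub>ob D i\<^esub> f i x"
    and "g \<in> carrier G \<Longrightarrow> x \<in> carrier (ob C i) \<Longrightarrow> f i (act (ob C i) g x) = act (ob D i) g (f i x)"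
    using khomD[OF h] khom_zero[OF _ _ h] khom_minus[OF _ _ h] khom_diff[OF _ _ h] c by simp_all
qed

text \<open>Homomorphisms are \<open>undefined\<close> off the carrier, so agreement on carriers is
  equality of functions. The targets serve to certify extensionality and may differ.\<close>

lemma map_eqI:
  assumes "\<And>i. f i \<in> khom (ob C i) (ob D i)" "\<And>i. f' i \<in> khom (ob C i) (ob D' i)"
    and "\<And>i x. x \<in> carrier (ob C i) \<Longrightarrow> f i x = f' i x"
  shows "f = f'"
proof (intro ext)
  fix i x show "f i x = f' i x"
    using assms(3) khomD(2)[OF assms(1)] khomD(2)[OF assms(2)] by (cases "x \<in> carrier (ob C i)") auto
qed

lemma cmap_eqI:
  assumes "cmap C f D" "cmap C f' D'" and "\<And>i x. x \<in> carrier (ob C i) \<Longrightarrow> f i x = f' i x"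
  shows "f = f'"
  using assms by (intro map_eqI[of f C D f' D']) (auto dest: cmapD)

lemma cmap_comp:
  assumes "cmap A f B" "cmap B g C"
  shows "cmap A (comp_map A g f) C"
proof (rule cmapI)
  note f = cmapD[OF assms(1)] and g = cmapD[OF assms(2)]
  show "cpx A" "cpx C" using f g by blast+
  show "comp_map A g f i \<in> khom (ob A i) (ob C i)" for i
    unfolding comp_map_def using khom_comp[OF f(3) g(3)] f(1) by simp
  show "comp_map A g f (i + 1) (diff A i x) = diff C i (comp_map A g f i x)"
    if "x \<in> carrier (ob A i)" for i x
    using that f(1,4,10) g(10) by (simp add: comp_map_def compose_def)
qed

lemma comp_map_apply [simp]: "x \<in> carrier (ob A i) \<Longrightarrow> comp_map A g f i x = g i (f i x)"
  by (simp add: comp_map_def compose_def)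

lemma cmap_id: "cpx C \<Longrightarrow> cmap C (id_map C) C"
  by (intro cmapI) (auto simp: id_map_def khom_id)

lemma id_map_apply [simp]: "x \<in> carrier (ob A i) \<Longrightarrow> id_map A i x = x"
  by (simp add: id_map_def)

lemma comp_map_id:
  assumes "cmap A f B"
  shows "comp_map A f (id_map A) = f" "comp_map A (id_map B) f = f"
  using cmap_comp[OF cmap_id assms] cmap_comp[OF assms cmap_id] assms cmapD(1,2)[OF assms]
  by (auto intro!: cmap_eqI simp: cmapD(4)[OF assms])

lemma cmap_zero: "cpx C \<Longrightarrow> cpx D \<Longrightarrow> cmap C (zero_map C D) D"
  by (intro cmapI) (auto simp: zero_map_def khom_zero_map)

lemma zero_map_apply [simp]: "x \<in> carrier (ob C i) \<Longrightarrow> zero_map C D i x = \<zero>\<^bsub>ob D i\<^esub>"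
  by (simp add: zero_map_def)

lemma add_map_apply [simp]: "x \<in> carrier (ob C i) \<Longrightarrow> add_map C D f g i x = f i x \<oplus>\<^bsub>ob D i\<^esub> g i x"
  by (simp add: add_map_def)

lemma scalar_map_apply [simp]: "x \<in> carrier (ob C i) \<Longrightarrow> scalar_map r C i x = r \<odot>\<^bsub>ob C i\<^esub> x"
  by (simp add: scalar_map_def)

lemma cmap_add:
  assumes "cmap C f D" "cmap C g D"
  shows "cmap C (add_map C D f g) D"
proof (rule cmapI)
  show "cpx C" "cpx D" using assms cmapD by blast+
  then show "add_map C D f g i \<in> khom (ob C i) (ob D i)" for i
    unfolding add_map_def using assms by (intro khom_add) (auto dest: cmapD(3))
  show "add_map C D f g (i + 1) (diff C i x) = diff D i (add_map C D f g i x)"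
    if "x \<in> carrier (ob C i)" for i x
    using that \<open>cpx C\<close> \<open>cpx D\<close> cmapD(4,10)[OF assms(1)] cmapD(4,10)[OF assms(2)]
    by (simp add: cpx_diff_linear)
qed

lemma cmap_scalar:
  assumes "cpx C" "r \<in> carrier R"
  shows "cmap C (scalar_map r C) C"
  by (rule cmapI) (use assms in \<open>auto simp: scalar_map_def khom_scalar cpx_diff_linear\<close>)

lemma kmod_zero_submodule: "kmod M \<Longrightarrow> kmod (zero_submodule M)"
  by (rule kmodI) (auto simp: zero_submodule_def kmod_smult kmod_act kmod_act_zero_minus)

lemma ob_conc: "ob (conc M) i = (if i = 0 then M else zero_submodule M)"
  by (simp add: conc_def)

lemma carrier_conc: "carrier (ob (conc M) i) = (if i = 0 then carrier M else {\<zero>\<^bsub>M\<^esub>})"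
  by (simp add: conc_def zero_submodule_def)

lemma zero_conc [simp]: "\<zero>\<^bsub>ob (conc M) i\<^esub> = \<zero>\<^bsub>M\<^esub>"
  by (simp add: conc_def zero_submodule_def)

lemma diff_conc: "x \<in> carrier (ob (conc M) i) \<Longrightarrow> diff (conc M) i x = \<zero>\<^bsub>M\<^esub>"
  by (simp add: conc_def)

lemma cpx_conc:
  assumes "kmod M" shows "cpx (conc M)"
proof (rule cpxI)
  show k: "kmod (ob (conc M) i)" for i using assms by (simp add: ob_conc kmod_zero_submodule)
  show "diff (conc M) i \<in> khom (ob (conc M) i) (ob (conc M) (i + 1))" for i
    using assms by (intro khomI) (auto simp: conc_def zero_submodule_def kmod_smult kmod_act_zero_minus)
  show "diff (conc M) (i + 1) (diff (conc M) i x) = \<zero>\<^bsub>ob (conc M) (i + 2)\<^esub>"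
    if "x \<in> carrier (ob (conc M) i)" for i x
    using that assms by (simp add: diff_conc carrier_conc)
qed

lemma kmod_trivial: "kmod (trivial_module R)"
proof -
  interpret cring R by (rule cring_R)
  show ?thesis
    by (rule kmodI) (auto simp: trivial_module_def a_ac l_distr r_distr m_assoc
        intro!: bexI[where x = "\<ominus>\<^bsub>R\<^esub> x" for x] r_neg)
qed

subsection \<open>Cohomology\<close>

lemma mem_coboundaries: "b \<in> coboundaries C n \<longleftrightarrow> (\<exists>x\<in>carrier (ob C (n - 1)). b = diff C (n - 1) x)"
  by (auto simp: coboundaries_def)

lemma coboundaries_closed:
  assumes "cpx C"
  shows "b \<in> coboundaries C n \<Longrightarrow> b \<in> carrier (ob C n)"
    and "b \<in> coboundaries C n \<Longrightarrow> b \<in> cocycles C n"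
    and "\<zero>\<^bsub>ob C n\<^esub> \<in> coboundaries C n"
    and "b \<in> coboundaries C n \<Longrightarrow> b' \<in> coboundaries C n \<Longrightarrow> b \<oplus>\<^bsub>ob C n\<^esub> b' \<in> coboundaries C n"
    and "b \<in> coboundaries C n \<Longrightarrow> \<ominus>\<^bsub>ob C n\<^esub> b \<in> coboundaries C n"
    and "b \<in> coboundaries C n \<Longrightarrow> b' \<in> coboundaries C n \<Longrightarrow> b \<ominus>\<^bsub>ob C n\<^esub> b' \<in> coboundaries C n"
    and "b \<in> coboundaries C n \<Longrightarrow> r \<in> carrier R \<Longrightarrow> r \<odot>\<^bsub>ob C n\<^esub> b \<in> coboundaries C n"
proof -
  note l = cpx_diff_linear[OF assms, where i = "n - 1", simplified]
  show "b \<in> coboundaries C n \<Longrightarrow> b \<in> carrier (ob C n)"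
    and "b \<in> coboundaries C n \<Longrightarrow> b \<in> cocycles C n"
    using assms by (auto simp: mem_coboundaries cocycles_def)
  show "\<zero>\<^bsub>ob C n\<^esub> \<in> coboundaries C n"
    unfolding mem_coboundaries using assms cpx_diff_zero[OF assms, of "n - 1"]
    by (intro bexI[of _ "\<zero>\<^bsub>ob C (n - 1)\<^esub>"]) simp_all
  show "b \<oplus>\<^bsub>ob C n\<^esub> b' \<in> coboundaries C n" "b \<ominus>\<^bsub>ob C n\<^esub> b' \<in> coboundaries C n"
    if bb: "b \<in> coboundaries C n" "b' \<in> coboundaries C n"
  proof -
    obtain x y where "x \<in> carrier (ob C (n - 1))" "y \<in> carrier (ob C (n - 1))"
      "b = diff C (n - 1) x" "b' = diff C (n - 1) y" using bb by (auto simp: mem_coboundaries)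
    then show "b \<oplus>\<^bsub>ob C n\<^esub> b' \<in> coboundaries C n" "b \<ominus>\<^bsub>ob C n\<^esub> b' \<in> coboundaries C n"
      using assms l(1,2)[of x y] unfolding mem_coboundaries
      by (intro bexI[of _ "x \<oplus>\<^bsub>ob C (n - 1)\<^esub> y"], simp_all,
          intro bexI[of _ "x \<ominus>\<^bsub>ob C (n - 1)\<^esub> y"], simp_all)
  qed
  show "\<ominus>\<^bsub>ob C n\<^esub> b \<in> coboundaries C n" "r \<in> carrier R \<Longrightarrow> r \<odot>\<^bsub>ob C n\<^esub> b \<in> coboundaries C n"
    if bb: "b \<in> coboundaries C n"
  proof -
    obtain x where "x \<in> carrier (ob C (n - 1))" "b = diff C (n - 1) x"
      using bb by (auto simp: mem_coboundaries)
    then show "\<ominus>\<^bsub>ob C n\<^esub> b \<in> coboundaries C n"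
      "r \<in> carrier R \<Longrightarrow> r \<odot>\<^bsub>ob C n\<^esub> b \<in> coboundaries C n"
      using assms l(3)[of x r] l(5)[of x] unfolding mem_coboundaries
      by (intro bexI[of _ "\<ominus>\<^bsub>ob C (n - 1)\<^esub> x"], simp_all,
          intro bexI[of _ "r \<odot>\<^bsub>ob C (n - 1)\<^esub> x"], simp_all)
  qed
qed

lemma cocycles_closed:
  assumes "cpx C"
  shows "x \<in> cocycles C n \<Longrightarrow> x \<in> carrier (ob C n)"
    and "\<zero>\<^bsub>ob C n\<^esub> \<in> cocycles C n"
    and "x \<in> cocycles C n \<Longrightarrow> y \<in> cocycles C n \<Longrightarrow> x \<oplus>\<^bsub>ob C n\<^esub> y \<in> cocycles C n"
    and "x \<in> cocycles C n \<Longrightarrow> r \<in> carrier R \<Longrightarrow> r \<odot>\<^bsub>ob C n\<^esub> x \<in> cocycles C n"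
  using assms by (auto simp: cocycles_def cpx_diff_linear kmod_smult)

lemma mem_coh_class:
  assumes "cpx C" "x \<in> carrier (ob C n)"
  shows "y \<in> coh_class C n x \<longleftrightarrow> y \<in> carrier (ob C n) \<and> y \<ominus>\<^bsub>ob C n\<^esub> x \<in> coboundaries C n"
proof -
  have "y \<in> coh_class C n x \<longleftrightarrow> (\<exists>b\<in>coboundaries C n. y = b \<oplus>\<^bsub>ob C n\<^esub> x)"
    by (auto simp: coh_class_def a_r_coset_def')
  also have "\<dots> \<longleftrightarrow> y \<in> carrier (ob C n) \<and> y \<ominus>\<^bsub>ob C n\<^esub> x \<in> coboundaries C n"
  proof
    assume "\<exists>b\<in>coboundaries C n. y = b \<oplus>\<^bsub>ob C n\<^esub> x"
    then obtain b where b: "b \<in> coboundaries C n" "y = b \<oplus>\<^bsub>ob C n\<^esub> x" by blast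
    then have bc: "b \<in> carrier (ob C n)" by (simp add: coboundaries_closed(1)[OF assms(1)])
    then have "y \<ominus>\<^bsub>ob C n\<^esub> x = b" using b assms by (simp add: kmod_grp)
    then show "y \<in> carrier (ob C n) \<and> y \<ominus>\<^bsub>ob C n\<^esub> x \<in> coboundaries C n"
      using b bc assms by simp
  next
    assume y: "y \<in> carrier (ob C n) \<and> y \<ominus>\<^bsub>ob C n\<^esub> x \<in> coboundaries C n"
    then have "y = (y \<ominus>\<^bsub>ob C n\<^esub> x) \<oplus>\<^bsub>ob C n\<^esub> x" using assms by (simp add: kmod_grp kmod_cancel)
    then show "\<exists>b\<in>coboundaries C n. y = b \<oplus>\<^bsub>ob C n\<^esub> x" using y by blast
  qed
  finally show ?thesis .
qed

lemma coh_class_self: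
  assumes "cpx C" "x \<in> carrier (ob C n)"
  shows "x \<in> coh_class C n x"
  using assms by (simp add: mem_coh_class coboundaries_closed)

lemma coh_class_eq:
  assumes "cpx C" "x \<in> carrier (ob C n)" "y \<in> carrier (ob C n)"
  shows "coh_class C n x = coh_class C n y \<longleftrightarrow> x \<ominus>\<^bsub>ob C n\<^esub> y \<in> coboundaries C n"
proof
  assume "coh_class C n x = coh_class C n y"
  then show "x \<ominus>\<^bsub>ob C n\<^esub> y \<in> coboundaries C n"
    using coh_class_self[OF assms(1,2)] assms by (simp add: mem_coh_class)
next
  assume b: "x \<ominus>\<^bsub>ob C n\<^esub> y \<in> coboundaries C n"
  have "z \<ominus>\<^bsub>ob C n\<^esub> x \<in> coboundaries C n \<longleftrightarrow> z \<ominus>\<^bsub>ob C n\<^esub> y \<in> coboundaries C n"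
    if "z \<in> carrier (ob C n)" for z
  proof -
    have "z \<ominus>\<^bsub>ob C n\<^esub> y = (z \<ominus>\<^bsub>ob C n\<^esub> x) \<oplus>\<^bsub>ob C n\<^esub> (x \<ominus>\<^bsub>ob C n\<^esub> y)"
      "z \<ominus>\<^bsub>ob C n\<^esub> x = (z \<ominus>\<^bsub>ob C n\<^esub> y) \<ominus>\<^bsub>ob C n\<^esub> (x \<ominus>\<^bsub>ob C n\<^esub> y)"
      using that assms by (simp_all add: kmod_grp kmod_cancel)
    then show ?thesis using b assms(1) coboundaries_closed(4,6) by metis
  qed
  then show "coh_class C n x = coh_class C n y" using assms by (auto simp: mem_coh_class)
qed

lemma coh_class_cocycle:
  assumes "cpx C" "x \<in> cocycles C n" "y \<in> coh_class C n x"
  shows "y \<in> cocycles C n"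
proof -
  have c: "x \<in> carrier (ob C n)" using assms by (simp add: cocycles_closed(1))
  have y: "y \<in> carrier (ob C n)" "y \<ominus>\<^bsub>ob C n\<^esub> x \<in> coboundaries C n"
    using assms c by (simp_all add: mem_coh_class)
  have "y = (y \<ominus>\<^bsub>ob C n\<^esub> x) \<oplus>\<^bsub>ob C n\<^esub> x" using assms(1) y c by (simp add: kmod_grp kmod_cancel)
  then show ?thesis using assms y coboundaries_closed(2) cocycles_closed(3) by metis
qed

text \<open>Well-definedness on a cohomology class, reduced to comparing \<open>h\<close> at two
  cocycles whose difference is a coboundary.\<close>

lemma induced_coh_class:
  assumes "cpx C" "x \<in> cocycles C n"
    and "\<And>y. y \<in> cocycles C n \<Longrightarrow> y \<ominus>\<^bsub>ob C n\<^esub> x \<in> coboundaries C n \<Longrightarrow> h y = h x"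
  shows "induced h (coh_class C n x) = h x"
proof (rule induced_eq)
  show "x \<in> coh_class C n x" using assms by (simp add: cocycles_closed(1) coh_class_self)
  show "h y = h x" if "y \<in> coh_class C n x" for y
    using that assms(3)[OF coh_class_cocycle[OF assms(1,2) that]] assms(1,2)
    by (simp add: mem_coh_class cocycles_closed(1))
qed

lemma coh_add:
  assumes "cpx C" "x \<in> carrier (ob C n)" "y \<in> carrier (ob C n)"
  shows "coh_class C n x \<oplus>\<^bsub>cohomology C n\<^esub> coh_class C n y = coh_class C n (x \<oplus>\<^bsub>ob C n\<^esub> y)"
proof -
  let ?M = "ob C n"
  have "z \<in> coh_class C n x <+>\<^bsub>?M\<^esub> coh_class C n y \<longleftrightarrow> z \<in> coh_class C n (x \<oplus>\<^bsub>?M\<^esub> y)" for z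
  proof
    assume "z \<in> coh_class C n x <+>\<^bsub>?M\<^esub> coh_class C n y"
    then obtain a b where ab: "a \<in> carrier ?M" "b \<in> carrier ?M" "z = a \<oplus>\<^bsub>?M\<^esub> b"
      "a \<ominus>\<^bsub>?M\<^esub> x \<in> coboundaries C n" "b \<ominus>\<^bsub>?M\<^esub> y \<in> coboundaries C n"
      using assms by (auto simp: set_add_def' mem_coh_class)
    have "z \<ominus>\<^bsub>?M\<^esub> (x \<oplus>\<^bsub>?M\<^esub> y) = (a \<ominus>\<^bsub>?M\<^esub> x) \<oplus>\<^bsub>?M\<^esub> (b \<ominus>\<^bsub>?M\<^esub> y)"
      using ab assms by (simp add: kmod_grp)
    then show "z \<in> coh_class C n (x \<oplus>\<^bsub>?M\<^esub> y)"
      using ab assms coboundaries_closed(4) by (simp add: mem_coh_class)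
  next
    assume z: "z \<in> coh_class C n (x \<oplus>\<^bsub>?M\<^esub> y)"
    \<comment> \<open>The sum of classes is the setwise sum of cosets, so an explicit splitting is
      required: the whole discrepancy goes into the first summand, the second is \<open>y\<close>
      itself.\<close>
    have "z = (z \<ominus>\<^bsub>?M\<^esub> y) \<oplus>\<^bsub>?M\<^esub> y" "(z \<ominus>\<^bsub>?M\<^esub> y) \<ominus>\<^bsub>?M\<^esub> x = z \<ominus>\<^bsub>?M\<^esub> (x \<oplus>\<^bsub>?M\<^esub> y)"
      using z assms by (simp_all add: kmod_grp kmod_cancel mem_coh_class)
    moreover have "z \<ominus>\<^bsub>?M\<^esub> y \<in> coh_class C n x" "y \<in> coh_class C n y"
      using z assms calculation(2) by (simp_all add: mem_coh_class coboundaries_closed(3))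
    ultimately show "z \<in> coh_class C n x <+>\<^bsub>?M\<^esub> coh_class C n y"
      unfolding set_add_def' by blast
  qed
  then show ?thesis by (simp add: cohomology_def set_eq_iff)
qed

lemma coh_smult:
  assumes "cpx C" "x \<in> cocycles C n" "r \<in> carrier R"
  shows "r \<odot>\<^bsub>cohomology C n\<^esub> coh_class C n x = coh_class C n (r \<odot>\<^bsub>ob C n\<^esub> x)"
proof -
  have x: "x \<in> carrier (ob C n)" using assms by (simp add: cocycles_closed(1))
  have "coh_class C n (r \<odot>\<^bsub>ob C n\<^esub> y) = coh_class C n (r \<odot>\<^bsub>ob C n\<^esub> x)"
    if "y \<in> cocycles C n" "y \<ominus>\<^bsub>ob C n\<^esub> x \<in> coboundaries C n" for y
  proof -
    have y: "y \<in> carrier (ob C n)" using assms that by (simp add: cocycles_closed(1))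
    have "r \<odot>\<^bsub>ob C n\<^esub> y \<ominus>\<^bsub>ob C n\<^esub> r \<odot>\<^bsub>ob C n\<^esub> x = r \<odot>\<^bsub>ob C n\<^esub> (y \<ominus>\<^bsub>ob C n\<^esub> x)"
      using x y assms by (simp add: kmod_grp kmod_smult)
    then show ?thesis using x y that assms coboundaries_closed(7)[OF assms(1) that(2)]
      by (simp add: coh_class_eq)
  qed
  then show ?thesis using assms by (simp add: cohomology_def induced_coh_class)
qed

lemma coh_zero:
  assumes "cpx C" shows "\<zero>\<^bsub>cohomology C n\<^esub> = coh_class C n \<zero>\<^bsub>ob C n\<^esub>"
  using assms by (auto simp: cohomology_def mem_coh_class coboundaries_closed)

lemma carrier_coh: "carrier (cohomology C n) = coh_class C n ` cocycles C n"
  by (simp add: cohomology_def)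

text \<open>Supplies the structure in which \<open>tensor_lift\<close> folds its sums; the laws
  descend from cochains through \<open>coh_add\<close> and \<open>coh_zero\<close>.\<close>

lemma abelian_monoid_cohomology:
  assumes "cpx C" shows "abelian_monoid (cohomology C n)"
  using cocycles_closed[OF assms] assms
  by (intro abelian_monoidI) (auto simp: carrier_coh coh_add coh_zero kmod_grp intro!: imageI)

text \<open>The induced map is additive, so injectivity may be tested at zero: a cocycle with exact
  image must be exact. Surjectivity means lifting a cocycle up to a coboundary. In this form classes
  disappear and later constructions are checked on cochains.\<close>

lemma quasi_iso_iff:
  "qi C s D \<longleftrightarrow> cmap C s D \<and>
    (\<forall>n. (\<forall>x\<in>cocycles C n. s n x \<in> coboundaries D n \<longrightarrow> x \<in> coboundaries C n) \<and>
         (\<forall>y\<in>cocycles D n. \<exists>x\<in>cocycles C n. y \<ominus>\<^bsub>ob D n\<^esub> s n x \<in> coboundaries D n))"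
proof (cases "cmap C s D")
  case True
  note s = cmapD[OF True]
  have z: "s n x \<in> cocycles D n" if "x \<in> cocycles C n" for n x
    using that s(1,2,4,8) s(10)[of x n "n + 1"] by (simp add: cocycles_def)
  have b: "s n x \<in> coboundaries D n" if "x \<in> coboundaries C n" for n x
    using that s(4)[of _ "n - 1"] s(10)[of _ "n - 1" n] by (force simp: mem_coboundaries)
  have i: "induced (\<lambda>x. coh_class D n (s n x)) (coh_class C n x) = coh_class D n (s n x)"
    if "x \<in> cocycles C n" for n x
  proof (rule induced_coh_class[OF s(1) that])
    fix y assume y: "y \<in> cocycles C n" "y \<ominus>\<^bsub>ob C n\<^esub> x \<in> coboundaries C n"
    then have "s n y \<ominus>\<^bsub>ob D n\<^esub> s n x \<in> coboundaries D n"
      using b[OF y(2)] that by (simp add: s(6) cocycles_closed(1)[OF s(1)])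
    then show "coh_class D n (s n y) = coh_class D n (s n x)"
      using y that z s(1,2) by (simp add: coh_class_eq cocycles_closed(1))
  qed
  have "bij_betw (induced (\<lambda>x. coh_class D n (s n x)))
            (carrier (cohomology C n)) (carrier (cohomology D n)) \<longleftrightarrow>
      (\<forall>x\<in>cocycles C n. s n x \<in> coboundaries D n \<longrightarrow> x \<in> coboundaries C n) \<and>
      (\<forall>y\<in>cocycles D n. \<exists>x\<in>cocycles C n. y \<ominus>\<^bsub>ob D n\<^esub> s n x \<in> coboundaries D n)" for n
  proof -
    have d: "x \<ominus>\<^bsub>ob C n\<^esub> y \<in> cocycles C n" if "x \<in> cocycles C n" "y \<in> cocycles C n" for x y
      using that s(1) by (auto simp: cocycles_def cpx_diff_linear)
    have inj: "inj_on (induced (\<lambda>x. coh_class D n (s n x))) (carrier (cohomology C n)) \<longleftrightarrow>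
      (\<forall>x\<in>cocycles C n. s n x \<in> coboundaries D n \<longrightarrow> x \<in> coboundaries C n)"
    proof
      assume l: "inj_on (induced (\<lambda>x. coh_class D n (s n x))) (carrier (cohomology C n))"
      show "\<forall>x\<in>cocycles C n. s n x \<in> coboundaries D n \<longrightarrow> x \<in> coboundaries C n"
      proof (intro ballI impI)
        fix x assume x: "x \<in> cocycles C n" "s n x \<in> coboundaries D n"
        have zz: "\<zero>\<^bsub>ob C n\<^esub> \<in> cocycles C n" using s(1) by (rule cocycles_closed(2))
        have "coh_class D n (s n x) = coh_class D n (s n \<zero>\<^bsub>ob C n\<^esub>)"
          using x zz s(1,2,8) z by (simp add: coh_class_eq cocycles_closed(1))
        then have "coh_class C n x = coh_class C n \<zero>\<^bsub>ob C n\<^esub>"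
          using x zz i by (intro inj_onD[OF l]) (simp_all add: carrier_coh)
        then show "x \<in> coboundaries C n" using x s(1) by (simp add: coh_class_eq cocycles_closed(1))
      qed
    next
      assume r: "\<forall>x\<in>cocycles C n. s n x \<in> coboundaries D n \<longrightarrow> x \<in> coboundaries C n"
      show "inj_on (induced (\<lambda>x. coh_class D n (s n x))) (carrier (cohomology C n))"
        unfolding carrier_coh
      proof (intro inj_onI, elim imageE, simp only: i)
        fix x y assume xy: "x \<in> cocycles C n" "y \<in> cocycles C n"
          "coh_class D n (s n x) = coh_class D n (s n y)"
        then have "s n (x \<ominus>\<^bsub>ob C n\<^esub> y) \<in> coboundaries D n"
          using s(1,2) z by (simp add: coh_class_eq cocycles_closed(1) s(6))
        then show "coh_class C n x = coh_class C n y"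
          using r d xy s(1) by (simp add: coh_class_eq cocycles_closed(1))
      qed
    qed
    have "induced (\<lambda>x. coh_class D n (s n x)) ` carrier (cohomology C n)
        = (\<lambda>x. coh_class D n (s n x)) ` cocycles C n"
      by (auto simp: carrier_coh image_image i)
    then have im: "induced (\<lambda>x. coh_class D n (s n x)) ` carrier (cohomology C n)
        = (\<lambda>x. coh_class D n (s n x)) ` cocycles C n" .
    have "induced (\<lambda>x. coh_class D n (s n x)) ` carrier (cohomology C n)
        = carrier (cohomology D n) \<longleftrightarrow>
      (\<forall>y\<in>cocycles D n. \<exists>x\<in>cocycles C n. coh_class D n y = coh_class D n (s n x))"
    proof -
      have "(\<lambda>x. coh_class D n (s n x)) ` cocycles C n \<subseteq> coh_class D n ` cocycles D n"
        using z by (intro image_subsetI imageI)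
      then have "(\<lambda>x. coh_class D n (s n x)) ` cocycles C n = coh_class D n ` cocycles D n \<longleftrightarrow>
          coh_class D n ` cocycles D n \<subseteq> (\<lambda>x. coh_class D n (s n x)) ` cocycles C n"
        by (simp add: set_eq_subset)
      then show ?thesis unfolding im
        by (simp add: carrier_coh image_subset_iff image_iff)
    qed
    also have "\<dots> \<longleftrightarrow> (\<forall>y\<in>cocycles D n. \<exists>x\<in>cocycles C n. y \<ominus>\<^bsub>ob D n\<^esub> s n x \<in> coboundaries D n)"
      using z s(1,2) by (simp add: coh_class_eq cocycles_closed(1) cong: bex_cong)
    finally show ?thesis using inj by (simp add: bij_betw_def)
  qed
  then show ?thesis using True by (simp add: quasi_iso_def)
qed (simp add: quasi_iso_def)

lemma qi_cmap: "qi C s D \<Longrightarrow> cmap C s D"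
  by (simp add: quasi_iso_def)

lemma qi_id: "cpx C \<Longrightarrow> qi C (id_map C) C"
  by (auto simp: quasi_iso_iff cmap_id coboundaries_closed(3) cocycles_closed(1) intro!: bexI)

subsection \<open>Homotopy\<close>

lemma homotopic_refl:
  assumes "cmap C f D" shows "homotopic G R C D f f"
  unfolding homotopic_def
proof (intro conjI assms exI[of _ "\<lambda>i. \<lambda>x\<in>carrier (ob C i). \<zero>\<^bsub>ob D (i - 1)\<^esub>"] allI ballI)
  note s = cmapD[OF assms]
  show "(\<lambda>x\<in>carrier (ob C i). \<zero>\<^bsub>ob D (i - 1)\<^esub>) \<in> khom (ob C i) (ob D (i - 1))" for i
    using s(1,2) by (intro khom_zero_map) simp_all
  show "f i x \<ominus>\<^bsub>ob D i\<^esub> f i x = diff D (i - 1) ((\<lambda>x\<in>carrier (ob C i). \<zero>\<^bsub>ob D (i - 1)\<^esub>) x) \<oplus>\<^bsub>ob D i\<^esub>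
      (\<lambda>x\<in>carrier (ob C (i + 1)). \<zero>\<^bsub>ob D (i + 1 - 1)\<^esub>) (diff C i x)"
    if "x \<in> carrier (ob C i)" for i x
    using that s(1,2,4) cpx_diff_zero[OF s(2), of "i - 1"] by simp
qed

text \<open>The difference of the two given homotopies works, because (f - g') - (f - g) = g - g'.
  Together with reflexivity the Euclidean form yields symmetry and transitivity at once.\<close>

lemma homotopic_euclid:
  assumes "homotopic G R C D f g" "homotopic G R C D f g'"
  shows "homotopic G R C D g g'"
proof -
  obtain h h' where h: "\<And>i. h i \<in> khom (ob C i) (ob D (i - 1))"
      "\<And>i x. x \<in> carrier (ob C i) \<Longrightarrow>
        f i x \<ominus>\<^bsub>ob D i\<^esub> g i x = diff D (i - 1) (h i x) \<oplus>\<^bsub>ob D i\<^esub> h (i + 1) (diff C i x)"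
    and h': "\<And>i. h' i \<in> khom (ob C i) (ob D (i - 1))"
      "\<And>i x. x \<in> carrier (ob C i) \<Longrightarrow>
        f i x \<ominus>\<^bsub>ob D i\<^esub> g' i x = diff D (i - 1) (h' i x) \<oplus>\<^bsub>ob D i\<^esub> h' (i + 1) (diff C i x)"
    using assms unfolding homotopic_def by metis
  have f: "cmap C f D" "cmap C g D" "cmap C g' D" using assms by (auto simp: homotopic_def)
  note c = cmapD(1,2)[OF f(1)]
  let ?k = "\<lambda>i. \<lambda>x\<in>carrier (ob C i). h' i x \<ominus>\<^bsub>ob D (i - 1)\<^esub> h i x"
  have "g i x \<ominus>\<^bsub>ob D i\<^esub> g' i x = diff D (i - 1) (?k i x) \<oplus>\<^bsub>ob D i\<^esub> ?k (i + 1) (diff C i x)"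
    if x: "x \<in> carrier (ob C i)" for i x
  proof -
    let ?M = "ob D i"
    have m: "f i x \<in> carrier ?M" "g i x \<in> carrier ?M" "g' i x \<in> carrier ?M"
      using cmapD(4)[OF f(1) x] cmapD(4)[OF f(2) x] cmapD(4)[OF f(3) x] by blast+
    have k: "h i x \<in> carrier (ob D (i - 1))" "h' i x \<in> carrier (ob D (i - 1))"
      "h (i + 1) (diff C i x) \<in> carrier ?M" "h' (i + 1) (diff C i x) \<in> carrier ?M"
      using x c khomD(1)[OF h(1), of x i] khomD(1)[OF h'(1), of x i]
        khomD(1)[OF h(1), of _ "i + 1"] khomD(1)[OF h'(1), of _ "i + 1"] by simp_all
    have "g i x \<ominus>\<^bsub>?M\<^esub> g' i x = (f i x \<ominus>\<^bsub>?M\<^esub> g' i x) \<ominus>\<^bsub>?M\<^esub> (f i x \<ominus>\<^bsub>?M\<^esub> g i x)"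
      using m c by (simp add: kmod_grp)
    also have "\<dots> = diff D (i - 1) (?k i x) \<oplus>\<^bsub>?M\<^esub> ?k (i + 1) (diff C i x)"
      unfolding h(2)[OF x] h'(2)[OF x]
      using x c k cpx_diff_linear(2)[OF c(2) k(2,1)] by (simp add: kmod_grp)
    finally show ?thesis .
  qed
  then show ?thesis unfolding homotopic_def using f h(1) h'(1) c
    by (intro conjI exI[of _ ?k]) (auto intro!: khom_diff_map)
qed

lemma htpy_class_eq:
  assumes "homotopic G R C D f g"
  shows "htpy_class G R C D f = htpy_class G R C D g"
proof -
  have "homotopic G R C D g f" "cmap C f D"
    using assms homotopic_euclid homotopic_refl by (metis homotopic_def)+
  then show ?thesis using assms homotopic_euclid homotopic_refl unfolding htpy_class_def
    by (metis (mono_tags, lifting) Collect_cong)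
qed


subsection \<open>Shifts and invariants\<close>

lemma ob_shift [simp]: "ob (shift n C) i = ob C (n + i)"
  by (simp add: shift_def)

lemma diff_shift:
  "x \<in> carrier (ob C (n + i)) \<Longrightarrow> diff (shift n C) i x =
    (if even n then diff C (n + i) x else \<ominus>\<^bsub>ob C (n + i + 1)\<^esub> diff C (n + i) x)"
  by (simp add: shift_def)

lemma shift_map_apply [simp]: "shift_map n f i = f (n + i)"
  by (simp add: shift_map_def)

lemma cpx_shift:
  assumes "cpx C" shows "cpx (shift n C)"
proof (rule cpxI)
  show "kmod (ob (shift n C) i)" for i using assms by simp
  note d = cpx_diff_linear[OF assms]
  show "diff (shift n C) i \<in> khom (ob (shift n C) i) (ob (shift n C) (i + 1))" for i
  proof (rule khomI)
    show "diff (shift n C) i x = undefined" if "x \<notin> carrier (ob (shift n C) i)" for x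
      using that khomD(2)[OF cpx_diff[OF assms, of "n + i"], of x] by (simp add: shift_def)
  qed (use assms in \<open>simp_all add: diff_shift d kmod_grp(4) kmod_smult kmod_act_zero_minus add.assoc\<close>)
  show "diff (shift n C) (i + 1) (diff (shift n C) i x) = \<zero>\<^bsub>ob (shift n C) (i + 2)\<^esub>"
    if "x \<in> carrier (ob (shift n C) i)" for i x
    using that assms by (simp add: diff_shift d(5) add.assoc)
qed

lemma cmap_shift:
  assumes "cmap C f D" shows "cmap (shift n C) (shift_map n f) (shift n D)"
proof (rule cmapI)
  note f = cmapD[OF assms]
  show "cpx (shift n C)" "cpx (shift n D)" using cpx_shift[OF f(1)] cpx_shift[OF f(2)] by blast+
  show "shift_map n f i \<in> khom (ob (shift n C) i) (ob (shift n D) i)" for i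
    using f(3) by simp
  show "shift_map n f (i + 1) (diff (shift n C) i x) = diff (shift n D) i (shift_map n f i x)"
    if "x \<in> carrier (ob (shift n C) i)" for i x
    using that f(1,2) f(10)[of x "n + i" "n + (i + 1)"] f(4)
    by (simp add: diff_shift f(9)[of _ "n + (i + 1)"] add.assoc)
qed

lemma cocycles_shift:
  assumes "cpx C" shows "cocycles (shift n C) i = cocycles C (n + i)"
proof -
  have "\<ominus>\<^bsub>ob C (n + i + 1)\<^esub> y = \<zero>\<^bsub>ob C (n + i + 1)\<^esub> \<longleftrightarrow> y = \<zero>\<^bsub>ob C (n + i + 1)\<^esub>"
    if "y \<in> carrier (ob C (n + i + 1))" for y
    using that assms kmod_grp_simps(3,4)[OF cpx_kmod[OF assms]] by metis
  then show ?thesis using assms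
    by (cases "even n") (auto simp: cocycles_def diff_shift add.assoc)
qed

text \<open>A sign on the differential does not change its image, since -dx = d(-x). With the same
  fact for kernels, shifting moves the degree of cohomology and nothing else.\<close>

lemma coboundaries_shift:
  assumes "cpx C" shows "coboundaries (shift n C) i = coboundaries C (n + i)"
proof -
  have e: "n + (i - 1) = n + i - 1" "n + i - 1 + 1 = n + i" by simp_all
  have "(\<lambda>x. \<ominus>\<^bsub>ob C (n + i)\<^esub> diff C (n + i - 1) x) ` carrier (ob C (n + i - 1))
      = diff C (n + i - 1) ` carrier (ob C (n + i - 1))" (is "?l = ?r")
  proof (intro subset_antisym image_subsetI)
    fix x assume x: "x \<in> carrier (ob C (n + i - 1))"
    have m: "\<ominus>\<^bsub>ob C (n + i)\<^esub> diff C (n + i - 1) x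
        = diff C (n + i - 1) (\<ominus>\<^bsub>ob C (n + i - 1)\<^esub> x)"
      using cpx_diff_linear(5)[OF assms x] by simp
    then show "\<ominus>\<^bsub>ob C (n + i)\<^esub> diff C (n + i - 1) x \<in> ?r" using x assms by simp
    have "diff C (n + i - 1) x
        = \<ominus>\<^bsub>ob C (n + i)\<^esub> diff C (n + i - 1) (\<ominus>\<^bsub>ob C (n + i - 1)\<^esub> x)"
      unfolding m[symmetric] using x assms by simp
    then show "diff C (n + i - 1) x \<in> ?l"
      by (rule image_eqI) (use x assms in simp)
  qed
  then show ?thesis using e
    by (cases "even n") (simp_all add: coboundaries_def diff_shift add_diff_eq cong: image_cong)
qed

lemma qi_shift:
  assumes "qi C s D" shows "qi (shift n C) (shift_map n s) (shift n D)"
proof -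
  have c: "cmap C s D" using assms by (rule qi_cmap)
  note cs = cmapD(1,2)[OF c]
  show ?thesis
    using assms unfolding quasi_iso_iff cocycles_shift[OF cs(1)] cocycles_shift[OF cs(2)]
      coboundaries_shift[OF cs(1)] coboundaries_shift[OF cs(2)]
    by (simp add: cmap_shift)
qed

lemma invariant_simps [simp]:
  "x \<in> carrier (invariant_submodule G M) \<longleftrightarrow>
    x \<in> carrier M \<and> (\<forall>g\<in>carrier G. act M g x = x)"
  "zero (invariant_submodule G M) = zero M"
  "add (invariant_submodule G M) = add M"
  "smult (invariant_submodule G M) = smult M"
  "act (invariant_submodule G M) = act M"
  by (simp_all add: invariant_submodule_def)

lemma kmod_invariant:
  assumes "kmod M" shows "kmod (invariant_submodule G M)"
proof (rule kmodI)
  show "\<exists>y\<in>carrier (invariant_submodule G M). y \<oplus>\<^bsub>invariant_submodule G M\<^esub> x = \<zero>\<^bsub>invariant_submodule G M\<^esub>"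
    if "x \<in> carrier (invariant_submodule G M)" for x
    using that assms by (intro bexI[of _ "\<ominus>\<^bsub>M\<^esub> x"]) (simp_all add: kmod_act_zero_minus)
qed (use assms in \<open>auto simp: kmod_grp(1-3) kmod_smult kmod_act kmod_act_zero_minus\<close>)

text \<open>Negation in a record is a definite description over its carrier. Unlike addition and
  zero it is therefore not inherited by unfolding when the carrier shrinks; uniqueness of inverses
  identifies the two.\<close>

lemma invariant_minus:
  assumes "kmod M" "x \<in> carrier (invariant_submodule G M)"
  shows "\<ominus>\<^bsub>invariant_submodule G M\<^esub> x = \<ominus>\<^bsub>M\<^esub> x"
  using assms by (intro kmod_minus_unique kmod_invariant) (auto simp: kmod_act_zero_minus)

lemma ob_invariant_complex: "ob (invariant_complex G C) i = invariant_submodule G (ob C i)"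
  by (simp add: invariant_complex_def)

lemma diff_invariant_complex:
  "x \<in> carrier (invariant_submodule G (ob C i)) \<Longrightarrow> diff (invariant_complex G C) i x = diff C i x"
  by (simp add: invariant_complex_def)

lemma cpx_invariant_complex:
  assumes "cpx C" shows "cpx (invariant_complex G C)"
proof (rule cpxI)
  note d = cpx_diff_linear[OF assms]
  show "kmod (ob (invariant_complex G C) i)" for i
    using assms by (simp add: ob_invariant_complex kmod_invariant)
  show "diff (invariant_complex G C) i \<in>
      khom (ob (invariant_complex G C) i) (ob (invariant_complex G C) (i + 1))" for i
  proof (rule khomI)
    show "diff (invariant_complex G C) i x = undefined"
      if "x \<notin> carrier (ob (invariant_complex G C) i)" for x
      using that by (simp add: invariant_complex_def restrict_def del: invariant_simps)
  qed (use assms in \<open>simp_all add: ob_invariant_complex diff_invariant_complex d(1,3)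
      d(4)[symmetric] kmod_act kmod_smult\<close>)
  show "diff (invariant_complex G C) (i + 1) (diff (invariant_complex G C) i x)
      = \<zero>\<^bsub>ob (invariant_complex G C) (i + 2)\<^esub>"
    if "x \<in> carrier (ob (invariant_complex G C) i)" for i x
    using that assms d(4)[symmetric]
    by (simp add: ob_invariant_complex diff_invariant_complex add.assoc)
qed

end

section \<open>Linear maps on tensor products\<close>

text \<open>Preservation of zero is a clause of its own because the structures are bare records, not
  assumed to be groups, and \<open>tensor_map\<close> has to respect the relation
  \<open>zero\<close> of \<open>tensor_eq\<close>.\<close>

definition tensor_linear ::
  "('k, 'b) ring_scheme \<Rightarrow> ('k, 'm, 'x) module_scheme \<Rightarrow> ('k, 'n, 'y) module_scheme \<Rightarrow> ('m \<Rightarrow> 'n) \<Rightarrow> bool"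
  where "tensor_linear R M N f \<longleftrightarrow> f \<in> carrier M \<rightarrow> carrier N \<and> f \<zero>\<^bsub>M\<^esub> = \<zero>\<^bsub>N\<^esub> \<and>
    (\<forall>x\<in>carrier M. \<forall>y\<in>carrier M. f (x \<oplus>\<^bsub>M\<^esub> y) = f x \<oplus>\<^bsub>N\<^esub> f y) \<and>
    (\<forall>r\<in>carrier R. \<forall>x\<in>carrier M. f (r \<odot>\<^bsub>M\<^esub> x) = r \<odot>\<^bsub>N\<^esub> f x)"

text \<open>
  The closure condition on \<open>b (r \<odot> x) y\<close> makes it unnecessary to know that \<open>M\<close> is closed under scalars.
\<close>

definition tensor_bilinear ::
  "('k, 'b) ring_scheme \<Rightarrow> ('k, 'm, 'x) module_scheme \<Rightarrow> ('k, 'n, 'y) module_scheme \<Rightarrow>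
   ('p, 'z) ring_scheme \<Rightarrow> ('m \<Rightarrow> 'n \<Rightarrow> 'p) \<Rightarrow> bool"
  where "tensor_bilinear R M N P b \<longleftrightarrow>
    (\<forall>x\<in>carrier M. \<forall>y\<in>carrier N. b x y \<in> carrier P) \<and>
    (\<forall>y\<in>carrier N. b \<zero>\<^bsub>M\<^esub> y = \<zero>\<^bsub>P\<^esub>) \<and>
    (\<forall>x\<in>carrier M. \<forall>x'\<in>carrier M. \<forall>y\<in>carrier N. b (x \<oplus>\<^bsub>M\<^esub> x') y = b x y \<oplus>\<^bsub>P\<^esub> b x' y) \<and>
    (\<forall>x\<in>carrier M. \<forall>y\<in>carrier N. \<forall>y'\<in>carrier N. b x (y \<oplus>\<^bsub>N\<^esub> y') = b x y \<oplus>\<^bsub>P\<^esub> b x y') \<and>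
    (\<forall>r\<in>carrier R. \<forall>x\<in>carrier M. \<forall>y\<in>carrier N.
       b (r \<odot>\<^bsub>M\<^esub> x) y = b x (r \<odot>\<^bsub>N\<^esub> y) \<and> b (r \<odot>\<^bsub>M\<^esub> x) y \<in> carrier P)"

lemma tensor_class_self:
  "set xs \<subseteq> carrier M \<times> carrier N \<Longrightarrow> xs \<in> tensor_class R M N xs"
  by (simp add: tensor_class_def tensor_eq.refl)

lemma tensor_class_eqI:
  "tensor_eq R M N xs ys \<Longrightarrow> tensor_class R M N xs = tensor_class R M N ys"
  unfolding tensor_class_def by (blast intro: tensor_eq.sym tensor_eq.trans)

lemma tensor_lift_class:
  assumes "abelian_monoid P" and b: "tensor_bilinear R M N P b"
    and "set xs \<subseteq> carrier M \<times> carrier N"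
  shows "tensor_lift P b (tensor_class R M N xs) = foldr (\<lambda>(m, n) s. b m n \<oplus>\<^bsub>P\<^esub> s) xs \<zero>\<^bsub>P\<^esub>"
proof -
  interpret abelian_monoid P by fact
  let ?f = "\<lambda>xs. foldr (\<lambda>(m, n) s. b m n \<oplus>\<^bsub>P\<^esub> s) xs \<zero>\<^bsub>P\<^esub>"
  \<comment> \<open>A chain of relations may pass through pairs with first entry
    \<open>r \<odot> m\<close>, not known to lie in \<open>M\<close>. The invariant therefore speaks
    of the values of \<open>b\<close>, which is enough for folding.\<close>
  let ?ok = "\<lambda>xs. \<forall>(m, n)\<in>set xs. b m n \<in> carrier P"
  have c: "?f xs \<in> carrier P" if "?ok xs" for xs
    using that by (induction xs) auto
  have app: "?f (xs @ ys) = ?f xs \<oplus>\<^bsub>P\<^esub> ?f ys" if "?ok xs" "?ok ys" for xs ys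
    using that by (induction xs) (auto simp: a_assoc c)
  have k: "?ok xs" if "set xs \<subseteq> carrier M \<times> carrier N" for xs
    using that b by (auto simp: tensor_bilinear_def)
  note bb = b[unfolded tensor_bilinear_def]
  have "?ok xs \<and> ?ok ys \<and> ?f xs = ?f ys" if "tensor_eq R M N xs ys" for xs ys
    using that
  proof (induction rule: tensor_eq.induct)
    case (append xs xs' ys ys')
    then have "?f (xs @ ys) = ?f (xs' @ ys')" using app by presburger
    then show ?case using append by auto
  next
    case (commute xs ys)
    then have o: "?ok xs" "?ok ys" using k by blast+
    then have "?f (xs @ ys) = ?f (ys @ xs)" using app c a_comm by presburger
    then show ?case using o by auto
  next
    case (balanced r m n)
    then have "b (r \<odot>\<^bsub>M\<^esub> m) n = b m (r \<odot>\<^bsub>N\<^esub> n)" "b (r \<odot>\<^bsub>M\<^esub> m) n \<in> carrier P" using bb by blast+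
    then show ?case by simp
  qed (use bb k in \<open>auto split: prod.splits\<close>)
  then show ?thesis unfolding tensor_lift_def
    using tensor_class_self[OF assms(3)]
    by (intro induced_eq[of xs]) (auto simp: tensor_class_def)
qed

lemma tensor_map_class:
  assumes f: "tensor_linear R M M' f" and g: "tensor_linear R N N' g"
    and "set xs \<subseteq> carrier M \<times> carrier N"
  shows "tensor_map R M' N' f g (tensor_class R M N xs) = tensor_class R M' N' (map (map_prod f g) xs)"
proof -
  note ff = f[unfolded tensor_linear_def] and gg = g[unfolded tensor_linear_def]
  have k: "set (map (map_prod f g) xs) \<subseteq> carrier M' \<times> carrier N'"
    if "set xs \<subseteq> carrier M \<times> carrier N" for xs
    using that ff gg by auto
  have "tensor_eq R M' N' (map (map_prod f g) xs) (map (map_prod f g) ys)"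
    if "tensor_eq R M N xs ys" for xs ys
    using that
  proof (induction rule: tensor_eq.induct)
    case (refl xs)
    then show ?case using k by (intro tensor_eq.refl) blast
  next
    case (commute xs ys)
    then show ?case using k unfolding map_append by (intro tensor_eq.commute) blast+
  next
    case (zero n)
    then show ?case using ff gg by (auto intro!: tensor_eq.zero)
  next
    case (add_left m m' n)
    then show ?case using ff gg by (auto intro!: tensor_eq.add_left)
  next
    case (add_right m n n')
    then show ?case using ff gg by (auto intro!: tensor_eq.add_right)
  next
    case (balanced r m n)
    then show ?case using ff gg by (auto intro!: tensor_eq.balanced)
  qed (auto intro: tensor_eq.sym tensor_eq.trans tensor_eq.append)
  then show ?thesis unfolding tensor_map_def
    using tensor_class_self[OF assms(3)]
    by (intro induced_eq[of xs] tensor_class_eqI)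
      (auto simp: tensor_class_def intro: tensor_eq.sym)
qed

text \<open>Reduces a square out of a tensor product to pure tensors. On a representing list both
  composites are folded sums, and \<open>h\<close> passes through the fold by additivity.\<close>

lemma tensor_square:
  assumes P: "abelian_monoid P" "abelian_monoid P'"
    and b: "tensor_bilinear R M N P b" "tensor_bilinear R M' N' P' b'"
    and fg: "tensor_linear R M M' f" "tensor_linear R N N' g"
    and h: "h \<zero>\<^bsub>P\<^esub> = \<zero>\<^bsub>P'\<^esub>"
      "\<And>x y. x \<in> carrier P \<Longrightarrow> y \<in> carrier P \<Longrightarrow> h (x \<oplus>\<^bsub>P\<^esub> y) = h x \<oplus>\<^bsub>P'\<^esub> h y"
    and comm: "\<And>m n. m \<in> carrier M \<Longrightarrow> n \<in> carrier N \<Longrightarrow> h (b m n) = b' (f m) (g n)"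
    and t: "t \<in> carrier (tensor R M N)"
  shows "h (tensor_lift P b t) = tensor_lift P' b' (tensor_map R M' N' f g t)"
proof -
  obtain xs where xs: "set xs \<subseteq> carrier M \<times> carrier N" "t = tensor_class R M N xs"
    using t by (auto simp: tensor_def)
  let ?f = "\<lambda>xs. foldr (\<lambda>(m, n) s. b m n \<oplus>\<^bsub>P\<^esub> s) xs \<zero>\<^bsub>P\<^esub>"
  have "set (map (map_prod f g) xs) \<subseteq> carrier M' \<times> carrier N'"
    using xs(1) fg by (auto simp: tensor_linear_def)
  then have r: "tensor_lift P' b' (tensor_map R M' N' f g t)
      = foldr (\<lambda>(m, n) s. b' m n \<oplus>\<^bsub>P'\<^esub> s) (map (map_prod f g) xs) \<zero>\<^bsub>P'\<^esub>"
    unfolding xs(2) tensor_map_class[OF fg xs(1)] by (intro tensor_lift_class P b)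
  \<comment> \<open>Membership is carried along in the induction because \<open>h\<close> is
    additive on the carrier of \<open>P\<close>.\<close>
  have "?f xs \<in> carrier P \<and>
      h (?f xs) = foldr (\<lambda>(m, n) s. b' m n \<oplus>\<^bsub>P'\<^esub> s) (map (map_prod f g) xs) \<zero>\<^bsub>P'\<^esub>"
    using xs(1)
  proof (induction xs)
    case Nil
    then show ?case using h(1) abelian_monoidE(2)[OF P(1)] by simp
  next
    case (Cons x xs)
    obtain m n where x: "x = (m, n)" "m \<in> carrier M" "n \<in> carrier N" using Cons.prems by auto
    then have "b m n \<in> carrier P" using b(1) by (simp add: tensor_bilinear_def)
    then show ?case using Cons x h(2) comm abelian_monoidE(1)[OF P(1)] by simp
  qed
  then show ?thesis unfolding r using tensor_lift_class[OF P(1) b(1) xs(1)] xs(2) by simp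
qed

context kG_setting
begin

section \<open>Zigzags\<close>

abbreviation zz ::
  "('k, 'g, 'u) cochain_complex \<Rightarrow> ('k, 'g, 'u) zigzag \<Rightarrow> ('k, 'g, 'u) cochain_complex \<Rightarrow> bool"
  where "zz C w D \<equiv> is_zigzag G R C w D"
abbreviation zeq ::
  "('k, 'g, 'u) cochain_complex \<Rightarrow> ('k, 'g, 'u) cochain_complex \<Rightarrow>
   ('k, 'g, 'u) zigzag \<Rightarrow> ('k, 'g, 'u) zigzag \<Rightarrow> bool"
  where "zeq C D v w \<equiv> zigzag_eq G R C D v w"

lemma zz_cpx:
  assumes "zz C w D" shows "cpx C" "cpx D"
  using assms by (induction rule: is_zigzag.induct) (auto dest: cmapD(1,2) qi_cmap)

lemma zz_append: "zz A u B \<Longrightarrow> zz B v C \<Longrightarrow> zz A (u @ v) C"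
  by (induction rule: is_zigzag.induct) (auto intro: is_zigzag.intros)

lemma zz_Fwd: "cmap C f D \<Longrightarrow> zz C [Fwd C f D] D"
  by (auto intro!: is_zigzag.intros dest: cmapD(2))

lemma zz_Bwd:
  assumes "qi C s D" shows "zz D [Bwd C s D] C"
  using is_zigzag.Bwd[OF assms is_zigzag.Nil] cmapD(1)[OF qi_cmap[OF assms]] by blast

lemma zeq_zz:
  assumes "zeq C D v w" shows "zz C v D" "zz C w D"
  using assms
proof (induction rule: zigzag_eq.induct)
  case (cong A u B C v v' w D)
  { case 1 then show ?case using cong zz_append by metis }
  { case 2 then show ?case using cong zz_append by metis }
qed (auto intro!: is_zigzag.intros dest: cmapD(1,2) qi_cmap intro: cmap_id cmap_comp)

lemma zeq_append:
  assumes "zeq A B u u'" "zeq B C v v'" shows "zeq A C (u @ v) (u' @ v')"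
proof -
  have "zz A [] A" "zz C [] C"
    using zz_cpx[OF zeq_zz(1)[OF assms(1)]] zz_cpx[OF zeq_zz(1)[OF assms(2)]] is_zigzag.Nil by blast+
  then have "zeq A C ([] @ u @ v) ([] @ u' @ v)" "zeq A C (u' @ v @ []) (u' @ v' @ [])"
    using assms zeq_zz by (metis zigzag_eq.cong)+
  then show ?thesis using zigzag_eq.trans by fastforce
qed

lemma zeq_pre: "zz A u B \<Longrightarrow> zeq B C v v' \<Longrightarrow> zeq A C (u @ v) (u @ v')"
  by (rule zeq_append[OF zigzag_eq.refl])

lemma zeq_post: "zeq A B u u' \<Longrightarrow> zz B v C \<Longrightarrow> zeq A C (u @ v) (u' @ v)"
  by (rule zeq_append[OF _ zigzag_eq.refl])

declare zigzag_eq.trans [trans]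

lemma zeq_Fwd_Fwd:
  assumes "cmap A f B" "cmap B g C" "comp_map A g f = h"
  shows "zeq A C ([Fwd A f B] @ [Fwd B g C]) [Fwd A h C]"
  using assms zigzag_eq.comp by fastforce

lemma zeq_id: "cpx A \<Longrightarrow> zeq A A [Fwd A (id_map A) A] []"
  by (rule zigzag_eq.ident)

lemma zeq_Fwd_Bwd:
  assumes "qi A s B" shows "zeq A A ([Fwd A s B] @ [Bwd A s B]) []"
  using zigzag_eq.inv_right[OF assms] by simp

lemma zeq_Bwd_Fwd:
  assumes "qi A s B" shows "zeq B B ([Bwd A s B] @ [Fwd A s B]) []"
  using zigzag_eq.inv_left[OF assms] by simp

text \<open>Prefixing the formal inverse of \<open>s\<close> contracts both sides. Identities that
  involve \<open>Bwd\<close> are proved later by composing with \<open>s\<close>, which reduces them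
  to chain maps.\<close>

lemma zeq_cancel_left:
  assumes "qi A s B" "zz B x C" "zz B y C" "zeq A C ([Fwd A s B] @ x) ([Fwd A s B] @ y)"
  shows "zeq B C x y"
proof -
  have e: "zeq B C ([Bwd A s B] @ [Fwd A s B] @ z) z" if "zz B z C" for z
    using zeq_append[OF zeq_Bwd_Fwd[OF assms(1)] zigzag_eq.refl[OF that]] by simp
  have "zeq B C ([Bwd A s B] @ [Fwd A s B] @ x) ([Bwd A s B] @ [Fwd A s B] @ y)"
    by (rule zeq_pre[OF zz_Bwd[OF assms(1)] assms(4)])
  then show ?thesis using e[OF assms(2)] e[OF assms(3)] zigzag_eq.trans zigzag_eq.sym by metis
qed

lemma zeq_cancel_right:
  assumes "qi B s C" "zz A x B" "zz A y B" "zeq A C (x @ [Fwd B s C]) (y @ [Fwd B s C])"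
  shows "zeq A B x y"
proof -
  have e: "zeq A B (z @ [Fwd B s C] @ [Bwd B s C]) z" if "zz A z B" for z
    using zeq_append[OF zigzag_eq.refl[OF that] zeq_Fwd_Bwd[OF assms(1)]] by simp
  have "zeq A B ((x @ [Fwd B s C]) @ [Bwd B s C]) ((y @ [Fwd B s C]) @ [Bwd B s C])"
    by (rule zeq_post[OF assms(4) zz_Bwd[OF assms(1)]])
  then show ?thesis using e[OF assms(2)] e[OF assms(3)] zigzag_eq.trans zigzag_eq.sym
    by (metis append_assoc)
qed

lemma zeq_Bwd_cancel:
  assumes "qi B s C" "zz A w C"
  shows "zeq A C ((w @ [Bwd B s C]) @ [Fwd B s C]) w"
  using zeq_append[OF zigzag_eq.refl[OF assms(2)] zeq_Bwd_Fwd[OF assms(1)]] by simp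

text \<open>A commuting square with quasi-isomorphisms on two opposite sides still commutes after
  these sides are reversed. This turns naturality for a quasi-isomorphism into naturality for its
  formal inverse.\<close>

lemma zeq_conjugate:
  assumes s: "qi A s B" and t: "qi A' t B'" and "zz A x A'" "zz B y B'"
    and e: "zeq A B' (x @ [Fwd A' t B']) ([Fwd A s B] @ y)"
  shows "zeq B A' ([Bwd A s B] @ x) (y @ [Bwd A' t B'])"
proof (rule zeq_cancel_right[OF t])
  show "zz B ([Bwd A s B] @ x) A'" "zz B (y @ [Bwd A' t B']) A'"
    using assms by (auto intro!: zz_append zz_Bwd simp del: append_Cons append_Nil)
  have "zeq B B' ([Bwd A s B] @ x @ [Fwd A' t B']) ([Bwd A s B] @ [Fwd A s B] @ y)"
    by (rule zeq_pre[OF zz_Bwd[OF s] e])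
  also have "zeq B B' ([Bwd A s B] @ [Fwd A s B] @ y) y"
    using zeq_append[OF zeq_Bwd_Fwd[OF s] zigzag_eq.refl[OF assms(4)]] by simp
  also have "zeq B B' y ((y @ [Bwd A' t B']) @ [Fwd A' t B'])"
    using zeq_Bwd_cancel[OF t assms(4)] by (rule zigzag_eq.sym)
  finally show "zeq B B' (([Bwd A s B] @ x) @ [Fwd A' t B']) ((y @ [Bwd A' t B']) @ [Fwd A' t B'])"
    by simp
qed

subsection \<open>Functors and natural transformations\<close>

primrec map_arrow ::
  "(('k, 'g, 'u) cochain_complex \<Rightarrow> ('k, 'g, 'u) cochain_complex) \<Rightarrow>
   (('k, 'g, 'u) cochain_complex \<Rightarrow> (int \<Rightarrow> 'u \<Rightarrow> 'u) \<Rightarrow> ('k, 'g, 'u) cochain_complex \<Rightarrow> (int \<Rightarrow> 'u \<Rightarrow> 'u)) \<Rightarrow>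
   ('k, 'g, 'u) arrow \<Rightarrow> ('k, 'g, 'u) arrow" where
  "map_arrow F F' (Fwd C f D) = Fwd (F C) (F' C f D) (F D)"
| "map_arrow F F' (Bwd C f D) = Bwd (F C) (F' C f D) (F D)"

text \<open>\<open>F'\<close> receives source and target because a chain map is a bare family of
  functions and does not record them. Exactness is meant as preservation of quasi-isomorphisms,
  which lets the functor act on zigzags arrow by arrow.\<close>

definition exact_functor ::
  "(('k, 'g, 'u) cochain_complex \<Rightarrow> ('k, 'g, 'u) cochain_complex) \<Rightarrow>
   (('k, 'g, 'u) cochain_complex \<Rightarrow> (int \<Rightarrow> 'u \<Rightarrow> 'u) \<Rightarrow> ('k, 'g, 'u) cochain_complex \<Rightarrow> (int \<Rightarrow> 'u \<Rightarrow> 'u)) \<Rightarrow> bool"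
  where "exact_functor F F' \<longleftrightarrow>
    (\<forall>C. cpx C \<longrightarrow> cpx (F C) \<and> F' C (id_map C) C = id_map (F C)) \<and>
    (\<forall>C f D. cmap C f D \<longrightarrow> cmap (F C) (F' C f D) (F D)) \<and>
    (\<forall>C f D. qi C f D \<longrightarrow> qi (F C) (F' C f D) (F D)) \<and>
    (\<forall>A f B g C. cmap A f B \<longrightarrow> cmap B g C \<longrightarrow>
      F' A (comp_map A g f) C = comp_map (F A) (F' B g C) (F' A f B))"

lemma functor_zz:
  assumes "exact_functor F F'" "zz C w D"
  shows "zz (F C) (map (map_arrow F F') w) (F D)"
  using assms(2) assms(1)
  by (induction rule: is_zigzag.induct) (auto simp: exact_functor_def intro!: is_zigzag.intros)

text \<open>Every generating relation of \<open>zigzag_eq\<close> is sent to a relation of the same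
  kind, so the functor descends to the derived category.\<close>

lemma functor_zeq:
  assumes F: "exact_functor F F'" and "zeq C D v w"
  shows "zeq (F C) (F D) (map (map_arrow F F') v) (map (map_arrow F F') w)"
  using assms(2)
proof (induction rule: zigzag_eq.induct)
  case (refl C w D)
  then show ?case using functor_zz[OF F] zigzag_eq.refl by blast
next
  case (cong A u B C v v' w D)
  then show ?case using functor_zz[OF F] unfolding map_append
    by (intro zigzag_eq.cong) blast+
next
  case (ident C)
  then show ?case using F zigzag_eq.ident[of G R "F C"] by (simp add: exact_functor_def)
next
  case (comp A f B g C)
  then show ?case using F zigzag_eq.comp[of G R "F A" "F' A f B" "F B" "F' B g C" "F C"]
    by (simp add: exact_functor_def)
next
  case (inv_right A s B)
  then show ?case using F zigzag_eq.inv_right[of G R "F A" "F' A s B" "F B"]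
    by (simp add: exact_functor_def)
next
  case (inv_left A s B)
  then show ?case using F zigzag_eq.inv_left[of G R "F A" "F' A s B" "F B"]
    by (simp add: exact_functor_def)
qed (blast intro: zigzag_eq.sym zigzag_eq.trans)+

lemma functor_id: "exact_functor (\<lambda>C. C) (\<lambda>C f D. f)"
  by (simp add: exact_functor_def)

lemma map_arrow_id [simp]: "map_arrow (\<lambda>C. C) (\<lambda>C f D. f) = (\<lambda>a. a)"
proof
  show "map_arrow (\<lambda>C. C) (\<lambda>C f D. f) a = a" for a by (cases a) simp_all
qed

lemma functor_const:
  assumes "cpx A" shows "exact_functor (\<lambda>C. A) (\<lambda>C f D. id_map A)"
  using assms comp_map_id(1)[OF cmap_id[OF assms]] by (simp add: exact_functor_def cmap_id qi_id)

text \<open>Under a constant functor every arrow becomes an identity or its formal inverse, and both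
  are trivial. Naturality to or from a constant functor therefore makes a whole zigzag disappear;
  this is how zero maps and the complementary projections are treated.\<close>

lemma zeq_const:
  assumes "cpx A" "zz C w D"
  shows "zeq A A (map (map_arrow (\<lambda>C. A) (\<lambda>C f D. id_map A)) w) []"
  using assms(2)
proof (induction rule: is_zigzag.induct)
  case (Nil C)
  then show ?case using assms(1) by (auto intro: zigzag_eq.refl is_zigzag.Nil)
next
  case (Fwd C f D w E)
  then show ?case using zeq_append[OF zeq_id[OF assms(1)] Fwd.IH] by simp
next
  case (Bwd D s C w E)
  \<comment> \<open>The identity is inserted behind its formal inverse so that the pair can be
    contracted.\<close>
  have "zeq A A ([Bwd A (id_map A) A] @ []) ([Bwd A (id_map A) A] @ [Fwd A (id_map A) A])"
    by (rule zeq_pre[OF zz_Bwd[OF qi_id] zigzag_eq.sym[OF zeq_id]]) (rule assms)+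
  then have "zeq A A [Bwd A (id_map A) A] []"
    using zeq_Bwd_Fwd[OF qi_id[OF assms(1)]] zigzag_eq.trans by fastforce
  then show ?case using zeq_append[OF _ Bwd.IH] by fastforce
qed

lemma functor_shift: "exact_functor (shift n) (\<lambda>C f D. shift_map n f)"
  unfolding exact_functor_def
  by (simp add: cpx_shift cmap_shift qi_shift) (simp add: id_map_def comp_map_def shift_map_def restrict_def)

lemma map_arrow_shift: "map_arrow (shift n) (\<lambda>C f D. shift_map n f) = shift_arrow n"
proof
  show "map_arrow (shift n) (\<lambda>C f D. shift_map n f) a = shift_arrow n a" for a
    by (cases a) simp_all
qed

text \<open>Commuting squares are pasted along the zigzag. For a chain map the square is the
  hypothesis; for a formal inverse it is the conjugated square of the underlying
  quasi-isomorphism.\<close>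

lemma zeq_natural:
  assumes F: "exact_functor F F'" and H: "exact_functor H H'"
    and n: "\<And>C. cpx C \<Longrightarrow> cmap (F C) (\<eta> C) (H C)"
    and c: "\<And>C f D. cmap C f D \<Longrightarrow> comp_map (F C) (\<eta> D) (F' C f D) = comp_map (F C) (H' C f D) (\<eta> C)"
    and "zz C w D"
  shows "zeq (F C) (H D) (map (map_arrow F F') w @ [Fwd (F D) (\<eta> D) (H D)])
    ([Fwd (F C) (\<eta> C) (H C)] @ map (map_arrow H H') w)"
proof -
  have sq: "zeq (F C) (H D) ([Fwd (F C) (F' C f D) (F D)] @ [Fwd (F D) (\<eta> D) (H D)])
      ([Fwd (F C) (\<eta> C) (H C)] @ [Fwd (H C) (H' C f D) (H D)])" if f: "cmap C f D" for C f D
  proof -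
    have "zeq (F C) (H D) ([Fwd (F C) (F' C f D) (F D)] @ [Fwd (F D) (\<eta> D) (H D)])
        [Fwd (F C) (comp_map (F C) (\<eta> D) (F' C f D)) (H D)]"
      using f F n cmapD(2)[OF f] by (intro zeq_Fwd_Fwd) (auto simp: exact_functor_def)
    also have "zeq (F C) (H D) \<dots> ([Fwd (F C) (\<eta> C) (H C)] @ [Fwd (H C) (H' C f D) (H D)])"
      using f H n cmapD(1)[OF f] unfolding c[OF f]
      by (intro zigzag_eq.sym[OF zeq_Fwd_Fwd]) (auto simp: exact_functor_def)
    finally show ?thesis .
  qed
  \<comment> \<open>One square is pasted in front of those already treated. The arrow
    \<open>a\<close> stays abstract so that both kinds of arrow share the argument.\<close>
  have step: "zeq (F C) (H E) (map (map_arrow F F') (a # w) @ [Fwd (F E) (\<eta> E) (H E)])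
        ([Fwd (F C) (\<eta> C) (H C)] @ map (map_arrow H H') (a # w))"
    if a: "zz C [a] D" and w: "zz D w E"
      and sq: "zeq (F C) (H D) ([map_arrow F F' a] @ [Fwd (F D) (\<eta> D) (H D)])
        ([Fwd (F C) (\<eta> C) (H C)] @ [map_arrow H H' a])"
      and IH: "zeq (F D) (H E) (map (map_arrow F F') w @ [Fwd (F E) (\<eta> E) (H E)])
        ([Fwd (F D) (\<eta> D) (H D)] @ map (map_arrow H H') w)" for C a D w E
  proof -
    have "zeq (F C) (H E) ([map_arrow F F' a] @ map (map_arrow F F') w @ [Fwd (F E) (\<eta> E) (H E)])
        ([map_arrow F F' a] @ [Fwd (F D) (\<eta> D) (H D)] @ map (map_arrow H H') w)"
      using functor_zz[OF F a] by (intro zeq_pre[OF _ IH]) simp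
    also have "zeq (F C) (H E) \<dots> (([Fwd (F C) (\<eta> C) (H C)] @ [map_arrow H H' a]) @ map (map_arrow H H') w)"
      unfolding append_assoc[symmetric] by (rule zeq_post[OF sq functor_zz[OF H w]])
    finally show ?thesis by simp
  qed
  show ?thesis using assms(5)
  proof (induction rule: is_zigzag.induct)
    case (Nil C)
    then show ?case using zigzag_eq.refl[OF zz_Fwd[OF n[OF Nil]]] by simp
  next
    case (Fwd C f D w E)
    then show ?case using sq by (intro step[OF zz_Fwd[OF Fwd(1)] Fwd(2)]) simp_all
  next
    case (Bwd D s C w E)
    have k: "cmap D s C" using Bwd(1) by (rule qi_cmap)
    have "zeq (F C) (H D) ([Bwd (F D) (F' D s C) (F C)] @ [Fwd (F D) (\<eta> D) (H D)])
        ([Fwd (F C) (\<eta> C) (H C)] @ [Bwd (H D) (H' D s C) (H C)])"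
      using F H Bwd(1) n k cmapD(1,2)[OF k] zigzag_eq.sym[OF sq[OF k]]
      by (intro zeq_conjugate zz_Fwd) (simp_all add: exact_functor_def)
    then show ?case using Bwd by (intro step[OF zz_Bwd[OF Bwd(1)] Bwd(2)]) simp_all
  qed
qed

subsection \<open>Classes of zigzags\<close>

lemma der_class_eq:
  assumes "zz C v D"
  shows "der_class G R C D v = der_class G R C D w \<longleftrightarrow> zeq C D v w"
proof
  assume "der_class G R C D v = der_class G R C D w"
  then have "v \<in> der_class G R C D w" using zigzag_eq.refl[OF assms] by (auto simp: der_class_def)
  then show "zeq C D v w" by (simp add: der_class_def zigzag_eq.sym)
next
  assume "zeq C D v w"
  then show "der_class G R C D v = der_class G R C D w"
    unfolding der_class_def by (blast intro: zigzag_eq.sym zigzag_eq.trans)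
qed

lemma der_class_eqI: "zeq C D v w \<Longrightarrow> der_class G R C D v = der_class G R C D w"
  using der_class_eq zeq_zz by metis

lemma der_class_self: "zz C w D \<Longrightarrow> w \<in> der_class G R C D w"
  by (simp add: der_class_def zigzag_eq.refl)

lemma der_comp_class:
  assumes "zz A u B" "zz B v C"
  shows "der_comp G R A C (der_class G R B C v) (der_class G R A B u) = der_class G R A C (u @ v)"
  unfolding der_comp_def
proof (rule induced2_eq)
  show "u \<in> der_class G R A B u" "v \<in> der_class G R B C v" using assms by (simp_all add: der_class_self)
  show "der_class G R A C (u' @ v') = der_class G R A C (u @ v)"
    if "u' \<in> der_class G R A B u" "v' \<in> der_class G R B C v" for u' v'
    using that by (intro der_class_eqI zigzag_eq.sym[OF zeq_append]) (auto simp: der_class_def)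
qed

lemma der_shift_class:
  assumes "zz C w D"
  shows "der_shift G R n C D (der_class G R C D w)
    = der_class G R (shift n C) (shift n D) (map (shift_arrow n) w)"
  unfolding der_shift_def
proof (rule induced_eq)
  show "w \<in> der_class G R C D w" using assms by (simp add: der_class_self)
  show "der_class G R (shift n C) (shift n D) (map (shift_arrow n) v)
      = der_class G R (shift n C) (shift n D) (map (shift_arrow n) w)"
    if "v \<in> der_class G R C D w" for v
    using that functor_zeq[OF functor_shift[of n], of C D w v]
    by (intro der_class_eqI zigzag_eq.sym[of G R _ _ "map _ w"]) (auto simp: der_class_def map_arrow_shift)
qed

end


section \<open>Biproducts and addition of zigzags\<close>

text \<open>The universe type is asked only for an injective pairing: direct sums of modules are
  carried by encoded pairs. The projections are constrained on such codes alone.\<close>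

locale kG_universe = kG_setting G R
  for G :: "('g, 'a) monoid_scheme" and R :: "('k, 'b) ring_scheme" +
  fixes pair :: "'u \<Rightarrow> 'u \<Rightarrow> 'u" and p1 p2 :: "'u \<Rightarrow> 'u"
  assumes p1_pair [simp]: "p1 (pair a b) = a" and p2_pair [simp]: "p2 (pair a b) = b"
begin

lemma pair_eq [simp]: "pair a b = pair a' b' \<longleftrightarrow> a = a' \<and> b = b'"
  using p1_pair p2_pair by metis

definition bimod :: "('k, 'g, 'u) kGmod \<Rightarrow> ('k, 'g, 'u) kGmod \<Rightarrow> ('k, 'g, 'u) kGmod" where
  "bimod M N = \<lparr>carrier = {pair a b | a b. a \<in> carrier M \<and> b \<in> carrier N},
     mult = undefined, one = undefined, zero = pair \<zero>\<^bsub>M\<^esub> \<zero>\<^bsub>N\<^esub>,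
     add = (\<lambda>x y. pair (p1 x \<oplus>\<^bsub>M\<^esub> p1 y) (p2 x \<oplus>\<^bsub>N\<^esub> p2 y)),
     smult = (\<lambda>r x. pair (r \<odot>\<^bsub>M\<^esub> p1 x) (r \<odot>\<^bsub>N\<^esub> p2 x)),
     act = (\<lambda>g x. pair (act M g (p1 x)) (act N g (p2 x)))\<rparr>"

lemma bimod_simps [simp]:
  "pair a b \<in> carrier (bimod M N) \<longleftrightarrow> a \<in> carrier M \<and> b \<in> carrier N"
  "\<zero>\<^bsub>bimod M N\<^esub> = pair \<zero>\<^bsub>M\<^esub> \<zero>\<^bsub>N\<^esub>"
  "x \<oplus>\<^bsub>bimod M N\<^esub> y = pair (p1 x \<oplus>\<^bsub>M\<^esub> p1 y) (p2 x \<oplus>\<^bsub>N\<^esub> p2 y)"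
  "r \<odot>\<^bsub>bimod M N\<^esub> x = pair (r \<odot>\<^bsub>M\<^esub> p1 x) (r \<odot>\<^bsub>N\<^esub> p2 x)"
  "act (bimod M N) g x = pair (act M g (p1 x)) (act N g (p2 x))"
  by (auto simp: bimod_def)

lemma bimodE:
  assumes "x \<in> carrier (bimod M N)"
  obtains a b where "x = pair a b" "a \<in> carrier M" "b \<in> carrier N"
  using assms by (auto simp: bimod_def)

lemma bimod_proj [simp]:
  "x \<in> carrier (bimod M N) \<Longrightarrow> p1 x \<in> carrier M"
  "x \<in> carrier (bimod M N) \<Longrightarrow> p2 x \<in> carrier N"
  by (auto elim!: bimodE)

lemma kmod_bimod:
  assumes "kmod M" "kmod N" shows "kmod (bimod M N)"
proof (rule kmodI)
  show "\<exists>y\<in>carrier (bimod M N). y \<oplus>\<^bsub>bimod M N\<^esub> x = \<zero>\<^bsub>bimod M N\<^esub>" if "x \<in> carrier (bimod M N)" for x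
    using that assms by (intro bexI[of _ "pair (\<ominus>\<^bsub>M\<^esub> p1 x) (\<ominus>\<^bsub>N\<^esub> p2 x)"]) (auto elim!: bimodE)
qed (use assms in \<open>auto elim!: bimodE simp: kmod_grp(1-3) kmod_smult kmod_act\<close>)

lemma bimod_minus [simp]:
  assumes "kmod M" "kmod N" "a \<in> carrier M" "b \<in> carrier N"
  shows "\<ominus>\<^bsub>bimod M N\<^esub> pair a b = pair (\<ominus>\<^bsub>M\<^esub> a) (\<ominus>\<^bsub>N\<^esub> b)"
  using assms by (intro kmod_minus_unique kmod_bimod) auto

lemma bimod_diff [simp]:
  assumes "kmod M" "kmod N" "a \<in> carrier M" "b \<in> carrier N" "a' \<in> carrier M" "b' \<in> carrier N"
  shows "pair a b \<ominus>\<^bsub>bimod M N\<^esub> pair a' b' = pair (a \<ominus>\<^bsub>M\<^esub> a') (b \<ominus>\<^bsub>N\<^esub> b')"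
  using assms by (simp add: kmod_grp(7) kmod_bimod)

definition bicpx ::
  "('k, 'g, 'u) cochain_complex \<Rightarrow> ('k, 'g, 'u) cochain_complex \<Rightarrow> ('k, 'g, 'u) cochain_complex" where
  "bicpx C D = \<lparr>ob = (\<lambda>i. bimod (ob C i) (ob D i)),
     diff = (\<lambda>i. \<lambda>x\<in>carrier (bimod (ob C i) (ob D i)). pair (diff C i (p1 x)) (diff D i (p2 x)))\<rparr>"

lemma ob_bicpx [simp]: "ob (bicpx C D) i = bimod (ob C i) (ob D i)"
  by (simp add: bicpx_def)

lemma diff_bicpx [simp]:
  "x \<in> carrier (bimod (ob C i) (ob D i)) \<Longrightarrow>
    diff (bicpx C D) i x = pair (diff C i (p1 x)) (diff D i (p2 x))"
  by (simp add: bicpx_def)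

lemma cpx_bicpx:
  assumes "cpx C" "cpx D" shows "cpx (bicpx C D)"
proof (rule cpxI)
  note d = cpx_diff_linear[OF assms(1)] cpx_diff_linear[OF assms(2)]
  show "kmod (ob (bicpx C D) i)" for i using assms by (simp add: kmod_bimod)
  show "diff (bicpx C D) i \<in> khom (ob (bicpx C D) i) (ob (bicpx C D) (i + 1))" for i
  proof (rule khomI)
    show "diff (bicpx C D) i x = undefined" if "x \<notin> carrier (ob (bicpx C D) i)" for x
      using that by (simp add: bicpx_def)
  qed (use assms d in \<open>auto elim!: bimodE\<close>)
  show "diff (bicpx C D) (i + 1) (diff (bicpx C D) i x) = \<zero>\<^bsub>ob (bicpx C D) (i + 2)\<^esub>"
    if "x \<in> carrier (ob (bicpx C D) i)" for i x
    using that assms by (simp add: add.assoc)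
qed

definition proj1 :: "('k, 'g, 'u) cochain_complex \<Rightarrow> ('k, 'g, 'u) cochain_complex \<Rightarrow> int \<Rightarrow> 'u \<Rightarrow> 'u"
  where "proj1 C D = (\<lambda>i. \<lambda>x\<in>carrier (ob (bicpx C D) i). p1 x)"
definition proj2 :: "('k, 'g, 'u) cochain_complex \<Rightarrow> ('k, 'g, 'u) cochain_complex \<Rightarrow> int \<Rightarrow> 'u \<Rightarrow> 'u"
  where "proj2 C D = (\<lambda>i. \<lambda>x\<in>carrier (ob (bicpx C D) i). p2 x)"
definition pairing ::
  "('k, 'g, 'u) cochain_complex \<Rightarrow> (int \<Rightarrow> 'u \<Rightarrow> 'u) \<Rightarrow> (int \<Rightarrow> 'u \<Rightarrow> 'u) \<Rightarrow> int \<Rightarrow> 'u \<Rightarrow> 'u"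
  where "pairing E f h = (\<lambda>i. \<lambda>x\<in>carrier (ob E i). pair (f i x) (h i x))"
definition diag :: "('k, 'g, 'u) cochain_complex \<Rightarrow> int \<Rightarrow> 'u \<Rightarrow> 'u"
  where "diag C = pairing C (id_map C) (id_map C)"
text \<open>Building it from projections, composition and pairing makes the chain map property an
  instance of the lemmas about these. For the same reason \<open>codiag\<close> is a sum of
  projections.\<close>

definition bimap ::
  "('k, 'g, 'u) cochain_complex \<Rightarrow> ('k, 'g, 'u) cochain_complex \<Rightarrow>
   (int \<Rightarrow> 'u \<Rightarrow> 'u) \<Rightarrow> (int \<Rightarrow> 'u \<Rightarrow> 'u) \<Rightarrow> int \<Rightarrow> 'u \<Rightarrow> 'u"
  where "bimap C D f h = pairing (bicpx C D) (comp_map (bicpx C D) f (proj1 C D))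
     (comp_map (bicpx C D) h (proj2 C D))"
definition codiag :: "('k, 'g, 'u) cochain_complex \<Rightarrow> int \<Rightarrow> 'u \<Rightarrow> 'u"
  where "codiag C = add_map (bicpx C C) C (proj1 C C) (proj2 C C)"

lemma proj_apply [simp]:
  "a \<in> carrier (ob C i) \<Longrightarrow> b \<in> carrier (ob D i) \<Longrightarrow> proj1 C D i (pair a b) = a"
  "a \<in> carrier (ob C i) \<Longrightarrow> b \<in> carrier (ob D i) \<Longrightarrow> proj2 C D i (pair a b) = b"
  by (simp_all add: proj1_def proj2_def)

lemma pairing_apply [simp]:
  "x \<in> carrier (ob E i) \<Longrightarrow> pairing E f h i x = pair (f i x) (h i x)"
  by (simp add: pairing_def)

lemma diag_apply [simp]: "x \<in> carrier (ob C i) \<Longrightarrow> diag C i x = pair x x"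
  by (simp add: diag_def)

lemma bimap_apply [simp]:
  "a \<in> carrier (ob C i) \<Longrightarrow> b \<in> carrier (ob D i) \<Longrightarrow> bimap C D f h i (pair a b) = pair (f i a) (h i b)"
  by (simp add: bimap_def)

lemma codiag_apply [simp]:
  "a \<in> carrier (ob C i) \<Longrightarrow> b \<in> carrier (ob C i) \<Longrightarrow> codiag C i (pair a b) = a \<oplus>\<^bsub>ob C i\<^esub> b"
  by (simp add: codiag_def)

lemma cmap_proj:
  assumes "cpx C" "cpx D"
  shows "cmap (bicpx C D) (proj1 C D) C" "cmap (bicpx C D) (proj2 C D) D"
  using assms by (auto intro!: cmapI khomI cpx_bicpx elim!: bimodE simp: proj1_def proj2_def)

lemma cmap_pairing:
  assumes "cmap E f C" "cmap E h D" shows "cmap E (pairing E f h) (bicpx C D)"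
proof (rule cmapI)
  note c = cmapD[OF assms(1)] cmapD[OF assms(2)]
  show "cpx E" "cpx (bicpx C D)" using c by (auto intro!: cpx_bicpx)
  show "pairing E f h i \<in> khom (ob E i) (ob (bicpx C D) i)" for i
    using c by (intro khomI) (auto simp: pairing_def)
  show "pairing E f h (i + 1) (diff E i x) = diff (bicpx C D) i (pairing E f h i x)"
    if "x \<in> carrier (ob E i)" for i x
    using that c by simp
qed

lemma cmap_diag: "cpx C \<Longrightarrow> cmap C (diag C) (bicpx C C)"
  by (simp add: diag_def cmap_pairing cmap_id)

lemma cmap_bimap:
  assumes "cmap C f C'" "cmap D h D'" shows "cmap (bicpx C D) (bimap C D f h) (bicpx C' D')"
  unfolding bimap_def using cmapD(1)[OF assms(1)] cmapD(1)[OF assms(2)] assms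
  by (intro cmap_pairing cmap_comp[of _ _ C] cmap_comp[of _ _ D] cmap_proj)

lemma cmap_codiag: "cpx C \<Longrightarrow> cmap (bicpx C C) (codiag C) C"
  by (simp add: codiag_def cmap_add cmap_proj)

lemma cocycles_bicpx:
  "pair a b \<in> cocycles (bicpx C D) n \<longleftrightarrow> a \<in> cocycles C n \<and> b \<in> cocycles D n"
  by (auto simp: cocycles_def)

lemma coboundaries_bicpx:
  "pair a b \<in> coboundaries (bicpx C D) n \<longleftrightarrow> a \<in> coboundaries C n \<and> b \<in> coboundaries D n"
proof
  assume "pair a b \<in> coboundaries (bicpx C D) n"
  then show "a \<in> coboundaries C n \<and> b \<in> coboundaries D n"
    by (auto simp: mem_coboundaries elim!: bimodE)
next
  assume "a \<in> coboundaries C n \<and> b \<in> coboundaries D n"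
  then obtain x y where "x \<in> carrier (ob C (n - 1))" "y \<in> carrier (ob D (n - 1))"
    "a = diff C (n - 1) x" "b = diff D (n - 1) y" by (auto simp: mem_coboundaries)
  then show "pair a b \<in> coboundaries (bicpx C D) n"
    unfolding mem_coboundaries by (intro bexI[of _ "pair x y"]) simp_all
qed

lemma cocycles_bicpxE:
  assumes "x \<in> cocycles (bicpx C D) n"
  obtains a b where "x = pair a b" "a \<in> cocycles C n" "b \<in> cocycles D n"
proof -
  have "x \<in> carrier (bimod (ob C n) (ob D n))" using assms by (simp add: cocycles_def)
  then obtain a b where "x = pair a b" by (auto elim: bimodE)
  then show ?thesis using assms that cocycles_bicpx by blast
qed

text \<open>Cocycles and coboundaries of a biproduct are formed componentwise, so both conditions of
  \<open>quasi_iso_iff\<close> can be met in each component separately.\<close>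

lemma qi_bimap:
  assumes "qi C f C'" "qi D h D'" shows "qi (bicpx C D) (bimap C D f h) (bicpx C' D')"
  unfolding quasi_iso_iff
proof (intro conjI allI ballI impI)
  have k: "cmap C f C'" "cmap D h D'" using assms qi_cmap by blast+
  note c = cmapD[OF k(1)] cmapD[OF k(2)]
  show "cmap (bicpx C D) (bimap C D f h) (bicpx C' D')" using k by (rule cmap_bimap)
  fix n
  show "x \<in> coboundaries (bicpx C D) n"
    if x0: "x \<in> cocycles (bicpx C D) n" "bimap C D f h n x \<in> coboundaries (bicpx C' D') n" for x
  proof -
    obtain a b where x: "x = pair a b" "a \<in> cocycles C n" "b \<in> cocycles D n"
      using x0(1) by (rule cocycles_bicpxE)
    have "a \<in> carrier (ob C n)" "b \<in> carrier (ob D n)" using x c(1,12) by (simp_all add: cocycles_closed(1))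
    then show ?thesis using x0(2) x assms by (simp add: coboundaries_bicpx quasi_iso_iff)
  qed
  show "\<exists>x\<in>cocycles (bicpx C D) n.
      y \<ominus>\<^bsub>ob (bicpx C' D') n\<^esub> bimap C D f h n x \<in> coboundaries (bicpx C' D') n"
    if y: "y \<in> cocycles (bicpx C' D') n" for y
  proof -
    obtain a b where ab: "y = pair a b" "a \<in> cocycles C' n" "b \<in> cocycles D' n"
      using y by (rule cocycles_bicpxE)
    obtain a' b' where ab': "a' \<in> cocycles C n" "b' \<in> cocycles D n"
      "a \<ominus>\<^bsub>ob C' n\<^esub> f n a' \<in> coboundaries C' n" "b \<ominus>\<^bsub>ob D' n\<^esub> h n b' \<in> coboundaries D' n"
      using assms ab unfolding quasi_iso_iff by blast
    have "a' \<in> carrier (ob C n)" "b' \<in> carrier (ob D n)" "a \<in> carrier (ob C' n)" "b \<in> carrier (ob D' n)"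
      using ab ab' c(1,2,12,13) by (simp_all add: cocycles_closed(1))
    then show ?thesis using ab ab' c
      by (intro bexI[of _ "pair a' b'"]) (simp_all add: cocycles_bicpx coboundaries_bicpx)
  qed
qed

lemma bimap_id: "cpx C \<Longrightarrow> cpx D \<Longrightarrow> bimap C D (id_map C) (id_map D) = id_map (bicpx C D)"
  by (rule cmap_eqI[OF cmap_bimap[OF cmap_id cmap_id] cmap_id]) (auto intro: cpx_bicpx elim!: bimodE)

lemma bimap_comp:
  assumes "cmap C f C'" "cmap C' f' C''" "cmap D h D'" "cmap D' h' D''"
  shows "comp_map (bicpx C D) (bimap C' D' f' h') (bimap C D f h)
    = bimap C D (comp_map C f' f) (comp_map D h' h)"
proof (rule cmap_eqI[OF cmap_comp[OF cmap_bimap cmap_bimap] cmap_bimap[OF cmap_comp cmap_comp]])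
  show "comp_map (bicpx C D) (bimap C' D' f' h') (bimap C D f h) i x
    = bimap C D (comp_map C f' f) (comp_map D h' h) i x" if "x \<in> carrier (ob (bicpx C D) i)" for i x
    using that cmapD(4)[OF assms(1)] cmapD(4)[OF assms(3)] by (auto elim!: bimodE)
qed (rule assms)+

text \<open>A zigzag acts on one summand while the other is held fixed, so biproducts are used as
  functors of one variable. Quasi-isomorphisms are preserved because the identity on the fixed
  summand is one as well.\<close>

lemma functor_left:
  assumes "cpx B"
  shows "exact_functor (\<lambda>C. bicpx C B) (\<lambda>C f D. bimap C B f (id_map B))"
proof -
  note i = cmap_id[OF assms]
  note k = bimap_comp[OF _ _ i i, unfolded comp_map_id(1)[OF i], symmetric]
  show ?thesis using assms i unfolding exact_functor_def
    by (auto simp: bimap_id k intro!: cpx_bicpx cmap_bimap qi_bimap qi_id)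
qed

lemma functor_right:
  assumes "cpx A"
  shows "exact_functor (\<lambda>C. bicpx A C) (\<lambda>C f D. bimap A C (id_map A) f)"
proof -
  note i = cmap_id[OF assms]
  note k = bimap_comp[OF i i, unfolded comp_map_id(1)[OF i], symmetric]
  show ?thesis using assms i unfolding exact_functor_def
    by (auto simp: bimap_id k intro!: cpx_bicpx cmap_bimap qi_bimap qi_id)
qed

abbreviation left_map ::
  "('k, 'g, 'u) cochain_complex \<Rightarrow> ('k, 'g, 'u) zigzag \<Rightarrow> ('k, 'g, 'u) zigzag"
  where "left_map B w \<equiv> map (map_arrow (\<lambda>C. bicpx C B) (\<lambda>C f D. bimap C B f (id_map B))) w"
abbreviation right_map ::
  "('k, 'g, 'u) cochain_complex \<Rightarrow> ('k, 'g, 'u) zigzag \<Rightarrow> ('k, 'g, 'u) zigzag"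
  where "right_map A w \<equiv> map (map_arrow (\<lambda>C. bicpx A C) (\<lambda>C f D. bimap A C (id_map A) f)) w"

text \<open>Two zigzags need not have arrows of matching kind or number, so their direct sum cannot
  be formed arrow by arrow. Instead \<open>v\<close> acts on the first summand while the second
  stays \<open>C\<close>, and then \<open>w\<close> acts on the second while the first stays
  \<open>D\<close>.\<close>

definition zadd ::
  "('k, 'g, 'u) cochain_complex \<Rightarrow> ('k, 'g, 'u) cochain_complex \<Rightarrow>
   ('k, 'g, 'u) zigzag \<Rightarrow> ('k, 'g, 'u) zigzag \<Rightarrow> ('k, 'g, 'u) zigzag" where
  "zadd C D v w = [Fwd C (diag C) (bicpx C C)] @ left_map C v @ right_map D w @
     [Fwd (bicpx D D) (codiag D) D]"

lemma zz_left: "cpx B \<Longrightarrow> zz C w D \<Longrightarrow> zz (bicpx C B) (left_map B w) (bicpx D B)"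
  by (rule functor_zz[OF functor_left])

lemma zz_right: "cpx A \<Longrightarrow> zz C w D \<Longrightarrow> zz (bicpx A C) (right_map A w) (bicpx A D)"
  by (rule functor_zz[OF functor_right])

lemma zadd_cong:
  assumes "zeq C D v v'" "zeq C D w w'" shows "zeq C D (zadd C D v w) (zadd C D v' w')"
proof -
  have c: "cpx C" "cpx D" using zz_cpx[OF zeq_zz(1)[OF assms(1)]] by blast+
  show ?thesis unfolding zadd_def
    by (rule zeq_append[OF zigzag_eq.refl[OF zz_Fwd[OF cmap_diag[OF c(1)]]]
          zeq_append[OF functor_zeq[OF functor_left[OF c(1)] assms(1)]
          zeq_append[OF functor_zeq[OF functor_right[OF c(2)] assms(2)]
            zigzag_eq.refl[OF zz_Fwd[OF cmap_codiag[OF c(2)]]]]]])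
qed

lemma zz_zadd: "zz C v D \<Longrightarrow> zz C w D \<Longrightarrow> zz C (zadd C D v w) D"
  by (rule zeq_zz(1)[OF zadd_cong[OF zigzag_eq.refl zigzag_eq.refl]])

text \<open>The four arrows compose to one chain map, computed on an element as x, (x, x), (f x, x),
  (f x, h x), f x + h x.\<close>

lemma zadd_Fwd:
  assumes "cmap C f D" "cmap C h D"
  shows "zeq C D (zadd C D [Fwd C f D] [Fwd C h D]) [Fwd C (add_map C D f h) D]"
proof -
  note c = cmapD(1,2)[OF assms(1)]
  let ?a = "bimap C C f (id_map C)" and ?b = "bimap D C (id_map D) h"
  have a: "cmap (bicpx C C) ?a (bicpx D C)" and b: "cmap (bicpx D C) ?b (bicpx D D)"
    using assms c by (auto intro!: cmap_bimap cmap_id)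
  let ?x = "comp_map (bicpx D C) (codiag D) ?b"
  let ?y = "comp_map (bicpx C C) ?x ?a"
  have x: "cmap (bicpx D C) ?x D" using b c by (intro cmap_comp[OF _ cmap_codiag])
  have y: "cmap (bicpx C C) ?y D" using a x by (rule cmap_comp)
  have e: "comp_map C ?y (diag C) = add_map C D f h"
    by (rule cmap_eqI[OF cmap_comp[OF cmap_diag y] cmap_add])
      (use c assms cmapD(4)[OF assms(1)] cmapD(4)[OF assms(2)] in simp_all)
  have "zeq (bicpx D C) D ([Fwd (bicpx D C) ?b (bicpx D D)] @ [Fwd (bicpx D D) (codiag D) D])
     [Fwd (bicpx D C) ?x D]" using b c by (intro zeq_Fwd_Fwd cmap_codiag) simp_all
  note zeq_pre[OF zz_Fwd[OF a] this]
  also have "zeq (bicpx C C) D ([Fwd (bicpx C C) ?a (bicpx D C)] @ [Fwd (bicpx D C) ?x D])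
     [Fwd (bicpx C C) ?y D]" using a x by (intro zeq_Fwd_Fwd) simp_all
  finally have "zeq (bicpx C C) D ([Fwd (bicpx C C) ?a (bicpx D C)] @
     [Fwd (bicpx D C) ?b (bicpx D D)] @ [Fwd (bicpx D D) (codiag D) D]) [Fwd (bicpx C C) ?y D]" .
  note zeq_pre[OF zz_Fwd[OF cmap_diag[OF c(1)]] this]
  also have "zeq C D ([Fwd C (diag C) (bicpx C C)] @ [Fwd (bicpx C C) ?y D]) [Fwd C (add_map C D f h) D]"
    using y c e by (intro zeq_Fwd_Fwd cmap_diag)
  finally show ?thesis by (simp add: zadd_def)
qed

text \<open>The copy of \<open>a\<close> that belongs to the second summand comes after
  \<open>w1\<close>. As it acts on the other summand, naturality moves it in front of
  \<open>w1\<close>; the two copies of \<open>a\<close> then pass through the diagonal together and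
  become one.\<close>

lemma zadd_pre_Fwd:
  assumes a: "cmap B a C" and w: "zz C w1 D" "zz C w2 D"
  shows "zeq B D (zadd B D ([Fwd B a C] @ w1) ([Fwd B a C] @ w2)) ([Fwd B a C] @ zadd C D w1 w2)"
proof -
  note c = cmapD(1,2)[OF a] zz_cpx(2)[OF w(1)]
  let ?\<eta> = "\<lambda>X. bimap X B (id_map X) a"
  let ?l = "bimap B B a (id_map B)"
  have \<eta>: "cmap (bicpx X B) (?\<eta> X) (bicpx X C)" if "cpx X" for X
    using that a by (intro cmap_bimap cmap_id)
  have l: "cmap (bicpx B B) ?l (bicpx C B)" using a c by (intro cmap_bimap cmap_id)
  have n: "comp_map (bicpx X B) (?\<eta> Y) (bimap X B f (id_map B))
      = comp_map (bicpx X B) (bimap X C f (id_map C)) (?\<eta> X)" if f: "cmap X f Y" for X f Y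
  proof -
    note X = cmapD(1,2)[OF f]
    show ?thesis
      using bimap_comp[OF f cmap_id[OF X(2)] cmap_id[OF c(1)] a]
        bimap_comp[OF cmap_id[OF X(1)] f a cmap_id[OF c(2)]] comp_map_id[OF f] comp_map_id[OF a] by simp
  qed
  \<comment> \<open>The second copy of \<open>a\<close>, seen as a transformation from adding
    \<open>B\<close> to adding \<open>C\<close>, crosses \<open>w1\<close>.\<close>
  have N: "zeq (bicpx C B) (bicpx D C) (left_map B w1 @ [Fwd (bicpx D B) (?\<eta> D) (bicpx D C)])
      ([Fwd (bicpx C B) (?\<eta> C) (bicpx C C)] @ left_map C w1)"
    using zeq_natural[OF functor_left[OF c(1)] functor_left[OF c(2)] \<eta> n w(1)] .
  have "zeq (bicpx B B) (bicpx C C)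
      ([Fwd (bicpx B B) ?l (bicpx C B)] @ [Fwd (bicpx C B) (?\<eta> C) (bicpx C C)])
      [Fwd (bicpx B B) (comp_map (bicpx B B) (?\<eta> C) ?l) (bicpx C C)]"
    using l \<eta>[OF c(2)] by (intro zeq_Fwd_Fwd) simp_all
  note zeq_pre[OF zz_Fwd[OF cmap_diag[OF c(1)]] this]
  also have "zeq B (bicpx C C) ([Fwd B (diag B) (bicpx B B)] @
      [Fwd (bicpx B B) (comp_map (bicpx B B) (?\<eta> C) ?l) (bicpx C C)])
      [Fwd B (comp_map B (diag C) a) (bicpx C C)]"
  proof (rule zeq_Fwd_Fwd)
    show d: "cmap B (diag B) (bicpx B B)" using c by (intro cmap_diag)
    show k: "cmap (bicpx B B) (comp_map (bicpx B B) (?\<eta> C) ?l) (bicpx C C)"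
      using l \<eta>[OF c(2)] by (rule cmap_comp)
    show "comp_map B (comp_map (bicpx B B) (?\<eta> C) ?l) (diag B) = comp_map B (diag C) a"
      by (rule cmap_eqI[OF cmap_comp[OF d k] cmap_comp[OF a cmap_diag]])
        (use c cmapD(4)[OF a] in simp_all)
  qed
  also have "zeq B (bicpx C C) \<dots> ([Fwd B a C] @ [Fwd C (diag C) (bicpx C C)])"
    using a c by (intro zigzag_eq.sym[OF zeq_Fwd_Fwd] cmap_diag) simp_all
  finally have M: "zeq B (bicpx C C) ([Fwd B (diag B) (bicpx B B)] @ [Fwd (bicpx B B) ?l (bicpx C B)] @
      [Fwd (bicpx C B) (?\<eta> C) (bicpx C C)]) ([Fwd B a C] @ [Fwd C (diag C) (bicpx C C)])" .
  let ?t = "right_map D w2 @ [Fwd (bicpx D D) (codiag D) D]"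
  have t: "zz (bicpx D C) ?t D" using c w by (intro zz_append[OF zz_right zz_Fwd] cmap_codiag)
  have "zeq B D (([Fwd B (diag B) (bicpx B B)] @ [Fwd (bicpx B B) ?l (bicpx C B)]) @
      (left_map B w1 @ [Fwd (bicpx D B) (?\<eta> D) (bicpx D C)]) @ ?t)
     (([Fwd B (diag B) (bicpx B B)] @ [Fwd (bicpx B B) ?l (bicpx C B)]) @
      ([Fwd (bicpx C B) (?\<eta> C) (bicpx C C)] @ left_map C w1) @ ?t)"
    by (rule zeq_pre[OF zz_append[OF zz_Fwd[OF cmap_diag[OF c(1)]] zz_Fwd[OF l]] zeq_post[OF N t]])
  also have "zeq B D (([Fwd B (diag B) (bicpx B B)] @ [Fwd (bicpx B B) ?l (bicpx C B)]) @
      ([Fwd (bicpx C B) (?\<eta> C) (bicpx C C)] @ left_map C w1) @ ?t)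
     (([Fwd B a C] @ [Fwd C (diag C) (bicpx C C)]) @ left_map C w1 @ ?t)"
    using zeq_post[OF M zz_append[OF zz_left[OF c(2) w(1)] t]] by simp
  finally show ?thesis by (simp add: zadd_def)
qed

text \<open>
  A formal inverse \<open>s\<^sup>-\<^sup>1\<close> is moved past \<open>zadd\<close> by composing both sides with \<open>s\<close>, which reduces to the
  case of a chain map.
\<close>

lemma zadd_pre:
  assumes "zz B v C" "zz C w1 D" "zz C w2 D"
  shows "zeq B D (zadd B D (v @ w1) (v @ w2)) (v @ zadd C D w1 w2)"
  using assms
proof (induction rule: is_zigzag.induct)
  case (Nil C)
  then show ?case using zz_zadd by (auto intro: zigzag_eq.refl)
next
  case (Fwd B f B' v C)
  have "zeq B D (zadd B D ([Fwd B f B'] @ v @ w1) ([Fwd B f B'] @ v @ w2))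
     ([Fwd B f B'] @ zadd B' D (v @ w1) (v @ w2))"
    using Fwd by (intro zadd_pre_Fwd zz_append) auto
  also have "zeq B D \<dots> ([Fwd B f B'] @ v @ zadd C D w1 w2)"
    using Fwd by (intro zeq_pre[OF zz_Fwd]) auto
  finally show ?case by simp
next
  case (Bwd B' s B v C)
  note s = Bwd(1) and ks = qi_cmap[OF Bwd(1)]
  have z: "zz B' (v @ w1) D" "zz B' (v @ w2) D" using Bwd by (auto intro: zz_append)
  have zs: "zz B ([Bwd B' s B] @ v @ w1) D" "zz B ([Bwd B' s B] @ v @ w2) D"
    using z s by (auto intro!: zz_append[OF zz_Bwd] simp del: append_Cons)
  have e: "zeq B' D ([Fwd B' s B] @ [Bwd B' s B] @ w) w" if "zz B' w D" for w
    using zeq_post[OF zeq_Fwd_Bwd[OF s] that] by simp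
  have "zeq B D (zadd B D ([Bwd B' s B] @ v @ w1) ([Bwd B' s B] @ v @ w2))
     ([Bwd B' s B] @ zadd B' D (v @ w1) (v @ w2))"
  proof (rule zeq_cancel_left[OF s zz_zadd[OF zs] zz_append[OF zz_Bwd[OF s] zz_zadd[OF z]]])
    have "zeq B' D ([Fwd B' s B] @ zadd B D ([Bwd B' s B] @ v @ w1) ([Bwd B' s B] @ v @ w2))
        (zadd B' D ([Fwd B' s B] @ [Bwd B' s B] @ v @ w1) ([Fwd B' s B] @ [Bwd B' s B] @ v @ w2))"
      by (rule zigzag_eq.sym[OF zadd_pre_Fwd[OF ks zs]])
    also have "zeq B' D \<dots> (zadd B' D (v @ w1) (v @ w2))" by (intro zadd_cong e z)
    also have "zeq B' D \<dots> ([Fwd B' s B] @ [Bwd B' s B] @ zadd B' D (v @ w1) (v @ w2))"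
      by (rule zigzag_eq.sym[OF e[OF zz_zadd[OF z]]])
    finally show "zeq B' D ([Fwd B' s B] @ zadd B D ([Bwd B' s B] @ v @ w1) ([Bwd B' s B] @ v @ w2))
       ([Fwd B' s B] @ [Bwd B' s B] @ zadd B' D (v @ w1) (v @ w2))" .
  qed
  also have "zeq B D \<dots> ([Bwd B' s B] @ v @ zadd C D w1 w2)"
    using Bwd by (intro zeq_pre[OF zz_Bwd[OF s]]) auto
  finally show ?case by simp
qed

text \<open>Links \<open>zadd\<close> to the common denominators by which \<open>der_add\<close> is
  described.\<close>

lemma zadd_common:
  assumes "zz C u E" "cmap E f D" "cmap E h D"
  shows "zeq C D (zadd C D (u @ [Fwd E f D]) (u @ [Fwd E h D])) (u @ [Fwd E (add_map E D f h) D])"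
  using zadd_pre[OF assms(1) zz_Fwd[OF assms(2)] zz_Fwd[OF assms(3)]]
    zeq_pre[OF assms(1) zadd_Fwd[OF assms(2,3)]] by (rule zigzag_eq.trans)

text \<open>The common part is the diagonal followed by \<open>v\<close> on the first and
  \<open>w\<close> on the second summand; a projection gives back \<open>v\<close> or
  \<open>w\<close>. It plays the role of an Ore condition: identities between sums of zigzags become
  pointwise identities between chain maps out of \<open>E\<close>.\<close>

lemma common_source:
  fixes C D D' :: "('k, 'g, 'u) cochain_complex"
  assumes v: "zz C v D" and w: "zz C w D'"
  obtains u E f h where "zz C u E" "cmap E f D" "cmap E h D'"
    "zeq C D (u @ [Fwd E f D]) v" "zeq C D' (u @ [Fwd E h D']) w"
proof
  note c = zz_cpx[OF v] zz_cpx(2)[OF w]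
  let ?\<Delta> = "[Fwd C (diag C) (bicpx C C)]"
  let ?u = "?\<Delta> @ left_map C v @ right_map D w"
  let ?K = "\<lambda>A. map (map_arrow (\<lambda>C. A) (\<lambda>C f D. id_map A))"
  show f: "cmap (bicpx D D') (proj1 D D') D" and h: "cmap (bicpx D D') (proj2 D D') D'"
    using c by (auto intro: cmap_proj)
  have zd: "zz C ?\<Delta> (bicpx C C)" using c by (intro zz_Fwd cmap_diag)
  have zv: "zz C (?\<Delta> @ left_map C v) (bicpx D C)" using zd zz_left[OF c(1) v] by (rule zz_append)
  show "zz C ?u (bicpx D D')" using zz_append[OF zv zz_right[OF c(2) w]] by simp
  \<comment> \<open>A projection onto the summand that is acted on is a transformation to the
    identity functor. A projection onto the fixed summand is one to a constant functor, under which
    the zigzag vanishes.\<close>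
  have nat: "comp_map (bicpx X B) (proj1 Y B) (bimap X B k (id_map B)) = comp_map (bicpx X B) k (proj1 X B)"
      "comp_map (bicpx X B) (proj2 Y B) (bimap X B k (id_map B))
        = comp_map (bicpx X B) (id_map B) (proj2 X B)"
      "comp_map (bicpx B X) (proj1 B Y) (bimap B X (id_map B) k)
        = comp_map (bicpx B X) (id_map B) (proj1 B X)"
      "comp_map (bicpx B X) (proj2 B Y) (bimap B X (id_map B) k) = comp_map (bicpx B X) k (proj2 B X)"
    if k: "cmap X k Y" and B: "cpx B" for X k Y B
  proof -
    note kk = cmapD(1,2)[OF k] and i = cmap_id[OF B]
    note b1 = cmap_bimap[OF k i] and b2 = cmap_bimap[OF i k]
    show "comp_map (bicpx X B) (proj1 Y B) (bimap X B k (id_map B)) = comp_map (bicpx X B) k (proj1 X B)"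
      by (rule cmap_eqI[OF cmap_comp[OF b1 cmap_proj(1)] cmap_comp[OF cmap_proj(1) k]])
        (use kk B cmapD(4)[OF k] in \<open>auto elim!: bimodE\<close>)
    show "comp_map (bicpx X B) (proj2 Y B) (bimap X B k (id_map B))
        = comp_map (bicpx X B) (id_map B) (proj2 X B)"
      by (rule cmap_eqI[OF cmap_comp[OF b1 cmap_proj(2)] cmap_comp[OF cmap_proj(2) i]])
        (use kk B cmapD(4)[OF k] in \<open>auto elim!: bimodE\<close>)
    show "comp_map (bicpx B X) (proj1 B Y) (bimap B X (id_map B) k)
        = comp_map (bicpx B X) (id_map B) (proj1 B X)"
      by (rule cmap_eqI[OF cmap_comp[OF b2 cmap_proj(1)] cmap_comp[OF cmap_proj(1) i]])
        (use kk B cmapD(4)[OF k] in \<open>auto elim!: bimodE\<close>)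
    show "comp_map (bicpx B X) (proj2 B Y) (bimap B X (id_map B) k) = comp_map (bicpx B X) k (proj2 B X)"
      by (rule cmap_eqI[OF cmap_comp[OF b2 cmap_proj(2)] cmap_comp[OF cmap_proj(2) k]])
        (use kk B cmapD(4)[OF k] in \<open>auto elim!: bimodE\<close>)
  qed
  have L1: "zeq (bicpx C C) D (left_map C v @ [Fwd (bicpx D C) (proj1 D C) D])
      ([Fwd (bicpx C C) (proj1 C C) C] @ v)"
    using zeq_natural[OF functor_left[OF c(1)] functor_id cmap_proj(1)[OF _ c(1)] nat(1)[OF _ c(1)] v]
    by simp
  have L2: "zeq (bicpx C C) C (left_map C v @ [Fwd (bicpx D C) (proj2 D C) C])
      ([Fwd (bicpx C C) (proj2 C C) C] @ [])"
    using zeq_natural[OF functor_left[OF c(1)] functor_const[OF c(1)] cmap_proj(2)[OF _ c(1)]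
        nat(2)[OF _ c(1)] v]
      zeq_pre[OF zz_Fwd[OF cmap_proj(2)[OF c(1) c(1)]] zeq_const[OF c(1) v]]
    by (rule zigzag_eq.trans)
  have R1: "zeq (bicpx D C) D (right_map D w @ [Fwd (bicpx D D') (proj1 D D') D])
      ([Fwd (bicpx D C) (proj1 D C) D] @ [])"
    using zeq_natural[OF functor_right[OF c(2)] functor_const[OF c(2)] cmap_proj(1)[OF c(2)]
        nat(3)[OF _ c(2)] w]
      zeq_pre[OF zz_Fwd[OF cmap_proj(1)[OF c(2) c(1)]] zeq_const[OF c(2) w]]
    by (rule zigzag_eq.trans)
  have R2: "zeq (bicpx D C) D' (right_map D w @ [Fwd (bicpx D D') (proj2 D D') D'])
      ([Fwd (bicpx D C) (proj2 D C) C] @ w)"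
    using zeq_natural[OF functor_right[OF c(2)] functor_id cmap_proj(2)[OF c(2)] nat(4)[OF _ c(2)] w]
    by simp
  have D1: "zeq C C (?\<Delta> @ [Fwd (bicpx C C) (proj1 C C) C]) []"
    and D2: "zeq C C (?\<Delta> @ [Fwd (bicpx C C) (proj2 C C) C]) []"
    using c by (auto intro!: zigzag_eq.trans[OF zeq_Fwd_Fwd zeq_id] cmap_diag cmap_proj cmap_id
        cmap_eqI[OF cmap_comp cmap_id] simp del: append_Cons)
  \<comment> \<open>The first projection absorbs the action of \<open>w\<close> and lets
    \<open>v\<close> pass. What is left in front of \<open>v\<close>, the diagonal followed by a
    projection, is the identity.\<close>
  have "zeq C D (?u @ [Fwd (bicpx D D') (proj1 D D') D])
      ((?\<Delta> @ left_map C v) @ [Fwd (bicpx D C) (proj1 D C) D])"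
    using zeq_pre[OF zv R1] by simp
  also have "zeq C D \<dots> (?\<Delta> @ [Fwd (bicpx C C) (proj1 C C) C] @ v)"
    using zeq_pre[OF zd L1] by simp
  also have "zeq C D \<dots> v" using zeq_post[OF D1 v] by simp
  finally show "zeq C D (?u @ [Fwd (bicpx D D') (proj1 D D') D]) v" .
  have "zeq C D' (?u @ [Fwd (bicpx D D') (proj2 D D') D'])
      ((?\<Delta> @ left_map C v @ [Fwd (bicpx D C) (proj2 D C) C]) @ w)"
    using zeq_pre[OF zv R2] by simp
  also have "zeq C D' \<dots> ((?\<Delta> @ [Fwd (bicpx C C) (proj2 C C) C]) @ w)"
    using zeq_post[OF zeq_pre[OF zd L2] w] by simp
  also have "zeq C D' \<dots> w" using zeq_post[OF D2 w] by simp
  finally show "zeq C D' (?u @ [Fwd (bicpx D D') (proj2 D D') D']) w" .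
qed


text \<open>The zero maps into \<open>E\<close> form a transformation from the identity functor to
  the constant functor at \<open>E\<close>, so naturality absorbs the zigzag. For a zero map in
  front, the two functors exchange roles.\<close>

lemma zeq_zero_right:
  assumes "zz C w D" "cpx E"
  shows "zeq C E (w @ [Fwd D (zero_map D E) E]) [Fwd C (zero_map C E) E]"
proof -
  note c = zz_cpx[OF assms(1)]
  have n: "comp_map X (zero_map Y E) f = comp_map X (id_map E) (zero_map X E)" if f: "cmap X f Y" for X f Y
    by (rule cmap_eqI[OF cmap_comp[OF f cmap_zero] cmap_comp[OF cmap_zero cmap_id]])
      (use cmapD(1,2,4)[OF f] assms(2) in simp_all)
  show ?thesis
    using zeq_natural[OF functor_id functor_const[OF assms(2)] cmap_zero[OF _ assms(2)] n assms(1)]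
      zeq_pre[OF zz_Fwd[OF cmap_zero[OF c(1) assms(2)]] zeq_const[OF assms(2,1)]] zigzag_eq.trans
    by fastforce
qed

lemma zeq_zero_left:
  assumes "zz D w E" "cpx C"
  shows "zeq C E ([Fwd C (zero_map C D) D] @ w) [Fwd C (zero_map C E) E]"
proof -
  note c = zz_cpx[OF assms(1)]
  have n: "comp_map C (zero_map C Y) (id_map C) = comp_map C f (zero_map C X)" if f: "cmap X f Y" for X f Y
    by (rule cmap_eqI[OF cmap_comp[OF cmap_id cmap_zero] cmap_comp[OF cmap_zero f]])
      (use cmapD(1,2,8)[OF f] assms(2) in simp_all)
  show ?thesis
    using zigzag_eq.sym[OF zeq_natural[OF functor_const[OF assms(2)] functor_id cmap_zero[OF assms(2)] n assms(1)]]
      zeq_post[OF zeq_const[OF assms(2,1)] zz_Fwd[OF cmap_zero[OF assms(2) c(2)]]] zigzag_eq.trans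
    by fastforce
qed

text \<open>By linearity of chain maps, multiplication by \<open>r\<close> is a natural endomorphism
  of the identity functor.\<close>

lemma zeq_scalar:
  assumes "zz C w D" "r \<in> carrier R"
  shows "zeq C D (w @ [Fwd D (scalar_map r D) D]) ([Fwd C (scalar_map r C) C] @ w)"
proof -
  have n: "comp_map X (scalar_map r Y) f = comp_map X f (scalar_map r X)" if f: "cmap X f Y" for X f Y
    by (rule cmap_eqI[OF cmap_comp[OF f cmap_scalar] cmap_comp[OF cmap_scalar f]])
      (use cmapD[OF f] assms in simp_all)
  show ?thesis
    using zeq_natural[OF functor_id functor_id cmap_scalar[OF _ assms(2)] n assms(1)] by simp
qed

end

section \<open>Distributivity and monoid laws for the sum of zigzags\<close>

context kG_universe
begin

text \<open>After passage to a common source the summands are chain maps \<open>a\<close> and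
  \<open>b\<close> out of \<open>E\<close>, and the claim is the additivity of
  \<open>f\<close>.\<close>

lemma zadd_post_Fwd:
  assumes w: "zz C w1 D" "zz C w2 D" and f: "cmap D f D'"
  shows "zeq C D' (zadd C D w1 w2 @ [Fwd D f D']) (zadd C D' (w1 @ [Fwd D f D']) (w2 @ [Fwd D f D']))"
proof -
  obtain u E a b where u: "zz C u E" "cmap E a D" "cmap E b D"
    "zeq C D (u @ [Fwd E a D]) w1" "zeq C D (u @ [Fwd E b D]) w2"
    using w by (rule common_source)
  note fa = cmap_comp[OF u(2) f] and fb = cmap_comp[OF u(3) f]
  have e: "comp_map E f (add_map E D a b) = add_map E D' (comp_map E f a) (comp_map E f b)"
    by (rule cmap_eqI[OF cmap_comp[OF cmap_add[OF u(2,3)] f] cmap_add[OF fa fb]])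
      (use cmapD[OF u(2)] cmapD[OF u(3)] cmapD(5)[OF f] in simp)
  have k: "zeq C D' (u @ [Fwd E (comp_map E f x) D']) (w @ [Fwd D f D'])"
    if x: "cmap E x D" and w: "zeq C D (u @ [Fwd E x D]) w" for x w
  proof -
    have "zeq C D' (u @ [Fwd E (comp_map E f x) D']) (u @ [Fwd E x D] @ [Fwd D f D'])"
      by (rule zeq_pre[OF u(1) zigzag_eq.sym[OF zeq_Fwd_Fwd[OF x f HOL.refl]]])
    also have "zeq C D' \<dots> (w @ [Fwd D f D'])"
      using zeq_post[OF w zz_Fwd[OF f]] by simp
    finally show ?thesis .
  qed
  have "zeq C D (zadd C D w1 w2) (zadd C D (u @ [Fwd E a D]) (u @ [Fwd E b D]))"
    using u by (intro zadd_cong) (auto intro: zigzag_eq.sym)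
  also have "zeq C D \<dots> (u @ [Fwd E (add_map E D a b) D])" by (rule zadd_common[OF u(1-3)])
  finally have "zeq C D' (zadd C D w1 w2 @ [Fwd D f D']) ((u @ [Fwd E (add_map E D a b) D]) @ [Fwd D f D'])"
    by (rule zeq_post[OF _ zz_Fwd[OF f]])
  also have "zeq C D' \<dots> (u @ [Fwd E (add_map E D' (comp_map E f a) (comp_map E f b)) D'])"
    using zeq_pre[OF u(1) zeq_Fwd_Fwd[OF cmap_add[OF u(2,3)] f e]] by simp
  also have "zeq C D' \<dots> (zadd C D' (u @ [Fwd E (comp_map E f a) D']) (u @ [Fwd E (comp_map E f b) D']))"
    by (rule zigzag_eq.sym[OF zadd_common[OF u(1) fa fb]])
  also have "zeq C D' \<dots> (zadd C D' (w1 @ [Fwd D f D']) (w2 @ [Fwd D f D']))"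
    by (rule zadd_cong[OF k[OF u(2,4)] k[OF u(3,5)]])
  finally show ?thesis .
qed

text \<open>Both sides are compared after composition with \<open>s\<close>. The left side
  contracts; on the right \<open>s\<close> is distributed over the sum by the case of a chain map,
  after which each summand contracts.\<close>

lemma zadd_post_Bwd:
  assumes w: "zz C w1 D" "zz C w2 D" and s: "qi D' s D"
  shows "zeq C D' (zadd C D w1 w2 @ [Bwd D' s D]) (zadd C D' (w1 @ [Bwd D' s D]) (w2 @ [Bwd D' s D]))"
proof (rule zeq_cancel_right[OF s])
  note k = qi_cmap[OF s]
  have z: "zz C (w @ [Bwd D' s D]) D'" if "zz C w D" for w
    by (rule zz_append[OF that zz_Bwd[OF s]])
  show "zz C (zadd C D w1 w2 @ [Bwd D' s D]) D'" by (rule z[OF zz_zadd[OF w]])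
  show "zz C (zadd C D' (w1 @ [Bwd D' s D]) (w2 @ [Bwd D' s D])) D'" by (intro zz_zadd z w)
  have "zeq C D ((zadd C D w1 w2 @ [Bwd D' s D]) @ [Fwd D' s D]) (zadd C D w1 w2)"
    by (rule zeq_Bwd_cancel[OF s zz_zadd[OF w]])
  also have "zeq C D \<dots> (zadd C D ((w1 @ [Bwd D' s D]) @ [Fwd D' s D]) ((w2 @ [Bwd D' s D]) @ [Fwd D' s D]))"
    by (rule zadd_cong[OF zigzag_eq.sym[OF zeq_Bwd_cancel[OF s w(1)]] zigzag_eq.sym[OF zeq_Bwd_cancel[OF s w(2)]]])
  also have "zeq C D \<dots> (zadd C D' (w1 @ [Bwd D' s D]) (w2 @ [Bwd D' s D]) @ [Fwd D' s D])"
    by (rule zigzag_eq.sym[OF zadd_post_Fwd[OF z[OF w(1)] z[OF w(2)] k]])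
  finally show "zeq C D ((zadd C D w1 w2 @ [Bwd D' s D]) @ [Fwd D' s D])
     (zadd C D' (w1 @ [Bwd D' s D]) (w2 @ [Bwd D' s D]) @ [Fwd D' s D])" .
qed

lemma zadd_post:
  assumes "zz D v E" "zz C w1 D" "zz C w2 D"
  shows "zeq C E (zadd C D w1 w2 @ v) (zadd C E (w1 @ v) (w2 @ v))"
  using assms
proof (induction arbitrary: w1 w2 rule: is_zigzag.induct)
  case (Nil D)
  then show ?case using zz_zadd by (auto intro: zigzag_eq.refl)
next
  case (Fwd D f D' v E)
  have "zeq C E ((zadd C D w1 w2 @ [Fwd D f D']) @ v) (zadd C D' (w1 @ [Fwd D f D']) (w2 @ [Fwd D f D']) @ v)"
    using Fwd by (intro zeq_post[OF zadd_post_Fwd])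
  also have "zeq C E \<dots> (zadd C E ((w1 @ [Fwd D f D']) @ v) ((w2 @ [Fwd D f D']) @ v))"
    using Fwd by (intro Fwd.IH zz_append[OF _ zz_Fwd])
  finally show ?case by simp
next
  case (Bwd D' s D v E)
  have "zeq C E ((zadd C D w1 w2 @ [Bwd D' s D]) @ v) (zadd C D' (w1 @ [Bwd D' s D]) (w2 @ [Bwd D' s D]) @ v)"
    using Bwd by (intro zeq_post[OF zadd_post_Bwd])
  also have "zeq C E \<dots> (zadd C E ((w1 @ [Bwd D' s D]) @ v) ((w2 @ [Bwd D' s D]) @ v))"
    using Bwd by (intro Bwd.IH zz_append[OF _ zz_Bwd])
  finally show ?case by simp
qed

lemma zadd_comm:
  assumes "zz C v D" "zz C w D" shows "zeq C D (zadd C D v w) (zadd C D w v)"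
proof -
  obtain u E a b where u: "zz C u E" "cmap E a D" "cmap E b D"
    "zeq C D (u @ [Fwd E a D]) v" "zeq C D (u @ [Fwd E b D]) w"
    using assms by (rule common_source)
  have e: "add_map E D a b = add_map E D b a"
    by (rule cmap_eqI[OF cmap_add[OF u(2,3)] cmap_add[OF u(3,2)]])
      (use cmapD(2,4)[OF u(2)] cmapD(4)[OF u(3)] in \<open>simp add: kmod_grp(2)\<close>)
  have "zeq C D (zadd C D v w) (zadd C D (u @ [Fwd E a D]) (u @ [Fwd E b D]))"
    using u by (intro zadd_cong) (auto intro: zigzag_eq.sym)
  also have "zeq C D \<dots> (u @ [Fwd E (add_map E D b a) D])"
    using zadd_common[OF u(1-3)] by (simp add: e)
  also have "zeq C D \<dots> (zadd C D (u @ [Fwd E b D]) (u @ [Fwd E a D]))"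
    by (rule zigzag_eq.sym[OF zadd_common[OF u(1,3,2)]])
  also have "zeq C D \<dots> (zadd C D w v)" using u by (intro zadd_cong)
  finally show ?thesis .
qed

text \<open>Three zigzags need a single source: \<open>common_source\<close> is applied to the first
  two, and then to the resulting \<open>u\<close> together with \<open>w3\<close>. What remains is
  associativity in the modules of \<open>D\<close>.\<close>

lemma zadd_assoc:
  assumes "zz C w1 D" "zz C w2 D" "zz C w3 D"
  shows "zeq C D (zadd C D (zadd C D w1 w2) w3) (zadd C D w1 (zadd C D w2 w3))"
proof -
  obtain u E a b where u: "zz C u E" "cmap E a D" "cmap E b D"
    "zeq C D (u @ [Fwd E a D]) w1" "zeq C D (u @ [Fwd E b D]) w2"
    using assms(1,2) by (rule common_source)
  obtain u' E' e c where u': "zz C u' E'" "cmap E' e E" "cmap E' c D"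
    "zeq C E (u' @ [Fwd E' e E]) u" "zeq C D (u' @ [Fwd E' c D]) w3"
    using u(1) assms(3) by (rule common_source)
  let ?a = "comp_map E' a e" and ?b = "comp_map E' b e"
  note m = cmap_comp[OF u'(2) u(2)] cmap_comp[OF u'(2) u(3)] u'(3)
  have k: "zeq C D (u' @ [Fwd E' (comp_map E' x e) D]) w"
    if x: "cmap E x D" and w: "zeq C D (u @ [Fwd E x D]) w" for x w
  proof -
    have "zeq C D (u' @ [Fwd E' (comp_map E' x e) D]) (u' @ [Fwd E' e E] @ [Fwd E x D])"
      by (rule zeq_pre[OF u'(1) zigzag_eq.sym[OF zeq_Fwd_Fwd[OF u'(2) x HOL.refl]]])
    also have "zeq C D \<dots> (u @ [Fwd E x D])" using zeq_post[OF u'(4) zz_Fwd[OF x]] by simp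
    also note w
    finally show ?thesis .
  qed
  note K = k[OF u(2,4)] k[OF u(3,5)] u'(5)
  have S: "zeq C D (zadd C D v w) (u' @ [Fwd E' (add_map E' D x y) D])"
    if "zeq C D (u' @ [Fwd E' x D]) v" "zeq C D (u' @ [Fwd E' y D]) w" "cmap E' x D" "cmap E' y D" for v w x y
    using zadd_cong[OF zigzag_eq.sym[OF that(1)] zigzag_eq.sym[OF that(2)]]
      zadd_common[OF u'(1) that(3,4)] by (rule zigzag_eq.trans)
  have eq: "add_map E' D (add_map E' D ?a ?b) c = add_map E' D ?a (add_map E' D ?b c)"
    by (rule cmap_eqI[OF cmap_add[OF cmap_add[OF m(1,2)] m(3)] cmap_add[OF m(1) cmap_add[OF m(2,3)]]])
      (use cmapD(2,4)[OF u(2)] cmapD(4)[OF u(3)] cmapD(4)[OF u'(2)] cmapD(4)[OF u'(3)]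
        in \<open>simp add: kmod_grp(1)\<close>)
  have "zeq C D (zadd C D (zadd C D w1 w2) w3) (u' @ [Fwd E' (add_map E' D (add_map E' D ?a ?b) c) D])"
    by (rule S[OF zigzag_eq.sym[OF S[OF K(1,2) m(1,2)]] K(3) cmap_add[OF m(1,2)] m(3)])
  also have "zeq C D \<dots> (zadd C D w1 (zadd C D w2 w3))"
    unfolding eq
    by (rule zigzag_eq.sym[OF S[OF K(1) zigzag_eq.sym[OF S[OF K(2,3) m(2,3)]] m(1) cmap_add[OF m(2,3)]]])
  finally show ?thesis .
qed

text \<open>The zigzag \<open>w\<close> serves as its own common part: the zero morphism is
  \<open>w\<close> followed by the zero map of \<open>D\<close>, and \<open>w\<close> is
  \<open>w\<close> followed by the identity.\<close>

lemma zadd_zero: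
  assumes "zz C w D" shows "zeq C D (zadd C D [Fwd C (zero_map C D) D] w) w"
proof -
  note c = zz_cpx[OF assms]
  have z: "cmap D (zero_map D D) D" "cmap D (id_map D) D" using c by (auto intro: cmap_zero cmap_id)
  have i: "zeq C D (w @ [Fwd D (id_map D) D]) w"
    using zeq_pre[OF assms zeq_id[OF c(2)]] by simp
  have e: "add_map D D (zero_map D D) (id_map D) = id_map D"
    by (rule cmap_eqI[OF cmap_add[OF z] z(2)]) (use c in simp)
  have "zeq C D (zadd C D [Fwd C (zero_map C D) D] w)
      (zadd C D (w @ [Fwd D (zero_map D D) D]) (w @ [Fwd D (id_map D) D]))"
    by (rule zadd_cong[OF zigzag_eq.sym[OF zeq_zero_right[OF assms c(2)]] zigzag_eq.sym[OF i]])
  also have "zeq C D \<dots> (w @ [Fwd D (id_map D) D])"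
    using zadd_common[OF assms z] by (simp add: e)
  also note i
  finally show ?thesis .
qed

text \<open>Over a common source the claim becomes compatibility of shifts with
  \<open>add_map\<close>, so shifted biproducts are never compared with biproducts of
  shifts.\<close>

lemma zadd_shift:
  assumes "zz C v D" "zz C w D"
  shows "zeq (shift n C) (shift n D) (map (shift_arrow n) (zadd C D v w))
    (zadd (shift n C) (shift n D) (map (shift_arrow n) v) (map (shift_arrow n) w))"
proof -
  obtain u E a b where u: "zz C u E" "cmap E a D" "cmap E b D"
    "zeq C D (u @ [Fwd E a D]) v" "zeq C D (u @ [Fwd E b D]) w"
    using assms by (rule common_source)
  have S: "zeq (shift n C) (shift n D) (map (shift_arrow n) x) (map (shift_arrow n) y)"
    if "zeq C D x y" for x y
    using functor_zeq[OF functor_shift that] by (simp add: map_arrow_shift)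
  have su: "zz (shift n C) (map (shift_arrow n) u) (shift n E)"
    using functor_zz[OF functor_shift u(1)] by (simp add: map_arrow_shift)
  have e: "shift_map n (add_map E D a b) = add_map (shift n E) (shift n D) (shift_map n a) (shift_map n b)"
    by (simp add: shift_map_def add_map_def restrict_def)
  have "zeq C D (zadd C D v w) (zadd C D (u @ [Fwd E a D]) (u @ [Fwd E b D]))"
    using u by (intro zadd_cong) (auto intro: zigzag_eq.sym)
  also have "zeq C D \<dots> (u @ [Fwd E (add_map E D a b) D])" by (rule zadd_common[OF u(1-3)])
  finally have "zeq (shift n C) (shift n D) (map (shift_arrow n) (zadd C D v w))
      (map (shift_arrow n) u @ [Fwd (shift n E) (shift_map n (add_map E D a b)) (shift n D)])"
    using S by fastforce
  also have "zeq (shift n C) (shift n D) \<dots>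
      (zadd (shift n C) (shift n D) (map (shift_arrow n) u @ [Fwd (shift n E) (shift_map n a) (shift n D)])
        (map (shift_arrow n) u @ [Fwd (shift n E) (shift_map n b) (shift n D)]))"
    unfolding e by (rule zigzag_eq.sym[OF zadd_common[OF su cmap_shift[OF u(2)] cmap_shift[OF u(3)]]])
  also have "zeq (shift n C) (shift n D) \<dots>
      (zadd (shift n C) (shift n D) (map (shift_arrow n) v) (map (shift_arrow n) w))"
    using zadd_cong[OF S[OF u(4)] S[OF u(5)]] by simp
  finally show ?thesis .
qed

section \<open>The linear structure of Ext\<close>

text \<open>The definite description needs two facts: \<open>common_source\<close> provides a common
  denominator, and by \<open>zadd_common\<close> every admissible choice of one yields the class of
  \<open>zadd\<close>.\<close>

lemma der_add_class:
  assumes v: "zz C v D" and w: "zz C w D"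
  shows "der_add G R C D (der_class G R C D v) (der_class G R C D w) = der_class G R C D (zadd C D v w)"
  unfolding der_add_def
proof (rule the_equality)
  obtain u E f h where u: "zz C u E" "cmap E f D" "cmap E h D"
    "zeq C D (u @ [Fwd E f D]) v" "zeq C D (u @ [Fwd E h D]) w"
    using assms by (rule common_source)
  have cm: "der_comp G R C D (der_of_map G R E x D) (der_class G R C E u)
      = der_class G R C D (u @ [Fwd E x D])" if "zz C u E" "cmap E x D" for u E x
    unfolding der_of_map_def by (rule der_comp_class[OF that(1) zz_Fwd[OF that(2)]])
  have sm: "zeq C D (zadd C D v w) (u @ [Fwd E (add_map E D f h) D])"
    if "zz C u E" "cmap E f D" "cmap E h D"
      "zeq C D v (u @ [Fwd E f D])" "zeq C D w (u @ [Fwd E h D])" for u E f h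
    using zadd_cong[OF that(4,5)] zadd_common[OF that(1-3)] by (rule zigzag_eq.trans)
  show "\<exists>E u f g. u \<in> der_hom G R C E \<and> cmap E f D \<and> cmap E g D \<and>
     der_class G R C D v = der_comp G R C D (der_of_map G R E f D) u \<and>
     der_class G R C D w = der_comp G R C D (der_of_map G R E g D) u \<and>
     der_class G R C D (zadd C D v w) = der_comp G R C D (der_of_map G R E (add_map E D f g) D) u"
  proof (intro exI conjI)
    show "der_class G R C E u \<in> der_hom G R C E" using u(1) by (simp add: der_hom_def)
    show "der_class G R C D v = der_comp G R C D (der_of_map G R E f D) (der_class G R C E u)"
      unfolding cm[OF u(1,2)] by (rule der_class_eqI[OF zigzag_eq.sym[OF u(4)]])
    show "der_class G R C D w = der_comp G R C D (der_of_map G R E h D) (der_class G R C E u)"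
      unfolding cm[OF u(1,3)] by (rule der_class_eqI[OF zigzag_eq.sym[OF u(5)]])
    show "der_class G R C D (zadd C D v w)
        = der_comp G R C D (der_of_map G R E (add_map E D f h) D) (der_class G R C E u)"
      unfolding cm[OF u(1) cmap_add[OF u(2,3)]]
      by (rule der_class_eqI[OF sm[OF u(1-3) zigzag_eq.sym[OF u(4)] zigzag_eq.sym[OF u(5)]]])
  qed (rule u)+
  show "Z = der_class G R C D (zadd C D v w)"
    if Z: "\<exists>E u f g. u \<in> der_hom G R C E \<and> cmap E f D \<and> cmap E g D \<and>
     der_class G R C D v = der_comp G R C D (der_of_map G R E f D) u \<and>
     der_class G R C D w = der_comp G R C D (der_of_map G R E g D) u \<and>
     Z = der_comp G R C D (der_of_map G R E (add_map E D f g) D) u" for Z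
  proof -
    obtain E u f g where u: "zz C u E" "cmap E f D" "cmap E g D"
      "der_class G R C D v = der_comp G R C D (der_of_map G R E f D) (der_class G R C E u)"
      "der_class G R C D w = der_comp G R C D (der_of_map G R E g D) (der_class G R C E u)"
      "Z = der_comp G R C D (der_of_map G R E (add_map E D f g) D) (der_class G R C E u)"
      using Z unfolding der_hom_def by blast
    have "zeq C D v (u @ [Fwd E f D])" "zeq C D w (u @ [Fwd E g D])"
      using u(4,5) v w by (simp_all add: cm[OF u(1,2)] cm[OF u(1,3)] der_class_eq)
    from der_class_eqI[OF sm[OF u(1-3) this]] show ?thesis
      using u(6) cm[OF u(1) cmap_add[OF u(2,3)]] by simp
  qed
qed

section \<open>Module operations and cup product of Ext on representatives\<close>

lemma Ext_simps:
  "carrier (Ext G R C D n) = der_hom G R C (shift n D)"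
  "\<zero>\<^bsub>Ext G R C D n\<^esub> = der_class G R C (shift n D) [Fwd C (zero_map C (shift n D)) (shift n D)]"
  "add (Ext G R C D n) = der_add G R C (shift n D)"
  by (simp_all add: Ext_def der_of_map_def)

lemma Ext_smult:
  assumes "zz C w (shift n D)" "r \<in> carrier R"
  shows "r \<odot>\<^bsub>Ext G R C D n\<^esub> der_class G R C (shift n D) w
    = der_class G R C (shift n D) (w @ [Fwd (shift n D) (scalar_map r (shift n D)) (shift n D)])"
  using der_comp_class[OF assms(1) zz_Fwd[OF cmap_scalar[OF zz_cpx(2)[OF assms(1)] assms(2)]]]
  by (simp add: Ext_def der_of_map_def)

lemma der_homE:
  assumes "X \<in> der_hom G R C D" obtains w where "zz C w D" "X = der_class G R C D w"
  using assms by (auto simp: der_hom_def)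

lemma der_homI: "zz C w D \<Longrightarrow> der_class G R C D w \<in> der_hom G R C D"
  by (simp add: der_hom_def)

lemma abelian_monoid_Ext:
  fixes C D :: "('k, 'g, 'u) cochain_complex"
  assumes "cpx C" "cpx D" shows "abelian_monoid (Ext G R C D n)"
proof (rule abelian_monoidI, unfold Ext_simps)
  have zz0: "zz C [Fwd C (zero_map C (shift n D)) (shift n D)] (shift n D)"
    using assms by (intro zz_Fwd cmap_zero cpx_shift)
  then show "der_class G R C (shift n D) [Fwd C (zero_map C (shift n D)) (shift n D)]
      \<in> der_hom G R C (shift n D)" by (rule der_homI)
  fix X Y Z assume X: "X \<in> der_hom G R C (shift n D)"
  then obtain x where x: "zz C x (shift n D)" "X = der_class G R C (shift n D) x" by (rule der_homE)
  show "der_add G R C (shift n D) (der_class G R C (shift n D) [Fwd C (zero_map C (shift n D)) (shift n D)]) X = X"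
    unfolding x(2) der_add_class[OF zz0 x(1)] by (rule der_class_eqI[OF zadd_zero[OF x(1)]])
  assume "Y \<in> der_hom G R C (shift n D)"
  then obtain y where y: "zz C y (shift n D)" "Y = der_class G R C (shift n D) y" by (rule der_homE)
  show "der_add G R C (shift n D) X Y \<in> der_hom G R C (shift n D)"
    unfolding x(2) y(2) der_add_class[OF x(1) y(1)] by (rule der_homI[OF zz_zadd[OF x(1) y(1)]])
  show "der_add G R C (shift n D) X Y = der_add G R C (shift n D) Y X"
    unfolding x(2) y(2) der_add_class[OF x(1) y(1)] der_add_class[OF y(1) x(1)]
    by (rule der_class_eqI[OF zadd_comm[OF x(1) y(1)]])
  assume "Z \<in> der_hom G R C (shift n D)"
  then obtain z where z: "zz C z (shift n D)" "Z = der_class G R C (shift n D) z" by (rule der_homE)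
  show "der_add G R C (shift n D) (der_add G R C (shift n D) X Y) Z
      = der_add G R C (shift n D) X (der_add G R C (shift n D) Y Z)"
    unfolding x(2) y(2) z(2) der_add_class[OF x(1) y(1)] der_add_class[OF y(1) z(1)]
      der_add_class[OF zz_zadd[OF x(1) y(1)] z(1)] der_add_class[OF x(1) zz_zadd[OF y(1) z(1)]]
    by (rule der_class_eqI[OF zadd_assoc[OF x(1) y(1) z(1)]])
qed

lemma zz_shift: "zz C w D \<Longrightarrow> zz (shift n C) (map (shift_arrow n) w) (shift n D)"
  using functor_zz[OF functor_shift] by (simp add: map_arrow_shift)

lemma ext_cup_class:
  assumes "cpx C" "zz B x (shift p C)" "zz A y (shift q B)"
  shows "ext_cup G R A B C p q (der_class G R B (shift p C) x) (der_class G R A (shift q B) y)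
    = der_class G R A (shift (p + q) C) (y @ map (shift_arrow q) x)"
  unfolding ext_cup_def der_shift_class[OF assms(2)]
  unfolding der_comp_class[OF assms(3) zz_shift[OF assms(2)]]
  unfolding shift_shift[OF assms(1)] by (rule HOL.refl)

text \<open>The first argument is shifted and stands last in the zigzag, so additivity in it uses
  \<open>zadd_shift\<close> and \<open>zadd_pre\<close>; additivity in the second uses
  \<open>zadd_post\<close>. Balancedness holds because scalars slide through zigzags.\<close>

lemma bilinear_ext_cup:
  fixes A B C :: "('k, 'g, 'u) cochain_complex"
  assumes A: "cpx A" and B: "cpx B" and C: "cpx C"
  shows "tensor_bilinear R (Ext G R B C p) (Ext G R A B q) (Ext G R A C (p + q)) (ext_cup G R A B C p q)"
  unfolding tensor_bilinear_def Ext_simps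
proof (intro conjI ballI)
  note ss = shift_shift[OF C, of q p]
  note sC = cpx_shift[OF C]
  let ?S = "map (shift_arrow q)"
  have S: "zz (shift q B) (?S x) (shift (p + q) C)" if "zz B x (shift p C)" for x
    using zz_shift[OF that] ss by metis
  fix X Y assume X: "X \<in> der_hom G R B (shift p C)" and Y: "Y \<in> der_hom G R A (shift q B)"
  obtain x where x: "zz B x (shift p C)" "X = der_class G R B (shift p C) x" using X by (rule der_homE)
  obtain y where y: "zz A y (shift q B)" "Y = der_class G R A (shift q B) y" using Y by (rule der_homE)
  have yx: "zz A (y @ ?S x) (shift (p + q) C)" by (rule zz_append[OF y(1) S[OF x(1)]])
  show "ext_cup G R A B C p q X Y \<in> der_hom G R A (shift (p + q) C)"
    unfolding x(2) y(2) ext_cup_class[OF C x(1) y(1)] by (rule der_homI[OF yx])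
  { fix X' assume "X' \<in> der_hom G R B (shift p C)"
    then obtain x' where x': "zz B x' (shift p C)" "X' = der_class G R B (shift p C) x'" by (rule der_homE)
    have yx': "zz A (y @ ?S x') (shift (p + q) C)" by (rule zz_append[OF y(1) S[OF x'(1)]])
    have "zeq A (shift (p + q) C) (y @ ?S (zadd B (shift p C) x x'))
        (y @ zadd (shift q B) (shift (p + q) C) (?S x) (?S x'))"
      using zeq_pre[OF y(1) zadd_shift[OF x(1) x'(1), of q]] by (simp only: ss)
    also have "zeq A (shift (p + q) C) \<dots> (zadd A (shift (p + q) C) (y @ ?S x) (y @ ?S x'))"
      by (rule zigzag_eq.sym[OF zadd_pre[OF y(1) S[OF x(1)] S[OF x'(1)]]])
    finally show "ext_cup G R A B C p q (der_add G R B (shift p C) X X') Y =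
        der_add G R A (shift (p + q) C) (ext_cup G R A B C p q X Y) (ext_cup G R A B C p q X' Y)"
      unfolding x(2) x'(2) y(2) der_add_class[OF x(1) x'(1)] ext_cup_class[OF C zz_zadd[OF x(1) x'(1)] y(1)]
        ext_cup_class[OF C x(1) y(1)] ext_cup_class[OF C x'(1) y(1)] der_add_class[OF yx yx']
      by (rule der_class_eqI) }
  { fix Y' assume "Y' \<in> der_hom G R A (shift q B)"
    then obtain y' where y': "zz A y' (shift q B)" "Y' = der_class G R A (shift q B) y'" by (rule der_homE)
    have y'x: "zz A (y' @ ?S x) (shift (p + q) C)" by (rule zz_append[OF y'(1) S[OF x(1)]])
    show "ext_cup G R A B C p q X (der_add G R A (shift q B) Y Y') =
        der_add G R A (shift (p + q) C) (ext_cup G R A B C p q X Y) (ext_cup G R A B C p q X Y')"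
      unfolding x(2) y(2) y'(2) der_add_class[OF y(1) y'(1)] ext_cup_class[OF C x(1) zz_zadd[OF y(1) y'(1)]]
        ext_cup_class[OF C x(1) y(1)] ext_cup_class[OF C x(1) y'(1)] der_add_class[OF yx y'x]
      by (rule der_class_eqI[OF zadd_post[OF S[OF x(1)] y(1) y'(1)]]) }
  { fix r assume r: "r \<in> carrier R"
    let ?r = "\<lambda>D. [Fwd D (scalar_map r D) D]"
    have sr: "zz D (?r D) D" if "cpx D" for D by (rule zz_Fwd[OF cmap_scalar[OF that r]])
    have xr: "zz B (x @ ?r (shift p C)) (shift p C)" by (rule zz_append[OF x(1) sr[OF sC]])
    have yr: "zz A (y @ ?r (shift q B)) (shift q B)" by (rule zz_append[OF y(1) sr[OF cpx_shift[OF B]]])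
    \<comment> \<open>A shift turns multiplication by \<open>r\<close> into multiplication by
      \<open>r\<close> on the shifted complex, without a sign.\<close>
    have e: "?S (x @ ?r (shift p C)) = ?S x @ ?r (shift (p + q) C)"
      by (simp add: ss) (simp add: scalar_map_def shift_map_def restrict_def add.assoc)
    have "zeq A (shift (p + q) C) (y @ ?S (x @ ?r (shift p C))) ((y @ ?r (shift q B)) @ ?S x)"
      unfolding e append_assoc by (rule zeq_pre[OF y(1) zeq_scalar[OF S[OF x(1)] r]])
    then show "ext_cup G R A B C p q (r \<odot>\<^bsub>Ext G R B C p\<^esub> X) Y
        = ext_cup G R A B C p q X (r \<odot>\<^bsub>Ext G R A B q\<^esub> Y)"
      unfolding x(2) y(2) Ext_smult[OF x(1) r] Ext_smult[OF y(1) r]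
        ext_cup_class[OF C xr y(1)] ext_cup_class[OF C x(1) yr] by (rule der_class_eqI)
    show "ext_cup G R A B C p q (r \<odot>\<^bsub>Ext G R B C p\<^esub> X) Y \<in> der_hom G R A (shift (p + q) C)"
      unfolding x(2) y(2) Ext_smult[OF x(1) r] ext_cup_class[OF C xr y(1)]
      by (rule der_homI[OF zz_append[OF y(1) S[OF xr]]]) }
next
  note ss = shift_shift[OF C, of q p]
  fix Y assume "Y \<in> der_hom G R A (shift q B)"
  then obtain y where y: "zz A y (shift q B)" "Y = der_class G R A (shift q B) y" by (rule der_homE)
  have z: "zz B [Fwd B (zero_map B (shift p C)) (shift p C)] (shift p C)"
    using B C by (intro zz_Fwd cmap_zero cpx_shift)
  have e: "map (shift_arrow q) [Fwd B (zero_map B (shift p C)) (shift p C)]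
      = [Fwd (shift q B) (zero_map (shift q B) (shift (p + q) C)) (shift (p + q) C)]"
    by (simp add: ss) (simp add: zero_map_def shift_map_def restrict_def add.assoc)
  show "ext_cup G R A B C p q (der_class G R B (shift p C) [Fwd B (zero_map B (shift p C)) (shift p C)]) Y
      = der_class G R A (shift (p + q) C) [Fwd A (zero_map A (shift (p + q) C)) (shift (p + q) C)]"
    unfolding y(2) ext_cup_class[OF C z y(1)] e
    by (rule der_class_eqI[OF zeq_zero_right[OF y(1) cpx_shift[OF C]]])
qed

section \<open>Homotopic maps are equal in the derived category\<close>

text \<open>
  A chain map into the path complex of \<open>D\<close> is a pair of chain maps into \<open>D\<close> with a homotopy between
  them; the two projections agree in the derived category because both are left inverse to \<open>path_const\<close>.
\<close>

definition path_complex :: "('k, 'g, 'u) cochain_complex \<Rightarrow> ('k, 'g, 'u) cochain_complex" where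
  "path_complex D =
     \<lparr>ob = (\<lambda>i. bimod (ob D i) (bimod (ob D i) (ob D (i - 1)))),
      diff = (\<lambda>i. \<lambda>x\<in>carrier (bimod (ob D i) (bimod (ob D i) (ob D (i - 1)))).
        pair (diff D i (p1 x)) (pair (diff D i (p1 (p2 x)))
          (p1 x \<ominus>\<^bsub>ob D i\<^esub> p1 (p2 x) \<ominus>\<^bsub>ob D i\<^esub> diff D (i - 1) (p2 (p2 x)))))\<rparr>"

lemma ob_path [simp]: "ob (path_complex D) i = bimod (ob D i) (bimod (ob D i) (ob D (i - 1)))"
  by (simp add: path_complex_def)

lemma diff_path [simp]:
  "a \<in> carrier (ob D i) \<Longrightarrow> b \<in> carrier (ob D i) \<Longrightarrow> c \<in> carrier (ob D (i - 1)) \<Longrightarrow>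
    diff (path_complex D) i (pair a (pair b c)) =
    pair (diff D i a) (pair (diff D i b) (a \<ominus>\<^bsub>ob D i\<^esub> b \<ominus>\<^bsub>ob D i\<^esub> diff D (i - 1) c))"
  by (simp add: path_complex_def)

lemma pathE:
  assumes "x \<in> carrier (ob (path_complex D) i)"
  obtains a b c where "x = pair a (pair b c)" "a \<in> carrier (ob D i)" "b \<in> carrier (ob D i)"
    "c \<in> carrier (ob D (i - 1))"
  using assms by (auto elim!: bimodE)

text \<open>The third component of the squared differential at (a, b, c) is da - db - d(a - b - dc).
  It vanishes because a and b enter both the inner and the outer difference and ddc = 0.\<close>

lemma cpx_path:
  assumes "cpx D" shows "cpx (path_complex D)"
proof (rule cpxI)
  note d = cpx_diff_linear[OF assms]
  note d' = cpx_diff_linear[OF assms, where i = "i - 1" for i, simplified]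
  show "kmod (ob (path_complex D) i)" for i using assms by (simp add: kmod_bimod)
  show "diff (path_complex D) i \<in> khom (ob (path_complex D) i) (ob (path_complex D) (i + 1))" for i
  proof (rule khomI)
    show "diff (path_complex D) i x = undefined" if "x \<notin> carrier (ob (path_complex D) i)" for x
      using that by (simp add: path_complex_def)
  qed (use assms in \<open>auto elim!: pathE simp del: ob_path,
      auto simp: d d' kmod_grp kmod_smult kmod_act kmod_act_zero_minus\<close>)
  show "diff (path_complex D) (i + 1) (diff (path_complex D) i x) = \<zero>\<^bsub>ob (path_complex D) (i + 2)\<^esub>"
    if "x \<in> carrier (ob (path_complex D) i)" for i x
    using that assms cpx_diff_diff[OF assms, of _ "i - 1" i]
    by (auto elim!: pathE simp del: ob_path) (auto simp: d kmod_diff_zero add.commute)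
qed

definition path_const :: "('k, 'g, 'u) cochain_complex \<Rightarrow> int \<Rightarrow> 'u \<Rightarrow> 'u" where
  "path_const D = (\<lambda>i. \<lambda>x\<in>carrier (ob D i). pair x (pair x \<zero>\<^bsub>ob D (i - 1)\<^esub>))"

text \<open>A cocycle (a, b, c) satisfies a - b = dc, so it differs from the constant path at b by
  (dc, 0, c), the differential of (c, 0, 0). If a constant path is exact, its first component shows
  that the underlying element is exact.\<close>

lemma qi_path_const:
  assumes "cpx D" shows "qi D (path_const D) (path_complex D)"
  unfolding quasi_iso_iff
proof (intro conjI allI ballI impI)
  have z: "diff D (i - 1) \<zero>\<^bsub>ob D (i - 1)\<^esub> = \<zero>\<^bsub>ob D i\<^esub>" for i
    using cpx_diff_zero[OF assms, of "i - 1"] by simp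
  show "cmap D (path_const D) (path_complex D)"
  proof (rule cmapI)
    show "path_const D i \<in> khom (ob D i) (ob (path_complex D) i)" for i
      using assms by (intro khomI) (auto simp: path_const_def kmod_smult kmod_act_zero_minus)
    show "path_const D (i + 1) (diff D i x) = diff (path_complex D) i (path_const D i x)"
      if "x \<in> carrier (ob D i)" for i x
      using that assms by (simp add: path_const_def z)
  qed (use assms cpx_path in auto)
  fix n
  show "x \<in> coboundaries D n"
    if x0: "x \<in> cocycles D n" "path_const D n x \<in> coboundaries (path_complex D) n" for x
  proof -
    have x: "x \<in> carrier (ob D n)" using x0(1) by (simp add: cocycles_def)
    obtain y where "y \<in> carrier (ob (path_complex D) (n - 1))"
      "path_const D n x = diff (path_complex D) (n - 1) y"
      using x0(2) unfolding mem_coboundaries by blast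
    then show ?thesis using x
      by (auto elim!: pathE simp del: ob_path) (auto simp: path_const_def mem_coboundaries)
  qed
  show "\<exists>x\<in>cocycles D n. y \<ominus>\<^bsub>ob (path_complex D) n\<^esub> path_const D n x \<in> coboundaries (path_complex D) n"
    if y: "y \<in> cocycles (path_complex D) n" for y
  proof -
    obtain a b c where abc: "y = pair a (pair b c)" "a \<in> carrier (ob D n)" "b \<in> carrier (ob D n)"
      "c \<in> carrier (ob D (n - 1))" using y by (auto simp: cocycles_def elim!: bimodE)
    have k: "kmod (ob D i)" for i using assms by simp
    have d: "diff D (n - 1) c \<in> carrier (ob D n)" using abc assms by simp
    have e: "diff D n b = \<zero>\<^bsub>ob D (n + 1)\<^esub>" "a \<ominus>\<^bsub>ob D n\<^esub> b \<ominus>\<^bsub>ob D n\<^esub> diff D (n - 1) c = \<zero>\<^bsub>ob D n\<^esub>"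
      using y abc by (simp_all add: cocycles_def)
    have ab: "a \<ominus>\<^bsub>ob D n\<^esub> b = diff D (n - 1) c"
      using e(2) d abc k[of n] by (simp add: kmod_diff_zero)
    \<comment> \<open>The entry \<open>c\<close> has degree \<open>n - 1\<close>, which is the
      degree of this path; its last entry therefore lies in degree \<open>n - 2\<close>.\<close>
    let ?z = "pair c (pair \<zero>\<^bsub>ob D (n - 1)\<^esub> \<zero>\<^bsub>ob D (n - 2)\<^esub>)"
    have zz: "diff D (n - 2) \<zero>\<^bsub>ob D (n - 2)\<^esub> = \<zero>\<^bsub>ob D (n - 1)\<^esub>"
      using z[of "n - 1"] by (simp add: algebra_simps)
    have "y \<ominus>\<^bsub>ob (path_complex D) n\<^esub> path_const D n b = diff (path_complex D) (n - 1) ?z"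
      using abc ab k by (simp add: path_const_def kmod_bimod z zz)
    moreover have "?z \<in> carrier (ob (path_complex D) (n - 1))" using abc k by simp
    ultimately have "y \<ominus>\<^bsub>ob (path_complex D) n\<^esub> path_const D n b \<in> coboundaries (path_complex D) n"
      unfolding mem_coboundaries by blast
    then show ?thesis using e abc by (intro bexI[of _ b]) (simp_all add: cocycles_def)
  qed
qed

text \<open>The homotopy becomes the third component of a chain map \<open>H\<close> into the path
  complex: compatibility with the differentials is the homotopy equation solved for
  \<open>h (i + 1) (diff C i x)\<close>. The ends \<open>q\<close> and \<open>q'\<close> are
  identified by cancelling \<open>path_const\<close>.\<close>

lemma zeq_homotopic:
  fixes C D :: "('k, 'g, 'u) cochain_complex"
  assumes "homotopic G R C D f g"
  shows "zeq C D [Fwd C f D] [Fwd C g D]"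
proof -
  have f: "cmap C f D" "cmap C g D" using assms by (auto simp: homotopic_def)
  note c = cmapD[OF f(1)] and c' = cmapD[OF f(2)]
  obtain h where h: "\<And>i. h i \<in> khom (ob C i) (ob D (i - 1))"
      "\<And>i x. x \<in> carrier (ob C i) \<Longrightarrow>
        f i x \<ominus>\<^bsub>ob D i\<^esub> g i x = diff D (i - 1) (h i x) \<oplus>\<^bsub>ob D i\<^esub> h (i + 1) (diff C i x)"
    using assms unfolding homotopic_def by metis
  let ?P = "path_complex D"
  define H where "H = (\<lambda>i. \<lambda>x\<in>carrier (ob C i). pair (f i x) (pair (g i x) (h i x)))"
  define q where "q = (\<lambda>i. \<lambda>x\<in>carrier (ob ?P i). p1 x)"
  define q' where "q' = (\<lambda>i. \<lambda>x\<in>carrier (ob ?P i). p1 (p2 x))"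
  note P = cpx_path[OF c(2)]
  have hc: "h (i + 1) (diff C i x) \<in> carrier (ob D i)" if "x \<in> carrier (ob C i)" for i x
    using that c(1) khomD(1)[OF h(1), of "diff C i x" "i + 1"] by simp
  have H: "cmap C H ?P"
  proof (rule cmapI[OF c(1) P])
    show "H i \<in> khom (ob C i) (ob ?P i)" for i
      using c(4,5,7,11) c'(4,5,7,11) khomD[OF h(1)] c(1) by (intro khomI) (auto simp: H_def)
    show "H (i + 1) (diff C i x) = diff ?P i (H i x)" if "x \<in> carrier (ob C i)" for i x
    proof -
      have dh: "diff D (i - 1) (h i x) \<in> carrier (ob D i)"
        using that c(2) khomD(1)[OF h(1)] by simp
      have "f i x \<ominus>\<^bsub>ob D i\<^esub> g i x \<ominus>\<^bsub>ob D i\<^esub> diff D (i - 1) (h i x) = h (i + 1) (diff C i x)"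
        unfolding h(2)[OF that] using c(2) dh hc[OF that] by (simp add: kmod_grp kmod_cancel)
      then show ?thesis
        using that c(1,4,10) c'(4,10) khomD(1)[OF h(1)] by (simp add: H_def)
    qed
  qed
  have q: "cmap ?P q D" "cmap ?P q' D"
    using P c(2) by (auto intro!: cmapI khomI elim!: bimodE simp: q_def q'_def)
  note s = qi_path_const[OF c(2)]
  note ks = qi_cmap[OF s]
  have e: "comp_map C q H = f" "comp_map C q' H = g"
    by (rule cmap_eqI[OF cmap_comp[OF H q(1)] f(1)] cmap_eqI[OF cmap_comp[OF H q(2)] f(2)],
        use c(4) c'(4) khomD(1)[OF h(1)] in \<open>simp add: H_def q_def q'_def\<close>)+
  have sq: "comp_map D q (path_const D) = id_map D" "comp_map D q' (path_const D) = id_map D"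
    by (rule cmap_eqI[OF cmap_comp[OF ks q(1)] cmap_id[OF c(2)]] cmap_eqI[OF cmap_comp[OF ks q(2)] cmap_id[OF c(2)]],
        use c(2) in \<open>simp add: path_const_def q_def q'_def\<close>)+
  have "zeq D D ([Fwd D (path_const D) ?P] @ [Fwd ?P q D]) ([Fwd D (path_const D) ?P] @ [Fwd ?P q' D])"
    using zeq_Fwd_Fwd[OF ks q(1) sq(1)] zigzag_eq.sym[OF zeq_Fwd_Fwd[OF ks q(2) sq(2)]]
    by (rule zigzag_eq.trans)
  from zeq_cancel_left[OF s zz_Fwd[OF q(1)] zz_Fwd[OF q(2)] this]
  have qq: "zeq ?P D [Fwd ?P q D] [Fwd ?P q' D]" .
  have "zeq C D [Fwd C f D] ([Fwd C H ?P] @ [Fwd ?P q D])"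
    by (rule zigzag_eq.sym[OF zeq_Fwd_Fwd[OF H q(1) e(1)]])
  also have "zeq C D \<dots> ([Fwd C H ?P] @ [Fwd ?P q' D])" by (rule zeq_pre[OF zz_Fwd[OF H] qq])
  also have "zeq C D \<dots> [Fwd C g D]" by (rule zeq_Fwd_Fwd[OF H q(2) e(2)])
  finally show ?thesis .
qed


section \<open>Transport\<close>

lemma transport_simps [simp]:
  assumes "inj j"
  shows "carrier (transport j M) = j ` carrier M"
    and "\<zero>\<^bsub>transport j M\<^esub> = j \<zero>\<^bsub>M\<^esub>"
    and "x \<in> carrier M \<Longrightarrow> y \<in> carrier M \<Longrightarrow> j x \<oplus>\<^bsub>transport j M\<^esub> j y = j (x \<oplus>\<^bsub>M\<^esub> y)"
    and "x \<in> carrier M \<Longrightarrow> r \<odot>\<^bsub>transport j M\<^esub> j x = j (r \<odot>\<^bsub>M\<^esub> x)"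
    and "x \<in> carrier M \<Longrightarrow> act (transport j M) g (j x) = j (act M g x)"
  using inj_on_subset[OF assms subset_UNIV, of "carrier M"]
  by (simp_all add: transport_def Let_def)

lemma kmod_transport:
  assumes "inj j" "kmod M" shows "kmod (transport j M)"
proof (rule kmodI)
  show "\<exists>y\<in>carrier (transport j M). y \<oplus>\<^bsub>transport j M\<^esub> x = \<zero>\<^bsub>transport j M\<^esub>"
    if "x \<in> carrier (transport j M)" for x
  proof -
    have "x \<in> j ` carrier M" using that assms(1) by simp
    then obtain y where "x = j y" "y \<in> carrier M" by blast
    then show ?thesis using assms by (intro bexI[of _ "j (\<ominus>\<^bsub>M\<^esub> y)"]) simp_all
  qed
qed (use assms in \<open>auto simp: kmod_grp(1-3) kmod_smult kmod_act\<close>)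

lemma transport_minus [simp]:
  assumes "inj j" "kmod M" "x \<in> carrier M" shows "\<ominus>\<^bsub>transport j M\<^esub> j x = j (\<ominus>\<^bsub>M\<^esub> x)"
  using assms by (intro kmod_minus_unique kmod_transport) auto

lemma transport_diff [simp]:
  assumes "inj j" "kmod M" "x \<in> carrier M" "y \<in> carrier M"
  shows "j x \<ominus>\<^bsub>transport j M\<^esub> j y = j (x \<ominus>\<^bsub>M\<^esub> y)"
  using assms by (simp add: kmod_grp(7) kmod_transport)

lemma transport_fun_apply [simp]: "inj j \<Longrightarrow> x \<in> A \<Longrightarrow> transport_fun j l A f (j x) = l (f x)"
  using inj_on_subset[of j UNIV A] by (simp add: transport_fun_def)

lemma khom_transport:
  assumes "inj j" "inj l" "f \<in> khom M N" "kmod M"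
  shows "transport_fun j l (carrier M) f \<in> khom (transport j M) (transport l N)"
proof (rule khomI)
  show "transport_fun j l (carrier M) f x = undefined" if "x \<notin> carrier (transport j M)" for x
    using that assms by (simp add: transport_fun_def)
qed (use assms khomD[OF assms(3)] in auto)

lemma ob_transport [simp]: "ob (transport_complex j C) i = transport j (ob C i)"
  by (simp add: transport_complex_def)

lemma diff_transport [simp]:
  "inj j \<Longrightarrow> x \<in> carrier (ob C i) \<Longrightarrow> diff (transport_complex j C) i (j x) = j (diff C i x)"
  by (simp add: transport_complex_def)

lemma cpx_transport:
  assumes "inj j" "cpx C" shows "cpx (transport_complex j C)"
proof (rule cpxI)
  show "kmod (ob (transport_complex j C) i)" for i using assms by (simp add: kmod_transport)
  show "diff (transport_complex j C) i \<in> khom (ob (transport_complex j C) i) (ob (transport_complex j C) (i + 1))" for i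
    using khom_transport[OF assms(1,1) cpx_diff[OF assms(2)] cpx_kmod[OF assms(2)]]
    by (simp add: transport_complex_def)
  show "diff (transport_complex j C) (i + 1) (diff (transport_complex j C) i x)
      = \<zero>\<^bsub>ob (transport_complex j C) (i + 2)\<^esub>"
    if "x \<in> carrier (ob (transport_complex j C) i)" for i x
    using that assms by (auto simp: add.assoc)
qed

lemma transport_map_apply [simp]:
  "inj j \<Longrightarrow> x \<in> carrier (ob C i) \<Longrightarrow> transport_map j l C f i (j x) = l (f i x)"
  by (simp add: transport_map_def)

lemma cmap_transport:
  assumes "inj j" "inj l" "cmap C f D"
  shows "cmap (transport_complex j C) (transport_map j l C f) (transport_complex l D)"
proof (rule cmapI)
  note f = cmapD[OF assms(3)]
  show "cpx (transport_complex j C)" "cpx (transport_complex l D)"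
    using assms f by (auto intro: cpx_transport)
  show "transport_map j l C f i \<in> khom (ob (transport_complex j C) i) (ob (transport_complex l D) i)" for i
    using khom_transport[OF assms(1,2) f(3) cpx_kmod[OF f(1)]] by (simp add: transport_map_def)
  show "transport_map j l C f (i + 1) (diff (transport_complex j C) i x)
      = diff (transport_complex l D) i (transport_map j l C f i x)"
    if "x \<in> carrier (ob (transport_complex j C) i)" for i x
    using that assms f(1,2,4,10) by auto
qed

lemma transport_map_comp:
  assumes "inj j" "inj l" "inj m" "cmap A f B" "cmap B g C"
  shows "comp_map (transport_complex j A) (transport_map l m B g) (transport_map j l A f)
    = transport_map j m A (comp_map A g f)"
  by (rule cmap_eqI[OF cmap_comp[OF cmap_transport cmap_transport] cmap_transport[OF _ _ cmap_comp]])
    (use assms cmapD(4)[OF assms(4)] in auto)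

lemma transport_map_add:
  assumes "inj j" "inj l" "cmap A f B" "cmap A g B"
  shows "transport_map j l A (add_map A B f g)
    = add_map (transport_complex j A) (transport_complex l B) (transport_map j l A f) (transport_map j l A g)"
  by (rule cmap_eqI[OF cmap_transport[OF _ _ cmap_add] cmap_add[OF cmap_transport cmap_transport]])
    (use assms cmapD(4)[OF assms(3)] cmapD(4)[OF assms(4)] in auto)

lemma transport_map_zero:
  assumes "inj j" "inj l" "cpx A" "cpx B"
  shows "transport_map j l A (zero_map A B) = zero_map (transport_complex j A) (transport_complex l B)"
  by (rule cmap_eqI[OF cmap_transport[OF _ _ cmap_zero] cmap_zero[OF cpx_transport cpx_transport]])
    (use assms in auto)

lemma transport_map_scalar:
  assumes "inj j" "cpx A" "r \<in> carrier R"
  shows "transport_map j j A (scalar_map r A) = scalar_map r (transport_complex j A)"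
  by (rule cmap_eqI[OF cmap_transport[OF _ _ cmap_scalar] cmap_scalar[OF cpx_transport]])
    (use assms in auto)

lemma cocycles_transport:
  assumes "inj j" "cpx C" shows "cocycles (transport_complex j C) n = j ` cocycles C n"
  using assms by (auto simp: cocycles_def inj_eq)

lemma coboundaries_transport:
  assumes "inj j" shows "coboundaries (transport_complex j C) n = j ` coboundaries C n"
  using assms by (auto simp: coboundaries_def image_image)

text \<open>Cocycles and coboundaries are images under injective maps, so membership in them
  transfers in both directions.\<close>

lemma qi_transport:
  assumes "inj j" "inj l" "qi C s D"
  shows "qi (transport_complex j C) (transport_map j l C s) (transport_complex l D)"
proof -
  have c: "cmap C s D" using assms by (intro qi_cmap)
  note s = cmapD[OF c]
  have "inj_on l X" for X using assms(2) by (rule inj_on_subset) simp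
  then have m: "l x \<in> l ` X \<longleftrightarrow> x \<in> X" for x X using assms(2) by (auto dest: injD)
  have m': "j x \<in> j ` X \<longleftrightarrow> x \<in> X" for x X using assms(1) by (auto dest: injD)
  have z: "x \<in> cocycles C n \<Longrightarrow> x \<in> carrier (ob C n)" "y \<in> cocycles D n \<Longrightarrow> y \<in> carrier (ob D n)" for x y n
    by (simp_all add: cocycles_def)
  show ?thesis
    unfolding quasi_iso_iff cocycles_transport[OF assms(1) s(1)] cocycles_transport[OF assms(2) s(2)]
      coboundaries_transport[OF assms(1)] coboundaries_transport[OF assms(2)]
    using assms(3) cmap_transport[OF assms(1,2) c] s(2)
    by (auto simp: quasi_iso_iff z m m' assms(1,2) s(4) cong: bex_cong)
qed

lemma homotopic_transport:
  assumes "inj j" "inj l" "homotopic G R C D f g"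
  shows "homotopic G R (transport_complex j C) (transport_complex l D)
    (transport_map j l C f) (transport_map j l C g)"
proof -
  have c: "cmap C f D" "cmap C g D" using assms(3) by (auto simp: homotopic_def)
  note f = cmapD[OF c(1)] and g = cmapD[OF c(2)]
  obtain h where h: "\<And>i. h i \<in> khom (ob C i) (ob D (i - 1))"
      "\<And>i x. x \<in> carrier (ob C i) \<Longrightarrow>
        f i x \<ominus>\<^bsub>ob D i\<^esub> g i x = diff D (i - 1) (h i x) \<oplus>\<^bsub>ob D i\<^esub> h (i + 1) (diff C i x)"
    using assms(3) unfolding homotopic_def by metis
  have hd: "h (i + 1) (diff C i x) \<in> carrier (ob D i)" if "x \<in> carrier (ob C i)" for i x
    using that f(1) khomD(1)[OF h(1), of "diff C i x" "i + 1"] by simp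
  let ?h = "\<lambda>i. transport_fun j l (carrier (ob C i)) (h i)"
  show ?thesis unfolding homotopic_def
  proof (intro conjI exI[of _ ?h] allI ballI)
    show "cmap (transport_complex j C) (transport_map j l C f) (transport_complex l D)"
      "cmap (transport_complex j C) (transport_map j l C g) (transport_complex l D)"
      using assms c by (auto intro: cmap_transport)
    show "?h i \<in> khom (ob (transport_complex j C) i) (ob (transport_complex l D) (i - 1))" for i
      using khom_transport[OF assms(1,2) h(1) cpx_kmod[OF f(1)]] by simp
    show "transport_map j l C f i x \<ominus>\<^bsub>ob (transport_complex l D) i\<^esub> transport_map j l C g i x
        = diff (transport_complex l D) (i - 1) (?h i x) \<oplus>\<^bsub>ob (transport_complex l D) i\<^esub>
          ?h (i + 1) (diff (transport_complex j C) i x)"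
      if "x \<in> carrier (ob (transport_complex j C) i)" for i x
    proof -
      have "x \<in> j ` carrier (ob C i)" using that assms(1) by simp
      then obtain y where y: "x = j y" "y \<in> carrier (ob C i)" by blast
      have "h i y \<in> carrier (ob D (i - 1))" using y khomD(1)[OF h(1)] by blast
      then show ?thesis
        using y assms(1,2) f(1,2,4) g(4) h(2)[OF y(2)] hd[OF y(2)] by simp
    qed
  qed
qed

text \<open>An equality of records, so that the ends of zigzags match literally. On the carriers the
  negations correspond; elsewhere both differentials are \<open>undefined\<close>.\<close>

lemma transport_shift:
  assumes "inj j" "cpx C"
  shows "transport_complex j (shift n C) = shift n (transport_complex j C)"
proof (rule cochain_complex.equality)
  show "ob (transport_complex j (shift n C)) = ob (shift n (transport_complex j C))"
    by (rule ext) simp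
  note k = cpx_transport[OF assms(1) cpx_shift[OF assms(2), of n]] cpx_shift[OF cpx_transport[OF assms], of n]
  show "diff (transport_complex j (shift n C)) = diff (shift n (transport_complex j C))"
  proof (intro ext)
    fix i x
    show "diff (transport_complex j (shift n C)) i x = diff (shift n (transport_complex j C)) i x"
    proof (cases "x \<in> j ` carrier (ob C (n + i))")
      case True
      then obtain y where y: "x = j y" "y \<in> carrier (ob C (n + i))" by blast
      then show ?thesis using assms by (simp add: diff_shift)
    next
      case False
      then show ?thesis
        using khomD(2)[OF cpx_diff[OF k(1), of i], of x] khomD(2)[OF cpx_diff[OF k(2), of i], of x] assms(1)
        by simp
    qed
  qed
qed simp

end


section \<open>Alternating sums\<close>

text \<open>The sum in the differential of \<open>EM_complex\<close>, named so that it can be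
  evaluated by recursion and split into blocks of faces.\<close>

definition alt :: "('m, 'x) ring_scheme \<Rightarrow> nat \<Rightarrow> (nat \<Rightarrow> 'm) \<Rightarrow> 'm" where
  "alt M n F = (\<Oplus>\<^bsub>M\<^esub>i\<in>{..<n}. if even i then F i else \<ominus>\<^bsub>M\<^esub> F i)"

definition sgn_by :: "('m, 'x) ring_scheme \<Rightarrow> nat \<Rightarrow> 'm \<Rightarrow> 'm" where
  "sgn_by M n x = (if even n then x else \<ominus>\<^bsub>M\<^esub> x)"

context kG_setting
begin

lemma alt_0 [simp]: "kmod M \<Longrightarrow> alt M 0 F = \<zero>\<^bsub>M\<^esub>"
  using abelian_monoid.finsum_empty[OF abelian_group.axioms(1)[OF kmod_abelian_group]]
  by (simp add: alt_def)

lemma sgn_by_closed [simp]: "kmod M \<Longrightarrow> x \<in> carrier M \<Longrightarrow> sgn_by M n x \<in> carrier M"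
  by (simp add: sgn_by_def)

lemma alt_Suc:
  assumes "kmod M" "\<And>i. i \<le> n \<Longrightarrow> F i \<in> carrier M"
  shows "alt M (Suc n) F = alt M n F \<oplus>\<^bsub>M\<^esub> sgn_by M n (F n)"
proof -
  interpret abelian_group M using assms(1) by (rule kmod_abelian_group)
  have c: "finsum M (\<lambda>i. if even i then F i else \<ominus>\<^bsub>M\<^esub> F i) {..<n} \<in> carrier M"
    using assms by (intro finsum_closed) auto
  show ?thesis unfolding alt_def lessThan_Suc
    using assms c by (subst finsum_insert) (auto simp: sgn_by_def a_comm)
qed

lemma alt_closed [simp]:
  assumes "kmod M" "\<And>i. i < n \<Longrightarrow> F i \<in> carrier M" shows "alt M n F \<in> carrier M"
  using assms(2) by (induction n) (simp_all add: assms(1) alt_Suc)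

lemma alt_cong:
  assumes "kmod M" "\<And>i. i < n \<Longrightarrow> F i = F' i" "\<And>i. i < n \<Longrightarrow> F i \<in> carrier M"
  shows "alt M n F = alt M n F'"
  using assms(2,3)
proof (induction n)
  case (Suc n)
  have "F' i \<in> carrier M" if "i \<le> n" for i using that Suc.prems[of i] by simp
  then show ?case using Suc assms(1) by (simp add: alt_Suc)
qed (simp add: assms(1))

lemma alt_hom:
  assumes "kmod M" "kmod N" "\<And>i. i < n \<Longrightarrow> F i \<in> carrier M"
    and "\<And>x. x \<in> carrier M \<Longrightarrow> h x \<in> carrier N"
    and "\<And>x y. x \<in> carrier M \<Longrightarrow> y \<in> carrier M \<Longrightarrow> h (x \<oplus>\<^bsub>M\<^esub> y) = h x \<oplus>\<^bsub>N\<^esub> h y"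
    and "\<And>x. x \<in> carrier M \<Longrightarrow> h (\<ominus>\<^bsub>M\<^esub> x) = \<ominus>\<^bsub>N\<^esub> h x" "h \<zero>\<^bsub>M\<^esub> = \<zero>\<^bsub>N\<^esub>"
  shows "h (alt M n F) = alt N n (\<lambda>i. h (F i))"
  using assms(3) by (induction n) (simp_all add: assms(1,2,4-7) alt_Suc sgn_by_def)

lemma alt_add:
  assumes "kmod M" "\<And>i. i < n \<Longrightarrow> F i \<in> carrier M" "\<And>i. i < n \<Longrightarrow> F' i \<in> carrier M"
  shows "alt M n (\<lambda>i. F i \<oplus>\<^bsub>M\<^esub> F' i) = alt M n F \<oplus>\<^bsub>M\<^esub> alt M n F'"
  using assms(2,3)
  by (induction n) (simp_all add: assms(1) alt_Suc sgn_by_def kmod_grp(1-4)[OF assms(1)])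

lemma alt_diff:
  assumes "kmod M" "\<And>i. i < n \<Longrightarrow> F i \<in> carrier M" "\<And>i. i < n \<Longrightarrow> F' i \<in> carrier M"
  shows "alt M n (\<lambda>i. F i \<ominus>\<^bsub>M\<^esub> F' i) = alt M n F \<ominus>\<^bsub>M\<^esub> alt M n F'"
  using assms(2,3)
  by (induction n) (simp_all add: assms(1) alt_Suc sgn_by_def kmod_grp[OF assms(1)])

text \<open>The second block begins at index \<open>m\<close>, and the parity of \<open>m\<close> is
  collected in front of it. The case \<open>m = 1\<close> isolates the face that omits the first
  entry.\<close>

lemma alt_append:
  assumes "kmod M" "\<And>i. i < m + n \<Longrightarrow> F i \<in> carrier M"
  shows "alt M (m + n) F = alt M m F \<oplus>\<^bsub>M\<^esub> sgn_by M m (alt M n (\<lambda>i. F (m + i)))"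
  using assms(2)
proof (induction n)
  case 0
  then show ?case by (simp add: assms(1) sgn_by_def)
next
  case (Suc n)
  then show ?case
    by (simp add: assms(1) alt_Suc) (simp add: sgn_by_def kmod_grp[OF assms(1)] assms(1))
qed

lemma alt_Suc_shift:
  assumes "kmod M" "\<And>i. i \<le> n \<Longrightarrow> F i \<in> carrier M"
  shows "alt M (Suc n) F = F 0 \<ominus>\<^bsub>M\<^esub> alt M n (\<lambda>i. F (Suc i))"
proof -
  have "alt M 1 F = F 0" using assms by (simp add: alt_Suc sgn_by_def)
  then show ?thesis using alt_append[OF assms(1), of 1 n F] assms by (simp add: sgn_by_def kmod_grp(7))
qed

section \<open>The coboundary on functions of lists\<close>

text \<open>Indexed by length, which is the degree plus one. Length zero is thereby included; it
  carries the augmentation term at which the contraction ends.\<close>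

definition glists :: "nat \<Rightarrow> 'g list set" where
  "glists n = {gs. length gs = n \<and> set gs \<subseteq> carrier G}"

text \<open>The coboundary without degrees or restriction: the number of faces is read off the
  argument. On lists of length one it is the augmentation, the value at the empty list.\<close>

definition lcob :: "('k, 'g, 'm) kGmod \<Rightarrow> ('g list \<Rightarrow> 'm) \<Rightarrow> 'g list \<Rightarrow> 'm" where
  "lcob W f gs = alt W (length gs) (\<lambda>i. f (omit i gs))"

lemma omit_glists [simp]: "gs \<in> glists (Suc n) \<Longrightarrow> i \<le> n \<Longrightarrow> omit i gs \<in> glists n"
  using set_take_subset[of i gs] set_drop_subset[of "Suc i" gs] by (auto simp: glists_def omit_def)

lemma omit_Cons [simp]: "omit 0 (x # gs) = gs" "omit (Suc i) (x # gs) = x # omit i gs"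
  by (simp_all add: omit_def)

lemma glists_Cons [simp]: "x # gs \<in> glists (Suc n) \<longleftrightarrow> x \<in> carrier G \<and> gs \<in> glists n"
  by (auto simp: glists_def)

lemma glists_SucE:
  assumes "gs \<in> glists (Suc n)"
  obtains x hs where "gs = x # hs" "x \<in> carrier G" "hs \<in> glists n"
  using assms by (cases gs) (auto simp: glists_def)

lemma glists_0 [simp]: "gs \<in> glists 0 \<longleftrightarrow> gs = []"
  by (auto simp: glists_def)

lemma length_glists: "gs \<in> glists n \<Longrightarrow> length gs = n"
  by (simp add: glists_def)

lemma lcob_Nil [simp]: "kmod W \<Longrightarrow> lcob W f [] = \<zero>\<^bsub>W\<^esub>"
  by (simp add: lcob_def)

lemma lcob_closed [simp]:
  assumes "kmod W" "gs \<in> glists (Suc n)" "\<And>hs. hs \<in> glists n \<Longrightarrow> f hs \<in> carrier W"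
  shows "lcob W f gs \<in> carrier W"
  using assms unfolding lcob_def by (intro alt_closed) (auto simp: length_glists)

lemma lcob_cong:
  assumes "kmod W" "gs \<in> glists (Suc n)"
    "\<And>hs. hs \<in> glists n \<Longrightarrow> f hs = f' hs" "\<And>hs. hs \<in> glists n \<Longrightarrow> f hs \<in> carrier W"
  shows "lcob W f gs = lcob W f' gs"
  using assms unfolding lcob_def by (intro alt_cong) (auto simp: length_glists)

text \<open>Omitting \<open>x\<close> gives the first term. Every other face keeps \<open>x\<close>
  in front and has its index raised by one, which accounts for the minus sign.\<close>

lemma lcob_Cons:
  assumes "kmod W" "x \<in> carrier G" "gs \<in> glists n" "\<And>hs. hs \<in> glists n \<Longrightarrow> f hs \<in> carrier W"
  shows "lcob W f (x # gs) = f gs \<ominus>\<^bsub>W\<^esub> lcob W (\<lambda>hs. f (x # hs)) gs"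
proof -
  have "x # gs \<in> glists (Suc n)" using assms by simp
  from omit_glists[OF this] have "f (omit i (x # gs)) \<in> carrier W" if "i \<le> length gs" for i
    using that assms by (simp add: length_glists)
  from alt_Suc_shift[OF assms(1) this] show ?thesis unfolding lcob_def by simp
qed

text \<open>
  Inserting \<open>x\<close> in front of the arguments is a contracting homotopy of the augmented complex,
  which gives \<open>d \<circ> d = 0\<close> by induction on the degree.
\<close>

lemma lcob_lcob:
  assumes "kmod W" "gs \<in> glists (Suc (Suc n))" "\<And>hs. hs \<in> glists n \<Longrightarrow> f hs \<in> carrier W"
  shows "lcob W (lcob W f) gs = \<zero>\<^bsub>W\<^esub>"
  using assms(2,3)
proof (induction n arbitrary: f gs)
  case 0
  obtain x hs where gs: "gs = x # hs" "x \<in> carrier G" "hs \<in> glists 1"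
    using 0(1) by (auto elim: glists_SucE)
  then obtain y where y: "gs = [x, y]" "y \<in> carrier G" by (auto elim: glists_SucE)
  have 1: "lcob W f [z] = f []" if "z \<in> carrier G" for z
    using 0(2) that assms(1) lcob_Cons[OF assms(1) that, of "[]" 0 f] by simp
  have "lcob W (lcob W f) gs = lcob W f [y] \<ominus>\<^bsub>W\<^esub> lcob W (\<lambda>hs. lcob W f (x # hs)) [y]"
    unfolding y using gs y 0(2) 1 assms(1) by (intro lcob_Cons[of _ _ _ 1]) (auto elim!: glists_SucE)
  also have "lcob W (\<lambda>hs. lcob W f (x # hs)) [y] = f []"
    using gs(2) y(2) 0(2) assms(1) by (subst lcob_Cons[of W y "[]" 0]) (simp_all add: 1)
  finally show ?case using 0(2) 1[OF y(2)] assms(1) by simp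
next
  case (Suc n)
  obtain x hs where gs: "gs = x # hs" "x \<in> carrier G" "hs \<in> glists (Suc (Suc n))"
    using Suc.prems(1) by (rule glists_SucE)
  let ?s = "\<lambda>hs. f (x # hs)"
  have s: "?s hs \<in> carrier W" if "hs \<in> glists n" for hs using that gs Suc.prems(2) by simp
  have cf: "lcob W f hs \<in> carrier W" if "hs \<in> glists (Suc (Suc n))" for hs
    using that assms(1) Suc.prems(2) by (intro lcob_closed)
  have cs: "lcob W ?s hs \<in> carrier W" if "hs \<in> glists (Suc n)" for hs
    using that assms(1) s by (intro lcob_closed)
  \<comment> \<open>With s for \<open>?s\<close>, the outer coboundary is df(hs) minus the
    coboundary of df(x, -) at hs, and df(x, -) = f - ds. What remains is dds(hs), one degree
    lower.\<close>
  have "lcob W (lcob W f) gs = lcob W f hs \<ominus>\<^bsub>W\<^esub> lcob W (\<lambda>hs. lcob W f (x # hs)) hs"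
    unfolding gs(1) using assms(1) gs(2,3) cf by (rule lcob_Cons)
  also have "lcob W (\<lambda>hs. lcob W f (x # hs)) hs = lcob W (\<lambda>hs. f hs \<ominus>\<^bsub>W\<^esub> lcob W ?s hs) hs"
    using assms(1) gs Suc.prems(2) cf by (intro lcob_cong[of _ _ "Suc n"] lcob_Cons) auto
  also have "\<dots> = lcob W f hs \<ominus>\<^bsub>W\<^esub> lcob W (lcob W ?s) hs"
    unfolding lcob_def[of W _ hs] using assms(1) gs(3) Suc.prems(2) cs
    by (intro alt_diff) (auto simp: length_glists)
  also have "lcob W (lcob W ?s) hs = \<zero>\<^bsub>W\<^esub>" using gs(3) s by (rule Suc.IH)
  finally show ?case using cf[OF gs(3)] assms(1) by simp
qed

section \<open>The Eilenberg--MacLane resolution\<close>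

lemma tuples_nat [simp]: "tuples G (int n) = glists (Suc n)"
  by (auto simp: tuples_def glists_def)

lemma tuples_neg [simp]: "n < 0 \<Longrightarrow> tuples G n = {}"
  by (simp add: tuples_def)

lemma EM_simps [simp]:
  "carrier (EM_module G W n) = tuples G n \<rightarrow>\<^sub>E carrier W"
  "\<zero>\<^bsub>EM_module G W n\<^esub> = (\<lambda>gs\<in>tuples G n. \<zero>\<^bsub>W\<^esub>)"
  "f \<oplus>\<^bsub>EM_module G W n\<^esub> f' = (\<lambda>gs\<in>tuples G n. f gs \<oplus>\<^bsub>W\<^esub> f' gs)"
  "r \<odot>\<^bsub>EM_module G W n\<^esub> f = (\<lambda>gs\<in>tuples G n. r \<odot>\<^bsub>W\<^esub> f gs)"
  "act (EM_module G W n) g f = (\<lambda>gs\<in>tuples G n. act W g (f (map (\<lambda>h. inv\<^bsub>G\<^esub> g \<otimes>\<^bsub>G\<^esub> h) gs)))"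
  by (simp_all add: EM_module_def)

lemma map_tuples [simp]:
  "g \<in> carrier G \<Longrightarrow> gs \<in> tuples G n \<Longrightarrow> map (\<lambda>h. inv\<^bsub>G\<^esub> g \<otimes>\<^bsub>G\<^esub> h) gs \<in> tuples G n"
  by (auto simp: tuples_def)

lemma EM_eqI:
  assumes "f \<in> A \<rightarrow>\<^sub>E B" "f' \<in> A \<rightarrow>\<^sub>E B'" "\<And>gs. gs \<in> A \<Longrightarrow> f gs = f' gs"
  shows "f = f'"
  using assms by (intro extensionalityI[of f A f']) (auto simp: PiE_def)

lemma kmod_EM:
  assumes "kmod W" shows "kmod (EM_module G W n)"
proof (rule kmodI)
  interpret group G by (rule group_G)
  show "\<exists>y\<in>carrier (EM_module G W n). y \<oplus>\<^bsub>EM_module G W n\<^esub> x = \<zero>\<^bsub>EM_module G W n\<^esub>"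
    if "x \<in> carrier (EM_module G W n)" for x
  proof -
    have "x gs \<in> carrier W" if "gs \<in> tuples G n" for gs using that \<open>x \<in> _\<close> by auto
    then show ?thesis using assms
      by (intro bexI[of _ "\<lambda>gs\<in>tuples G n. \<ominus>\<^bsub>W\<^esub> x gs"]) (auto intro!: restrict_ext)
  qed
  show "act (EM_module G W n) (g \<otimes>\<^bsub>G\<^esub> h) x = act (EM_module G W n) g (act (EM_module G W n) h x)"
    if "g \<in> carrier G" "h \<in> carrier G" "x \<in> carrier (EM_module G W n)" for g h x
  proof -
    \<comment> \<open>Inversion reverses products, so translating the arguments by inverses gives a
      left action.\<close>
    have "map (\<lambda>k. inv\<^bsub>G\<^esub> (g \<otimes>\<^bsub>G\<^esub> h) \<otimes>\<^bsub>G\<^esub> k) gs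
        = map (\<lambda>k. inv\<^bsub>G\<^esub> h \<otimes>\<^bsub>G\<^esub> k) (map (\<lambda>k. inv\<^bsub>G\<^esub> g \<otimes>\<^bsub>G\<^esub> k) gs)" if "gs \<in> tuples G n" for gs
      using that \<open>g \<in> _\<close> \<open>h \<in> _\<close> by (auto simp: tuples_def inv_mult_group m_assoc)
    moreover have "x gs \<in> carrier W" if "gs \<in> tuples G n" for gs using that \<open>x \<in> _\<close> by auto
    ultimately show ?thesis using that assms by (auto intro!: restrict_ext simp: kmod_act simp del: map_map)
  qed
  show "act (EM_module G W n) \<one>\<^bsub>G\<^esub> x = x" if "x \<in> carrier (EM_module G W n)" for x
  proof -
    have "map (\<lambda>k. inv\<^bsub>G\<^esub> \<one>\<^bsub>G\<^esub> \<otimes>\<^bsub>G\<^esub> k) gs = gs" if "gs \<in> tuples G n" for gs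
      using that by (auto simp: tuples_def intro!: map_idI)
    moreover have "x gs \<in> carrier W" if "gs \<in> tuples G n" for gs using that \<open>x \<in> _\<close> by auto
    ultimately show ?thesis using that assms
      by (intro EM_eqI[of _ "tuples G n" "carrier W" _ "carrier W"]) (auto simp: kmod_act)
  qed
qed (use assms in \<open>auto intro!: restrict_ext EM_eqI[of _ "tuples G n" "carrier W" _ "carrier W"]
    simp: kmod_grp(1-3) kmod_smult kmod_act PiE_mem[of _ "tuples G n" "\<lambda>_. carrier W"]\<close>)


lemma tuples_Suc [simp]: "tuples G (int n + 1) = glists (Suc (Suc n))"
  "tuples G (1 + int n) = glists (Suc (Suc n))"
  using tuples_nat[of "Suc n"] by (simp_all add: add.commute)

lemma ob_EM [simp]: "ob (EM_complex G W) = EM_module G W"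
  by (simp add: EM_complex_def)

lemma EM_diff:
  "f \<in> carrier (EM_module G W (int n)) \<Longrightarrow>
    diff (EM_complex G W) (int n) f = (\<lambda>gs\<in>glists (Suc (Suc n)). lcob W f gs)"
  by (auto simp: EM_complex_def lcob_def alt_def intro!: restrict_ext)

lemma EM_diff_neg:
  "f \<in> carrier (EM_module G W i) \<Longrightarrow> i < 0 \<Longrightarrow> diff (EM_complex G W) i f = \<zero>\<^bsub>EM_module G W (i + 1)\<^esub>"
  by (simp add: EM_complex_def)

lemma EM_neg:
  assumes "f \<in> carrier (EM_module G W i)" "i < 0" shows "f = \<zero>\<^bsub>EM_module G W i\<^esub>"
  using assms by auto

lemma map_omit: "map \<phi> (omit i gs) = omit i (map \<phi> gs)"
  by (simp add: omit_def take_map drop_map)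

lemma int_cases_neg: obtains "(i::int) < 0" | n where "i = int n"
  by (metis nonneg_int_cases not_le)

text \<open>In nonnegative degrees linearity is that of alternating sums and the square of the
  differential is treated by \<open>lcob_lcob\<close>. In negative degrees the differential is zero
  by definition.\<close>

lemma cpx_EM:
  assumes W: "kmod W" shows "cpx (EM_complex G W)"
proof (rule cpxI)
  show k: "kmod (ob (EM_complex G W) i)" for i using W by (simp add: kmod_EM)
  show h: "diff (EM_complex G W) i \<in> khom (ob (EM_complex G W) i) (ob (EM_complex G W) (i + 1))" for i
  proof (cases i rule: int_cases_neg)
    case 1
    have "diff (EM_complex G W) i = (\<lambda>f\<in>carrier (EM_module G W i). \<zero>\<^bsub>EM_module G W (i + 1)\<^esub>)"
      using 1 by (simp add: EM_complex_def)
    then show ?thesis using khom_zero_map[OF k[of i] k[of "i + 1"]] by simp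
  next
    case (2 n)
    let ?M = "EM_module G W (int n)"
    have v: "f (omit i gs) \<in> carrier W" if "f \<in> carrier ?M" "gs \<in> glists (Suc (Suc n))" "i < length gs" for f gs i
      using that by (auto simp: length_glists intro!: PiE_mem[of f "glists (Suc n)"])
    show ?thesis unfolding 2 ob_EM
    proof (rule khomI)
      fix f assume f: "f \<in> carrier ?M"
      show "diff (EM_complex G W) (int n) f \<in> carrier (EM_module G W (int n + 1))"
        unfolding EM_diff[OF f] using f W by (auto intro!: lcob_closed PiE_mem[of f "glists (Suc n)"])
      fix f' assume f': "f' \<in> carrier ?M"
      have ff: "f \<oplus>\<^bsub>?M\<^esub> f' \<in> carrier ?M" using f f' kmod_EM[OF W] by (rule kmod_closed(2)[rotated])
      show "diff (EM_complex G W) (int n) (f \<oplus>\<^bsub>?M\<^esub> f') = diff (EM_complex G W) (int n) f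
          \<oplus>\<^bsub>EM_module G W (int n + 1)\<^esub> diff (EM_complex G W) (int n) f'"
        unfolding EM_diff[OF f] EM_diff[OF f'] EM_diff[OF ff] unfolding EM_simps tuples_Suc
      proof (intro restrict_ext)
        fix gs assume gs: "gs \<in> glists (Suc (Suc n))"
        have "lcob W (\<lambda>gs\<in>tuples G (int n). f gs \<oplus>\<^bsub>W\<^esub> f' gs) gs
            = alt W (length gs) (\<lambda>i. f (omit i gs) \<oplus>\<^bsub>W\<^esub> f' (omit i gs))"
          unfolding lcob_def using W gs v[OF f gs] v[OF f' gs] by (intro alt_cong) (auto simp: length_glists)
        also have "\<dots> = lcob W f gs \<oplus>\<^bsub>W\<^esub> lcob W f' gs"
          unfolding lcob_def using W v[OF f gs] v[OF f' gs] by (intro alt_add)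
        finally show "lcob W (\<lambda>gs\<in>tuples G (int n). f gs \<oplus>\<^bsub>W\<^esub> f' gs) gs
          = restrict (lcob W f) (glists (Suc (Suc n))) gs \<oplus>\<^bsub>W\<^esub> restrict (lcob W f') (glists (Suc (Suc n))) gs"
          using gs by simp
      qed
    next
      fix r f assume r: "r \<in> carrier R" and f: "f \<in> carrier ?M"
      have rf: "r \<odot>\<^bsub>?M\<^esub> f \<in> carrier ?M" using r f kmod_EM[OF W] by (rule kmod_closed(5)[rotated])
      show "diff (EM_complex G W) (int n) (r \<odot>\<^bsub>?M\<^esub> f)
          = r \<odot>\<^bsub>EM_module G W (int n + 1)\<^esub> diff (EM_complex G W) (int n) f"
        unfolding EM_diff[OF f] EM_diff[OF rf] unfolding EM_simps tuples_Suc
      proof (intro restrict_ext)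
        fix gs assume gs: "gs \<in> glists (Suc (Suc n))"
        have "lcob W (\<lambda>gs\<in>tuples G (int n). r \<odot>\<^bsub>W\<^esub> f gs) gs
            = alt W (length gs) (\<lambda>i. r \<odot>\<^bsub>W\<^esub> f (omit i gs))"
          unfolding lcob_def using W gs v[OF f gs] r by (intro alt_cong) (auto simp: length_glists)
        also have "\<dots> = r \<odot>\<^bsub>W\<^esub> lcob W f gs"
          unfolding lcob_def using W v[OF f gs] r by (intro alt_hom[symmetric]) (auto simp: kmod_smult)
        finally show "lcob W (\<lambda>gs\<in>tuples G (int n). r \<odot>\<^bsub>W\<^esub> f gs) gs
          = r \<odot>\<^bsub>W\<^esub> restrict (lcob W f) (glists (Suc (Suc n))) gs" using gs by simp
      qed
    next
      fix g f assume g: "g \<in> carrier G" and f: "f \<in> carrier ?M"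
      have gf: "act ?M g f \<in> carrier ?M" using g f kmod_EM[OF W] by (rule kmod_closed(6)[rotated])
      \<comment> \<open>Translation acts entry by entry and so commutes with omitting an entry;
        equivariance then reduces to applying \<open>act W g\<close> to each face.\<close>
      let ?\<phi> = "map (\<lambda>h. inv\<^bsub>G\<^esub> g \<otimes>\<^bsub>G\<^esub> h)"
      have \<phi>: "?\<phi> gs \<in> glists m" if "gs \<in> glists m" for gs m
        using that g by (auto simp: glists_def)
      show "diff (EM_complex G W) (int n) (act ?M g f)
          = act (EM_module G W (int n + 1)) g (diff (EM_complex G W) (int n) f)"
        unfolding EM_diff[OF f] EM_diff[OF gf] unfolding EM_simps tuples_Suc
      proof (intro restrict_ext)
        fix gs assume gs: "gs \<in> glists (Suc (Suc n))"
        note v' = v[OF f \<phi>[OF gs]]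
        have "lcob W (\<lambda>gs\<in>tuples G (int n). act W g (f (?\<phi> gs))) gs
            = alt W (length gs) (\<lambda>i. act W g (f (omit i (?\<phi> gs))))"
          unfolding lcob_def using W gs v' g
          by (intro alt_cong) (auto simp: length_glists map_omit)
        also have "\<dots> = act W g (lcob W f (?\<phi> gs))"
          unfolding lcob_def using W v' g
          by (subst alt_hom[where h = "act W g"]) (auto simp: kmod_act kmod_act_zero_minus)
        finally show "lcob W (\<lambda>gs\<in>tuples G (int n). act W g (f (?\<phi> gs))) gs
          = act W g (restrict (lcob W f) (glists (Suc (Suc n))) (?\<phi> gs))" using \<phi>[OF gs] by simp
      qed
    next
      show "diff (EM_complex G W) (int n) f = undefined" if "f \<notin> carrier ?M" for f
        using that by (simp add: EM_complex_def del: EM_simps)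
    qed
  qed
  show "diff (EM_complex G W) (i + 1) (diff (EM_complex G W) i f) = \<zero>\<^bsub>ob (EM_complex G W) (i + 2)\<^esub>"
    if f: "f \<in> carrier (ob (EM_complex G W) i)" for i f
  proof (cases i rule: int_cases_neg)
    case 1
    then show ?thesis using f khom_zero[OF k k h, of "i + 1"] EM_diff_neg[of f W i]
      by (simp add: add.assoc del: EM_simps)
  next
    case (2 n)
    let ?d = "\<lambda>gs\<in>glists (Suc (Suc n)). lcob W f gs"
    have d: "?d \<in> carrier (EM_module G W (int (Suc n)))"
      using khomD(1)[OF h f] EM_diff[of f W n] f unfolding 2 by (simp add: add.commute del: EM_simps)
    have "diff (EM_complex G W) (int (Suc n)) ?d = \<zero>\<^bsub>EM_module G W (int (Suc (Suc n)))\<^esub>"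
      unfolding EM_diff[OF d] unfolding EM_simps tuples_nat
    proof (intro restrict_ext)
      fix gs assume gs: "gs \<in> glists (Suc (Suc (Suc n)))"
      have c: "f hs \<in> carrier W" if "hs \<in> glists (Suc n)" for hs using that f 2 by auto
      have "lcob W ?d gs = lcob W (lcob W f) gs"
        using W gs c by (intro lcob_cong[of _ _ "Suc (Suc n)"]) auto
      then show "lcob W ?d gs = \<zero>\<^bsub>W\<^esub>" using lcob_lcob[OF W gs c] by simp
    qed
    then show ?thesis using f 2 EM_diff[of f W n] by (simp add: add.commute del: EM_simps)
  qed
qed

text \<open>For a cocycle y, \<open>lcob_Cons\<close> with the neutral element in front gives y =
  d(y(1, -)). In positive degree this exhibits y as a coboundary; in degree zero it says that y is
  constant.\<close>

lemma qi_coaug: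
  assumes W: "kmod W" shows "qi (conc W) (coaug G W) (EM_complex G W)"
  unfolding quasi_iso_iff
proof (intro conjI allI ballI impI)
  note E = cpx_EM[OF W] and C = cpx_conc[OF W]
  have k: "kmod (EM_module G W i)" for i using W by (rule kmod_EM)
  have s0: "coaug G W 0 x = (\<lambda>gs\<in>glists (Suc 0). x)" if "x \<in> carrier W" for x
    using that tuples_nat[of 0] by (simp add: coaug_def carrier_conc)
  have s1: "coaug G W i \<zero>\<^bsub>W\<^esub> = \<zero>\<^bsub>EM_module G W i\<^esub>" for i
    using W by (simp add: coaug_def carrier_conc)
  have s0c: "coaug G W 0 x \<in> carrier (EM_module G W 0)" if "x \<in> carrier W" for x
    using that s0[OF that] tuples_nat[of 0] by simp
  show "cmap (conc W) (coaug G W) (EM_complex G W)"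
  proof (rule cmapI[OF C E])
    show "coaug G W i \<in> khom (ob (conc W) i) (ob (EM_complex G W) i)" for i
    proof (cases "i = 0")
      case True
      have t: "tuples G 0 = glists (Suc 0)" using tuples_nat[of 0] by simp
      have \<phi>: "map (\<lambda>h. inv\<^bsub>G\<^esub> g \<otimes>\<^bsub>G\<^esub> h) gs \<in> glists (Suc 0)" if "g \<in> carrier G" "gs \<in> glists (Suc 0)" for g gs
        using that by (auto simp: glists_def)
      show ?thesis using True W
        by (intro khomI) (auto simp: ob_conc s0 t \<phi> coaug_def intro!: restrict_ext)
    next
      case False
      have "coaug G W i = (\<lambda>x\<in>carrier (ob (conc W) i). \<zero>\<^bsub>EM_module G W i\<^esub>)"
        using False by (simp add: coaug_def)
      then show ?thesis using khom_zero_map[OF cpx_kmod[OF C] k] by simp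
    qed
    show "coaug G W (i + 1) (diff (conc W) i x) = diff (EM_complex G W) i (coaug G W i x)"
      if x: "x \<in> carrier (ob (conc W) i)" for i x
    proof (cases "i = 0")
      case True
      have xW: "x \<in> carrier W" using x True by (simp add: carrier_conc)
      have "lcob W (coaug G W 0 x) gs = \<zero>\<^bsub>W\<^esub>" if gs: "gs \<in> glists (Suc (Suc 0))" for gs
      proof -
        obtain a hs where a: "gs = a # hs" "a \<in> carrier G" "hs \<in> glists (Suc 0)"
          using gs by (rule glists_SucE)
        obtain b where b: "hs = [b]" "b \<in> carrier G" using a(3) by (auto elim: glists_SucE)
        have "lcob W (\<lambda>hs. (\<lambda>gs\<in>glists (Suc 0). x) (a # hs)) [b] = x"
          using b W xW a by (subst lcob_Cons[of _ _ _ 0]) (auto simp: lcob_def)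
        then show ?thesis unfolding s0[OF xW] a(1)
          using a b xW W by (subst lcob_Cons[of _ _ _ "Suc 0"]) auto
      qed
      then show ?thesis using True s1[of 1] x EM_diff[of "coaug G W 0 x" W 0] s0c[OF xW] tuples_Suc(1)[of 0]
        by (auto simp: diff_conc intro!: restrict_ext)
    next
      case False
      then have "x = \<zero>\<^bsub>W\<^esub>" using x by (simp add: carrier_conc)
      then show ?thesis using x s1 cpx_diff_zero[OF E, of i] by (simp add: diff_conc del: EM_simps)
    qed
  qed
  fix n
  have z: "\<zero>\<^bsub>W\<^esub> \<in> cocycles (conc W) n" "\<zero>\<^bsub>W\<^esub> \<in> coboundaries (conc W) n" for n
    using cocycles_closed(2)[OF C, of n] coboundaries_closed(3)[OF C, of n] by simp_all
  show "x \<in> coboundaries (conc W) n"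
    if x: "x \<in> cocycles (conc W) n" "coaug G W n x \<in> coboundaries (EM_complex G W) n" for x
  proof (cases "n = 0")
    case True
    have xW: "x \<in> carrier W" using x(1) True by (simp add: cocycles_def carrier_conc)
    obtain y where "y \<in> carrier (EM_module G W (- 1))" "coaug G W 0 x = diff (EM_complex G W) (- 1) y"
      using x(2) True by (auto simp: mem_coboundaries simp del: EM_simps)
    \<comment> \<open>The differential out of degree -1 is zero, so a coboundary of degree zero
      vanishes. Evaluating the constant map at the neutral element then gives x = 0.\<close>
    then have "coaug G W 0 x = \<zero>\<^bsub>EM_module G W (int 0)\<^esub>" using EM_diff_neg[of y W "- 1"] by simp
    then have "coaug G W 0 x [\<one>\<^bsub>G\<^esub>] = \<zero>\<^bsub>W\<^esub>" using tuples_nat[of 0] by simp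
    then show ?thesis using z True s0[OF xW] by simp
  next
    case False
    then show ?thesis using x(1) z by (simp add: cocycles_def carrier_conc)
  qed
  show "\<exists>x\<in>cocycles (conc W) n. y \<ominus>\<^bsub>ob (EM_complex G W) n\<^esub> coaug G W n x \<in> coboundaries (EM_complex G W) n"
    if y: "y \<in> cocycles (EM_complex G W) n" for y
  proof -
    have yc: "y \<in> carrier (EM_module G W n)" using y by (simp add: cocycles_def)
    have Z: ?thesis if "y \<in> coboundaries (EM_complex G W) n"
      using that yc z(1)[of n] k by (intro bexI[of _ "\<zero>\<^bsub>W\<^esub>"]) (simp_all add: s1 del: EM_simps)
    show ?thesis
    proof (cases n rule: int_cases_neg)
      case 1
      then show ?thesis using Z EM_neg[OF yc] coboundaries_closed(3)[OF E, of n] by (simp del: EM_simps)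
    next
      case (2 m)
      have yv: "y gs \<in> carrier W" if "gs \<in> glists (Suc m)" for gs using that yc 2 by auto
      have "diff (EM_complex G W) (int m) y = \<zero>\<^bsub>EM_module G W (int m + 1)\<^esub>"
        using y 2 by (simp add: cocycles_def del: EM_simps)
      then have d: "lcob W y gs = \<zero>\<^bsub>W\<^esub>" if "gs \<in> glists (Suc (Suc m))" for gs
        using that EM_diff[of y W m] yc 2 by (auto dest: fun_cong[of _ _ gs])
      have h: "y gs = lcob W (\<lambda>hs. y (\<one>\<^bsub>G\<^esub> # hs)) gs" if "gs \<in> glists (Suc m)" for gs
      proof -
        have c: "lcob W (\<lambda>hs. y (\<one>\<^bsub>G\<^esub> # hs)) gs \<in> carrier W"
          using W that yv by (intro lcob_closed) auto
        have "y gs \<ominus>\<^bsub>W\<^esub> lcob W (\<lambda>hs. y (\<one>\<^bsub>G\<^esub> # hs)) gs = \<zero>\<^bsub>W\<^esub>"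
          using lcob_Cons[OF W _ that yv, of "\<one>\<^bsub>G\<^esub>"] d[of "\<one>\<^bsub>G\<^esub> # gs"] that by simp
        then show ?thesis using c W yv[OF that] by (simp add: kmod_diff_zero)
      qed
      show ?thesis
      proof (cases m)
        case 0
        \<comment> \<open>On lists of length one the coboundary of y(1, -) is its value at the empty
          list, that is y(1), the constant sought.\<close>
        let ?x = "y [\<one>\<^bsub>G\<^esub>]"
        have x: "?x \<in> carrier W" using yv 0 by simp
        have e: "y gs = ?x" if gs: "gs \<in> glists (Suc 0)" for gs
        proof -
          obtain b where b: "gs = [b]" "b \<in> carrier G" using gs by (auto elim: glists_SucE)
          then show ?thesis using h[of gs] gs 0 W x lcob_Cons[OF W b(2), of "[]" 0 "\<lambda>hs. y (\<one>\<^bsub>G\<^esub> # hs)"]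
            by (simp add: lcob_def[of _ _ "[]"])
        qed
        have "y = coaug G W 0 ?x" unfolding s0[OF x]
        proof (rule EM_eqI)
          show "y \<in> glists (Suc 0) \<rightarrow>\<^sub>E carrier W" using yc 2 0 tuples_nat[of 0] by simp
          show "(\<lambda>gs\<in>glists (Suc 0). ?x) \<in> glists (Suc 0) \<rightarrow>\<^sub>E carrier W" using x by simp
          show "y gs = (\<lambda>gs\<in>glists (Suc 0). ?x) gs" if "gs \<in> glists (Suc 0)" for gs
            unfolding restrict_apply' [OF that] by (rule e[OF that])
        qed
        then have "y \<ominus>\<^bsub>EM_module G W 0\<^esub> coaug G W 0 ?x \<in> coboundaries (EM_complex G W) 0"
          using k[of 0] yc 2 0 coboundaries_closed(3)[OF E, of 0] by (simp del: EM_simps)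
        moreover have "?x \<in> cocycles (conc W) 0" using x by (simp add: cocycles_def carrier_conc diff_conc)
        ultimately show ?thesis using 2 0 by auto
      next
        case (Suc l)
        let ?h = "\<lambda>hs\<in>glists (Suc l). y (\<one>\<^bsub>G\<^esub> # hs)"
        have hc: "?h \<in> carrier (EM_module G W (int l))" using yv Suc by auto
        have "y = diff (EM_complex G W) (int l) ?h" unfolding EM_diff[OF hc]
        proof (rule EM_eqI[of y "glists (Suc m)" "carrier W" _ UNIV])
          show "y gs = (\<lambda>gs\<in>glists (Suc (Suc l)). lcob W ?h gs) gs" if "gs \<in> glists (Suc m)" for gs
            using that h[OF that] Suc yv W lcob_cong[OF W, of gs "Suc l" "\<lambda>hs. y (\<one>\<^bsub>G\<^esub> # hs)" ?h] by simp
        qed (use yc 2 Suc in auto)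
        then have "y \<in> coboundaries (EM_complex G W) n" unfolding mem_coboundaries
          using hc 2 Suc by (intro bexI[of _ ?h]) simp_all
        then show ?thesis by (rule Z)
      qed
    qed
  qed
qed

section \<open>Cup products of cochains\<close>

lemma trivial_simps [simp]:
  "carrier (trivial_module R :: ('k, 'g, 'k) kGmod) = carrier R"
  "zero (trivial_module R :: ('k, 'g, 'k) kGmod) = zero R"
  "add (trivial_module R :: ('k, 'g, 'k) kGmod) = add R"
  "smult (trivial_module R :: ('k, 'g, 'k) kGmod) = mult R"
  "act (trivial_module R :: ('k, 'g, 'k) kGmod) g x = x"
  by (simp_all add: trivial_module_def)

text \<open>Bookkeeping for the Leibniz rule: an omitted index up to p leaves the back block
  independent of it, a later one does so for the front block. The last two equations concern the
  extreme faces, which cancel there.\<close>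

lemma omit_cup:
  assumes "length gs = p + q + 2"
  shows "j \<le> p \<Longrightarrow> drop p (omit j gs) = drop (Suc p) gs"
    and "j \<le> p \<Longrightarrow> take (Suc p) (omit j gs) = omit j (take (Suc (Suc p)) gs)"
    and "drop p (omit (Suc p + i) gs) = omit (Suc i) (drop p gs)"
    and "take (Suc p) (omit (Suc p + i) gs) = take (Suc p) gs"
    and "omit (Suc p) (take (Suc (Suc p)) gs) = take (Suc p) gs"
    and "omit 0 (drop p gs) = drop (Suc p) gs"
  using assms by (simp_all add: omit_def drop_take min_def Suc_diff_le add.commute)

abbreviation triv :: "('k, 'g, 'k) kGmod" where "triv \<equiv> trivial_module R"

text \<open>The faces on the left are split after index p into those of the front and those of the
  back block. On the right each coboundary has one face more, the last of the front and the first of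
  the back. Both give \<open>f (drop (Suc p) gs) \<odot> \<alpha> (take (Suc p) gs)\<close>, with
  opposite signs, and cancel.\<close>

lemma leibniz:
  assumes V: "kmod V" and a: "\<And>gs. gs \<in> glists (Suc p) \<Longrightarrow> \<alpha> gs \<in> carrier V"
    and f: "\<And>gs. gs \<in> glists (Suc q) \<Longrightarrow> f gs \<in> carrier R" and gs: "gs \<in> glists (Suc (Suc (p + q)))"
  shows "lcob V (\<lambda>gs. f (drop p gs) \<odot>\<^bsub>V\<^esub> \<alpha> (take (Suc p) gs)) gs =
    f (drop (Suc p) gs) \<odot>\<^bsub>V\<^esub> lcob V \<alpha> (take (Suc (Suc p)) gs) \<oplus>\<^bsub>V\<^esub>
    sgn_by V p (lcob triv f (drop p gs) \<odot>\<^bsub>V\<^esub> \<alpha> (take (Suc p) gs))"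
proof -
  have len: "length gs = p + q + 2" using gs by (simp add: glists_def)
  note o = omit_cup[OF len]
  let ?F = "\<lambda>j. f (drop p (omit j gs)) \<odot>\<^bsub>V\<^esub> \<alpha> (take (Suc p) (omit j gs))"
  \<comment> \<open>The two blocks overlap in the entries with indices p and p + 1, since each is
    one entry longer than an argument of its cochain.\<close>
  let ?D = "drop p gs" and ?T = "take (Suc (Suc p)) gs"
  let ?c = "f (drop (Suc p) gs)" and ?a = "\<alpha> (take (Suc p) gs)"
  have sub: "set (drop m gs) \<subseteq> carrier G" "set (take m gs) \<subseteq> carrier G" for m
    using gs set_drop_subset[of m gs] set_take_subset[of m gs] by (auto simp: glists_def)
  have g: "drop (Suc p) gs \<in> glists (Suc q)" "take (Suc p) gs \<in> glists (Suc p)"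
    "?D \<in> glists (Suc (Suc q))" "?T \<in> glists (Suc (Suc p))"
    using len sub by (auto simp: glists_def)
  have ca: "?c \<in> carrier R" "?a \<in> carrier V" using g a f by auto
  have aT: "\<alpha> (omit j ?T) \<in> carrier V" if "j \<le> Suc p" for j using that g a by simp
  have fD: "f (omit j ?D) \<in> carrier R" if "j \<le> Suc q" for j using that g f by simp
  have F1: "?F j = ?c \<odot>\<^bsub>V\<^esub> \<alpha> (omit j ?T)" if "j \<le> p" for j using that o(1,2) by simp
  have F2: "?F (Suc p + i) = f (omit (Suc i) ?D) \<odot>\<^bsub>V\<^esub> ?a" for i using o(3,4) by simp
  have Fc: "?F j \<in> carrier V" if "j < Suc p + Suc q" for j
  proof (cases "j \<le> p")
    case True
    then show ?thesis unfolding F1[OF True] using ca aT V by simp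
  next
    case False
    then obtain i where i: "j = Suc p + i" by (metis add_Suc_right less_natE not_le add_Suc)
    then have "i \<le> q" using that by simp
    then show ?thesis unfolding i F2 using ca fD[of "Suc i"] V by simp
  qed
  let ?A = "alt V (Suc p) (\<lambda>j. ?c \<odot>\<^bsub>V\<^esub> \<alpha> (omit j ?T))"
  let ?B = "alt V (Suc q) (\<lambda>i. f (omit (Suc i) ?D) \<odot>\<^bsub>V\<^esub> ?a)"
  have AB: "?A \<in> carrier V" "?B \<in> carrier V" using V ca aT fD by (auto intro!: alt_closed)
  have "lcob V (\<lambda>gs. f (drop p gs) \<odot>\<^bsub>V\<^esub> \<alpha> (take (Suc p) gs)) gs = alt V (Suc p + Suc q) ?F"
    using len by (simp add: lcob_def)
  also have "\<dots> = alt V (Suc p) ?F \<oplus>\<^bsub>V\<^esub> sgn_by V (Suc p) (alt V (Suc q) (\<lambda>i. ?F (Suc p + i)))"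
    using V Fc by (rule alt_append)
  also have "alt V (Suc p) ?F = ?A" using V Fc F1 ca aT by (intro alt_cong) auto
  also have "alt V (Suc q) (\<lambda>i. ?F (Suc p + i)) = ?B" unfolding F2 ..
  finally have L: "lcob V (\<lambda>gs. f (drop p gs) \<odot>\<^bsub>V\<^esub> \<alpha> (take (Suc p) gs)) gs
      = ?A \<oplus>\<^bsub>V\<^esub> sgn_by V (Suc p) ?B" .
  have "lcob V \<alpha> ?T = alt V (Suc p) (\<lambda>j. \<alpha> (omit j ?T)) \<oplus>\<^bsub>V\<^esub> sgn_by V (Suc p) (\<alpha> (omit (Suc p) ?T))"
    unfolding lcob_def length_glists[OF g(4)] using V aT by (intro alt_Suc)
  then have "?c \<odot>\<^bsub>V\<^esub> lcob V \<alpha> ?T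
      = ?c \<odot>\<^bsub>V\<^esub> alt V (Suc p) (\<lambda>j. \<alpha> (omit j ?T)) \<oplus>\<^bsub>V\<^esub> ?c \<odot>\<^bsub>V\<^esub> sgn_by V (Suc p) ?a"
    using V aT ca o(5) by (simp add: kmod_smult(2))
  also have "?c \<odot>\<^bsub>V\<^esub> alt V (Suc p) (\<lambda>j. \<alpha> (omit j ?T)) = ?A"
    using V aT ca by (intro alt_hom) (auto simp: kmod_smult)
  also have "?c \<odot>\<^bsub>V\<^esub> sgn_by V (Suc p) ?a = sgn_by V (Suc p) (?c \<odot>\<^bsub>V\<^esub> ?a)"
    using V ca by (simp add: sgn_by_def kmod_smult(5))
  finally have M: "?c \<odot>\<^bsub>V\<^esub> lcob V \<alpha> ?T = ?A \<oplus>\<^bsub>V\<^esub> sgn_by V (Suc p) (?c \<odot>\<^bsub>V\<^esub> ?a)" .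
  have t: "kmod triv" by (rule kmod_trivial)
  have fDc: "alt triv (Suc q) (\<lambda>i. f (omit (Suc i) ?D)) \<in> carrier triv"
    using t fD by (intro alt_closed) auto
  have "lcob triv f ?D = ?c \<ominus>\<^bsub>triv\<^esub> alt triv (Suc q) (\<lambda>i. f (omit (Suc i) ?D))"
    unfolding lcob_def length_glists[OF g(3)] o(6)[symmetric] using t fD by (intro alt_Suc_shift) auto
  then have lf: "lcob triv f ?D = ?c \<oplus>\<^bsub>triv\<^esub> \<ominus>\<^bsub>triv\<^esub> alt triv (Suc q) (\<lambda>i. f (omit (Suc i) ?D))"
    using t fDc ca by (simp add: kmod_grp(7))
  \<comment> \<open>Negation is taken in the record \<open>triv\<close>. It is an additive inverse
    for the addition of \<open>R\<close>, so it passes through scalar multiplication by uniqueness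
    of inverses in \<open>V\<close>.\<close>
  have neg: "(\<ominus>\<^bsub>triv\<^esub> x) \<odot>\<^bsub>V\<^esub> y = \<ominus>\<^bsub>V\<^esub> (x \<odot>\<^bsub>V\<^esub> y)" if "x \<in> carrier R" "y \<in> carrier V" for x y
  proof -
    have m: "\<ominus>\<^bsub>triv\<^esub> x \<in> carrier R" "\<ominus>\<^bsub>triv\<^esub> x \<oplus>\<^bsub>R\<^esub> x = \<zero>\<^bsub>R\<^esub>"
      using kmod_closed(3)[OF t, of x] kmod_grp_simps(6)[OF t, of x] that by simp_all
    then have "(\<ominus>\<^bsub>triv\<^esub> x) \<odot>\<^bsub>V\<^esub> y \<oplus>\<^bsub>V\<^esub> x \<odot>\<^bsub>V\<^esub> y = \<zero>\<^bsub>V\<^esub>"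
      using that V kmod_smult(1)[OF V m(1) that(1) that(2)] by (simp add: kmod_smult(7))
    then show ?thesis using that V m by (intro kmod_minus_unique[symmetric]) simp_all
  qed
  have "alt triv (Suc q) (\<lambda>i. f (omit (Suc i) ?D)) \<odot>\<^bsub>V\<^esub> ?a = ?B"
    using t V fD ca neg by (intro alt_hom[of triv V _ _ "\<lambda>x. x \<odot>\<^bsub>V\<^esub> ?a"]) (auto simp: kmod_smult)
  then have N: "lcob triv f ?D \<odot>\<^bsub>V\<^esub> ?a = ?c \<odot>\<^bsub>V\<^esub> ?a \<oplus>\<^bsub>V\<^esub> \<ominus>\<^bsub>V\<^esub> ?B"
    unfolding lf using V ca fDc kmod_closed(3)[OF t fDc] neg by (simp add: kmod_smult(1))
  have cav: "?c \<odot>\<^bsub>V\<^esub> ?a \<in> carrier V" using V ca by simp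
  show ?thesis unfolding L M N using V AB cav
    by (auto simp: sgn_by_def kmod_grp[OF V] kmod_cancel[OF V])
qed


text \<open>The value for negative \<open>i\<close> is set explicitly: the target degree
  \<open>int p + i\<close> can still be nonnegative, and there \<open>drop p gs\<close> would not be
  an argument of \<open>f\<close>.\<close>

definition cup_map ::
  "('k, 'g, 'v) kGmod \<Rightarrow> nat \<Rightarrow> ('g list \<Rightarrow> 'v) \<Rightarrow> int \<Rightarrow> ('g list \<Rightarrow> 'k) \<Rightarrow> 'g list \<Rightarrow> 'v" where
  "cup_map V p \<alpha> = (\<lambda>i. \<lambda>f\<in>carrier (EM_module G triv i). \<lambda>gs\<in>tuples G (int p + i).
     if i < 0 then \<zero>\<^bsub>V\<^esub> else f (drop p gs) \<odot>\<^bsub>V\<^esub> \<alpha> (take (Suc p) gs))"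

lemma cup_map_nat:
  "f \<in> carrier (EM_module G triv (int q)) \<Longrightarrow> cup_map V p \<alpha> (int q) f = cup_cochain G V p q \<alpha> f"
  by (simp add: cup_map_def cup_cochain_def del: EM_simps)

lemma cup_map_neg:
  "f \<in> carrier (EM_module G triv i) \<Longrightarrow> i < 0 \<Longrightarrow> cup_map V p \<alpha> i f = \<zero>\<^bsub>EM_module G V (int p + i)\<^esub>"
  by (simp add: cup_map_def)

lemma glists_split:
  assumes "gs \<in> glists (Suc (p + q))"
  shows "drop p gs \<in> glists (Suc q)" "take (Suc p) gs \<in> glists (Suc p)"
  using assms set_drop_subset[of p gs] set_take_subset[of "Suc p" gs] by (auto simp: glists_def)

lemma cup_cochain_apply:
  "gs \<in> glists (Suc (p + q)) \<Longrightarrow> cup_cochain G V p q \<alpha> \<beta> gs = \<beta> (drop p gs) \<odot>\<^bsub>V\<^esub> \<alpha> (take (Suc p) gs)"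
  by (simp add: cup_cochain_def del: of_nat_add)

lemma cup_cochain_closed:
  assumes "kmod V" "\<alpha> \<in> carrier (EM_module G V (int p))" "\<beta> \<in> carrier (EM_module G triv (int q))"
  shows "cup_cochain G V p q \<alpha> \<beta> \<in> carrier (EM_module G V (int (p + q)))"
  unfolding cup_cochain_def EM_simps tuples_nat
proof (rule restrict_PiE_iff[THEN iffD2], intro ballI)
  fix gs assume gs: "gs \<in> glists (Suc (p + q))"
  have "\<beta> (drop p gs) \<in> carrier R" "\<alpha> (take (Suc p) gs) \<in> carrier V"
    using glists_split[OF gs] assms(2,3) by auto
  then show "\<beta> (drop p gs) \<odot>\<^bsub>V\<^esub> \<alpha> (take (Suc p) gs) \<in> carrier V" using assms(1) by simp
qed

lemma EM_diff_cup:
  assumes V: "kmod V" and \<alpha>: "\<alpha> \<in> carrier (EM_module G V (int p))"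
    and \<beta>: "\<beta> \<in> carrier (EM_module G triv (int q))" and gs: "gs \<in> glists (Suc (Suc (p + q)))"
  shows "diff (EM_complex G V) (int (p + q)) (cup_cochain G V p q \<alpha> \<beta>) gs =
    \<beta> (drop (Suc p) gs) \<odot>\<^bsub>V\<^esub> lcob V \<alpha> (take (Suc (Suc p)) gs) \<oplus>\<^bsub>V\<^esub>
    sgn_by V p (lcob triv \<beta> (drop p gs) \<odot>\<^bsub>V\<^esub> \<alpha> (take (Suc p) gs))"
proof -
  have v: "\<alpha> hs \<in> carrier V" if "hs \<in> glists (Suc p)" for hs using that \<alpha> by auto
  have w: "\<beta> hs \<in> carrier R" if "hs \<in> glists (Suc q)" for hs using that \<beta> by auto
  have "lcob V (cup_cochain G V p q \<alpha> \<beta>) gs = lcob V (\<lambda>gs. \<beta> (drop p gs) \<odot>\<^bsub>V\<^esub> \<alpha> (take (Suc p) gs)) gs"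
  proof (rule lcob_cong[OF V gs])
    fix hs assume hs: "hs \<in> glists (Suc (p + q))"
    show "cup_cochain G V p q \<alpha> \<beta> hs = \<beta> (drop p hs) \<odot>\<^bsub>V\<^esub> \<alpha> (take (Suc p) hs)"
      by (rule cup_cochain_apply[OF hs])
    then show "cup_cochain G V p q \<alpha> \<beta> hs \<in> carrier V" using v w glists_split[OF hs] V by simp
  qed
  then show ?thesis using leibniz[of V p \<alpha> q \<beta> gs, OF V v w gs] gs
    by (simp add: EM_diff[OF cup_cochain_closed[OF V \<alpha> \<beta>]] del: of_nat_add)
qed

text \<open>Equivariance is where the invariance of \<alpha> enters: g(\<alpha> cup f) is the
  cup-product of g\<alpha> and gf, and g\<alpha> = \<alpha>. The trivial action on scalars lets g
  pass to the module factor.\<close>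

lemma khom_cup_map:
  assumes V: "kmod V" and \<alpha>: "\<alpha> \<in> carrier (invariant_submodule G (EM_module G V (int p)))"
  shows "cup_map V p \<alpha> i \<in> khom (EM_module G triv i) (EM_module G V (int p + i))"
proof (cases i rule: int_cases_neg)
  case 1
  have "cup_map V p \<alpha> i = (\<lambda>f\<in>carrier (EM_module G triv i). \<zero>\<^bsub>EM_module G V (int p + i)\<^esub>)"
    using 1 by (simp add: cup_map_def)
  then show ?thesis
    using khom_zero_map[OF kmod_EM[OF kmod_trivial, of i] kmod_EM[OF V, of "int p + i"]] by simp
next
  case (2 q)
  let ?M = "EM_module G triv (int q)"
  have a: "\<alpha> \<in> carrier (EM_module G V (int p))" using \<alpha> by simp
  have v: "\<alpha> hs \<in> carrier V" if "hs \<in> glists (Suc p)" for hs using that a by auto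
  have w: "f hs \<in> carrier R" if "hs \<in> glists (Suc q)" "f \<in> carrier ?M" for hs f using that by auto
  have k: "kmod ?M" by (rule kmod_EM[OF kmod_trivial])
  have e: "EM_module G V (int p + int q) = EM_module G V (int (p + q))" by simp
  show ?thesis unfolding 2 e
  proof (rule khomI)
    fix f assume f: "f \<in> carrier ?M"
    show "cup_map V p \<alpha> (int q) f \<in> carrier (EM_module G V (int (p + q)))"
      unfolding cup_map_nat[OF f] by (rule cup_cochain_closed[OF V a f])
    fix h assume h: "h \<in> carrier ?M"
    show "cup_map V p \<alpha> (int q) (f \<oplus>\<^bsub>?M\<^esub> h)
        = cup_map V p \<alpha> (int q) f \<oplus>\<^bsub>EM_module G V (int (p + q))\<^esub> cup_map V p \<alpha> (int q) h"
      unfolding cup_map_nat[OF f] cup_map_nat[OF h] cup_map_nat[OF kmod_closed(2)[OF k f h]]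
      unfolding EM_simps tuples_nat
      by (subst (1) cup_cochain_def, unfold tuples_nat, intro restrict_ext)
        (use f h V v w in \<open>simp add: cup_cochain_apply glists_split kmod_smult(1)\<close>)
  next
    fix r f assume r: "r \<in> carrier R" and f: "f \<in> carrier ?M"
    show "cup_map V p \<alpha> (int q) (r \<odot>\<^bsub>?M\<^esub> f) = r \<odot>\<^bsub>EM_module G V (int (p + q))\<^esub> cup_map V p \<alpha> (int q) f"
      unfolding cup_map_nat[OF f] cup_map_nat[OF kmod_closed(5)[OF k r f]]
      unfolding EM_simps tuples_nat
      by (subst (1) cup_cochain_def, unfold tuples_nat, intro restrict_ext)
        (use r f V v w in \<open>simp add: cup_cochain_apply glists_split kmod_smult(3)\<close>)
  next
    fix g f assume g: "g \<in> carrier G" and f: "f \<in> carrier ?M"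
    let ?\<phi> = "map (\<lambda>h. inv\<^bsub>G\<^esub> g \<otimes>\<^bsub>G\<^esub> h)"
    have \<phi>: "?\<phi> gs \<in> glists m" if "gs \<in> glists m" for gs m
      using that g by (auto simp: glists_def)
    have inv: "\<alpha> hs = act V g (\<alpha> (?\<phi> hs))" if "hs \<in> glists (Suc p)" for hs
    proof -
      have "act (EM_module G V (int p)) g \<alpha> = \<alpha>" using \<alpha> g by simp
      from fun_cong[OF this, of hs] show ?thesis using that by simp
    qed
    show "cup_map V p \<alpha> (int q) (act ?M g f)
        = act (EM_module G V (int (p + q))) g (cup_map V p \<alpha> (int q) f)"
      unfolding cup_map_nat[OF f] cup_map_nat[OF kmod_closed(6)[OF k g f]]
      unfolding EM_simps tuples_nat
    proof (subst (1) cup_cochain_def, unfold tuples_nat, intro restrict_ext)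
      fix gs assume gs: "gs \<in> glists (Suc (p + q))"
      have "f (drop p (?\<phi> gs)) \<odot>\<^bsub>V\<^esub> \<alpha> (take (Suc p) gs)
          = act V g (f (drop p (?\<phi> gs)) \<odot>\<^bsub>V\<^esub> \<alpha> (?\<phi> (take (Suc p) gs)))"
        unfolding inv[OF glists_split(2)[OF gs]]
        using g V w[OF glists_split(1)[OF \<phi>[OF gs]] f] v[OF \<phi>[OF glists_split(2)[OF gs]]]
        by (simp add: kmod_act(2))
      then show "(\<lambda>gs\<in>glists (Suc q). act triv g (f (?\<phi> gs))) (drop p gs) \<odot>\<^bsub>V\<^esub> \<alpha> (take (Suc p) gs)
          = act V g (cup_cochain G V p q \<alpha> f (?\<phi> gs))"
        using glists_split[OF gs] by (simp add: cup_cochain_apply \<phi>[OF gs] drop_map take_map)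
    qed
  next
    show "cup_map V p \<alpha> (int q) f = undefined" if "f \<notin> carrier ?M" for f
      using that by (simp add: cup_map_def del: EM_simps)
  qed
qed

lemma lcob_cocycle:
  assumes "\<alpha> \<in> cocycles (EM_complex G W) (int p)" "gs \<in> glists (Suc (Suc p))"
  shows "lcob W \<alpha> gs = \<zero>\<^bsub>W\<^esub>"
proof -
  have "\<alpha> \<in> carrier (EM_module G W (int p))"
    "diff (EM_complex G W) (int p) \<alpha> = \<zero>\<^bsub>EM_module G W (int p + 1)\<^esub>"
    using assms by (simp_all add: cocycles_def del: EM_simps)
  then show ?thesis using EM_diff[of \<alpha> W p] assms(2) by (auto dest: fun_cong[of _ _ gs])
qed

text \<open>With d\<alpha> = 0 the Leibniz rule becomes d(\<alpha> cup f) = (-1)^p \<alpha> cup df,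
  and (-1)^p is exactly the sign in the differential of the p-th shift. Hence \<open>cup_map\<close>
  itself carries no sign.\<close>

lemma cmap_cup_map:
  assumes V: "kmod V" and \<alpha>: "\<alpha> \<in> carrier (invariant_submodule G (EM_module G V (int p)))"
    and z: "\<alpha> \<in> cocycles (EM_complex G V) (int p)"
  shows "cmap (EM_complex G triv) (cup_map V p \<alpha>) (shift (int p) (EM_complex G V))"
proof (rule cmapI)
  note E = cpx_EM[OF V] and Et = cpx_EM[OF kmod_trivial]
  show "cpx (EM_complex G triv)" "cpx (shift (int p) (EM_complex G V))"
    using E Et by (auto intro: cpx_shift)
  have h: "cup_map V p \<alpha> i \<in> khom (EM_module G triv i) (EM_module G V (int p + i))" for i
    by (rule khom_cup_map[OF V \<alpha>])
  then show "cup_map V p \<alpha> i \<in> khom (ob (EM_complex G triv) i) (ob (shift (int p) (EM_complex G V)) i)" for i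
    by simp
  have a: "\<alpha> \<in> carrier (EM_module G V (int p))" using \<alpha> by simp
  show "cup_map V p \<alpha> (i + 1) (diff (EM_complex G triv) i f)
      = diff (shift (int p) (EM_complex G V)) i (cup_map V p \<alpha> i f)"
    if f: "f \<in> carrier (ob (EM_complex G triv) i)" for i f
  proof (cases i rule: int_cases_neg)
    case 1
    have f': "f \<in> carrier (EM_module G triv i)" using f by simp
    have kz: "cup_map V p \<alpha> j \<zero>\<^bsub>EM_module G triv j\<^esub> = \<zero>\<^bsub>EM_module G V (int p + j)\<^esub>" for j
      using khom_zero[OF kmod_EM[OF kmod_trivial] kmod_EM[OF V] h] .
    have "diff (shift (int p) (EM_complex G V)) i \<zero>\<^bsub>ob (shift (int p) (EM_complex G V)) i\<^esub>
       = \<zero>\<^bsub>ob (shift (int p) (EM_complex G V)) (i + 1)\<^esub>" by (rule cpx_diff_zero[OF cpx_shift[OF E]])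
    then show ?thesis unfolding cup_map_neg[OF f' 1] EM_diff_neg[OF f' 1] kz by (simp del: EM_simps)
  next
    case (2 q)
    have f': "f \<in> carrier (EM_module G triv (int q))" using f 2 by simp
    let ?d = "diff (EM_complex G triv) (int q) f"
    have d: "?d \<in> carrier (EM_module G triv (int (Suc q)))"
      using cpx_diff_closed[OF Et, of f "int q" "int (Suc q)"] f' by (simp del: EM_simps)
    let ?c = "cup_cochain G V p q \<alpha> f"
    have c: "?c \<in> carrier (EM_module G V (int (p + q)))" by (rule cup_cochain_closed[OF V a f'])
    let ?dc = "diff (EM_complex G V) (int (p + q)) ?c"
    have dcc: "?dc \<in> carrier (EM_module G V (int (Suc (p + q))))"
      using cpx_diff_closed[OF E, of ?c "int (p + q)" "int (Suc (p + q))"] c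
      by (simp del: EM_simps of_nat_add)
    have v: "\<alpha> hs \<in> carrier V" if "hs \<in> glists (Suc p)" for hs using that a by auto
    have fv: "f hs \<in> carrier R" if "hs \<in> glists (Suc q)" for hs using that f' by auto
    have dc: "?dc gs = sgn_by V p (cup_cochain G V p (Suc q) \<alpha> ?d gs)" if gs: "gs \<in> glists (Suc (p + Suc q))" for gs
    proof -
      have s: "take (Suc (Suc p)) gs \<in> glists (Suc (Suc p))" "drop (Suc p) gs \<in> glists (Suc q)"
        using gs set_take_subset[of "Suc (Suc p)" gs] set_drop_subset[of "Suc p" gs] by (auto simp: glists_def)
      have t: "drop p gs \<in> glists (Suc (Suc q))" "take (Suc p) gs \<in> glists (Suc p)"
        using glists_split[OF gs] by simp_all
      have l: "lcob triv f (drop p gs) \<in> carrier R"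
        using lcob_closed[OF kmod_trivial t(1), of f] fv by simp
      show ?thesis unfolding cup_cochain_apply[OF gs]
        using EM_diff_cup[OF V a f', of gs] gs lcob_cocycle[OF z s(1)] V fv[OF s(2)] v[OF t(2)] t l
        by (simp add: EM_diff[OF f'] kmod_smult(6) del: EM_simps)
    qed
    have cc: "cup_cochain G V p (Suc q) \<alpha> ?d \<in> carrier (EM_module G V (int (p + Suc q)))"
      by (rule cup_cochain_closed[OF V a d])
    have cv: "cup_cochain G V p (Suc q) \<alpha> ?d gs \<in> carrier V" if "gs \<in> glists (Suc (p + Suc q))" for gs
      using that cc PiE_mem[of _ "glists (Suc (p + Suc q))" "\<lambda>_. carrier V"]
      unfolding EM_simps tuples_nat by blast
    \<comment> \<open>Negation of cochains is pointwise. As it is a definite description, this is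
      derived from uniqueness of inverses.\<close>
    have m: "(\<ominus>\<^bsub>EM_module G V (int (p + Suc q))\<^esub> ?dc) gs = \<ominus>\<^bsub>V\<^esub> ?dc gs" if gs: "gs \<in> glists (Suc (p + Suc q))" for gs
    proof -
      let ?m = "\<lambda>gs\<in>glists (Suc (p + Suc q)). \<ominus>\<^bsub>V\<^esub> ?dc gs"
      have dv: "?dc gs \<in> carrier V" if "gs \<in> glists (Suc (p + Suc q))" for gs
        using that dcc PiE_mem[of _ "glists (Suc (p + Suc q))" "\<lambda>_. carrier V"]
        unfolding EM_simps tuples_nat by simp
      have "\<ominus>\<^bsub>EM_module G V (int (p + Suc q))\<^esub> ?dc = ?m"
      proof (rule kmod_minus_unique[OF kmod_EM[OF V]])
        show "?dc \<in> carrier (EM_module G V (int (p + Suc q)))" using dcc by simp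
        show "?m \<in> carrier (EM_module G V (int (p + Suc q)))" using dv V by (simp del: of_nat_add)
        show "?m \<oplus>\<^bsub>EM_module G V (int (p + Suc q))\<^esub> ?dc = \<zero>\<^bsub>EM_module G V (int (p + Suc q))\<^esub>"
          unfolding EM_simps tuples_nat using dv V by (auto intro!: restrict_ext)
      qed
      then show ?thesis using gs by simp
    qed
    have "cup_cochain G V p (Suc q) \<alpha> ?d
        = (if even (int p) then ?dc else \<ominus>\<^bsub>EM_module G V (int (p + Suc q))\<^esub> ?dc)"
    proof (rule EM_eqI[of _ "glists (Suc (p + Suc q))" "carrier V" _ "carrier V"])
      show "cup_cochain G V p (Suc q) \<alpha> ?d \<in> glists (Suc (p + Suc q)) \<rightarrow>\<^sub>E carrier V"
        using cc by (simp del: of_nat_add)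
      have "\<ominus>\<^bsub>EM_module G V (int (p + Suc q))\<^esub> ?dc \<in> carrier (EM_module G V (int (p + Suc q)))"
        using dcc by (intro kmod_closed(3) kmod_EM V) (simp del: EM_simps of_nat_add)
      then show "(if even (int p) then ?dc else \<ominus>\<^bsub>EM_module G V (int (p + Suc q))\<^esub> ?dc)
          \<in> glists (Suc (p + Suc q)) \<rightarrow>\<^sub>E carrier V"
        using dcc by (simp del: of_nat_add)
      show "cup_cochain G V p (Suc q) \<alpha> ?d gs
          = (if even (int p) then ?dc else \<ominus>\<^bsub>EM_module G V (int (p + Suc q))\<^esub> ?dc) gs"
        if gs: "gs \<in> glists (Suc (p + Suc q))" for gs
        using m[OF gs] dc[OF gs] cv[OF gs] V by (simp add: sgn_by_def)
    qed
    moreover have e: "int q + 1 = int (Suc q)" "int p + int q = int (p + q)" "int (p + q) + 1 = int (p + Suc q)"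
      by simp_all
    have "diff (shift (int p) (EM_complex G V)) (int q) ?c
        = (if even (int p) then ?dc else \<ominus>\<^bsub>EM_module G V (int (p + Suc q))\<^esub> ?dc)"
      using diff_shift[of ?c "EM_complex G V" "int p" "int q"] c unfolding e ob_EM by blast
    ultimately show ?thesis unfolding 2 e(1) cup_map_nat[OF f'] cup_map_nat[OF d] by simp
  qed
qed


subsection \<open>The cup product on Eilenberg--MacLane cohomology\<close>

text \<open>One side negates in the ambient module, the other in the module of invariants;
  \<open>invariant_minus\<close> reconciles them. Chain maps into a shift can thereby be applied to
  the cohomology of invariants.\<close>

lemma invariant_shift:
  assumes "cpx C"
  shows "invariant_complex G (shift n C) = shift n (invariant_complex G C)"
proof (rule cochain_complex.equality)
  show "ob (invariant_complex G (shift n C)) = ob (shift n (invariant_complex G C))"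
    by (rule ext) (simp add: ob_invariant_complex)
  show "diff (invariant_complex G (shift n C)) = diff (shift n (invariant_complex G C))"
  proof (intro ext)
    fix i x
    show "diff (invariant_complex G (shift n C)) i x = diff (shift n (invariant_complex G C)) i x"
    proof (cases "x \<in> carrier (invariant_submodule G (ob C (n + i)))")
      case True
      then have d: "diff C (n + i) x \<in> carrier (invariant_submodule G (ob C (n + i + 1)))"
        using assms cpx_diff_linear(4)[OF assms, of x "n + i", symmetric] by simp
      show ?thesis using True assms invariant_minus[OF cpx_kmod[OF assms] d]
        by (simp add: diff_shift diff_invariant_complex ob_invariant_complex)
    next
      case False
      then show ?thesis by (simp add: invariant_complex_def shift_def del: invariant_simps)
    qed
  qed
qed simp

lemma khom_invariant:
  assumes "f \<in> khom M N" "x \<in> carrier (invariant_submodule G M)"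
  shows "f x \<in> carrier (invariant_submodule G N)"
  using assms(2) by (simp add: khomD(1)[OF assms(1)] khomD(5)[OF assms(1), symmetric])

lemma cocycles_invariant:
  "x \<in> cocycles (invariant_complex G C) n \<longleftrightarrow>
    x \<in> carrier (invariant_submodule G (ob C n)) \<and> x \<in> cocycles C n"
  by (auto simp: cocycles_def ob_invariant_complex diff_invariant_complex)

lemma coboundaries_invariant:
  "b \<in> coboundaries (invariant_complex G C) n \<longleftrightarrow>
    (\<exists>x\<in>carrier (invariant_submodule G (ob C (n - 1))). b = diff C (n - 1) x)"
  unfolding mem_coboundaries by (auto simp: ob_invariant_complex diff_invariant_complex)

text \<open>A coboundary of invariants must have an invariant primitive; equivariance of
  \<open>f\<close> carries one such primitive to another.\<close>

lemma cmap_coboundaries_invariant: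
  assumes "cmap C f D" "b \<in> coboundaries (invariant_complex G C) n"
  shows "f n b \<in> coboundaries (invariant_complex G D) n"
proof -
  obtain x where x: "x \<in> carrier (invariant_submodule G (ob C (n - 1)))" "b = diff C (n - 1) x"
    using assms(2) unfolding coboundaries_invariant by blast
  have "f n b = diff D (n - 1) (f (n - 1) x)" using x cmapD(10)[OF assms(1), of x "n - 1" n] by simp
  then show ?thesis unfolding coboundaries_invariant
    using khom_invariant[OF cmapD(3)[OF assms(1)] x(1)] by blast
qed

abbreviation EM_inv :: "('k, 'g, 'w) kGmod \<Rightarrow> ('k, 'g, 'g list \<Rightarrow> 'w) cochain_complex"
  where "EM_inv W \<equiv> invariant_complex G (EM_complex G W)"

lemma cpx_EM_inv: "kmod W \<Longrightarrow> cpx (EM_inv W)"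
  by (intro cpx_invariant_complex cpx_EM)

lemma EM_inv_cocycleD:
  assumes "\<alpha> \<in> cocycles (EM_inv W) n"
  shows "\<alpha> \<in> carrier (invariant_submodule G (EM_module G W n))" "\<alpha> \<in> cocycles (EM_complex G W) n"
    "\<alpha> \<in> carrier (EM_module G W n)" "\<alpha> \<in> carrier (ob (EM_inv W) n)"
  using assms by (simp_all add: cocycles_invariant ob_invariant_complex del: EM_simps)

lemma cmap_cup:
  assumes "kmod V" "\<alpha> \<in> cocycles (EM_inv V) (int p)"
  shows "cmap (EM_complex G triv) (cup_map V p \<alpha>) (shift (int p) (EM_complex G V))"
  using cmap_cup_map[OF assms(1)] EM_inv_cocycleD[OF assms(2)] by blast

lemma cup_cocycle:
  assumes V: "kmod V" and \<alpha>: "\<alpha> \<in> cocycles (EM_inv V) (int p)"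
    and \<beta>: "\<beta> \<in> cocycles (EM_inv triv) (int q)"
  shows "cup_cochain G V p q \<alpha> \<beta> \<in> cocycles (EM_inv V) (int (p + q))"
proof -
  note m = cmapD[OF cmap_cup[OF V \<alpha>]] and b = EM_inv_cocycleD[OF \<beta>]
  have "cup_map V p \<alpha> (int q) \<beta> \<in> cocycles (shift (int p) (EM_complex G V)) (int q)"
    using b(2,3) m(4)[of \<beta> "int q"] m(10)[of \<beta> "int q" "int q + 1"] m(8)[of "int q + 1"]
    by (simp add: cocycles_def del: EM_simps)
  then have "cup_cochain G V p q \<alpha> \<beta> \<in> cocycles (EM_complex G V) (int (p + q))"
    unfolding cocycles_shift[OF cpx_EM[OF V]] cup_map_nat[OF b(3)] by simp
  moreover have "cup_cochain G V p q \<alpha> \<beta> \<in> carrier (invariant_submodule G (EM_module G V (int (p + q))))"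
    using khom_invariant[OF m(3)[of "int q"], of \<beta>] b(1)
    unfolding cup_map_nat[OF b(3)] ob_EM ob_shift of_nat_add by blast
  ultimately show ?thesis by (simp add: cocycles_invariant del: EM_simps)
qed

text \<open>For a cocycle \<alpha> the map f |-> \<alpha> cup f is an equivariant chain map into a
  shift, so it preserves coboundaries of invariants.\<close>

lemma cup_coboundary_right:
  assumes V: "kmod V" and \<alpha>: "\<alpha> \<in> cocycles (EM_inv V) (int p)"
    and b: "b \<in> coboundaries (EM_inv triv) (int q)"
  shows "cup_cochain G V p q \<alpha> b \<in> coboundaries (EM_inv V) (int (p + q))"
proof -
  note t = cpx_EM_inv[OF kmod_trivial]
  have bc: "b \<in> carrier (EM_module G triv (int q))"
    by (rule EM_inv_cocycleD(3)[OF coboundaries_closed(2)[OF t b]])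
  have "cup_map V p \<alpha> (int q) b \<in> coboundaries (invariant_complex G (shift (int p) (EM_complex G V))) (int q)"
    by (rule cmap_coboundaries_invariant[OF cmap_cup[OF V \<alpha>] b])
  then show ?thesis
    unfolding invariant_shift[OF cpx_EM[OF V]] coboundaries_shift[OF cpx_EM_inv[OF V]] cup_map_nat[OF bc]
    by simp
qed

text \<open>Now the left factor varies, so the Leibniz rule is used directly: if a = d\<gamma> and
  d\<beta> = 0, then a cup \<beta> = d(\<gamma> cup \<beta>), without a sign, and \<gamma> cup
  \<beta> is again invariant.\<close>

lemma cup_coboundary_left:
  assumes V: "kmod V" and a: "a \<in> coboundaries (EM_inv V) (int p)"
    and \<beta>: "\<beta> \<in> cocycles (EM_inv triv) (int q)"
  shows "cup_cochain G V p q a \<beta> \<in> coboundaries (EM_inv V) (int (p + q))"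
proof -
  note b = EM_inv_cocycleD[OF \<beta>]
  have bv: "\<beta> hs \<in> carrier R" if "hs \<in> glists (Suc q)" for hs using that b(3) by auto
  obtain \<gamma> where \<gamma>: "\<gamma> \<in> carrier (invariant_submodule G (EM_module G V (int p - 1)))"
    "a = diff (EM_complex G V) (int p - 1) \<gamma>"
    using a unfolding coboundaries_invariant by auto
  show ?thesis
  proof (cases p)
    case 0
    \<comment> \<open>For p = 0 the primitive lies in degree -1, out of reach of
      \<open>cup_cochain\<close>, whose degrees are natural numbers. The differential is zero there,
      so a = 0.\<close>
    have "\<gamma> \<in> carrier (EM_module G V (- 1))" using \<gamma>(1) 0 by simp
    then have z: "a = \<zero>\<^bsub>EM_module G V (int 0)\<^esub>" using \<gamma>(2) 0 EM_diff_neg[of \<gamma> V "- 1"] by simp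
    have "cup_cochain G V 0 q a \<beta> = \<zero>\<^bsub>EM_module G V (int (0 + q))\<^esub>"
      unfolding cup_cochain_def EM_simps tuples_nat
    proof (intro restrict_ext)
      fix gs assume gs: "gs \<in> glists (Suc (0 + q))"
      show "\<beta> (drop 0 gs) \<odot>\<^bsub>V\<^esub> a (take (Suc 0) gs) = \<zero>\<^bsub>V\<^esub>"
        using glists_split[OF gs] bv V z tuples_nat[of 0] by (simp add: kmod_smult(6))
    qed
    then show ?thesis using 0 coboundaries_closed(3)[OF cpx_EM_inv[OF V], of "int (p + q)"]
      by (simp add: ob_invariant_complex del: EM_simps of_nat_add)
  next
    case (Suc p')
    have g: "\<gamma> \<in> carrier (invariant_submodule G (EM_module G V (int p')))" using \<gamma>(1) Suc by simp
    then have gc: "\<gamma> \<in> carrier (EM_module G V (int p'))" by simp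
    have ad: "a = diff (EM_complex G V) (int p') \<gamma>" using \<gamma>(2) Suc by simp
    have gv: "\<gamma> hs \<in> carrier V" if "hs \<in> glists (Suc p')" for hs using that gc by auto
    let ?c = "cup_cochain G V p' q \<gamma> \<beta>"
    have cc: "?c \<in> carrier (EM_module G V (int (p' + q)))" by (rule cup_cochain_closed[OF V gc b(3)])
    have ci: "?c \<in> carrier (invariant_submodule G (EM_module G V (int (p' + q))))"
      using khom_invariant[OF khom_cup_map[OF V g] b(1)] unfolding cup_map_nat[OF b(3)] of_nat_add .
    have dc: "diff (EM_complex G V) (int (p' + q)) ?c \<in> carrier (EM_module G V (int (Suc (p' + q))))"
      using cpx_diff_closed[OF cpx_EM[OF V], of ?c "int (p' + q)" "int (Suc (p' + q))"] cc
      by (simp del: EM_simps of_nat_add)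
    have ac: "a \<in> carrier (EM_module G V (int p))"
      by (rule EM_inv_cocycleD(3)[OF coboundaries_closed(2)[OF cpx_EM_inv[OF V] a]])
    have "cup_cochain G V p q a \<beta> = diff (EM_complex G V) (int (p' + q)) ?c"
    proof (rule EM_eqI)
      show "cup_cochain G V p q a \<beta> \<in> glists (Suc (p + q)) \<rightarrow>\<^sub>E carrier V"
        using cup_cochain_closed[OF V ac b(3)] unfolding EM_simps tuples_nat .
      show "diff (EM_complex G V) (int (p' + q)) ?c \<in> glists (Suc (p + q)) \<rightarrow>\<^sub>E carrier V"
        using dc Suc unfolding EM_simps tuples_nat by simp
      fix gs assume gs: "gs \<in> glists (Suc (p + q))"
      then have gs': "gs \<in> glists (Suc (Suc (p' + q)))" using Suc by simp
      have s: "drop p gs \<in> glists (Suc q)" "take (Suc p) gs \<in> glists (Suc p)" using glists_split[OF gs] .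
      have t: "drop p' gs \<in> glists (Suc (Suc q))" "take (Suc p') gs \<in> glists (Suc p')"
        using glists_split[of gs p' "Suc q"] gs' by simp_all
      have l: "lcob V \<gamma> (take (Suc p) gs) \<in> carrier V"
        using s(2) gv V Suc by (intro lcob_closed[of _ _ "Suc p'"]) auto
      have z: "lcob triv \<beta> (drop p' gs) \<odot>\<^bsub>V\<^esub> \<gamma> (take (Suc p') gs) = \<zero>\<^bsub>V\<^esub>"
        using lcob_cocycle[OF b(2) t(1)] V gv[OF t(2)] by (simp add: kmod_smult(7))
      have "a (take (Suc p) gs) = lcob V \<gamma> (take (Suc p) gs)"
        unfolding ad EM_diff[OF gc] using s(2) Suc by simp
      moreover have "sgn_by V p' \<zero>\<^bsub>V\<^esub> = \<zero>\<^bsub>V\<^esub>" using V by (simp add: sgn_by_def)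
      ultimately show "cup_cochain G V p q a \<beta> gs = diff (EM_complex G V) (int (p' + q)) ?c gs"
        unfolding EM_diff_cup[OF V gc b(3) gs'] cup_cochain_apply[OF gs] z
        using V l bv[OF s(1)] Suc by simp
    qed
    moreover have e: "int (p + q) - 1 = int (p' + q)" using Suc by simp
    ultimately show ?thesis unfolding coboundaries_invariant e ob_EM using ci by blast
  qed
qed

section \<open>Bilinearity of the cup-product on cochains and on classes\<close>

lemma cup_add_left:
  assumes V: "kmod V" and "\<alpha> \<in> carrier (EM_module G V (int p))" "\<alpha>' \<in> carrier (EM_module G V (int p))"
    "\<beta> \<in> carrier (EM_module G triv (int q))"
  shows "cup_cochain G V p q (\<alpha> \<oplus>\<^bsub>EM_module G V (int p)\<^esub> \<alpha>') \<beta>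
    = cup_cochain G V p q \<alpha> \<beta> \<oplus>\<^bsub>EM_module G V (int (p + q))\<^esub> cup_cochain G V p q \<alpha>' \<beta>"
  unfolding EM_simps tuples_nat
proof (subst (1) cup_cochain_def, unfold tuples_nat, intro restrict_ext)
  fix gs assume gs: "gs \<in> glists (Suc (p + q))"
  note s = glists_split[OF gs]
  have "\<alpha> (take (Suc p) gs) \<in> carrier V" "\<alpha>' (take (Suc p) gs) \<in> carrier V" "\<beta> (drop p gs) \<in> carrier R"
    using s assms by auto
  then show "\<beta> (drop p gs) \<odot>\<^bsub>V\<^esub> (\<lambda>gs\<in>glists (Suc p). \<alpha> gs \<oplus>\<^bsub>V\<^esub> \<alpha>' gs) (take (Suc p) gs)
      = cup_cochain G V p q \<alpha> \<beta> gs \<oplus>\<^bsub>V\<^esub> cup_cochain G V p q \<alpha>' \<beta> gs"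
    using V s by (simp add: cup_cochain_apply[OF gs] kmod_smult(2))
qed

lemma cup_smult_left:
  assumes V: "kmod V" and "\<alpha> \<in> carrier (EM_module G V (int p))"
    "\<beta> \<in> carrier (EM_module G triv (int q))" and r: "r \<in> carrier R"
  shows "cup_cochain G V p q (r \<odot>\<^bsub>EM_module G V (int p)\<^esub> \<alpha>) \<beta>
    = cup_cochain G V p q \<alpha> (r \<odot>\<^bsub>EM_module G triv (int q)\<^esub> \<beta>)"
  unfolding EM_simps tuples_nat unfolding cup_cochain_def tuples_nat
proof (intro restrict_ext)
  fix gs assume gs: "gs \<in> glists (Suc (p + q))"
  note s = glists_split[OF gs]
  have ab: "\<alpha> (take (Suc p) gs) \<in> carrier V" "\<beta> (drop p gs) \<in> carrier R"
    using s assms by auto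
  \<comment> \<open>Commutativity of \<open>R\<close> moves \<open>r\<close> from the module factor
    to the scalar factor.\<close>
  then have "\<beta> (drop p gs) \<odot>\<^bsub>V\<^esub> (r \<odot>\<^bsub>V\<^esub> \<alpha> (take (Suc p) gs))
      = (r \<otimes>\<^bsub>R\<^esub> \<beta> (drop p gs)) \<odot>\<^bsub>V\<^esub> \<alpha> (take (Suc p) gs)"
    using V r by (metis cring.cring_simprules(14) cring_R kmod_smult(3))
  then show "\<beta> (drop p gs) \<odot>\<^bsub>V\<^esub> (\<lambda>gs\<in>glists (Suc p). r \<odot>\<^bsub>V\<^esub> \<alpha> gs) (take (Suc p) gs)
      = (\<lambda>gs\<in>glists (Suc q). r \<odot>\<^bsub>triv\<^esub> \<beta> gs) (drop p gs) \<odot>\<^bsub>V\<^esub> \<alpha> (take (Suc p) gs)"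
    using s by simp
qed

lemma cup_add_right:
  assumes V: "kmod V" and \<alpha>: "\<alpha> \<in> cocycles (EM_inv V) (int p)"
    and b: "\<beta> \<in> carrier (EM_module G triv (int q))" "\<beta>' \<in> carrier (EM_module G triv (int q))"
  shows "cup_cochain G V p q \<alpha> (\<beta> \<oplus>\<^bsub>EM_module G triv (int q)\<^esub> \<beta>')
    = cup_cochain G V p q \<alpha> \<beta> \<oplus>\<^bsub>EM_module G V (int (p + q))\<^esub> cup_cochain G V p q \<alpha> \<beta>'"
proof -
  have "\<beta> \<oplus>\<^bsub>EM_module G triv (int q)\<^esub> \<beta>' \<in> carrier (EM_module G triv (int q))"
    using b kmod_EM[OF kmod_trivial] by (intro kmod_closed(2))
  then show ?thesis
    using cmapD(5)[OF cmap_cup[OF V \<alpha>], of \<beta> "int q" \<beta>'] b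
    by (simp add: cup_map_nat[symmetric] del: EM_simps)
qed

text \<open>u cup v - \<alpha> cup \<beta> = u cup (v - \<beta>) + (u - \<alpha>) cup \<beta>, where
  the first term is a coboundary because u is again a cocycle, and the second because \<beta> is
  one.\<close>

lemma cup_EM_class:
  assumes V: "kmod V" and \<alpha>: "\<alpha> \<in> cocycles (EM_inv V) (int p)"
    and \<beta>: "\<beta> \<in> cocycles (EM_inv triv) (int q)"
  shows "cup_EM G V p q (coh_class (EM_inv V) (int p) \<alpha>) (coh_class (EM_inv triv) (int q) \<beta>)
    = coh_class (EM_inv V) (int (p + q)) (cup_cochain G V p q \<alpha> \<beta>)"
  unfolding cup_EM_def
proof (rule induced2_eq)
  note c = cpx_EM_inv[OF V] and t = cpx_EM_inv[OF kmod_trivial]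
  note a = EM_inv_cocycleD[OF \<alpha>] and b = EM_inv_cocycleD[OF \<beta>]
  show "\<alpha> \<in> coh_class (EM_inv V) (int p) \<alpha>" "\<beta> \<in> coh_class (EM_inv triv) (int q) \<beta>"
    using a(4) b(4) c t by (auto intro: coh_class_self)
  fix u v assume u: "u \<in> coh_class (EM_inv V) (int p) \<alpha>" and v: "v \<in> coh_class (EM_inv triv) (int q) \<beta>"
  have uz: "u \<in> cocycles (EM_inv V) (int p)" and vz: "v \<in> cocycles (EM_inv triv) (int q)"
    using coh_class_cocycle[OF c \<alpha> u] coh_class_cocycle[OF t \<beta> v] .
  note u' = EM_inv_cocycleD[OF uz] and v' = EM_inv_cocycleD[OF vz]
  let ?e = "u \<ominus>\<^bsub>ob (EM_inv V) (int p)\<^esub> \<alpha>" and ?d = "v \<ominus>\<^bsub>ob (EM_inv triv) (int q)\<^esub> \<beta>"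
  have e: "?e \<in> coboundaries (EM_inv V) (int p)" and d: "?d \<in> coboundaries (EM_inv triv) (int q)"
    using u v mem_coh_class[OF c a(4)] mem_coh_class[OF t b(4)] by blast+
  have ec: "?e \<in> carrier (EM_module G V (int p))" and dc: "?d \<in> carrier (EM_module G triv (int q))"
    using EM_inv_cocycleD(3)[OF coboundaries_closed(2)[OF c e]] EM_inv_cocycleD(3)[OF coboundaries_closed(2)[OF t d]] .
  have "?e \<oplus>\<^bsub>ob (EM_inv V) (int p)\<^esub> \<alpha> = u" "?d \<oplus>\<^bsub>ob (EM_inv triv) (int q)\<^esub> \<beta> = v"
    using cpx_kmod[OF c, of "int p"] cpx_kmod[OF t, of "int q"] a(4) b(4) u'(4) v'(4)
    by (simp_all add: kmod_grp kmod_cancel del: cpx_kmod)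
  then have ue: "?e \<oplus>\<^bsub>EM_module G V (int p)\<^esub> \<alpha> = u" and vd: "?d \<oplus>\<^bsub>EM_module G triv (int q)\<^esub> \<beta> = v"
    by (simp_all add: ob_invariant_complex del: EM_simps)
  let ?M = "EM_module G V (int (p + q))" and ?N = "ob (EM_inv V) (int (p + q))"
  let ?c = "cup_cochain G V p q"
  have 1: "?c u ?d \<in> coboundaries (EM_inv V) (int (p + q))" by (rule cup_coboundary_right[OF V uz d])
  have 2: "?c ?e \<beta> \<in> coboundaries (EM_inv V) (int (p + q))" by (rule cup_coboundary_left[OF V e \<beta>])
  have uv: "?c u v = ?c u ?d \<oplus>\<^bsub>?M\<^esub> ?c u \<beta>" using cup_add_right[OF V uz dc b(3)] vd by simp
  have "?c u \<beta> = ?c ?e \<beta> \<oplus>\<^bsub>?M\<^esub> ?c \<alpha> \<beta>" using cup_add_left[OF V ec a(3) b(3)] ue by simp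
  then have eq: "?c u v = ?c u ?d \<oplus>\<^bsub>?N\<^esub> (?c ?e \<beta> \<oplus>\<^bsub>?N\<^esub> ?c \<alpha> \<beta>)"
    unfolding uv by (simp add: ob_invariant_complex del: EM_simps)
  have m: "?c u v \<in> carrier ?N" "?c \<alpha> \<beta> \<in> carrier ?N" "?c u ?d \<in> carrier ?N" "?c ?e \<beta> \<in> carrier ?N"
    using EM_inv_cocycleD(4)[OF cup_cocycle[OF V uz vz]] EM_inv_cocycleD(4)[OF cup_cocycle[OF V \<alpha> \<beta>]]
      coboundaries_closed(1)[OF c 1] coboundaries_closed(1)[OF c 2] by blast+
  have "?c u v \<ominus>\<^bsub>?N\<^esub> ?c \<alpha> \<beta> = ?c u ?d \<oplus>\<^bsub>?N\<^esub> ?c ?e \<beta>"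
    unfolding eq using m(2-4) cpx_kmod[OF c, of "int (p + q)"]
    by (simp add: kmod_grp kmod_cancel del: cpx_kmod)
  then show "coh_class (EM_inv V) (int (p + q)) (?c u v) = coh_class (EM_inv V) (int (p + q)) (?c \<alpha> \<beta>)"
    using coboundaries_closed(4)[OF c 1 2] coh_class_eq[OF c m(1,2)] by simp
qed

lemma EM_inv_ops:
  "x \<oplus>\<^bsub>ob (EM_inv W) n\<^esub> y = x \<oplus>\<^bsub>EM_module G W n\<^esub> y" "r \<odot>\<^bsub>ob (EM_inv W) n\<^esub> x = r \<odot>\<^bsub>EM_module G W n\<^esub> x"
  "\<zero>\<^bsub>ob (EM_inv W) n\<^esub> = \<zero>\<^bsub>EM_module G W n\<^esub>"
  by (simp_all add: ob_invariant_complex del: EM_simps)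

lemma bilinear_cup_EM:
  assumes V: "kmod V"
  shows "tensor_bilinear R (H_EM G V p) (H_EM G triv q) (H_EM G V (p + q)) (cup_EM G V p q)"
  unfolding tensor_bilinear_def H_EM_def
proof (intro conjI ballI)
  note c = cpx_EM_inv[OF V] and t = cpx_EM_inv[OF kmod_trivial]
  let ?p = "coh_class (EM_inv V) (int p)" and ?q = "coh_class (EM_inv triv) (int q)"
  let ?r = "coh_class (EM_inv V) (int (p + q))"
  fix Y assume "Y \<in> carrier (cohomology (EM_inv triv) (int q))"
  then obtain y where y: "Y = ?q y" "y \<in> cocycles (EM_inv triv) (int q)" by (auto simp: carrier_coh)
  note y' = EM_inv_cocycleD[OF y(2)]
  have z: "\<zero>\<^bsub>ob (EM_inv V) (int p)\<^esub> \<in> cocycles (EM_inv V) (int p)" by (rule cocycles_closed(2)[OF c])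
  have "cup_cochain G V p q \<zero>\<^bsub>ob (EM_inv V) (int p)\<^esub> y \<in> coboundaries (EM_inv V) (int (p + q))"
    by (rule cup_coboundary_left[OF V coboundaries_closed(3)[OF c] y(2)])
  moreover have "cup_cochain G V p q \<zero>\<^bsub>ob (EM_inv V) (int p)\<^esub> y \<in> carrier (ob (EM_inv V) (int (p + q)))"
    by (rule EM_inv_cocycleD(4)[OF cup_cocycle[OF V z y(2)]])
  ultimately have "?r (cup_cochain G V p q \<zero>\<^bsub>ob (EM_inv V) (int p)\<^esub> y) = ?r \<zero>\<^bsub>ob (EM_inv V) (int (p + q))\<^esub>"
    using c cpx_kmod[OF c, of "int (p + q)"] by (simp add: coh_class_eq del: cpx_kmod)
  then show "cup_EM G V p q \<zero>\<^bsub>cohomology (EM_inv V) (int p)\<^esub> Y = \<zero>\<^bsub>cohomology (EM_inv V) (int (p + q))\<^esub>"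
    unfolding coh_zero[OF c] y(1) cup_EM_class[OF V z y(2)] .
  fix X assume "X \<in> carrier (cohomology (EM_inv V) (int p))"
  then obtain x where x: "X = ?p x" "x \<in> cocycles (EM_inv V) (int p)" by (auto simp: carrier_coh)
  note x' = EM_inv_cocycleD[OF x(2)]
  note xy = cup_cocycle[OF V x(2) y(2)]
  show "cup_EM G V p q X Y \<in> carrier (cohomology (EM_inv V) (int (p + q)))"
    unfolding x(1) y(1) cup_EM_class[OF V x(2) y(2)] carrier_coh using xy by (rule imageI)
  { fix X' assume "X' \<in> carrier (cohomology (EM_inv V) (int p))"
    then obtain w where w: "X' = ?p w" "w \<in> cocycles (EM_inv V) (int p)" by (auto simp: carrier_coh)
    note w' = EM_inv_cocycleD[OF w(2)]
    show "cup_EM G V p q (X \<oplus>\<^bsub>cohomology (EM_inv V) (int p)\<^esub> X') Y =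
        cup_EM G V p q X Y \<oplus>\<^bsub>cohomology (EM_inv V) (int (p + q))\<^esub> cup_EM G V p q X' Y"
      unfolding x(1) y(1) w(1) coh_add[OF c x'(4) w'(4)] cup_EM_class[OF V x(2) y(2)]
        cup_EM_class[OF V w(2) y(2)] cup_EM_class[OF V cocycles_closed(3)[OF c x(2) w(2)] y(2)]
        coh_add[OF c EM_inv_cocycleD(4)[OF xy] EM_inv_cocycleD(4)[OF cup_cocycle[OF V w(2) y(2)]]]
      unfolding EM_inv_ops cup_add_left[OF V x'(3) w'(3) y'(3)] .. }
  { fix Y' assume "Y' \<in> carrier (cohomology (EM_inv triv) (int q))"
    then obtain w where w: "Y' = ?q w" "w \<in> cocycles (EM_inv triv) (int q)" by (auto simp: carrier_coh)
    note w' = EM_inv_cocycleD[OF w(2)]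
    show "cup_EM G V p q X (Y \<oplus>\<^bsub>cohomology (EM_inv triv) (int q)\<^esub> Y') =
        cup_EM G V p q X Y \<oplus>\<^bsub>cohomology (EM_inv V) (int (p + q))\<^esub> cup_EM G V p q X Y'"
      unfolding x(1) y(1) w(1) coh_add[OF t y'(4) w'(4)] cup_EM_class[OF V x(2) y(2)]
        cup_EM_class[OF V x(2) w(2)] cup_EM_class[OF V x(2) cocycles_closed(3)[OF t y(2) w(2)]]
        coh_add[OF c EM_inv_cocycleD(4)[OF xy] EM_inv_cocycleD(4)[OF cup_cocycle[OF V x(2) w(2)]]]
      unfolding EM_inv_ops cup_add_right[OF V x(2) y'(3) w'(3)] .. }
  { fix r assume r: "r \<in> carrier R"
    note rx = cocycles_closed(4)[OF c x(2) r] and ry = cocycles_closed(4)[OF t y(2) r]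
    show "cup_EM G V p q (r \<odot>\<^bsub>cohomology (EM_inv V) (int p)\<^esub> X) Y
        = cup_EM G V p q X (r \<odot>\<^bsub>cohomology (EM_inv triv) (int q)\<^esub> Y)"
      unfolding x(1) y(1) coh_smult[OF c x(2) r] coh_smult[OF t y(2) r]
        cup_EM_class[OF V rx y(2)] cup_EM_class[OF V x(2) ry]
      unfolding EM_inv_ops cup_smult_left[OF V x'(3) y'(3) r] ..
    show "cup_EM G V p q (r \<odot>\<^bsub>cohomology (EM_inv V) (int p)\<^esub> X) Y
        \<in> carrier (cohomology (EM_inv V) (int (p + q)))"
      unfolding x(1) y(1) coh_smult[OF c x(2) r] cup_EM_class[OF V rx y(2)] carrier_coh
      using cup_cocycle[OF V rx y(2)] by (rule imageI) }
qed


section \<open>Cocycles as chain maps\<close>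

abbreviation kc :: "('k, 'g, 'k) cochain_complex" where "kc \<equiv> conc triv"

lemma cpx_kc: "cpx kc"
  by (rule cpx_conc[OF kmod_trivial])

lemma cocycle_map_apply:
  "c \<in> carrier R \<Longrightarrow> cocycle_map G R W n \<alpha> 0 c = c \<odot>\<^bsub>EM_module G W n\<^esub> \<alpha>"
  "i \<noteq> 0 \<Longrightarrow> cocycle_map G R W n \<alpha> i \<zero>\<^bsub>R\<^esub> = \<zero>\<^bsub>EM_module G W (n + i)\<^esub>"
  by (simp_all add: cocycle_map_def carrier_conc del: EM_simps)

lemma carrier_kc: "c \<in> carrier (ob kc i) \<Longrightarrow> c \<in> carrier R" "i \<noteq> 0 \<Longrightarrow> c \<in> carrier (ob kc i) \<Longrightarrow> c = \<zero>\<^bsub>R\<^esub>"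
  "carrier (ob kc 0) = carrier R"
  using cring.cring_simprules(2)[OF cring_R] by (auto simp: carrier_conc split: if_splits)

text \<open>Formulated for invariant cochains because it serves twice: cocycles give chain maps, and
  primitives of coboundaries give homotopies.\<close>

lemma khom_cocycle_map:
  assumes W: "kmod W" and \<alpha>: "\<alpha> \<in> carrier (invariant_submodule G (EM_module G W n))"
  shows "cocycle_map G R W n \<alpha> i \<in> khom (ob kc i) (EM_module G W (n + i))"
proof (cases "i = 0")
  case True
  interpret cring R by (rule cring_R)
  have k: "kmod (EM_module G W n)" using W by (rule kmod_EM)
  have a: "\<alpha> \<in> carrier (EM_module G W n)" "\<And>g. g \<in> carrier G \<Longrightarrow> act (EM_module G W n) g \<alpha> = \<alpha>"
    using \<alpha> by (simp_all del: EM_simps)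
  have "(\<lambda>c\<in>carrier R. c \<odot>\<^bsub>EM_module G W n\<^esub> \<alpha>) \<in> khom triv (EM_module G W n)"
    using k a by (intro khomI) (simp_all add: kmod_smult(1,3) kmod_act(2) del: EM_simps)
  then show ?thesis using True by (simp add: cocycle_map_def ob_conc del: EM_simps)
next
  case False
  have "cocycle_map G R W n \<alpha> i = (\<lambda>c\<in>carrier (ob kc i). \<zero>\<^bsub>EM_module G W (n + i)\<^esub>)"
    using False by (simp add: cocycle_map_def del: EM_simps)
  then show ?thesis using khom_zero_map[OF cpx_kmod[OF cpx_kc] kmod_EM[OF W]] by simp
qed

lemma cmap_cocycle_map:
  assumes W: "kmod W" and \<alpha>: "\<alpha> \<in> cocycles (EM_inv W) n"
  shows "cmap kc (cocycle_map G R W n \<alpha>) (shift n (EM_complex G W))"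
proof (rule cmapI[OF cpx_kc cpx_shift[OF cpx_EM[OF W]]])
  note a = EM_inv_cocycleD[OF \<alpha>] and E = cpx_EM[OF W]
  note S = cpx_shift[OF E, of n]
  show h: "cocycle_map G R W n \<alpha> i \<in> khom (ob kc i) (ob (shift n (EM_complex G W)) i)" for i
    using khom_cocycle_map[OF W a(1)] by simp
  have z: "diff (shift n (EM_complex G W)) 0 \<alpha> = \<zero>\<^bsub>EM_module G W (n + 1)\<^esub>"
  proof -
    have "\<alpha> \<in> cocycles (shift n (EM_complex G W)) 0"
      using a(2) by (simp add: cocycles_shift[OF E])
    then show ?thesis by (simp add: cocycles_def del: EM_simps)
  qed
  show "cocycle_map G R W n \<alpha> (i + 1) (diff kc i c)
      = diff (shift n (EM_complex G W)) i (cocycle_map G R W n \<alpha> i c)"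
    if c: "c \<in> carrier (ob kc i)" for i c
  proof (cases "i = 0")
    case True
    have "diff (shift n (EM_complex G W)) 0 (c \<odot>\<^bsub>EM_module G W n\<^esub> \<alpha>) = \<zero>\<^bsub>EM_module G W (n + 1)\<^esub>"
      using cpx_diff_linear(3)[OF S, of \<alpha> 0 c] a(3) carrier_kc(1)[OF c] z kmod_EM[OF W, of "n + 1"]
      by (simp add: kmod_smult(6) del: EM_simps)
    then show ?thesis using True c carrier_kc(1)[OF c] cocycle_map_apply(2)[of 1 W n \<alpha>]
      by (simp add: diff_conc cocycle_map_apply(1) del: EM_simps)
  next
    case False
    have "c = \<zero>\<^bsub>R\<^esub>" using carrier_kc(2)[OF False c] .
    then show ?thesis using False c khom_zero[OF cpx_kmod[OF cpx_kc, of "i + 1"] cpx_kmod[OF S, of "i + 1"] h]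
      cpx_diff_zero[OF S, of i] by (simp add: diff_conc cocycle_map_apply(2) del: EM_simps)
  qed
qed

text \<open>Outside degree zero the only element of \<open>kc\<close> is zero, which both maps send
  to zero.\<close>

lemma cocycle_map_eqI:
  assumes "cmap kc f (shift n (EM_complex G W))" "cmap kc f' (shift n (EM_complex G W))"
    and "\<And>c. c \<in> carrier R \<Longrightarrow> f 0 c = f' 0 c"
  shows "f = f'"
proof (rule cmap_eqI[OF assms(1,2)])
  show "f i x = f' i x" if "x \<in> carrier (ob kc i)" for i x
    using that assms(3) carrier_kc(1)[of x i] carrier_kc(2)[of i x] cmapD(8)[OF assms(1), of i] cmapD(8)[OF assms(2), of i]
    by (cases "i = 0") (auto simp del: EM_simps)
qed

lemma cocycle_map_add:
  assumes W: "kmod W" and \<alpha>: "\<alpha> \<in> cocycles (EM_inv W) n" "\<beta> \<in> cocycles (EM_inv W) n"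
  shows "cocycle_map G R W n (\<alpha> \<oplus>\<^bsub>EM_module G W n\<^esub> \<beta>)
    = add_map kc (shift n (EM_complex G W)) (cocycle_map G R W n \<alpha>) (cocycle_map G R W n \<beta>)"
proof (rule cocycle_map_eqI[OF cmap_cocycle_map[OF W]])
  show "\<alpha> \<oplus>\<^bsub>EM_module G W n\<^esub> \<beta> \<in> cocycles (EM_inv W) n"
    using cocycles_closed(3)[OF cpx_EM_inv[OF W] \<alpha>] unfolding EM_inv_ops .
qed (use EM_inv_cocycleD(3)[OF \<alpha>(1)] EM_inv_cocycleD(3)[OF \<alpha>(2)] kmod_EM[OF W, of n] carrier_kc(3)
    in \<open>simp_all add: cmap_add cmap_cocycle_map W \<alpha> cocycle_map_apply(1) kmod_smult(2) del: EM_simps\<close>)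

lemma cocycle_map_zero:
  assumes W: "kmod W"
  shows "cocycle_map G R W n \<zero>\<^bsub>EM_module G W n\<^esub> = zero_map kc (shift n (EM_complex G W))"
proof (rule cocycle_map_eqI[OF cmap_cocycle_map[OF W] cmap_zero])
  show "\<zero>\<^bsub>EM_module G W n\<^esub> \<in> cocycles (EM_inv W) n"
    using cocycles_closed(2)[OF cpx_EM_inv[OF W], of n] unfolding EM_inv_ops .
qed (use cpx_kc cpx_shift[OF cpx_EM[OF W]] kmod_EM[OF W, of n] carrier_kc(3)
    in \<open>simp_all add: cocycle_map_apply(1) kmod_smult(6) del: EM_simps\<close>)

lemma cocycle_map_scalar:
  assumes W: "kmod W" and \<alpha>: "\<alpha> \<in> cocycles (EM_inv W) n" and r: "r \<in> carrier R"
  shows "cocycle_map G R W n (r \<odot>\<^bsub>EM_module G W n\<^esub> \<alpha>)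
    = comp_map kc (scalar_map r (shift n (EM_complex G W))) (cocycle_map G R W n \<alpha>)"
proof (rule cocycle_map_eqI[OF cmap_cocycle_map[OF W] cmap_comp[OF cmap_cocycle_map[OF W \<alpha>] cmap_scalar]])
  show "r \<odot>\<^bsub>EM_module G W n\<^esub> \<alpha> \<in> cocycles (EM_inv W) n"
    using cocycles_closed(4)[OF cpx_EM_inv[OF W] \<alpha> r] unfolding EM_inv_ops .
  note a = EM_inv_cocycleD(3)[OF \<alpha>] and k = kmod_EM[OF W, of n]
  show "cocycle_map G R W n (r \<odot>\<^bsub>EM_module G W n\<^esub> \<alpha>) 0 c
      = comp_map kc (scalar_map r (shift n (EM_complex G W))) (cocycle_map G R W n \<alpha>) 0 c"
    if c: "c \<in> carrier R" for c
  proof -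
    have "c \<odot>\<^bsub>EM_module G W n\<^esub> (r \<odot>\<^bsub>EM_module G W n\<^esub> \<alpha>) = r \<odot>\<^bsub>EM_module G W n\<^esub> (c \<odot>\<^bsub>EM_module G W n\<^esub> \<alpha>)"
      using k a c r by (metis cring.cring_simprules(14) cring_R kmod_smult(3))
    then show ?thesis using c k a carrier_kc(3) by (simp add: cocycle_map_apply(1) del: EM_simps)
  qed
qed (use r cpx_shift[OF cpx_EM[OF W]] in simp_all)

text \<open>The homotopy is the map c |-> c\<gamma> for a primitive \<gamma> of the difference. The
  primitive is chosen in the shifted complex, which absorbs the sign of the shifted differential;
  the other homotopy term vanishes since \<open>kc\<close> has zero differential.\<close>

lemma cocycle_map_homotopic:
  assumes W: "kmod W" and \<alpha>: "\<alpha> \<in> cocycles (EM_inv W) n" "\<beta> \<in> cocycles (EM_inv W) n"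
    and d: "\<beta> \<ominus>\<^bsub>ob (EM_inv W) n\<^esub> \<alpha> \<in> coboundaries (EM_inv W) n"
  shows "homotopic G R kc (shift n (EM_complex G W)) (cocycle_map G R W n \<beta>) (cocycle_map G R W n \<alpha>)"
proof -
  note E = cpx_EM[OF W] and I = cpx_EM_inv[OF W]
  note S = cpx_shift[OF E, of n]
  let ?S = "shift n (EM_complex G W)"
  have "\<beta> \<ominus>\<^bsub>ob (EM_inv W) n\<^esub> \<alpha> \<in> coboundaries (invariant_complex G ?S) 0"
    unfolding invariant_shift[OF E] coboundaries_shift[OF I] using d by simp
  then obtain \<gamma> where g: "\<gamma> \<in> carrier (invariant_submodule G (EM_module G W (n - 1)))"
    "\<beta> \<ominus>\<^bsub>ob (EM_inv W) n\<^esub> \<alpha> = diff ?S (- 1) \<gamma>"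
    unfolding coboundaries_invariant by auto
  have gc: "\<gamma> \<in> carrier (ob ?S (- 1))" using g(1) by (simp del: EM_simps)
  note ac = EM_inv_cocycleD[OF \<alpha>(1)] and bc = EM_inv_cocycleD[OF \<alpha>(2)]
  let ?M = "EM_module G W n"
  have k: "kmod ?M" by (rule kmod_EM[OF W])
  have "(\<beta> \<ominus>\<^bsub>ob (EM_inv W) n\<^esub> \<alpha>) \<oplus>\<^bsub>ob (EM_inv W) n\<^esub> \<alpha> = \<beta>"
    using cpx_kmod[OF I, of n] ac(4) bc(4) by (simp add: kmod_grp kmod_cancel del: cpx_kmod)
  then have "diff ?S (- 1) \<gamma> \<oplus>\<^bsub>?M\<^esub> \<alpha> = \<beta>" unfolding EM_inv_ops g(2) .
  moreover have dg: "diff ?S (- 1) \<gamma> \<in> carrier ?M"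
    using cpx_diff_closed[OF S gc, of 0] by (simp del: EM_simps)
  ultimately have dd: "\<beta> \<ominus>\<^bsub>?M\<^esub> \<alpha> = diff ?S (- 1) \<gamma>"
    using k ac(3) by (auto simp: kmod_grp kmod_cancel simp del: EM_simps)
  let ?h = "cocycle_map G R W (n - 1) \<gamma>"
  \<comment> \<open>A map of degree -1 into the n-th shift and a map of degree 0 into the (n-1)-st
    shift have the same modules as targets, up to this reindexing.\<close>
  have i: "n - 1 + i = n + (i - 1)" for i by simp
  show ?thesis unfolding homotopic_def
  proof (intro conjI exI[of _ ?h] allI ballI)
    show "cmap kc (cocycle_map G R W n \<beta>) ?S" "cmap kc (cocycle_map G R W n \<alpha>) ?S"
      using W \<alpha> by (auto intro: cmap_cocycle_map)
    show h: "?h i \<in> khom (ob kc i) (ob ?S (i - 1))" for i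
      using khom_cocycle_map[OF W g(1), of i] unfolding i by simp
    show "cocycle_map G R W n \<beta> i c \<ominus>\<^bsub>ob ?S i\<^esub> cocycle_map G R W n \<alpha> i c
        = diff ?S (i - 1) (?h i c) \<oplus>\<^bsub>ob ?S i\<^esub> ?h (i + 1) (diff kc i c)"
      if c: "c \<in> carrier (ob kc i)" for i c
    proof -
      have hz: "?h (i + 1) (diff kc i c) = \<zero>\<^bsub>ob ?S i\<^esub>"
        using c khom_zero[OF cpx_kmod[OF cpx_kc] cpx_kmod[OF S] h, of "i + 1"]
        by (simp add: diff_conc del: EM_simps)
      show ?thesis
      proof (cases "i = 0")
        case True
        have cR: "c \<in> carrier R" using carrier_kc(1)[OF c] .
        have "diff ?S (- 1) (c \<odot>\<^bsub>ob ?S (- 1)\<^esub> \<gamma>) = c \<odot>\<^bsub>?M\<^esub> diff ?S (- 1) \<gamma>"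
          using cpx_diff_linear(3)[OF S gc cR] by (simp del: EM_simps)
        also have "\<dots> = c \<odot>\<^bsub>?M\<^esub> \<beta> \<ominus>\<^bsub>?M\<^esub> c \<odot>\<^bsub>?M\<^esub> \<alpha>"
          unfolding dd[symmetric] using k ac(3) bc(3) cR
          by (simp add: kmod_grp(7) kmod_smult(2,5) del: EM_simps)
        finally show ?thesis unfolding hz using True cR k ac(3) bc(3)
          by (simp add: cocycle_map_apply(1) del: EM_simps)
      next
        case False
        have "c = \<zero>\<^bsub>R\<^esub>" using carrier_kc(2)[OF False c] .
        moreover have "diff ?S (i - 1) \<zero>\<^bsub>ob ?S (i - 1)\<^esub> = \<zero>\<^bsub>ob ?S i\<^esub>"
          using cpx_diff_zero[OF S, of "i - 1"] by simp
        moreover have "?h i \<zero>\<^bsub>R\<^esub> = \<zero>\<^bsub>ob ?S (i - 1)\<^esub>"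
          using cocycle_map_apply(2)[OF False, of W "n - 1" \<gamma>] unfolding i by simp
        ultimately show ?thesis unfolding hz using False kmod_EM[OF W, of "n + i"]
          by (simp add: cocycle_map_apply(2) del: EM_simps)
      qed
    qed
  qed
qed

text \<open>The coaugmentation sends c to the constant 0-cochain, and the cup-product with it scales
  \<alpha> by c, because \<open>drop p\<close> leaves a single one of p + 1 entries.\<close>

lemma cup_map_coaug:
  assumes V: "kmod V" and \<alpha>: "\<alpha> \<in> cocycles (EM_inv V) (int p)"
  shows "comp_map kc (cup_map V p \<alpha>) (coaug G triv) = cocycle_map G R V (int p) \<alpha>"
proof (rule cocycle_map_eqI[OF cmap_comp[OF qi_cmap[OF qi_coaug[OF kmod_trivial]] cmap_cup[OF V \<alpha>]] cmap_cocycle_map[OF V \<alpha>]])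
  fix c assume c: "c \<in> carrier R"
  let ?f = "\<lambda>gs\<in>glists (Suc 0). c"
  have s: "coaug G triv 0 c = ?f" using c tuples_nat[of 0] by (simp add: coaug_def carrier_conc)
  have f: "?f \<in> carrier (EM_module G triv (int 0))" using c unfolding EM_simps tuples_nat by auto
  have "cup_map V p \<alpha> (int 0) ?f = c \<odot>\<^bsub>EM_module G V (int p)\<^esub> \<alpha>"
    unfolding cup_map_nat[OF f] cup_cochain_def EM_simps add_0_right tuples_nat
  proof (intro restrict_ext)
    fix gs assume gs: "gs \<in> glists (Suc p)"
    then have "drop p gs \<in> glists (Suc 0)" using glists_split(1)[of gs p 0] by simp
    then show "?f (drop p gs) \<odot>\<^bsub>V\<^esub> \<alpha> (take (Suc p) gs) = c \<odot>\<^bsub>V\<^esub> \<alpha> gs"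
      using length_glists[OF gs] by simp
  qed
  then show "comp_map kc (cup_map V p \<alpha>) (coaug G triv) 0 c = cocycle_map G R V (int p) \<alpha> 0 c"
    using c s carrier_kc(3) by (simp add: cocycle_map_apply(1) del: EM_simps)
qed

text \<open>In degree zero both sides send c to c times \<alpha> cup \<beta>, by linearity of
  \<open>cup_map\<close>. The double shift in the target is identified through
  \<open>shift_shift\<close>, and shifting a chain map brings in no sign.\<close>

lemma cup_map_cocycle_map:
  assumes V: "kmod V" and \<alpha>: "\<alpha> \<in> cocycles (EM_inv V) (int p)" and \<beta>: "\<beta> \<in> cocycles (EM_inv triv) (int q)"
  shows "comp_map kc (shift_map (int q) (cup_map V p \<alpha>)) (cocycle_map G R triv (int q) \<beta>)
    = cocycle_map G R V (int (p + q)) (cup_cochain G V p q \<alpha> \<beta>)"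
proof (rule cocycle_map_eqI)
  note m = cmap_cup[OF V \<alpha>] and b = EM_inv_cocycleD(3)[OF \<beta>]
  have e: "shift (int q) (shift (int p) (EM_complex G V)) = shift (int (p + q)) (EM_complex G V)"
    using shift_shift[OF cpx_EM[OF V]] by simp
  show "cmap kc (comp_map kc (shift_map (int q) (cup_map V p \<alpha>)) (cocycle_map G R triv (int q) \<beta>))
     (shift (int (p + q)) (EM_complex G V))"
    using cmap_comp[OF cmap_cocycle_map[OF kmod_trivial \<beta>] cmap_shift[OF m]] unfolding e .
  show "cmap kc (cocycle_map G R V (int (p + q)) (cup_cochain G V p q \<alpha> \<beta>))
     (shift (int (p + q)) (EM_complex G V))"
    by (rule cmap_cocycle_map[OF V cup_cocycle[OF V \<alpha> \<beta>]])
  fix c assume c: "c \<in> carrier R"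
  have "cup_map V p \<alpha> (int q) (c \<odot>\<^bsub>EM_module G triv (int q)\<^esub> \<beta>)
      = c \<odot>\<^bsub>EM_module G V (int (p + q))\<^esub> cup_cochain G V p q \<alpha> \<beta>"
    using cmapD(7)[OF m c, of \<beta> "int q"] b unfolding cup_map_nat[OF b] by (simp del: EM_simps)
  then show "comp_map kc (shift_map (int q) (cup_map V p \<alpha>)) (cocycle_map G R triv (int q) \<beta>) 0 c
      = cocycle_map G R V (int (p + q)) (cup_cochain G V p q \<alpha> \<beta>) 0 c"
    using c carrier_kc(3) by (simp add: cocycle_map_apply(1) del: EM_simps of_nat_add)
qed

end

context kG_universe
begin

section \<open>The canonical map from Eilenberg--MacLane cohomology to Ext\<close>

abbreviation EMt :: "(('g list \<Rightarrow> 'w) \<Rightarrow> 'u) \<Rightarrow> ('k, 'g, 'w) kGmod \<Rightarrow> ('k, 'g, 'u) cochain_complex"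
  where "EMt l W \<equiv> transport_complex l (EM_complex G W)"

abbreviation kct :: "('k \<Rightarrow> 'u) \<Rightarrow> ('k, 'g, 'u) cochain_complex"
  where "kct j \<equiv> transport_complex j kc"

abbreviation coct ::
  "('k \<Rightarrow> 'u) \<Rightarrow> (('g list \<Rightarrow> 'w) \<Rightarrow> 'u) \<Rightarrow> ('k, 'g, 'w) kGmod \<Rightarrow> int \<Rightarrow> ('g list \<Rightarrow> 'w) \<Rightarrow> int \<Rightarrow> 'u \<Rightarrow> 'u"
  where "coct j l W n \<alpha> \<equiv> transport_map j l kc (cocycle_map G R W n \<alpha>)"

abbreviation coaugt ::
  "('w \<Rightarrow> 'u) \<Rightarrow> (('g list \<Rightarrow> 'w) \<Rightarrow> 'u) \<Rightarrow> ('k, 'g, 'w) kGmod \<Rightarrow> int \<Rightarrow> 'u \<Rightarrow> 'u"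
  where "coaugt i l W \<equiv> transport_map i l (conc W) (coaug G W)"

lemma qi_coaugt:
  assumes "inj i" "inj l" "kmod W"
  shows "qi (shift n (transport_complex i (conc W))) (shift_map n (coaugt i l W)) (shift n (EMt l W))"
  using assms by (intro qi_shift qi_transport qi_coaug)

lemma cmap_coct:
  assumes "inj j" "inj l" "kmod W" "\<alpha> \<in> cocycles (EM_inv W) n"
  shows "cmap (kct j) (coct j l W n \<alpha>) (shift n (EMt l W))"
  using cmap_transport[OF assms(1,2) cmap_cocycle_map[OF assms(3,4)]]
  unfolding transport_shift[OF assms(2) cpx_EM[OF assms(3)]] .

definition Phi_zz ::
  "('k \<Rightarrow> 'u) \<Rightarrow> ('w \<Rightarrow> 'u) \<Rightarrow> (('g list \<Rightarrow> 'w) \<Rightarrow> 'u) \<Rightarrow> ('k, 'g, 'w) kGmod \<Rightarrow> int \<Rightarrow>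
   ('g list \<Rightarrow> 'w) \<Rightarrow> ('k, 'g, 'u) zigzag" where
  "Phi_zz j i l W n \<alpha> = [Fwd (kct j) (coct j l W n \<alpha>) (shift n (EMt l W))] @
     [Bwd (shift n (transport_complex i (conc W))) (shift_map n (coaugt i l W)) (shift n (EMt l W))]"

lemma zz_Phi:
  assumes "inj j" "inj i" "inj l" "kmod W" "\<alpha> \<in> cocycles (EM_inv W) n"
  shows "zz (kct j) (Phi_zz j i l W n \<alpha>) (shift n (transport_complex i (conc W)))"
  unfolding Phi_zz_def
  by (rule zz_append[OF zz_Fwd[OF cmap_coct] zz_Bwd[OF qi_coaugt]]) (rule assms)+

text \<open>\<open>Phi\<close> inverts composition with the coaugmentation. That operation is
  injective because a quasi-isomorphism can be cancelled, and \<open>Phi_zz\<close> is a preimage,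
  so \<open>inv_into\<close> returns its class. Independence of the representative of the homotopy
  class comes from \<open>zeq_homotopic\<close>.\<close>

lemma Phi_class:
  assumes j: "inj j" and i: "inj i" and l: "inj l" and W: "kmod W"
    and \<alpha>: "\<alpha> \<in> cocycles (EM_inv W) (int n)"
  shows "Phi G R j i l W n (coh_class (EM_inv W) (int n) \<alpha>)
    = der_class G R (kct j) (shift (int n) (transport_complex i (conc W))) (Phi_zz j i l W (int n) \<alpha>)"
proof -
  let ?n = "int n"
  let ?T = "shift ?n (EMt l W)" and ?W = "shift ?n (transport_complex i (conc W))"
  let ?s = "shift_map ?n (coaugt i l W)"
  note q = qi_coaugt[OF i l W, of ?n]
  note m = cmap_coct[OF j l W \<alpha>]
  let ?H = "htpy_class G R kc (shift ?n (EM_complex G W)) (cocycle_map G R W ?n \<alpha>)"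
  have h: "EM_to_htpy G R W n (coh_class (EM_inv W) ?n \<alpha>) = ?H"
    unfolding EM_to_htpy_def
    by (rule induced_coh_class[OF cpx_EM_inv[OF W] \<alpha>])
      (rule htpy_class_eq[OF cocycle_map_homotopic[OF W \<alpha>]])
  have e: "htpy_to_ext G R j l kc (EM_complex G W) ?n ?H
      = der_class G R (kct j) ?T [Fwd (kct j) (coct j l W ?n \<alpha>) ?T]"
    unfolding htpy_to_ext_def der_of_map_def
  proof (rule induced_eq)
    show "cocycle_map G R W ?n \<alpha> \<in> ?H"
      using homotopic_refl[OF cmap_cocycle_map[OF W \<alpha>]] by (simp add: htpy_class_def)
    fix f assume "f \<in> ?H"
    then have "homotopic G R kc (shift ?n (EM_complex G W)) (cocycle_map G R W ?n \<alpha>) f"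
      by (simp add: htpy_class_def)
    from homotopic_transport[OF j l this]
    have "homotopic G R (kct j) ?T (coct j l W ?n \<alpha>) (transport_map j l kc f)"
      unfolding transport_shift[OF l cpx_EM[OF W]] .
    from zigzag_eq.sym[OF zeq_homotopic[OF this]]
    show "der_class G R (kct j) ?T [Fwd (kct j) (transport_map j l kc f) ?T]
      = der_class G R (kct j) ?T [Fwd (kct j) (coct j l W ?n \<alpha>) ?T]" by (rule der_class_eqI)
  qed
  let ?c = "coaug_ext G R j i l W ?n"
  have cc: "?c (der_class G R (kct j) ?W w) = der_class G R (kct j) ?T (w @ [Fwd ?W ?s ?T])"
    if "zz (kct j) w ?W" for w
    unfolding coaug_ext_def der_of_map_def by (rule der_comp_class[OF that zz_Fwd[OF qi_cmap[OF q]]])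
  have inj: "inj_on ?c (der_hom G R (kct j) ?W)"
  proof (rule inj_onI)
    fix X Y assume X: "X \<in> der_hom G R (kct j) ?W" and Y: "Y \<in> der_hom G R (kct j) ?W" and eq: "?c X = ?c Y"
    obtain x where x: "zz (kct j) x ?W" "X = der_class G R (kct j) ?W x" using X by (rule der_homE)
    obtain y where y: "zz (kct j) y ?W" "Y = der_class G R (kct j) ?W y" using Y by (rule der_homE)
    have "zeq (kct j) ?T (x @ [Fwd ?W ?s ?T]) (y @ [Fwd ?W ?s ?T])"
      using eq unfolding x(2) y(2) cc[OF x(1)] cc[OF y(1)]
        der_class_eq[OF zz_append[OF x(1) zz_Fwd[OF qi_cmap[OF q]]]] .
    from zeq_cancel_right[OF q x(1) y(1) this] show "X = Y" unfolding x(2) y(2) by (rule der_class_eqI)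
  qed
  note z = zz_Phi[OF j i l W \<alpha>]
  have "?c (der_class G R (kct j) ?W (Phi_zz j i l W ?n \<alpha>))
      = der_class G R (kct j) ?T [Fwd (kct j) (coct j l W ?n \<alpha>) ?T]"
    unfolding cc[OF z] unfolding Phi_zz_def
    by (rule der_class_eqI[OF zeq_Bwd_cancel[OF q zz_Fwd[OF m]]])
  then show ?thesis
    unfolding Phi_def h e Ext_simps by (rule inv_into_f_eq[OF inj der_homI[OF z]])
qed

text \<open>The chain map of a cocycle depends linearly on it. Sums cross the final formal inverse
  by \<open>zadd_Fwd\<close> and \<open>zadd_post\<close>, scalars by \<open>zeq_scalar\<close>, and
  zero is absorbed by \<open>zeq_zero_left\<close>.\<close>

lemma linear_Phi:
  assumes j: "inj j" and i: "inj i" and l: "inj l" and W: "kmod W"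
  shows "tensor_linear R (H_EM G W n) (Ext G R (kct j) (transport_complex i (conc W)) (int n))
    (Phi G R j i l W n)"
  unfolding tensor_linear_def H_EM_def Ext_simps
proof (intro conjI ballI funcsetI)
  let ?n = "int n"
  note c = cpx_EM_inv[OF W] and E = cpx_EM[OF W]
  let ?T = "shift ?n (EMt l W)" and ?W = "shift ?n (transport_complex i (conc W))"
  let ?B = "[Bwd ?W (shift_map ?n (coaugt i l W)) ?T]"
  let ?F = "\<lambda>f. [Fwd (kct j) f ?T]"
  note q = qi_coaugt[OF i l W, of ?n]
  note B = zz_Bwd[OF q]
  have T: "cpx ?T" using cmapD(2)[OF qi_cmap[OF q]] .
  have K: "cpx (kct j)" by (rule cpx_transport[OF j cpx_kc])
  have t: "transport_complex l (shift ?n (EM_complex G W)) = ?T" by (rule transport_shift[OF l E])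
  have z0: "\<zero>\<^bsub>ob (EM_inv W) ?n\<^esub> \<in> cocycles (EM_inv W) ?n" by (rule cocycles_closed(2)[OF c])
  have "coct j l W ?n \<zero>\<^bsub>ob (EM_inv W) ?n\<^esub> = zero_map (kct j) ?T"
    unfolding EM_inv_ops cocycle_map_zero[OF W] transport_map_zero[OF j l cpx_kc cpx_shift[OF E]] t ..
  then have "zeq (kct j) ?W (Phi_zz j i l W ?n \<zero>\<^bsub>ob (EM_inv W) ?n\<^esub>) [Fwd (kct j) (zero_map (kct j) ?W) ?W]"
    unfolding Phi_zz_def using zeq_zero_left[OF B K] by simp
  then show "Phi G R j i l W n \<zero>\<^bsub>cohomology (EM_inv W) ?n\<^esub>
      = der_class G R (kct j) ?W [Fwd (kct j) (zero_map (kct j) ?W) ?W]"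
    unfolding coh_zero[OF c] Phi_class[OF j i l W z0] by (rule der_class_eqI)
  fix X assume "X \<in> carrier (cohomology (EM_inv W) ?n)"
  then obtain x where x: "X = coh_class (EM_inv W) ?n x" "x \<in> cocycles (EM_inv W) ?n"
    by (auto simp: carrier_coh)
  note x' = EM_inv_cocycleD[OF x(2)] and zx = zz_Phi[OF j i l W x(2)]
  show "Phi G R j i l W n X \<in> der_hom G R (kct j) ?W"
    unfolding x(1) Phi_class[OF j i l W x(2)] by (rule der_homI[OF zx])
  note mx = cmap_coct[OF j l W x(2)]
  { fix Y assume "Y \<in> carrier (cohomology (EM_inv W) ?n)"
    then obtain y where y: "Y = coh_class (EM_inv W) ?n y" "y \<in> cocycles (EM_inv W) ?n"
      by (auto simp: carrier_coh)
    note y' = EM_inv_cocycleD[OF y(2)] and zy = zz_Phi[OF j i l W y(2)]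
    note my = cmap_coct[OF j l W y(2)]
    note xy = cocycles_closed(3)[OF c x(2) y(2)]
    have e: "coct j l W ?n (x \<oplus>\<^bsub>ob (EM_inv W) ?n\<^esub> y) = add_map (kct j) ?T (coct j l W ?n x) (coct j l W ?n y)"
      unfolding EM_inv_ops cocycle_map_add[OF W x(2) y(2)]
        transport_map_add[OF j l cmap_cocycle_map[OF W x(2)] cmap_cocycle_map[OF W y(2)]] t ..
    have "zeq (kct j) ?W (?F (add_map (kct j) ?T (coct j l W ?n x) (coct j l W ?n y)) @ ?B)
        (zadd (kct j) ?T (?F (coct j l W ?n x)) (?F (coct j l W ?n y)) @ ?B)"
      by (rule zeq_post[OF zigzag_eq.sym[OF zadd_Fwd[OF mx my]] B])
    also have "zeq (kct j) ?W \<dots> (zadd (kct j) ?W (Phi_zz j i l W ?n x) (Phi_zz j i l W ?n y))"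
      unfolding Phi_zz_def by (rule zadd_post[OF B zz_Fwd[OF mx] zz_Fwd[OF my]])
    finally have "zeq (kct j) ?W (Phi_zz j i l W ?n (x \<oplus>\<^bsub>ob (EM_inv W) ?n\<^esub> y))
        (zadd (kct j) ?W (Phi_zz j i l W ?n x) (Phi_zz j i l W ?n y))"
      unfolding Phi_zz_def e .
    then show "Phi G R j i l W n (X \<oplus>\<^bsub>cohomology (EM_inv W) ?n\<^esub> Y)
        = der_add G R (kct j) ?W (Phi G R j i l W n X) (Phi G R j i l W n Y)"
      unfolding x(1) y(1) coh_add[OF c x'(4) y'(4)] Phi_class[OF j i l W x(2)] Phi_class[OF j i l W y(2)]
        Phi_class[OF j i l W xy] der_add_class[OF zx zy] by (rule der_class_eqI) }
  fix r assume r: "r \<in> carrier R"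
  note rx = cocycles_closed(4)[OF c x(2) r]
  have "coct j l W ?n (r \<odot>\<^bsub>ob (EM_inv W) ?n\<^esub> x)
      = transport_map j l kc (comp_map kc (scalar_map r (shift ?n (EM_complex G W))) (cocycle_map G R W ?n x))"
    unfolding EM_inv_ops cocycle_map_scalar[OF W x(2) r] ..
  also have "\<dots> = comp_map (kct j) (scalar_map r ?T) (coct j l W ?n x)"
    unfolding transport_map_comp[OF j l l cmap_cocycle_map[OF W x(2)] cmap_scalar[OF cpx_shift[OF E] r], symmetric]
      transport_map_scalar[OF l cpx_shift[OF E] r] t ..
  finally have e: "coct j l W ?n (r \<odot>\<^bsub>ob (EM_inv W) ?n\<^esub> x) = comp_map (kct j) (scalar_map r ?T) (coct j l W ?n x)" .
  have "zeq (kct j) ?W (?F (comp_map (kct j) (scalar_map r ?T) (coct j l W ?n x)) @ ?B)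
      ((?F (coct j l W ?n x) @ [Fwd ?T (scalar_map r ?T) ?T]) @ ?B)"
    by (rule zeq_post[OF zigzag_eq.sym[OF zeq_Fwd_Fwd[OF mx cmap_scalar[OF T r] HOL.refl]] B])
  also have "zeq (kct j) ?W \<dots> (?F (coct j l W ?n x) @ ?B @ [Fwd ?W (scalar_map r ?W) ?W])"
    using zeq_pre[OF zz_Fwd[OF mx] zigzag_eq.sym[OF zeq_scalar[OF B r]]] by simp
  finally have "zeq (kct j) ?W (Phi_zz j i l W ?n (r \<odot>\<^bsub>ob (EM_inv W) ?n\<^esub> x))
      (Phi_zz j i l W ?n x @ [Fwd ?W (scalar_map r ?W) ?W])"
    unfolding Phi_zz_def e append_assoc .
  then show "Phi G R j i l W n (r \<odot>\<^bsub>cohomology (EM_inv W) ?n\<^esub> X)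
      = r \<odot>\<^bsub>Ext G R (kct j) (transport_complex i (conc W)) ?n\<^esub> Phi G R j i l W n X"
    unfolding x(1) coh_smult[OF c x(2) r] Phi_class[OF j i l W x(2)] Phi_class[OF j i l W rx]
      Ext_smult[OF zx r] by (rule der_class_eqI)
qed

lemma Phi_cup:
  assumes j: "inj j" and i: "inj i" and l: "inj l" and l': "inj l'" and V: "kmod V"
    and \<alpha>: "\<alpha> \<in> cocycles (EM_inv V) (int p)" and \<beta>: "\<beta> \<in> cocycles (EM_inv triv) (int q)"
  shows "Phi G R j i l V (p + q) (cup_EM G V p q (coh_class (EM_inv V) (int p) \<alpha>) (coh_class (EM_inv triv) (int q) \<beta>))
    = ext_cup G R (kct j) (kct j) (transport_complex i (conc V)) (int p) (int q)
        (Phi G R j i l V p (coh_class (EM_inv V) (int p) \<alpha>))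
        (Phi G R j j l' triv q (coh_class (EM_inv triv) (int q) \<beta>))"
proof -
  let ?p = "int p" and ?q = "int q"
  let ?V = "transport_complex i (conc V)"
  note CV = cpx_transport[OF i cpx_conc[OF V]] and EV = cpx_EM[OF V] and Et = cpx_EM[OF kmod_trivial]
  note TV = cpx_transport[OF l EV]
  note ss = shift_shift[OF CV, of ?q ?p] shift_shift[OF TV, of ?q ?p]
  let ?Tk = "EMt l' triv" and ?T = "EMt l V"
  let ?\<gamma> = "transport_map l' l (EM_complex G triv) (cup_map V p \<alpha>)"
  let ?a = "coct j l V ?p \<alpha>" and ?b = "coct j l' triv ?q \<beta>"
  let ?c = "coaugt j l' triv" and ?c' = "coaugt i l V"
  note m = cmap_cup[OF V \<alpha>]
  have \<gamma>: "cmap ?Tk ?\<gamma> (shift ?p ?T)"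
    using cmap_transport[OF l' l m] unfolding transport_shift[OF l EV] .
  have ec: "comp_map (kct j) ?\<gamma> ?c = ?a"
    unfolding transport_map_comp[OF j l' l qi_cmap[OF qi_coaug[OF kmod_trivial]] m] cup_map_coaug[OF V \<alpha>] ..
  have ecq: "comp_map (shift ?q (kct j)) (shift_map ?q ?\<gamma>) (shift_map ?q ?c) = shift_map ?q ?a"
    unfolding ec[symmetric] by (simp add: comp_map_def shift_map_def)
  have t2: "transport_complex l (shift ?q (shift ?p (EM_complex G V))) = shift ?q (shift ?p ?T)"
    unfolding transport_shift[OF l cpx_shift[OF EV]] transport_shift[OF l EV] ..
  have eb: "comp_map (kct j) (shift_map ?q ?\<gamma>) ?b = coct j l V (int (p + q)) (cup_cochain G V p q \<alpha> \<beta>)"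
  proof -
    have "shift_map ?q ?\<gamma> = transport_map l' l (shift ?q (EM_complex G triv)) (shift_map ?q (cup_map V p \<alpha>))"
      by (simp add: transport_map_def shift_map_def)
    then show ?thesis
      using transport_map_comp[OF j l' l cmap_cocycle_map[OF kmod_trivial \<beta>] cmap_shift[OF m]]
      unfolding cup_map_cocycle_map[OF V \<alpha> \<beta>] by simp
  qed
  let ?S2 = "shift (?p + ?q) ?T" and ?V2 = "shift (?p + ?q) ?V"
  have q1: "qi (shift ?q (kct j)) (shift_map ?q ?c) (shift ?q ?Tk)" by (rule qi_coaugt[OF j l' kmod_trivial])
  have q2: "qi ?V2 (shift_map (?p + ?q) ?c') ?S2" by (rule qi_coaugt[OF i l V])
  have \<gamma>q: "cmap (shift ?q ?Tk) (shift_map ?q ?\<gamma>) ?S2" using cmap_shift[OF \<gamma>, of ?q] unfolding ss .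
  have aq: "cmap (shift ?q (kct j)) (shift_map ?q ?a) ?S2"
    using cmap_shift[OF cmap_coct[OF j l V \<alpha>], of ?q] unfolding ss .
  have b: "cmap (kct j) ?b (shift ?q ?Tk)" by (rule cmap_coct[OF j l' kmod_trivial \<beta>])
  let ?Fb = "[Fwd (kct j) ?b (shift ?q ?Tk)]"
  let ?B1 = "[Bwd (shift ?q (kct j)) (shift_map ?q ?c) (shift ?q ?Tk)]"
  let ?F1 = "[Fwd (shift ?q (kct j)) (shift_map ?q ?c) (shift ?q ?Tk)]"
  let ?Fa = "[Fwd (shift ?q (kct j)) (shift_map ?q ?a) ?S2]"
  let ?Fg = "[Fwd (shift ?q ?Tk) (shift_map ?q ?\<gamma>) ?S2]"
  let ?B2 = "[Bwd ?V2 (shift_map (?p + ?q) ?c') ?S2]"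
  have sh: "map (shift_arrow ?q) (Phi_zz j i l V ?p \<alpha>) = ?Fa @ ?B2"
  proof -
    have "shift_map ?q (shift_map ?p ?c') = shift_map (?p + ?q) ?c'" by (simp add: shift_map_def add.assoc)
    then show ?thesis by (simp add: Phi_zz_def ss)
  qed
  \<comment> \<open>The inverse coaugmentation that ends the representative of \<Phi>(\<beta>) meets
    the shifted \<alpha>. Factoring \<alpha> through the coaugmentation of \<open>k\<close> makes
    the two cancel.\<close>
  have "zeq (shift ?q ?Tk) ?S2 (?B1 @ ?Fa) (?B1 @ ?F1 @ ?Fg)"
    by (rule zeq_pre[OF zz_Bwd[OF q1] zigzag_eq.sym[OF zeq_Fwd_Fwd[OF qi_cmap[OF q1] \<gamma>q ecq]]])
  also have "zeq (shift ?q ?Tk) ?S2 \<dots> ?Fg"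
    using zeq_post[OF zeq_Bwd_Fwd[OF q1] zz_Fwd[OF \<gamma>q]] by simp
  finally have "zeq (kct j) ?S2 (?Fb @ ?B1 @ ?Fa) (?Fb @ ?Fg)" by (rule zeq_pre[OF zz_Fwd[OF b]])
  also have "zeq (kct j) ?S2 \<dots> [Fwd (kct j) (coct j l V (int (p + q)) (cup_cochain G V p q \<alpha> \<beta>)) ?S2]"
    by (rule zeq_Fwd_Fwd[OF b \<gamma>q eb])
  finally have "zeq (kct j) ?V2 ((?Fb @ ?B1 @ ?Fa) @ ?B2)
      ([Fwd (kct j) (coct j l V (int (p + q)) (cup_cochain G V p q \<alpha> \<beta>)) ?S2] @ ?B2)"
    by (rule zeq_post[OF _ zz_Bwd[OF q2]])
  then have k: "zeq (kct j) ?V2 (Phi_zz j j l' triv ?q \<beta> @ map (shift_arrow ?q) (Phi_zz j i l V ?p \<alpha>))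
      (Phi_zz j i l V (int (p + q)) (cup_cochain G V p q \<alpha> \<beta>))"
    unfolding sh by (simp add: Phi_zz_def)
  show ?thesis
    unfolding cup_EM_class[OF V \<alpha> \<beta>] Phi_class[OF j i l V \<alpha>] Phi_class[OF j j l' kmod_trivial \<beta>]
      Phi_class[OF j i l V cup_cocycle[OF V \<alpha> \<beta>]]
      ext_cup_class[OF CV zz_Phi[OF j i l V \<alpha>] zz_Phi[OF j j l' kmod_trivial \<beta>]]
    using der_class_eqI[OF zigzag_eq.sym[OF k]] by simp
qed

text \<open>\<open>Phi_cup\<close> settles pure tensors; bilinearity of the two products and
  linearity of the canonical maps make everything well defined on tensor products. The embeddings
  into the universe are arbitrary injections.\<close>

lemma Phi_tensor_square:
  assumes j: "inj j" and i: "inj i" and l: "inj l" and l': "inj l'" and V: "kmod V"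
    and t: "t \<in> carrier (tensor R (H_EM G V p) (H_EM G triv q))"
  shows "Phi G R j i l V (p + q) (tensor_lift (H_EM G V (p + q)) (cup_EM G V p q) t)
    = tensor_lift (Ext G R (kct j) (transport_complex i (conc V)) (int (p + q)))
        (ext_cup G R (kct j) (kct j) (transport_complex i (conc V)) (int p) (int q))
        (tensor_map R (Ext G R (kct j) (transport_complex i (conc V)) (int p))
          (Ext G R (kct j) (kct j) (int q)) (Phi G R j i l V p) (Phi G R j j l' triv q) t)"
proof (rule tensor_square[OF _ _ bilinear_cup_EM[OF V] _ linear_Phi[OF j i l V]
      linear_Phi[OF j j l' kmod_trivial] _ _ _ t])
  let ?V = "transport_complex i (conc V)"
  note K = cpx_transport[OF j cpx_kc] and CV = cpx_transport[OF i cpx_conc[OF V]]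
  show "abelian_monoid (H_EM G V (p + q))"
    unfolding H_EM_def by (rule abelian_monoid_cohomology[OF cpx_EM_inv[OF V]])
  show "abelian_monoid (Ext G R (kct j) ?V (int (p + q)))" by (rule abelian_monoid_Ext[OF K CV])
  show "tensor_bilinear R (Ext G R (kct j) ?V (int p)) (Ext G R (kct j) (kct j) (int q))
      (Ext G R (kct j) ?V (int (p + q))) (ext_cup G R (kct j) (kct j) ?V (int p) (int q))"
    using bilinear_ext_cup[OF K K CV, of "int p" "int q"] by simp
  note L = linear_Phi[OF j i l V, of "p + q", unfolded tensor_linear_def]
  show "Phi G R j i l V (p + q) \<zero>\<^bsub>H_EM G V (p + q)\<^esub> = \<zero>\<^bsub>Ext G R (kct j) ?V (int (p + q))\<^esub>"
    using L by blast
  show "Phi G R j i l V (p + q) (x \<oplus>\<^bsub>H_EM G V (p + q)\<^esub> y)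
      = Phi G R j i l V (p + q) x \<oplus>\<^bsub>Ext G R (kct j) ?V (int (p + q))\<^esub> Phi G R j i l V (p + q) y"
    if "x \<in> carrier (H_EM G V (p + q))" "y \<in> carrier (H_EM G V (p + q))" for x y
    using L that by blast
  show "Phi G R j i l V (p + q) (cup_EM G V p q m n)
      = ext_cup G R (kct j) (kct j) ?V (int p) (int q) (Phi G R j i l V p m) (Phi G R j j l' triv q n)"
    if "m \<in> carrier (H_EM G V p)" "n \<in> carrier (H_EM G triv q)" for m n
    using that Phi_cup[OF j i l l' V] by (auto simp: H_EM_def carrier_coh)
qed

end

theorem mainTheorem3:
  fixes G :: "('g, 'a) monoid_scheme"
    and R :: "('k, 'b) ring_scheme"
    and V :: "('k, 'g, 'v) kGmod"
  assumes "group G" and "cring R" and "kG_module G R V"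
  shows "\<forall>p q. \<forall>t \<in> carrier (tensor R (H_EM G V p) (H_EM G (trivial_module R) q)).
     (Phi_V G R V (p + q) (tensor_lift (H_EM G V (p + q)) (cup_EM G V p q) t)
        :: ('k, 'g, ('k, 'g, 'v, 'x) univ) zigzag set)
     = tensor_lift (H_V G R V (p + q)) (cup_H G R V p q)
         (tensor_map R (H_V G R V p) (H_k G R q) (Phi_V G R V p) (Phi_k G R q) t)"
proof (intro allI ballI)
  fix p q t
  assume t: "t \<in> carrier (tensor R (H_EM G V p) (H_EM G (trivial_module R) q))"
  \<comment> \<open>Pairs are formed by the constructor \<open>Pair\<close>; off its range the
    projections return their argument as a default.\<close>
  interpret kG_universe G R "Pair :: ('k, 'g, 'v, 'x) univ \<Rightarrow> _ \<Rightarrow> _"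
    "\<lambda>z. case z of Pair a b \<Rightarrow> a | _ \<Rightarrow> z" "\<lambda>z. case z of Pair a b \<Rightarrow> b | _ \<Rightarrow> z"
    by (intro kG_universe.intro kG_setting.intro kG_universe_axioms.intro assms(1,2)) simp_all
  show "(Phi_V G R V (p + q) (tensor_lift (H_EM G V (p + q)) (cup_EM G V p q) t)
        :: ('k, 'g, ('k, 'g, 'v, 'x) univ) zigzag set)
     = tensor_lift (H_V G R V (p + q)) (cup_H G R V p q)
         (tensor_map R (H_V G R V p) (H_k G R q) (Phi_V G R V p) (Phi_k G R q) t)"
    unfolding Phi_V_def Phi_k_def H_V_def H_k_def cup_H_def k_complex_def V_complex_def
    \<comment> \<open>The remaining goals are the injectivity of the constructors
      \<open>Scalar\<close>, \<open>Vector\<close>, \<open>VectorFun\<close> and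
      \<open>ScalarFun\<close>.\<close>
    by (rule Phi_tensor_square[OF _ _ _ _ assms(3) t]) (simp_all add: inj_def)
qed

end
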